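(* Let $(M,g)$ be a closed revolution manifold of dimension $n\geq 2$, with $M\setminus\{N,S\}\cong(0,R)\times\mathbb S^{n-1}$. Fix a number $\alpha\ge1$ such that $\frac{(n-1)\alpha^2}{16}-2\alpha R\ge2$, and for positive integers $j$ (large enough that $R-\frac1{\alpha j}>0$) endow $M$ with the radial density $\sigma_j(r)=e^{-j\,h_j(r)^2}$, where, with $r_j=R-\frac1{\alpha j}$, $$h_j(r)=\begin{cases} r&\text{if }0\le r\le r_j,\\ r-\frac{\alpha j}{2}(r-r_j)^2&\text{if }r_j\le r\le R.\end{cases}$$ Then there exist an integer $j_0$ and a constant $C$, not depending on $j$, such that for all $j\ge j_0$, $$\lambda_2(L_{\sigma_j})\ge2j+C.$$
   Context: A closed revolution manifold of dimension $n$ is a compact Riemannian manifold $(M,g)$ without boundary, with two distinguished points $N,S$ such that $(M\setminus\{N,S\},g)$ is isometric to $(0,R)\times\mathbb S^{n-1}$ with metric $dr^2+\theta^2(r)g_{\mathbb S^{n-1}}$, where $g_{\mathbb S^{n-1}}$ is the standard metric and $\theta:[0,R]\to\mathbb R$ is smooth, positive on $(0,R)$, with $\theta(0)=\theta(R)=0$, $\theta'(0)=-\theta'(R)=1$, $\theta''(0)=\theta''(R)=0$. The point $N$ corresponds to $r=0$ and $S$ to $r=R$. For a positive density $\sigma=e^{-f}$, $L_\sigma=\Delta_g+\nabla f\cdot\nabla$ with $\Delta_g=-\mathrm{div}_g\nabla$, self-adjoint on $L^2(\sigma\,dv_g)$, with eigenvalues $0=\lambda_1(L_\sigma)<\lambda_2(L_\sigma)\le\cdots$;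 equivalently $\lambda_k(L_\sigma)$ is the min-max over $k$-dimensional subspaces of $H^1(M)$ of the Rayleigh quotient $\int_M|\nabla u|^2\sigma\,dv_g/\int_Mu^2\sigma\,dv_g$. (The densities $\sigma_j$ are of class $C^1$ on $M$.) *)

theory Defs
  imports "HOL-Analysis.Analysis"
begin

section \<open>Closed Riemannian manifolds\<close>

primrec Ck_on :: "nat \<Rightarrow> ('a::real_normed_vector \<Rightarrow> 'b::real_normed_vector) \<Rightarrow> 'a set \<Rightarrow> bool" where
  "Ck_on 0 f U \<longleftrightarrow> continuous_on U f"
| "Ck_on (Suc k) f U \<longleftrightarrow>
     (\<forall>x\<in>U. f differentiable (at x)) \<and>
     (\<forall>v. Ck_on k (\<lambda>x. frechet_derivative f (at x) v) U)"

definition smooth_on :: "('a::real_normed_vector \<Rightarrow> 'b::real_normed_vector) \<Rightarrow> 'a set \<Rightarrow> bool" where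
  "smooth_on f U \<longleftrightarrow> (\<forall>k. Ck_on k f U)"

text \<open>The underlying set of a manifold is the whole type \<open>'m\<close>; its dimension is \<open>CARD('n)\<close>.
  A chart is a pair of its domain and its coordinate map.\<close>

type_synonym ('m, 'n) chart = "'m set \<times> ('m \<Rightarrow> real ^ 'n)"

definition is_chart :: "('m::topological_space, 'n::finite) chart \<Rightarrow> bool" where
  "is_chart c \<longleftrightarrow> open (fst c) \<and> open (snd c ` fst c) \<and>
     homeomorphism (fst c) (snd c ` fst c) (snd c) (inv_into (fst c) (snd c))"

definition local_rep :: "('m, 'n::finite) chart \<Rightarrow> ('m \<Rightarrow> 'b) \<Rightarrow> real ^ 'n \<Rightarrow> 'b" where
  "local_rep c f = f \<circ> inv_into (fst c) (snd c)"

definition smooth_atlas :: "('m::topological_space, 'n::finite) chart set \<Rightarrow> bool" where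
  "smooth_atlas \<A> \<longleftrightarrow>
     (\<forall>c\<in>\<A>. is_chart c) \<and> (\<Union>c\<in>\<A>. fst c) = UNIV \<and>
     (\<forall>c\<in>\<A>. \<forall>d\<in>\<A>. smooth_on (local_rep c (snd d)) (snd c ` (fst c \<inter> fst d)))"

text \<open>\<open>g c x\<close> is the Gram matrix of the metric in the chart \<open>c\<close> at the coordinate point \<open>x\<close>;
  the last condition is the transformation law of a covariant 2-tensor.\<close>

definition riemannian_metric ::
  "('m::topological_space, 'n::finite) chart set \<Rightarrow>
   (('m, 'n) chart \<Rightarrow> real ^ 'n \<Rightarrow> real ^ 'n ^ 'n) \<Rightarrow> bool" where
  "riemannian_metric \<A> g \<longleftrightarrow>
     (\<forall>c\<in>\<A>. smooth_on (g c) (snd c ` fst c) \<and>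
        (\<forall>x\<in>snd c ` fst c. transpose (g c x) = g c x \<and>
            (\<forall>v. v \<noteq> 0 \<longrightarrow> v \<bullet> (g c x *v v) > 0)) \<and>
        (\<forall>d\<in>\<A>. \<forall>x\<in>snd c ` (fst c \<inter> fst d).
            (let J = matrix (frechet_derivative (local_rep c (snd d)) (at x))
             in g c x = transpose J ** g d (local_rep c (snd d) x) ** J)))"

definition closed_riemannian_manifold ::
  "('m::t2_space, 'n::finite) chart set \<Rightarrow>
   (('m, 'n) chart \<Rightarrow> real ^ 'n \<Rightarrow> real ^ 'n ^ 'n) \<Rightarrow> bool" where
  "closed_riemannian_manifold \<A> g \<longleftrightarrow>
     compact (UNIV :: 'm set) \<and> smooth_atlas \<A> \<and> riemannian_metric \<A> g"

text \<open>The defining property of the measure \<open>dv\<^sub>g\<close>, which determines it uniquely on a closed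
  manifold.\<close>

definition riemannian_volume ::
  "('m::t2_space, 'n::finite) chart set \<Rightarrow>
   (('m, 'n) chart \<Rightarrow> real ^ 'n \<Rightarrow> real ^ 'n ^ 'n) \<Rightarrow> 'm measure \<Rightarrow> bool" where
  "riemannian_volume \<A> g \<mu> \<longleftrightarrow> sets \<mu> = sets borel \<and>
     (\<forall>c\<in>\<A>. \<forall>B\<in>sets borel. B \<subseteq> fst c \<longrightarrow>
        emeasure \<mu> B = (\<integral>\<^sup>+x\<in>snd c ` B. ennreal (sqrt (det (g c x))) \<partial>lborel))"

definition smooth_fun :: "('m::topological_space, 'n::finite) chart set \<Rightarrow> ('m \<Rightarrow> real) \<Rightarrow> bool" where
  "smooth_fun \<A> w \<longleftrightarrow> (\<forall>c\<in>\<A>. smooth_on (local_rep c w) (snd c ` fst c))"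

text \<open>\<open>|\<nabla>w|\<^sup>2 = \<Sum> g\<^sup>i\<^sup>j \<partial>\<^sub>iw \<partial>\<^sub>jw\<close> in a chart around \<open>p\<close>; by the transformation law the value does
  not depend on the chart selected.\<close>

definition grad_sq ::
  "('m::topological_space, 'n::finite) chart set \<Rightarrow>
   (('m, 'n) chart \<Rightarrow> real ^ 'n \<Rightarrow> real ^ 'n ^ 'n) \<Rightarrow> ('m \<Rightarrow> real) \<Rightarrow> 'm \<Rightarrow> real" where
  "grad_sq \<A> g w p =
     (let c = (SOME c. c \<in> \<A> \<and> p \<in> fst c);
          dw = (\<chi> i. frechet_derivative (local_rep c w) (at (snd c p)) (axis i 1))
      in dw \<bullet> (matrix_inv (g c (snd c p)) *v dw))"

section \<open>The Sobolev space and the weighted spectrum\<close>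

text \<open>\<open>H\<^sup>1(M)\<close> is the completion of the smooth functions, realised inside \<open>L\<^sup>2(M)\<close>: \<open>w\<close> is a
  sequence of smooth functions that tends to \<open>u\<close> in \<open>L\<^sup>2\<close> and whose gradients are Cauchy in \<open>L\<^sup>2\<close>.\<close>

definition H1_approx ::
  "('m::t2_space, 'n::finite) chart set \<Rightarrow>
   (('m, 'n) chart \<Rightarrow> real ^ 'n \<Rightarrow> real ^ 'n ^ 'n) \<Rightarrow> 'm measure \<Rightarrow>
   ('m \<Rightarrow> real) \<Rightarrow> (nat \<Rightarrow> 'm \<Rightarrow> real) \<Rightarrow> bool" where
  "H1_approx \<A> g \<mu> u w \<longleftrightarrow>
     (\<forall>k. smooth_fun \<A> (w k)) \<and>
     (\<lambda>k. \<integral>p. (w k p - u p)\<^sup>2 \<partial>\<mu>) \<longlonglongrightarrow> 0 \<and>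
     (\<forall>e>0. \<exists>K. \<forall>k\<ge>K. \<forall>l\<ge>K. (\<integral>p. grad_sq \<A> g (\<lambda>q. w k q - w l q) p \<partial>\<mu>) < e)"

definition H1 ::
  "('m::t2_space, 'n::finite) chart set \<Rightarrow>
   (('m, 'n) chart \<Rightarrow> real ^ 'n \<Rightarrow> real ^ 'n ^ 'n) \<Rightarrow> 'm measure \<Rightarrow> ('m \<Rightarrow> real) set" where
  "H1 \<A> g \<mu> = {u. u \<in> borel_measurable \<mu> \<and> integrable \<mu> (\<lambda>p. (u p)\<^sup>2) \<and>
                 (\<exists>w. H1_approx \<A> g \<mu> u w)}"

text \<open>\<open>\<integral>|\<nabla>u|\<^sup>2\<sigma> dv\<^sub>g\<close> for \<open>u \<in> H\<^sup>1(M)\<close> and a continuous weight \<open>\<sigma> > 0\<close>. The limit exists along every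
  approximating sequence and does not depend on it, the Dirichlet form being closable, so that
  \<open>SOME\<close> selects the only candidate.\<close>

definition dirichlet_energy ::
  "('m::t2_space, 'n::finite) chart set \<Rightarrow>
   (('m, 'n) chart \<Rightarrow> real ^ 'n \<Rightarrow> real ^ 'n ^ 'n) \<Rightarrow> 'm measure \<Rightarrow>
   ('m \<Rightarrow> real) \<Rightarrow> ('m \<Rightarrow> real) \<Rightarrow> real" where
  "dirichlet_energy \<A> g \<mu> \<sigma> u =
     (SOME E. \<exists>w. H1_approx \<A> g \<mu> u w \<and>
                 (\<lambda>k. \<integral>p. grad_sq \<A> g (w k) p * \<sigma> p \<partial>\<mu>) \<longlonglongrightarrow> E)"

definition rayleigh_quotient ::
  "('m::t2_space, 'n::finite) chart set \<Rightarrow>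
   (('m, 'n) chart \<Rightarrow> real ^ 'n \<Rightarrow> real ^ 'n ^ 'n) \<Rightarrow> 'm measure \<Rightarrow>
   ('m \<Rightarrow> real) \<Rightarrow> ('m \<Rightarrow> real) \<Rightarrow> real" where
  "rayleigh_quotient \<A> g \<mu> \<sigma> u =
     dirichlet_energy \<A> g \<mu> \<sigma> u / (\<integral>p. (u p)\<^sup>2 * \<sigma> p \<partial>\<mu>)"

text \<open>Elements of \<open>H\<^sup>1(M)\<close> are classes modulo equality almost everywhere. A \<open>k\<close>-dimensional subspace
  is given by the span of \<open>k\<close> representatives that are linearly independent modulo this relation.\<close>

definition H1_subspaces ::
  "('m::t2_space, 'n::finite) chart set \<Rightarrow>
   (('m, 'n) chart \<Rightarrow> real ^ 'n \<Rightarrow> real ^ 'n ^ 'n) \<Rightarrow> 'm measure \<Rightarrow> nat \<Rightarrow>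
   ('m \<Rightarrow> real) set set" where
  "H1_subspaces \<A> g \<mu> k =
     {V. \<exists>b :: nat \<Rightarrow> 'm \<Rightarrow> real.
           (\<forall>i<k. b i \<in> H1 \<A> g \<mu>) \<and>
           (\<forall>a :: nat \<Rightarrow> real. (AE p in \<mu>. (\<Sum>i<k. a i * b i p) = 0) \<longrightarrow> (\<forall>i<k. a i = 0)) \<and>
           V = range (\<lambda>(a :: nat \<Rightarrow> real) p. \<Sum>i<k. a i * b i p)}"

text \<open>\<open>\<lambda>\<^sub>k(L\<^sub>\<sigma>)\<close>, \<open>k \<ge> 1\<close>, by the min-max principle. The value is finite; it is taken in the extended
  reals so that infima and suprema are unconditional.\<close>

definition weighted_eigenvalue ::
  "('m::t2_space, 'n::finite) chart set \<Rightarrow>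
   (('m, 'n) chart \<Rightarrow> real ^ 'n \<Rightarrow> real ^ 'n ^ 'n) \<Rightarrow> 'm measure \<Rightarrow>
   ('m \<Rightarrow> real) \<Rightarrow> nat \<Rightarrow> ereal" where
  "weighted_eigenvalue \<A> g \<mu> \<sigma> k =
     (INF V \<in> H1_subspaces \<A> g \<mu> k.
        SUP u \<in> {u \<in> V. \<not> (AE p in \<mu>. u p = 0)}. ereal (rayleigh_quotient \<A> g \<mu> \<sigma> u))"

section \<open>Revolution manifolds\<close>

definition revolution_profile :: "real \<Rightarrow> (real \<Rightarrow> real) \<Rightarrow> bool" where
  "revolution_profile R \<theta> \<longleftrightarrow>
     0 < R \<and> (\<forall>r\<in>{0<..<R}. 0 < \<theta> r) \<and> \<theta> 0 = 0 \<and> \<theta> R = 0 \<and>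
     (\<exists>D :: nat \<Rightarrow> real \<Rightarrow> real. D 0 = \<theta> \<and>
        (\<forall>k. \<forall>r\<in>{0..R}. (D k has_real_derivative D (Suc k) r) (at r within {0..R})) \<and>
        D 1 0 = 1 \<and> D 1 R = - 1 \<and> D 2 0 = 0 \<and> D 2 R = 0)"

text \<open>\<open>\<Phi> = (r, \<omega>)\<close> is a diffeomorphism of \<open>M - {N,S}\<close> onto \<open>(0,R) \<times> S\<^sup>n\<^sup>-\<^sup>1\<close> that pulls
  \<open>dr\<^sup>2 + \<theta>(r)\<^sup>2 g\<^sub>S\<close> back to \<open>g\<close>. Here \<open>S\<^sup>n\<^sup>-\<^sup>1\<close> is the unit sphere of \<open>real ^ 'n\<close> with the induced
  metric, and smoothness of the inverse of \<open>\<Phi>\<close> is expressed through the diffeomorphism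
  \<open>y \<mapsto> (|y|, y/|y|)\<close> of the punctured ball onto \<open>(0,R) \<times> S\<^sup>n\<^sup>-\<^sup>1\<close>.\<close>

definition polar_isometry ::
  "('m::t2_space, 'n::finite) chart set \<Rightarrow>
   (('m, 'n) chart \<Rightarrow> real ^ 'n \<Rightarrow> real ^ 'n ^ 'n) \<Rightarrow> 'm \<Rightarrow> 'm \<Rightarrow> real \<Rightarrow> (real \<Rightarrow> real) \<Rightarrow>
   ('m \<Rightarrow> real \<times> (real ^ 'n)) \<Rightarrow> bool" where
  "polar_isometry \<A> g N S R \<theta> \<Phi> \<longleftrightarrow>
     bij_betw \<Phi> (- {N, S}) ({0<..<R} \<times> sphere 0 1) \<and>
     (\<forall>c\<in>\<A>. smooth_on (local_rep c \<Phi>) (snd c ` (fst c - {N, S})) \<and>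
        (let \<Psi> = (\<lambda>y. inv_into (- {N, S}) \<Phi> (norm y, y /\<^sub>R norm y))
         in smooth_on (\<lambda>y. snd c (\<Psi> y)) {y. 0 < norm y \<and> norm y < R \<and> \<Psi> y \<in> fst c}) \<and>
        (\<forall>x\<in>snd c ` (fst c - {N, S}). \<forall>v.
           (let D = frechet_derivative (local_rep c \<Phi>) (at x)
            in v \<bullet> (g c x *v v) =
                 (fst (D v))\<^sup>2 + (\<theta> (fst (local_rep c \<Phi> x)))\<^sup>2 * (norm (snd (D v)))\<^sup>2)))"

definition closed_revolution_manifold ::
  "('m::t2_space, 'n::finite) chart set \<Rightarrow>
   (('m, 'n) chart \<Rightarrow> real ^ 'n \<Rightarrow> real ^ 'n ^ 'n) \<Rightarrow> 'm \<Rightarrow> 'm \<Rightarrow> real \<Rightarrow> (real \<Rightarrow> real) \<Rightarrow>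
   ('m \<Rightarrow> real \<times> (real ^ 'n)) \<Rightarrow> bool" where
  "closed_revolution_manifold \<A> g N S R \<theta> \<Phi> \<longleftrightarrow>
     closed_riemannian_manifold \<A> g \<and> N \<noteq> S \<and> revolution_profile R \<theta> \<and>
     polar_isometry \<A> g N S R \<theta> \<Phi> \<and>
     ((\<lambda>p. fst (\<Phi> p)) \<longlongrightarrow> 0) (at N) \<and> ((\<lambda>p. fst (\<Phi> p)) \<longlongrightarrow> R) (at S)"

text \<open>The radial coordinate on all of \<open>M\<close>, poles included.\<close>

definition radius :: "'m \<Rightarrow> 'm \<Rightarrow> real \<Rightarrow> ('m \<Rightarrow> real \<times> 'b) \<Rightarrow> 'm \<Rightarrow> real" where
  "radius N S R \<Phi> p = (if p = N then 0 else if p = S then R else fst (\<Phi> p))"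

definition h_fun :: "real \<Rightarrow> real \<Rightarrow> nat \<Rightarrow> real \<Rightarrow> real" where
  "h_fun R \<alpha> j r =
     (let r\<^sub>j = R - 1 / (\<alpha> * real j)
      in if r \<le> r\<^sub>j then r else r - \<alpha> * real j / 2 * (r - r\<^sub>j)\<^sup>2)"

definition radial_density :: "real \<Rightarrow> real \<Rightarrow> nat \<Rightarrow> real \<Rightarrow> real" where
  "radial_density R \<alpha> j r = exp (- (real j * (h_fun R \<alpha> j r)\<^sup>2))"

end

theory Submission
  imports Defs "HOL-Probability.Probability" "HOL-Real_Asymp.Real_Asymp"
begin

text \<open>In polar coordinates the measure \<open>\<sigma>\<^sub>j dv\<^sub>g\<close> is the product of the radial weight
  \<open>\<theta>\<^sup>m exp (- j h\<^sub>j\<^sup>2)\<close>, \<open>m = n - 1\<close>, with the uniform measure of the sphere. The score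
  \<open>2 j h\<^sub>j h\<^sub>j' - m \<theta>' / \<theta>\<close> of the weight increases at rate at least \<open>K = 2 j + C\<close>: this is clear where
  \<open>h\<^sub>j r = r\<close>, and next to \<open>S\<close> the condition on \<open>\<alpha>\<close> lets the curvature term of \<open>\<theta>\<close> absorb the concavity of
  \<open>h\<^sub>j\<close>. A one-dimensional Brascamp--Lieb inequality then gives the Poincare inequality with constant \<open>K\<close>
  for the spherical mean of a function. For the rest, the Poincare inequality on the sphere together with
  a Hardy inequality in \<open>r\<close> gives the same constant, because \<open>score / r + m / \<theta>\<^sup>2 \<ge> K\<close>. The resulting
  Poincare inequality for smooth functions extends to \<open>H\<^sup>1\<close>, and every two-dimensional subspace
  of \<open>H\<^sup>1\<close> contains a nonzero function of mean zero.\<close>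

section \<open>The Poincare inequality for a density with monotone score\<close>

text \<open>Near \<open>N\<close> the model is Euclidean space with weight exp (- j |x|^2). Its
  first nonzero eigenvalue is 2 j, with the linear functions r \<omega>_i as eigenfunctions, so the
  leading term of the angular estimate has nothing to give away; this is why its Hardy inequality is
  built on the ground state r. The singular parts of score / r + m / \<theta>^2 cancel at 0 up to a
  bounded error because r - \<theta> \<theta>' vanishes there to third order, which uses \<theta>''
  = 0; the error enters \<open>C = - (real m * max C1 C2)\<close>, free of \<open>j\<close>. At
  \<open>S\<close> the function r is not C^1. The slope of h_j is brought down to 0 there, at the
  price of a very negative second derivative on a short interval. The number 1/16 that pays for it
  is (1/4) / 2^2, with 1/4 a lower bound for \<theta>'^2 - \<theta> \<theta>'' and 2 an upper bound
  for \<theta> / (R - r) near \<open>S\<close>. Variances are handled as double integrals of squared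
  differences, to which Fubini and tensorization apply in \<open>ennreal\<close>.\<close>

lemma square_lebesgue_integral_le:
  fixes a :: "real \<Rightarrow> real"
  assumes "y \<le> x" "set_integrable lborel {y..x} a" "set_integrable lborel {y..x} (\<lambda>t. (a t)\<^sup>2)"
  shows "(LINT t:{y..x}|lborel. a t)\<^sup>2 \<le> (x - y) * (LINT t:{y..x}|lborel. (a t)\<^sup>2)"
proof (cases "x = y")
  case True
  have "(LINT t:{x..x}|lborel. a t) = (LINT t|lborel. indicator {x} t *\<^sub>R a x)"
    unfolding set_lebesgue_integral_def
    by (intro Bochner_Integration.integral_cong) (auto simp: indicator_def)
  with True show ?thesis by simp
next
  case False
  define L where "L = x - y"
  have L: "L > 0" using False assms by (simp add: L_def)
  define I where "I = (LINT t:{y..x}|lborel. a t)"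
  define Q where "Q = (LINT t:{y..x}|lborel. (a t)\<^sup>2)"
  have "0 \<le> (LINT t:{y..x}|lborel. (a t - I / L)\<^sup>2)"
    unfolding set_lebesgue_integral_def by simp
  also have "(\<lambda>t. (a t - I / L)\<^sup>2) = (\<lambda>t. (a t)\<^sup>2 - (2 * I / L) * a t + (I / L)\<^sup>2)"
    by (auto simp: power2_eq_square algebra_simps)
  also have "(LINT t:{y..x}|lborel. (a t)\<^sup>2 - (2 * I / L) * a t + (I / L)\<^sup>2)
      = Q - (2 * I / L) * I + (I/L)\<^sup>2 * L"
  proof -
    have c: "set_integrable lborel {y..x} (\<lambda>t. (I / L)\<^sup>2)"
      by (simp add: set_integrable_def integrable_indicator_iff emeasure_lborel_Icc_eq)
    have "(LINT t:{y..x}|lborel. (I / L)\<^sup>2) = (I/L)\<^sup>2 * L"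
      using assms by (simp add: set_lebesgue_integral_def L_def)
    thus ?thesis
      using assms c by (simp add: Q_def I_def)
  qed
  also have "\<dots> = Q - I\<^sup>2 / L" using L by (simp add: power2_eq_square field_simps)
  finally show ?thesis using L
    unfolding I_def[symmetric] Q_def[symmetric] L_def[symmetric] by (simp add: field_simps)
qed

text \<open>Twice the variance, scaled for a measure of arbitrary finite mass. As a double integral,
  a variance makes sense in \<open>ennreal\<close> before any mean is known to exist, and Fubini and
  Efron--Stein act on it directly.\<close>

lemma nn_integral_square_diff:
  fixes f :: "'a \<Rightarrow> real"
  assumes "finite_measure M" "integrable M f" "integrable M (\<lambda>x. (f x)\<^sup>2)"
  shows "(\<integral>\<^sup>+x. \<integral>\<^sup>+y. ennreal ((f x - f y)\<^sup>2) \<partial>M \<partial>M)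
    = ennreal (2 * (measure M (space M) * (\<integral>x. (f x)\<^sup>2 \<partial>M) - (\<integral>x. f x \<partial>M)\<^sup>2))"
proof -
  interpret finite_measure M by fact
  let ?m = "measure M (space M)" and ?a = "\<integral>x. f x \<partial>M" and ?b = "\<integral>x. (f x)\<^sup>2 \<partial>M"
  have e: "(\<lambda>y. (f x - f y)\<^sup>2) = (\<lambda>y. (f x)\<^sup>2 - 2 * f x * f y + (f y)\<^sup>2)" for x
    by (auto simp: power2_eq_square algebra_simps)
  have i1: "integrable M (\<lambda>y. (f x - f y)\<^sup>2)" for x
    unfolding e using assms by auto
  have v1: "(\<integral>y. (f x - f y)\<^sup>2 \<partial>M) = ?m * (f x)\<^sup>2 - 2 * ?a * f x + ?b" for x
    unfolding e using assms by simp
  have "(\<integral>\<^sup>+y. ennreal ((f x - f y)\<^sup>2) \<partial>M) = ennreal (?m * (f x)\<^sup>2 - 2 * ?a * f x + ?b)" for x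
    by (subst nn_integral_eq_integral[OF i1]) (auto simp: v1)
  moreover have "0 \<le> ?m * (f x)\<^sup>2 - 2 * ?a * f x + ?b" for x
    unfolding v1[symmetric] by simp
  moreover have "integrable M (\<lambda>x. ?m * (f x)\<^sup>2 - 2 * ?a * f x + ?b)"
    using assms by auto
  ultimately have "(\<integral>\<^sup>+x. \<integral>\<^sup>+y. ennreal ((f x - f y)\<^sup>2) \<partial>M \<partial>M)
     = ennreal (\<integral>x. ?m * (f x)\<^sup>2 - 2 * ?a * f x + ?b \<partial>M)"
    by (simp add: nn_integral_eq_integral)
  also have "(\<integral>x. ?m * (f x)\<^sup>2 - 2 * ?a * f x + ?b \<partial>M) = 2 * (?m * ?b - ?a\<^sup>2)"
    using assms(2,3) by (simp add: power2_eq_square[of ?a])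
  finally show ?thesis .
qed

lemma set_integral_nonneg:
  fixes f :: "'a \<Rightarrow> real"
  assumes "\<And>x. x \<in> A \<Longrightarrow> 0 \<le> f x"
  shows "0 \<le> (LINT x:A|M. f x)"
  unfolding set_lebesgue_integral_def using assms
  by (intro Bochner_Integration.integral_nonneg) (auto simp: indicator_def)

text \<open>\<open>G\<close> is minus the logarithmic derivative of \<open>\<rho>\<close>. Its
  growth is required through differences, since the score of the radial weight has a corner where
  \<open>h_fun\<close> changes branch. The end points are extended reals so that the locale covers
  both the Gaussian on the line and the weight on an open interval of length
  \<open>R\<close>.\<close>

locale monotone_score =
  fixes l u :: ereal and \<rho> G :: "real \<Rightarrow> real" and K :: real
  assumes lu: "l < u"
    and nonneg: "\<And>x. 0 \<le> \<rho> x"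
    and support: "\<And>x. x \<notin> einterval l u \<Longrightarrow> \<rho> x = 0"
    and G_measurable [measurable]: "G \<in> borel_measurable borel"
    and \<rho>i: "integrable lborel \<rho>" and G\<rho>i: "integrable lborel (\<lambda>x. G x * \<rho> x)"
    and score: "\<And>x. x \<in> einterval l u \<Longrightarrow> (\<rho> has_real_derivative - (G x * \<rho> x)) (at x)"
    and score_cont: "\<And>x. x \<in> einterval l u \<Longrightarrow> isCont G x"
    and lim_l: "((\<rho> \<circ> real_of_ereal) \<longlongrightarrow> 0) (at_right l)"
    and lim_u: "((\<rho> \<circ> real_of_ereal) \<longlongrightarrow> 0) (at_left u)"
    and K: "0 \<le> K"
    and mono: "\<And>x y. x \<in> einterval l u \<Longrightarrow> y \<in> einterval l u \<Longrightarrow> y < x \<Longrightarrow> K * (x - y) \<le> G x - G y"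
begin

lemma \<rho>_measurable [measurable]: "\<rho> \<in> borel_measurable borel"
  using borel_measurable_integrable[OF \<rho>i] by simp

lemma \<rho>_cont: "x \<in> einterval l u \<Longrightarrow> isCont \<rho> x"
  using score DERIV_isCont by blast

lemma upper_tail:
  assumes t: "t \<in> einterval l u"
  shows "(\<integral>x. indicator {t<..} x * (G x * \<rho> x) \<partial>lborel) = \<rho> t"
proof -
  have tu: "ereal t < u" and lt: "l < ereal t" using t by (auto simp: einterval_def)
  have "(LBINT x=ereal t..u. G x * \<rho> x) = 0 - (- \<rho> t)"
  proof (rule interval_integral_FTC_integrable[where F = "\<lambda>x. - \<rho> x"])
    show "ereal t < u" by fact
    show "((\<lambda>x. - \<rho> x) has_vector_derivative G x * \<rho> x) (at x)"
      if "ereal t < ereal x" "ereal x < u" for x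
      using DERIV_minus[OF score[of x]] that less_trans[OF lt that(1)]
      by (simp add: has_real_derivative_iff_has_vector_derivative einterval_def)
    show "isCont (\<lambda>x. G x * \<rho> x) x" if "ereal t < ereal x" "ereal x < u" for x
      using that lt by (intro continuous_intros score_cont \<rho>_cont) (auto simp: einterval_def intro: less_trans[OF lt])
    show "set_integrable lborel (einterval (ereal t) u) (\<lambda>x. G x * \<rho> x)"
      unfolding set_integrable_def using G\<rho>i integrable_mult_indicator[OF _ G\<rho>i] by simp
    show "(((\<lambda>x. - \<rho> x) \<circ> real_of_ereal) \<longlongrightarrow> - \<rho> t) (at_right (ereal t))"
      unfolding ereal_tendsto_simps using \<rho>_cont[OF t]
      by (intro tendsto_minus) (auto simp: isCont_def filterlim_at_split)
    show "(((\<lambda>x. - \<rho> x) \<circ> real_of_ereal) \<longlongrightarrow> 0) (at_left u)"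
      using tendsto_minus[OF lim_u] by (simp add: o_def)
  qed
  moreover have "(LBINT x=ereal t..u. G x * \<rho> x) = (\<integral>x. indicator {t<..} x * (G x * \<rho> x) \<partial>lborel)"
    unfolding interval_lebesgue_integral_def set_lebesgue_integral_def using tu lt
    by (auto intro!: Bochner_Integration.integral_cong support simp: indicator_def einterval_def)
  ultimately show ?thesis by simp
qed

lemma lower_tail:
  assumes t: "t \<in> einterval l u"
  shows "(\<integral>x. indicator {..<t} x * (G x * \<rho> x) \<partial>lborel) = - \<rho> t"
proof -
  have tu: "ereal t < u" and lt: "l < ereal t" using t by (auto simp: einterval_def)
  have "(LBINT x=l..ereal t. G x * \<rho> x) = - \<rho> t - 0"
  proof (rule interval_integral_FTC_integrable[where F = "\<lambda>x. - \<rho> x"])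
    show "l < ereal t" by fact
    show "((\<lambda>x. - \<rho> x) has_vector_derivative G x * \<rho> x) (at x)"
      if "l < ereal x" "ereal x < ereal t" for x
      using DERIV_minus[OF score[of x]] that less_trans[OF that(2) tu]
      by (simp add: has_real_derivative_iff_has_vector_derivative einterval_def)
    show "isCont (\<lambda>x. G x * \<rho> x) x" if "l < ereal x" "ereal x < ereal t" for x
      using that tu by (intro continuous_intros score_cont \<rho>_cont) (auto simp: einterval_def intro: less_trans[OF _ tu])
    show "set_integrable lborel (einterval l (ereal t)) (\<lambda>x. G x * \<rho> x)"
      unfolding set_integrable_def using integrable_mult_indicator[OF _ G\<rho>i] by simp
    show "(((\<lambda>x. - \<rho> x) \<circ> real_of_ereal) \<longlongrightarrow> - \<rho> t) (at_left (ereal t))"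
      unfolding ereal_tendsto_simps using \<rho>_cont[OF t]
      by (intro tendsto_minus) (auto simp: isCont_def filterlim_at_split)
    show "(((\<lambda>x. - \<rho> x) \<circ> real_of_ereal) \<longlongrightarrow> 0) (at_right l)"
      using tendsto_minus[OF lim_l] by (simp add: o_def)
  qed
  moreover have "(LBINT x=l..ereal t. G x * \<rho> x) = (\<integral>x. indicator {..<t} x * (G x * \<rho> x) \<partial>lborel)"
    unfolding interval_lebesgue_integral_def set_lebesgue_integral_def using tu lt
    by (auto intro!: Bochner_Integration.integral_cong support simp: indicator_def einterval_def)
  ultimately show ?thesis by simp
qed

text \<open>For \<open>y < x\<close>, Cauchy--Schwarz and \<open>K (x - y) \<le> G x - G y\<close> bound \<open>K (f x - f y)\<^sup>2\<close> by
  \<open>(G x - G y)\<close> times the integral of \<open>a\<^sup>2\<close> over \<open>[y, x]\<close>. Integrating against \<open>\<rho> x \<rho> y\<close> and exchanging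
  the integrals leaves, for fixed \<open>t\<close>, the integral of \<open>(G x - G y) \<rho> x \<rho> y\<close> over \<open>y < t < x\<close>, which is
  \<open>\<rho> t\<close> times the total mass because \<open>G \<rho> = - \<rho>'\<close>.\<close>

lemma brascamp_lieb_nn:
  fixes a f :: "real \<Rightarrow> real"
  defines "X \<equiv> einterval l u"
  assumes [measurable]: "a \<in> borel_measurable borel" "f \<in> borel_measurable borel"
    and ai: "\<And>x y. x \<in> X \<Longrightarrow> y \<in> X \<Longrightarrow> y < x \<Longrightarrow> set_integrable lborel {y..x} a"
       "\<And>x y. x \<in> X \<Longrightarrow> y \<in> X \<Longrightarrow> y < x \<Longrightarrow> set_integrable lborel {y..x} (\<lambda>t. (a t)\<^sup>2)"
    and f: "\<And>x y. x \<in> X \<Longrightarrow> y \<in> X \<Longrightarrow> y < x \<Longrightarrow> f x - f y = (LINT t:{y..x}|lborel. a t)"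
  shows "ennreal K * (\<integral>\<^sup>+x. \<integral>\<^sup>+y. ennreal ((f x - f y)\<^sup>2 * \<rho> x * \<rho> y) \<partial>lborel \<partial>lborel)
     \<le> ennreal (2 * (\<integral>x. \<rho> x \<partial>lborel)) * (\<integral>\<^sup>+t. ennreal ((a t)\<^sup>2 * \<rho> t) \<partial>lborel)"
proof -
  have between: "y < t \<Longrightarrow> t < x \<Longrightarrow> x \<in> X \<Longrightarrow> y \<in> X \<Longrightarrow> t \<in> X" for x y t
    using less_trans[of l "ereal y" "ereal t"] less_trans[of "ereal t" "ereal x" u]
    by (auto simp: X_def einterval_def)
  note \<rho>0 = nonneg support[folded X_def]
  note up = upper_tail[folded X_def] and lo = lower_tail[folded X_def] and G = mono[folded X_def]
  define h where "h x y = ennreal ((f x - f y)\<^sup>2 * \<rho> x * \<rho> y)" for x y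
  define M where "M = (\<integral>x. \<rho> x \<partial>lborel)"
  have [measurable]: "case_prod h \<in> borel_measurable (borel \<Otimes>\<^sub>M borel)"
    unfolding h_def by measurable
  define H where "H = (\<integral>\<^sup>+x. \<integral>\<^sup>+y. indicator {..<x} y * h x y \<partial>lborel \<partial>lborel)"
  have sq: "K * (f x - f y)\<^sup>2 \<le> (G x - G y) * (LINT t:{y..x}|lborel. (a t)\<^sup>2)"
    if "x \<in> X" "y \<in> X" "y < x" for x y
  proof -
    have "K * (f x - f y)\<^sup>2 \<le> K * ((x - y) * (LINT t:{y..x}|lborel. (a t)\<^sup>2))"
      unfolding f[OF that]
      using square_lebesgue_integral_le[OF _ ai[OF that]] that K
      by (intro mult_left_mono) auto
    also have "\<dots> = (K * (x - y)) * (LINT t:{y..x}|lborel. (a t)\<^sup>2)" by simp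
    also have "\<dots> \<le> (G x - G y) * (LINT t:{y..x}|lborel. (a t)\<^sup>2)"
      using G[OF that] by (intro mult_right_mono set_integral_nonneg) auto
    finally show ?thesis .
  qed
  have Gpos: "0 \<le> G x - G y" if "x \<in> X" "y \<in> X" "y < x" for x y
    using G[OF that] K that by (smt (verit) mult_nonneg_nonneg)
  define k where "k x y = ennreal ((G x - G y) * \<rho> x * \<rho> y)" for x y
  have [measurable]: "case_prod k \<in> borel_measurable (borel \<Otimes>\<^sub>M borel)"
    unfolding k_def by measurable
  have pt: "ennreal K * (indicator {..<x} y * h x y)
     \<le> (\<integral>\<^sup>+t. indicator {y<..<x} t * ennreal ((a t)\<^sup>2) * k x y \<partial>lborel)" for x y
  proof (cases "x \<in> X \<and> y \<in> X \<and> y < x")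
    case False
    hence "indicator {..<x} y * h x y = 0"
      using \<rho>0 by (auto simp: h_def indicator_def)
    thus ?thesis by (simp only: mult_zero_right zero_le)
  next
    case True
    hence xy: "x \<in> X" "y \<in> X" "y < x" by auto
    have "(\<integral>\<^sup>+t. indicator {y<..<x} t * ennreal ((a t)\<^sup>2) * k x y \<partial>lborel)
       = (\<integral>\<^sup>+t. indicator {y<..<x} t * ennreal ((a t)\<^sup>2) \<partial>lborel) * k x y"
      by (subst nn_integral_multc) auto
    also have "(\<integral>\<^sup>+t. indicator {y<..<x} t * ennreal ((a t)\<^sup>2) \<partial>lborel)
        = (\<integral>\<^sup>+t. ennreal (indicator {y..x} t * (a t)\<^sup>2) \<partial>lborel)"
    proof (rule nn_integral_cong_AE)
      have "AE t in lborel. t \<noteq> x" "AE t in lborel. t \<noteq> y" by (auto intro: AE_lborel_singleton)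
      thus "AE t in lborel. indicator {y<..<x} t * ennreal ((a t)\<^sup>2) = ennreal (indicator {y..x} t * (a t)\<^sup>2)"
        by eventually_elim (auto simp: indicator_def)
    qed
    also have "\<dots> = ennreal (LINT t:{y..x}|lborel. (a t)\<^sup>2)"
      using ai(2)[OF xy] unfolding set_integrable_def set_lebesgue_integral_def
      by (subst nn_integral_eq_integral) auto
    also have "\<dots> * k x y = ennreal ((LINT t:{y..x}|lborel. (a t)\<^sup>2) * ((G x - G y) * \<rho> x * \<rho> y))"
      unfolding k_def by (subst ennreal_mult) (auto intro!: mult_nonneg_nonneg Gpos xy \<rho>0 set_integral_nonneg)
    also have "\<dots> \<ge> ennreal (K * ((f x - f y)\<^sup>2 * \<rho> x * \<rho> y))"
      using mult_right_mono[OF sq[OF xy], of "\<rho> x * \<rho> y"] \<rho>0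
      by (intro ennreal_leI) (auto simp: algebra_simps)
    also have "ennreal (K * ((f x - f y)\<^sup>2 * \<rho> x * \<rho> y)) = ennreal K * (indicator {..<x} y * h x y)"
      using xy K \<rho>0 by (simp add: h_def ennreal_mult)
    finally show ?thesis by simp
  qed
  have inner: "(\<integral>\<^sup>+x. \<integral>\<^sup>+y. indicator {y<..<x} t * k x y \<partial>lborel \<partial>lborel) \<le> ennreal (M * \<rho> t)" for t
  proof (cases "t \<in> X")
    case False
    have z: "indicator {y<..<x} t * k x y = 0" for x y
    proof (cases "x \<in> X \<and> y \<in> X")
      case True
      hence "t \<notin> {y<..<x}" using False True between by auto
      thus ?thesis by simp
    qed (use \<rho>0 in \<open>auto simp: k_def\<close>)
    show ?thesis unfolding z by simp
  next
    case True
    \<comment> \<open>\<open>p\<close> and \<open>q\<close> are the masses below and above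
      \<open>t\<close>. Over \<open>y < t < x\<close>, the term \<open>G x\<close> contributes
      \<open>\<rho> t * p\<close> by \<open>upper_tail\<close> and the term \<open>- G y\<close>
      contributes \<open>\<rho> t * q\<close> by \<open>lower_tail\<close>.\<close>
    define p where "p = (\<integral>y. indicator {..<t} y * \<rho> y \<partial>lborel)"
    define q where "q = (\<integral>y. indicator {t<..} y * \<rho> y \<partial>lborel)"
    have ii: "integrable lborel (\<lambda>y. indicator A y * \<rho> y)"
        "integrable lborel (\<lambda>y. indicator A y * (G y * \<rho> y))" if "A \<in> sets borel" for A
      using that integrable_mult_indicator[OF _ \<rho>i, of A] integrable_mult_indicator[OF _ G\<rho>i, of A] by auto
    have pq: "p + q = M"
    proof -
      have "p + q = (\<integral>y. indicator {..<t} y * \<rho> y + indicator {t<..} y * \<rho> y \<partial>lborel)"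
        unfolding p_def q_def using ii by (subst Bochner_Integration.integral_add) auto
      also have "\<dots> = M" unfolding M_def
      proof (rule integral_cong_AE)
        have "AE y in lborel. y \<noteq> t" by (rule AE_lborel_singleton)
        thus "AE y in lborel. indicator {..<t} y * \<rho> y + indicator {t<..} y * \<rho> y = \<rho> y"
          by eventually_elim (auto simp: indicator_def)
      qed auto
      finally show ?thesis .
    qed
    have "(\<integral>\<^sup>+y. indicator {y<..<x} t * k x y \<partial>lborel)
       = indicator {t<..} x * ennreal (G x * \<rho> x * p + \<rho> x * \<rho> t)"  for x
    proof (cases "x > t \<and> x \<in> X")
      case False
      thus ?thesis using \<rho>0 by (auto simp: k_def indicator_def)
    next
      case c: True
      have "(\<integral>\<^sup>+y. indicator {y<..<x} t * k x y \<partial>lborel)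
         = (\<integral>\<^sup>+y. ennreal (G x * \<rho> x * (indicator {..<t} y * \<rho> y) - \<rho> x * (indicator {..<t} y * (G y * \<rho> y))) \<partial>lborel)"
        using c by (intro nn_integral_cong) (auto simp: k_def indicator_def algebra_simps)
      also have "\<dots> = ennreal (\<integral>y. G x * \<rho> x * (indicator {..<t} y * \<rho> y) - \<rho> x * (indicator {..<t} y * (G y * \<rho> y)) \<partial>lborel)"
      proof (rule nn_integral_eq_integral)
        show "integrable lborel (\<lambda>y. G x * \<rho> x * (indicator {..<t} y * \<rho> y) - \<rho> x * (indicator {..<t} y * (G y * \<rho> y)))"
          by (intro Bochner_Integration.integrable_diff integrable_mult_right ii) auto
        have "0 \<le> G x * \<rho> x * (indicator {..<t} y * \<rho> y) - \<rho> x * (indicator {..<t} y * (G y * \<rho> y))" for y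
        proof (cases "y < t \<and> y \<in> X")
          case True
          hence "0 \<le> (G x - G y) * (\<rho> x * \<rho> y)" using c by (intro mult_nonneg_nonneg Gpos \<rho>0) auto
          thus ?thesis using True by (simp add: algebra_simps)
        qed (use \<rho>0 in \<open>auto simp: indicator_def\<close>)
        thus "AE y in lborel. 0 \<le> G x * \<rho> x * (indicator {..<t} y * \<rho> y) - \<rho> x * (indicator {..<t} y * (G y * \<rho> y))"
          by simp
      qed
      also have "(\<integral>y. G x * \<rho> x * (indicator {..<t} y * \<rho> y) - \<rho> x * (indicator {..<t} y * (G y * \<rho> y)) \<partial>lborel)
         = G x * \<rho> x * p + \<rho> x * \<rho> t"
        using ii by (subst Bochner_Integration.integral_diff) (auto simp: p_def lo[OF True])
      finally show ?thesis using c by simp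
    qed
    hence "(\<integral>\<^sup>+x. \<integral>\<^sup>+y. indicator {y<..<x} t * k x y \<partial>lborel \<partial>lborel)
      = (\<integral>\<^sup>+x. ennreal (p * (indicator {t<..} x * (G x * \<rho> x)) + \<rho> t * (indicator {t<..} x * \<rho> x)) \<partial>lborel)"
      by (intro nn_integral_cong) (auto simp: indicator_def algebra_simps)
    also have "\<dots> = ennreal (\<integral>x. p * (indicator {t<..} x * (G x * \<rho> x)) + \<rho> t * (indicator {t<..} x * \<rho> x) \<partial>lborel)"
    proof (rule nn_integral_eq_integral)
      show "integrable lborel (\<lambda>x. p * (indicator {t<..} x * (G x * \<rho> x)) + \<rho> t * (indicator {t<..} x * \<rho> x))"
        by (intro Bochner_Integration.integrable_add integrable_mult_right ii) auto
      \<comment> \<open>\<open>G x\<close> may be negative; the sign comes from writing the sum as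
        \<open>\<rho> x\<close> times the integral of \<open>(G x - G y) * \<rho> y\<close> over
        \<open>y < t\<close>.\<close>
      have "0 \<le> p * (indicator {t<..} x * (G x * \<rho> x)) + \<rho> t * (indicator {t<..} x * \<rho> x)" for x
      proof (cases "t < x \<and> x \<in> X")
        case c: True
        have "(\<integral>y. G x * (indicator {..<t} y * \<rho> y) - (indicator {..<t} y * (G y * \<rho> y)) \<partial>lborel) = G x * p + \<rho> t"
          using ii by (subst Bochner_Integration.integral_diff) (auto simp: p_def lo[OF True])
        hence "p * (G x * \<rho> x) + \<rho> t * \<rho> x = \<rho> x * (\<integral>y. G x * (indicator {..<t} y * \<rho> y) - (indicator {..<t} y * (G y * \<rho> y)) \<partial>lborel)"
          by (simp only:) (simp add: algebra_simps)
        also have "\<dots> \<ge> 0"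
        proof (intro mult_nonneg_nonneg \<rho>0 Bochner_Integration.integral_nonneg)
          fix y show "0 \<le> G x * (indicator {..<t} y * \<rho> y) - indicator {..<t} y * (G y * \<rho> y)"
          proof (cases "y < t \<and> y \<in> X")
            case True
            hence "0 \<le> (G x - G y) * (\<rho> y)" using c by (intro mult_nonneg_nonneg Gpos \<rho>0) auto
            thus ?thesis using True by (simp add: algebra_simps)
          qed (use \<rho>0 in \<open>auto simp: indicator_def\<close>)
        qed
        finally show ?thesis using c by simp
      qed (use \<rho>0 in \<open>auto simp: indicator_def\<close>)
      thus "AE x in lborel. 0 \<le> p * (indicator {t<..} x * (G x * \<rho> x)) + \<rho> t * (indicator {t<..} x * \<rho> x)" by simp
    qed
    also have "(\<integral>x. p * (indicator {t<..} x * (G x * \<rho> x)) + \<rho> t * (indicator {t<..} x * \<rho> x) \<partial>lborel) = p * \<rho> t + \<rho> t * q"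
      using ii by (subst Bochner_Integration.integral_add) (auto simp: q_def up[OF True])
    also have "\<dots> = M * \<rho> t" by (simp add: pq[symmetric] algebra_simps)
    finally show ?thesis by simp
  qed
  have "ennreal K * H = (\<integral>\<^sup>+x. \<integral>\<^sup>+y. ennreal K * (indicator {..<x} y * h x y) \<partial>lborel \<partial>lborel)"
  proof -
    have m: "(\<lambda>x. \<integral>\<^sup>+y. indicator {..<x} y * h x y \<partial>lborel) \<in> borel_measurable lborel"
      unfolding h_def indicator_def lessThan_iff by measurable
    show ?thesis
      unfolding H_def nn_integral_cmult[OF m, symmetric]
      by (intro nn_integral_cong nn_integral_cmult[symmetric]) (auto simp: h_def)
  qed
  also have "\<dots> \<le> (\<integral>\<^sup>+x. \<integral>\<^sup>+y. \<integral>\<^sup>+t. indicator {y<..<x} t * ennreal ((a t)\<^sup>2) * k x y \<partial>lborel \<partial>lborel \<partial>lborel)"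
    by (intro nn_integral_mono pt)
  also have "\<dots> = (\<integral>\<^sup>+x. \<integral>\<^sup>+t. \<integral>\<^sup>+y. indicator {y<..<x} t * ennreal ((a t)\<^sup>2) * k x y \<partial>lborel \<partial>lborel \<partial>lborel)"
    unfolding indicator_def greaterThanLessThan_iff k_def
    by (rule nn_integral_cong, rule lborel_pair.Fubini') measurable
  also have "\<dots> = (\<integral>\<^sup>+t. \<integral>\<^sup>+x. \<integral>\<^sup>+y. indicator {y<..<x} t * ennreal ((a t)\<^sup>2) * k x y \<partial>lborel \<partial>lborel \<partial>lborel)"
    unfolding indicator_def greaterThanLessThan_iff k_def
    by (rule lborel_pair.Fubini') measurable
  also have "\<dots> = (\<integral>\<^sup>+t. ennreal ((a t)\<^sup>2) * (\<integral>\<^sup>+x. \<integral>\<^sup>+y. indicator {y<..<x} t * k x y \<partial>lborel \<partial>lborel) \<partial>lborel)"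
  proof (rule nn_integral_cong)
    fix t
    have m: "(\<lambda>x. \<integral>\<^sup>+y. indicator {y<..<x} t * k x y \<partial>lborel) \<in> borel_measurable lborel"
      unfolding indicator_def greaterThanLessThan_iff k_def by measurable
    have m': "(\<lambda>y. indicator {y<..<x} t * k x y) \<in> borel_measurable lborel" for x
      unfolding indicator_def greaterThanLessThan_iff k_def by measurable
    show "(\<integral>\<^sup>+x. \<integral>\<^sup>+y. indicator {y<..<x} t * ennreal ((a t)\<^sup>2) * k x y \<partial>lborel \<partial>lborel)
      = ennreal ((a t)\<^sup>2) * (\<integral>\<^sup>+x. \<integral>\<^sup>+y. indicator {y<..<x} t * k x y \<partial>lborel \<partial>lborel)"
      unfolding nn_integral_cmult[OF m, symmetric] nn_integral_cmult[OF m', symmetric]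
      by (simp add: mult_ac)
  qed
  also have "\<dots> \<le> (\<integral>\<^sup>+t. ennreal ((a t)\<^sup>2) * ennreal (M * \<rho> t) \<partial>lborel)"
    by (intro nn_integral_mono mult_left_mono inner) auto
  also have "\<dots> = (\<integral>\<^sup>+t. ennreal M * ennreal ((a t)\<^sup>2 * \<rho> t) \<partial>lborel)"
    using \<rho>0 by (intro nn_integral_cong) (auto simp: ennreal_mult' ennreal_mult'' mult_ac)
  also have "\<dots> = ennreal M * (\<integral>\<^sup>+t. ennreal ((a t)\<^sup>2 * \<rho> t) \<partial>lborel)"
    by (subst nn_integral_cmult) auto
  finally have KH: "ennreal K * H \<le> ennreal M * (\<integral>\<^sup>+t. ennreal ((a t)\<^sup>2 * \<rho> t) \<partial>lborel)" .
  \<comment> \<open>\<open>h\<close> is symmetric and zero on the diagonal, so the triangles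
    \<open>y < x\<close> and \<open>y > x\<close> both contribute \<open>H\<close>.\<close>
  have "(\<integral>\<^sup>+x. \<integral>\<^sup>+y. h x y \<partial>lborel \<partial>lborel)
      = (\<integral>\<^sup>+x. \<integral>\<^sup>+y. indicator {..<x} y * h x y + indicator {x<..} y * h x y \<partial>lborel \<partial>lborel)"
    by (intro nn_integral_cong) (auto simp: indicator_def h_def linorder_neq_iff)
  also have "\<dots> = H + (\<integral>\<^sup>+x. \<integral>\<^sup>+y. indicator {x<..} y * h x y \<partial>lborel \<partial>lborel)"
  proof -
    have m: "(\<lambda>x. \<integral>\<^sup>+y. indicator {..<x} y * h x y \<partial>lborel) \<in> borel_measurable lborel"
      "(\<lambda>x. \<integral>\<^sup>+y. indicator {x<..} y * h x y \<partial>lborel) \<in> borel_measurable lborel"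
      unfolding h_def indicator_def lessThan_iff greaterThan_iff by measurable
    show ?thesis
      unfolding H_def nn_integral_add[OF m, symmetric]
      by (intro nn_integral_cong nn_integral_add) (auto simp: h_def)
  qed
  also have "(\<integral>\<^sup>+x. \<integral>\<^sup>+y. indicator {x<..} y * h x y \<partial>lborel \<partial>lborel)
     = (\<integral>\<^sup>+y. \<integral>\<^sup>+x. indicator {x<..} y * h x y \<partial>lborel \<partial>lborel)"
    unfolding indicator_def greaterThan_iff h_def
    by (rule lborel_pair.Fubini') measurable
  also have "\<dots> = H"
    unfolding H_def by (intro nn_integral_cong) (auto simp: indicator_def h_def power2_commute mult_ac)
  finally have "ennreal K * (\<integral>\<^sup>+x. \<integral>\<^sup>+y. h x y \<partial>lborel \<partial>lborel) = 2 * (ennreal K * H)"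
    by (simp add: mult_2[symmetric] mult_ac)
  also have "\<dots> \<le> 2 * (ennreal M * (\<integral>\<^sup>+t. ennreal ((a t)\<^sup>2 * \<rho> t) \<partial>lborel))"
    using KH by (intro mult_left_mono) auto
  also have "\<dots> = ennreal (2 * M) * (\<integral>\<^sup>+t. ennreal ((a t)\<^sup>2 * \<rho> t) \<partial>lborel)"
    by (subst ennreal_mult') (auto simp: mult_ac)
  finally show ?thesis unfolding h_def M_def .
qed

text \<open>Here the double integral has become twice mass times second moment minus squared first
  moment. The total mass stays as a factor because the radial weight is not normalised.\<close>

lemma brascamp_lieb:
  fixes a f :: "real \<Rightarrow> real"
  defines "X \<equiv> einterval l u"
  assumes [measurable]: "a \<in> borel_measurable borel" "f \<in> borel_measurable borel"
    and ai: "\<And>x y. x \<in> X \<Longrightarrow> y \<in> X \<Longrightarrow> y < x \<Longrightarrow> set_integrable lborel {y..x} a"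
       "\<And>x y. x \<in> X \<Longrightarrow> y \<in> X \<Longrightarrow> y < x \<Longrightarrow> set_integrable lborel {y..x} (\<lambda>t. (a t)\<^sup>2)"
    and f: "\<And>x y. x \<in> X \<Longrightarrow> y \<in> X \<Longrightarrow> y < x \<Longrightarrow> f x - f y = (LINT t:{y..x}|lborel. a t)"
    and int: "integrable lborel (\<lambda>x. f x * \<rho> x)" "integrable lborel (\<lambda>x. (f x)\<^sup>2 * \<rho> x)"
       "integrable lborel (\<lambda>x. (a x)\<^sup>2 * \<rho> x)"
  shows "K * ((\<integral>x. \<rho> x \<partial>lborel) * (\<integral>x. (f x)\<^sup>2 * \<rho> x \<partial>lborel) - (\<integral>x. f x * \<rho> x \<partial>lborel)\<^sup>2)
     \<le> (\<integral>x. \<rho> x \<partial>lborel) * (\<integral>t. (a t)\<^sup>2 * \<rho> t \<partial>lborel)"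
proof -
  let ?D = "density lborel (\<lambda>x. ennreal (\<rho> x))"
  have mass: "measure ?D (space ?D) = (\<integral>x. \<rho> x \<partial>lborel)"
    using nonneg \<rho>i by (simp add: measure_def emeasure_density nn_integral_eq_integral)
  have fin: "finite_measure ?D"
  proof
    have "emeasure ?D (space ?D) = ennreal (\<integral>x. \<rho> x \<partial>lborel)"
      using nonneg \<rho>i by (simp add: emeasure_density nn_integral_eq_integral)
    thus "emeasure ?D (space ?D) \<noteq> \<infinity>" by simp
  qed
  have i: "integrable ?D f" "integrable ?D (\<lambda>x. (f x)\<^sup>2)"
    using int nonneg by (auto simp: integrable_density mult.commute)
  have v: "(\<integral>x. f x \<partial>?D) = (\<integral>x. f x * \<rho> x \<partial>lborel)"
     "(\<integral>x. (f x)\<^sup>2 \<partial>?D) = (\<integral>x. (f x)\<^sup>2 * \<rho> x \<partial>lborel)"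
    using nonneg by (auto simp: integral_density mult.commute)
  define V where "V = (\<integral>x. \<rho> x \<partial>lborel) * (\<integral>x. (f x)\<^sup>2 * \<rho> x \<partial>lborel) - (\<integral>x. f x * \<rho> x \<partial>lborel)\<^sup>2"
  have "(\<integral>\<^sup>+x. \<integral>\<^sup>+y. ennreal ((f x - f y)\<^sup>2 * \<rho> x * \<rho> y) \<partial>lborel \<partial>lborel)
     = (\<integral>\<^sup>+x. \<integral>\<^sup>+y. ennreal ((f x - f y)\<^sup>2) \<partial>?D \<partial>?D)"
    using nonneg
    by (auto simp: nn_integral_density ennreal_mult nn_integral_cmult[symmetric] mult_ac intro!: nn_integral_cong)
  also have "\<dots> = ennreal (2 * V)"
    unfolding V_def nn_integral_square_diff[OF fin i] mass v by simp
  finally have e: "(\<integral>\<^sup>+x. \<integral>\<^sup>+y. ennreal ((f x - f y)\<^sup>2 * \<rho> x * \<rho> y) \<partial>lborel \<partial>lborel) = ennreal (2 * V)" .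
  have e2: "(\<integral>\<^sup>+t. ennreal ((a t)\<^sup>2 * \<rho> t) \<partial>lborel) = ennreal (\<integral>t. (a t)\<^sup>2 * \<rho> t \<partial>lborel)"
    using int nonneg by (intro nn_integral_eq_integral) auto
  have "ennreal K * ennreal (2 * V) \<le> ennreal (2 * (\<integral>x. \<rho> x \<partial>lborel)) * ennreal (\<integral>t. (a t)\<^sup>2 * \<rho> t \<partial>lborel)"
    using brascamp_lieb_nn[OF assms(2-3), folded X_def, OF ai f] unfolding e e2 by simp
  hence "ennreal (K * (2 * V)) \<le> ennreal (2 * (\<integral>x. \<rho> x \<partial>lborel) * (\<integral>t. (a t)\<^sup>2 * \<rho> t \<partial>lborel))"
    using K nonneg by (simp add: ennreal_mult' ennreal_mult'')
  hence "K * (2 * V) \<le> 2 * (\<integral>x. \<rho> x \<partial>lborel) * (\<integral>t. (a t)\<^sup>2 * \<rho> t \<partial>lborel)"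
    using nonneg by (subst (asm) ennreal_le_iff) auto
  hence "K * V \<le> (\<integral>x. \<rho> x \<partial>lborel) * (\<integral>t. (a t)\<^sup>2 * \<rho> t \<partial>lborel)"
    by (simp add: mult.assoc mult.left_commute)
  thus ?thesis unfolding V_def .
qed

end

text \<open>This instance supplies the one-dimensional input for the inequality on the
  sphere.\<close>

lemma std_normal_monotone_score: "monotone_score (-\<infinity>) \<infinity> std_normal_density (\<lambda>x. x) 1"
proof
  show "integrable lborel std_normal_density" using integrable_std_normal_moment[of 0] by simp
  show "integrable lborel (\<lambda>x. x * std_normal_density x)"
    using integrable_std_normal_moment[of 1] by (simp add: mult.commute)
  show "(std_normal_density has_real_derivative - (x * std_normal_density x)) (at x)" for x
    unfolding normal_density_def[abs_def]
    by (rule derivative_eq_intros refl | simp)+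
  show "((std_normal_density \<circ> real_of_ereal) \<longlongrightarrow> 0) (at_right (- \<infinity>))"
    unfolding normal_density_def[abs_def] ereal_tendsto_simps by real_asymp
  show "((std_normal_density \<circ> real_of_ereal) \<longlongrightarrow> 0) (at_left \<infinity>)"
    unfolding normal_density_def[abs_def] ereal_tendsto_simps by real_asymp
qed auto

section \<open>The Gaussian Poincare inequality\<close>

lemma norm_sq_sum_Basis: "(norm z)\<^sup>2 = (\<Sum>b\<in>Basis. (z \<bullet> b)\<^sup>2)" for z :: "'a::euclidean_space"
  by (subst power2_norm_eq_inner, subst euclidean_inner) (simp add: power2_eq_square)

text \<open>Flattening to one product measure settles the measurability of the inner integrals once
  for all four levels.\<close>

lemma nn_integral_iterated_add:
  fixes u v :: "'a \<Rightarrow> 'a \<Rightarrow> 'b \<Rightarrow> 'b \<Rightarrow> ennreal"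
  assumes "sigma_finite_measure P" "sigma_finite_measure Q"
    and [measurable]: "(\<lambda>(((x, y), s), t). u x y s t) \<in> borel_measurable (((P \<Otimes>\<^sub>M P) \<Otimes>\<^sub>M Q) \<Otimes>\<^sub>M Q)"
      "(\<lambda>(((x, y), s), t). v x y s t) \<in> borel_measurable (((P \<Otimes>\<^sub>M P) \<Otimes>\<^sub>M Q) \<Otimes>\<^sub>M Q)"
  shows "(\<integral>\<^sup>+x. \<integral>\<^sup>+y. \<integral>\<^sup>+s. \<integral>\<^sup>+t. u x y s t + v x y s t \<partial>Q \<partial>Q \<partial>P \<partial>P)
    = (\<integral>\<^sup>+x. \<integral>\<^sup>+y. \<integral>\<^sup>+s. \<integral>\<^sup>+t. u x y s t \<partial>Q \<partial>Q \<partial>P \<partial>P)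
    + (\<integral>\<^sup>+x. \<integral>\<^sup>+y. \<integral>\<^sup>+s. \<integral>\<^sup>+t. v x y s t \<partial>Q \<partial>Q \<partial>P \<partial>P)"
proof -
  interpret P: sigma_finite_measure P by fact
  interpret Q: sigma_finite_measure Q by fact
  let ?N = "((P \<Otimes>\<^sub>M P) \<Otimes>\<^sub>M Q) \<Otimes>\<^sub>M Q"
  have flat: "(\<integral>\<^sup>+x. \<integral>\<^sup>+y. \<integral>\<^sup>+s. \<integral>\<^sup>+t. w (((x, y), s), t) \<partial>Q \<partial>Q \<partial>P \<partial>P) = (\<integral>\<^sup>+z. w z \<partial>?N)"
    if [measurable]: "w \<in> borel_measurable ?N" for w
  proof -
    have "(\<lambda>z. \<integral>\<^sup>+t. w (z, t) \<partial>Q) \<in> borel_measurable ((P \<Otimes>\<^sub>M P) \<Otimes>\<^sub>M Q)"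
      by (rule Q.borel_measurable_nn_integral_fst) fact
    moreover from this have "(\<lambda>z. \<integral>\<^sup>+s. \<integral>\<^sup>+t. w ((z, s), t) \<partial>Q \<partial>Q) \<in> borel_measurable (P \<Otimes>\<^sub>M P)"
      by (rule Q.borel_measurable_nn_integral_fst)
    ultimately show ?thesis
      using that by (simp add: Q.nn_integral_fst[symmetric] P.nn_integral_fst[symmetric])
  qed
  define U where "U = (\<lambda>(((x, y), s), t). u x y s t)"
  define V where "V = (\<lambda>(((x, y), s), t). v x y s t)"
  have [measurable]: "U \<in> borel_measurable ?N" "V \<in> borel_measurable ?N"
    unfolding U_def V_def by measurable
  have "(\<integral>\<^sup>+x. \<integral>\<^sup>+y. \<integral>\<^sup>+s. \<integral>\<^sup>+t. U (((x, y), s), t) + V (((x, y), s), t) \<partial>Q \<partial>Q \<partial>P \<partial>P)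
    = (\<integral>\<^sup>+x. \<integral>\<^sup>+y. \<integral>\<^sup>+s. \<integral>\<^sup>+t. U (((x, y), s), t) \<partial>Q \<partial>Q \<partial>P \<partial>P)
    + (\<integral>\<^sup>+x. \<integral>\<^sup>+y. \<integral>\<^sup>+s. \<integral>\<^sup>+t. V (((x, y), s), t) \<partial>Q \<partial>Q \<partial>P \<partial>P)"
    by (subst (1 2 3) flat) (auto intro!: nn_integral_add)
  thus ?thesis by (simp add: U_def V_def)
qed

text \<open>For four real numbers placed as the corners of a quadrilateral, the squared differences
  along the diagonals add up to at most those along the sides; this is \<open>quad\<close>, for the
  values at \<open>(x, s)\<close>, \<open>(y, s)\<close>, \<open>(y, t)\<close>,
  \<open>(x, t)\<close>. After integration the two diagonals agree, and so do opposite sides, which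
  cancels a factor 2.\<close>

lemma efron_stein_two_factors:
  fixes f :: "'a \<Rightarrow> 'b \<Rightarrow> real"
  assumes "prob_space P" "prob_space Q"
    and f [measurable]: "(\<lambda>(x, s). f x s) \<in> borel_measurable (P \<Otimes>\<^sub>M Q)"
  shows "(\<integral>\<^sup>+x. \<integral>\<^sup>+s. \<integral>\<^sup>+y. \<integral>\<^sup>+t. ennreal ((f x s - f y t)\<^sup>2) \<partial>Q \<partial>P \<partial>Q \<partial>P)
    \<le> (\<integral>\<^sup>+s. \<integral>\<^sup>+x. \<integral>\<^sup>+y. ennreal ((f x s - f y s)\<^sup>2) \<partial>P \<partial>P \<partial>Q)
     + (\<integral>\<^sup>+x. \<integral>\<^sup>+s. \<integral>\<^sup>+t. ennreal ((f x s - f x t)\<^sup>2) \<partial>Q \<partial>Q \<partial>P)"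
proof -
  interpret P: prob_space P by fact
  interpret Q: prob_space Q by fact
  interpret QP: pair_sigma_finite Q P ..
  interpret PP: pair_sigma_finite P P ..
  interpret QQ: pair_sigma_finite Q Q ..
  let ?e = "\<lambda>a b. ennreal ((a - b)\<^sup>2)"
  let ?I = "\<lambda>g. (\<integral>\<^sup>+x. \<integral>\<^sup>+y. \<integral>\<^sup>+s. \<integral>\<^sup>+t. g x y s t \<partial>Q \<partial>Q \<partial>P \<partial>P)"
  have fm [measurable (raw)]: "g \<in> M \<rightarrow>\<^sub>M P \<Longrightarrow> h \<in> M \<rightarrow>\<^sub>M Q \<Longrightarrow> (\<lambda>z. f (g z) (h z)) \<in> borel_measurable M"
    for M :: "'c measure" and g h
    using measurable_compose[OF measurable_Pair f, of g M h] by simp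
  have T1: "(\<integral>\<^sup>+x. \<integral>\<^sup>+s. \<integral>\<^sup>+y. \<integral>\<^sup>+t. ?e (f x s) (f y t) \<partial>Q \<partial>P \<partial>Q \<partial>P) = ?I (\<lambda>x y s t. ?e (f x s) (f y t))"
    by (rule nn_integral_cong, rule QP.Fubini'[symmetric]) measurable
  have T2: "?I (\<lambda>x y s t. ?e (f x s) (f y t)) = ?I (\<lambda>x y s t. ?e (f y s) (f x t))"
    by (rule PP.Fubini') measurable
  have A: "?I (\<lambda>x y s t. ?e (f x s) (f y s)) = (\<integral>\<^sup>+s. \<integral>\<^sup>+x. \<integral>\<^sup>+y. ?e (f x s) (f y s) \<partial>P \<partial>P \<partial>Q)"
  proof -
    have "?I (\<lambda>x y s t. ?e (f x s) (f y s)) = (\<integral>\<^sup>+x. \<integral>\<^sup>+y. \<integral>\<^sup>+s. ?e (f x s) (f y s) \<partial>Q \<partial>P \<partial>P)"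
      by (simp add: Q.emeasure_space_1)
    also have "\<dots> = (\<integral>\<^sup>+x. \<integral>\<^sup>+s. \<integral>\<^sup>+y. ?e (f x s) (f y s) \<partial>P \<partial>Q \<partial>P)"
      by (rule nn_integral_cong, rule QP.Fubini') measurable
    also have "\<dots> = (\<integral>\<^sup>+s. \<integral>\<^sup>+x. \<integral>\<^sup>+y. ?e (f x s) (f y s) \<partial>P \<partial>P \<partial>Q)"
      by (rule QP.Fubini') measurable
    finally show ?thesis .
  qed
  have A': "?I (\<lambda>x y s t. ?e (f x t) (f y t)) = ?I (\<lambda>x y s t. ?e (f x s) (f y s))"
    by (simp add: Q.emeasure_space_1)
  have B: "?I (\<lambda>x y s t. ?e (f x s) (f x t)) = (\<integral>\<^sup>+x. \<integral>\<^sup>+s. \<integral>\<^sup>+t. ?e (f x s) (f x t) \<partial>Q \<partial>Q \<partial>P)"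
    by (simp add: P.emeasure_space_1)
  have B': "?I (\<lambda>x y s t. ?e (f y s) (f y t)) = (\<integral>\<^sup>+x. \<integral>\<^sup>+s. \<integral>\<^sup>+t. ?e (f x s) (f x t) \<partial>Q \<partial>Q \<partial>P)"
    by (simp add: P.emeasure_space_1)
  note add = nn_integral_iterated_add[OF P.sigma_finite_measure_axioms Q.sigma_finite_measure_axioms]
  have quad: "?e (f x s) (f y t) + ?e (f y s) (f x t)
     \<le> (?e (f x s) (f y s) + ?e (f x t) (f y t)) + (?e (f x s) (f x t) + ?e (f y s) (f y t))" for x y s t
  proof -
    have "0 \<le> (f x s - f y s - f x t + f y t)\<^sup>2" by simp
    hence "(f x s - f y t)\<^sup>2 + (f y s - f x t)\<^sup>2
      \<le> ((f x s - f y s)\<^sup>2 + (f x t - f y t)\<^sup>2) + ((f x s - f x t)\<^sup>2 + (f y s - f y t)\<^sup>2)"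
      by (simp add: power2_eq_square algebra_simps)
    from ennreal_leI[OF this] show ?thesis by simp
  qed
  have "2 * ?I (\<lambda>x y s t. ?e (f x s) (f y t)) = ?I (\<lambda>x y s t. ?e (f x s) (f y t)) + ?I (\<lambda>x y s t. ?e (f y s) (f x t))"
    unfolding mult_2 using T2 by simp
  also have "\<dots> = ?I (\<lambda>x y s t. ?e (f x s) (f y t) + ?e (f y s) (f x t))"
    by (rule add[symmetric]) (unfold split_beta', measurable)
  also have "\<dots> \<le> ?I (\<lambda>x y s t. (?e (f x s) (f y s) + ?e (f x t) (f y t)) + (?e (f x s) (f x t) + ?e (f y s) (f y t)))"
    by (intro nn_integral_mono quad)
  also have "\<dots> = ?I (\<lambda>x y s t. ?e (f x s) (f y s) + ?e (f x t) (f y t))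
      + ?I (\<lambda>x y s t. ?e (f x s) (f x t) + ?e (f y s) (f y t))"
    by (rule add) (unfold split_beta', measurable)
  also have "?I (\<lambda>x y s t. ?e (f x s) (f y s) + ?e (f x t) (f y t))
      = ?I (\<lambda>x y s t. ?e (f x s) (f y s)) + ?I (\<lambda>x y s t. ?e (f x t) (f y t))"
    by (rule add) (unfold split_beta', measurable)
  also have "?I (\<lambda>x y s t. ?e (f x s) (f x t) + ?e (f y s) (f y t))
      = ?I (\<lambda>x y s t. ?e (f x s) (f x t)) + ?I (\<lambda>x y s t. ?e (f y s) (f y t))"
    by (rule add) (unfold split_beta', measurable)
  also have "(?I (\<lambda>x y s t. ?e (f x s) (f y s)) + ?I (\<lambda>x y s t. ?e (f x t) (f y t)))
      + (?I (\<lambda>x y s t. ?e (f x s) (f x t)) + ?I (\<lambda>x y s t. ?e (f y s) (f y t)))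
      = 2 * ((\<integral>\<^sup>+s. \<integral>\<^sup>+x. \<integral>\<^sup>+y. ?e (f x s) (f y s) \<partial>P \<partial>P \<partial>Q)
       + (\<integral>\<^sup>+x. \<integral>\<^sup>+s. \<integral>\<^sup>+t. ?e (f x s) (f x t) \<partial>Q \<partial>Q \<partial>P))"
    unfolding A' A B B' by (simp add: mult_2 add_ac)
  finally show ?thesis unfolding T1
    by (subst (asm) ennreal_mult_le_mult_iff) auto
qed

text \<open>Tensorization of variance. The induction splits off the coordinate \<open>i\<close>: one
  term resamples \<open>i\<close> alone, the other compares the remaining coordinates with
  \<open>i\<close> frozen at \<open>s\<close> and falls under the induction hypothesis.\<close>

lemma efron_stein:
  fixes M :: "'i \<Rightarrow> 'a measure" and F :: "('i \<Rightarrow> 'a) \<Rightarrow> real"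
  assumes M: "\<And>i. prob_space (M i)" and "finite I" and "F \<in> borel_measurable (PiM I M)"
  shows "(\<integral>\<^sup>+x. \<integral>\<^sup>+y. ennreal ((F x - F y)\<^sup>2) \<partial>PiM I M \<partial>PiM I M)
    \<le> (\<Sum>i\<in>I. \<integral>\<^sup>+x. \<integral>\<^sup>+s. \<integral>\<^sup>+t. ennreal ((F (x(i := s)) - F (x(i := t)))\<^sup>2) \<partial>M i \<partial>M i \<partial>PiM I M)"
  using assms(2,3)
proof (induction I arbitrary: F rule: finite_induct)
  case empty
  interpret product_sigma_finite M
    by (simp add: product_sigma_finite_def M prob_space_imp_sigma_finite)
  show ?case by (simp add: PiM_empty nn_integral_count_space_finite)
next
  case (insert i I)
  interpret product_sigma_finite M
    by (simp add: product_sigma_finite_def M prob_space_imp_sigma_finite)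
  let ?P = "PiM I M"
  interpret P: prob_space ?P by (intro prob_space_PiM M)
  interpret Mi: prob_space "M i" by (rule M)
  interpret MP: pair_sigma_finite "M i" ?P ..
  note Fm [measurable] = insert.prems
  have upd: "(\<lambda>z. F ((g z)(i := h z))) \<in> borel_measurable N"
    if "g \<in> N \<rightarrow>\<^sub>M ?P" "h \<in> N \<rightarrow>\<^sub>M M i" for N :: "'z measure" and g h
    by (rule measurable_compose[OF _ Fm], rule measurable_fun_upd[OF _ that]) auto
  have upd2: "(\<lambda>z. F ((g z)(k := a z, i := h z))) \<in> borel_measurable N"
    if "k \<in> I" "g \<in> N \<rightarrow>\<^sub>M ?P" "h \<in> N \<rightarrow>\<^sub>M M i" "a \<in> N \<rightarrow>\<^sub>M M k"
    for N :: "'z measure" and g h k a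
    by (rule measurable_compose[OF _ Fm], rule measurable_fun_upd[OF _ measurable_fun_upd[OF _ that(2) that(4)] that(3)])
       (use that in auto)
  have upd1: "(\<lambda>z. F ((g z)(k := a z))) \<in> borel_measurable N"
    if "k \<in> insert i I" "g \<in> N \<rightarrow>\<^sub>M PiM (insert i I) M" "a \<in> N \<rightarrow>\<^sub>M M k"
    for N :: "'z measure" and g k a
    by (rule measurable_compose[OF _ Fm], rule measurable_fun_upd[OF _ that(2) that(3)]) (use that in auto)
  let ?e = "\<lambda>a b. ennreal ((a - b)\<^sup>2)"
  have sf: "sigma_finite_measure (M k)" for k by (rule prob_space_imp_sigma_finite[OF M])
  have "(\<integral>\<^sup>+x. \<integral>\<^sup>+y. ?e (F x) (F y) \<partial>PiM (insert i I) M \<partial>PiM (insert i I) M)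
     = (\<integral>\<^sup>+x. \<integral>\<^sup>+s. \<integral>\<^sup>+y. \<integral>\<^sup>+t. ?e (F (x(i := s))) (F (y(i := t))) \<partial>M i \<partial>?P \<partial>M i \<partial>?P)"
  proof -
    interpret PI: prob_space "PiM (insert i I) M" by (intro prob_space_PiM M)
    have "(\<lambda>x. \<integral>\<^sup>+y. ?e (F x) (F y) \<partial>PiM (insert i I) M) \<in> borel_measurable (PiM (insert i I) M)"
      by measurable
    thus ?thesis using insert.hyps
      by (subst product_nn_integral_insert) (auto intro!: nn_integral_cong product_nn_integral_insert)
  qed
  also have "\<dots> \<le> (\<integral>\<^sup>+s. \<integral>\<^sup>+x. \<integral>\<^sup>+y. ?e (F (x(i := s))) (F (y(i := s))) \<partial>?P \<partial>?P \<partial>M i)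
     + (\<integral>\<^sup>+x. \<integral>\<^sup>+s. \<integral>\<^sup>+t. ?e (F (x(i := s))) (F (x(i := t))) \<partial>M i \<partial>M i \<partial>?P)"
    by (rule efron_stein_two_factors[OF P.prob_space_axioms Mi.prob_space_axioms])
       (auto simp: split_beta' intro!: upd)
  finally have two: "(\<integral>\<^sup>+x. \<integral>\<^sup>+y. ?e (F x) (F y) \<partial>PiM (insert i I) M \<partial>PiM (insert i I) M)
    \<le> (\<integral>\<^sup>+s. \<integral>\<^sup>+x. \<integral>\<^sup>+y. ?e (F (x(i := s))) (F (y(i := s))) \<partial>?P \<partial>?P \<partial>M i)
     + (\<integral>\<^sup>+x. \<integral>\<^sup>+s. \<integral>\<^sup>+t. ?e (F (x(i := s))) (F (x(i := t))) \<partial>M i \<partial>M i \<partial>?P)" .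
  have "(\<integral>\<^sup>+s. \<integral>\<^sup>+x. \<integral>\<^sup>+y. ?e (F (x(i := s))) (F (y(i := s))) \<partial>?P \<partial>?P \<partial>M i)
    \<le> (\<integral>\<^sup>+s. (\<Sum>k\<in>I. \<integral>\<^sup>+x. \<integral>\<^sup>+a. \<integral>\<^sup>+b. ?e (F (x(k := a, i := s))) (F (x(k := b, i := s))) \<partial>M k \<partial>M k \<partial>?P) \<partial>M i)"
    by (intro nn_integral_mono insert.IH upd) auto
  also have "\<dots> = (\<Sum>k\<in>I. \<integral>\<^sup>+s. \<integral>\<^sup>+x. \<integral>\<^sup>+a. \<integral>\<^sup>+b. ?e (F (x(k := a, i := s))) (F (x(k := b, i := s))) \<partial>M k \<partial>M k \<partial>?P \<partial>M i)"
  proof (rule nn_integral_sum)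
    fix k assume k: "k \<in> I"
    interpret Mk: sigma_finite_measure "M k" by (rule sf)
    note [measurable (raw)] = upd2[OF k]
    show "(\<lambda>s. \<integral>\<^sup>+x. \<integral>\<^sup>+a. \<integral>\<^sup>+b. ?e (F (x(k := a, i := s))) (F (x(k := b, i := s))) \<partial>M k \<partial>M k \<partial>?P) \<in> borel_measurable (M i)"
      by measurable
  qed
  also have "\<dots> = (\<Sum>k\<in>I. \<integral>\<^sup>+x. \<integral>\<^sup>+a. \<integral>\<^sup>+b. ?e (F (x(k := a))) (F (x(k := b))) \<partial>M k \<partial>M k \<partial>PiM (insert i I) M)"
  proof (rule sum.cong[OF refl])
    fix k assume k: "k \<in> I"
    hence ki: "k \<noteq> i" using insert.hyps by auto
    interpret Mk: sigma_finite_measure "M k" by (rule sf)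
    note [measurable (raw)] = upd2[OF k] upd1[OF insertI2[OF k]]
    have "(\<integral>\<^sup>+s. \<integral>\<^sup>+x. \<integral>\<^sup>+a. \<integral>\<^sup>+b. ?e (F (x(k := a, i := s))) (F (x(k := b, i := s))) \<partial>M k \<partial>M k \<partial>?P \<partial>M i)
       = (\<integral>\<^sup>+x. \<integral>\<^sup>+s. \<integral>\<^sup>+a. \<integral>\<^sup>+b. ?e (F (x(k := a, i := s))) (F (x(k := b, i := s))) \<partial>M k \<partial>M k \<partial>M i \<partial>?P)"
      by (rule MP.Fubini'[symmetric]) measurable
    also have "\<dots> = (\<integral>\<^sup>+x. \<integral>\<^sup>+a. \<integral>\<^sup>+b. ?e (F (x(k := a))) (F (x(k := b))) \<partial>M k \<partial>M k \<partial>PiM (insert i I) M)"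
    proof (subst product_nn_integral_insert)
      show "(\<lambda>x. \<integral>\<^sup>+a. \<integral>\<^sup>+b. ?e (F (x(k := a))) (F (x(k := b))) \<partial>M k \<partial>M k) \<in> borel_measurable (PiM (insert i I) M)"
        by measurable
    qed (use insert.hyps ki in \<open>auto simp: fun_upd_twist\<close>)
    finally show "(\<integral>\<^sup>+s. \<integral>\<^sup>+x. \<integral>\<^sup>+a. \<integral>\<^sup>+b. ?e (F (x(k := a, i := s))) (F (x(k := b, i := s))) \<partial>M k \<partial>M k \<partial>?P \<partial>M i)
       = (\<integral>\<^sup>+x. \<integral>\<^sup>+a. \<integral>\<^sup>+b. ?e (F (x(k := a))) (F (x(k := b))) \<partial>M k \<partial>M k \<partial>PiM (insert i I) M)" .
  qed
  finally have rest: "(\<integral>\<^sup>+s. \<integral>\<^sup>+x. \<integral>\<^sup>+y. ?e (F (x(i := s))) (F (y(i := s))) \<partial>?P \<partial>?P \<partial>M i)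
    \<le> (\<Sum>k\<in>I. \<integral>\<^sup>+x. \<integral>\<^sup>+a. \<integral>\<^sup>+b. ?e (F (x(k := a))) (F (x(k := b))) \<partial>M k \<partial>M k \<partial>PiM (insert i I) M)" .
  have last: "(\<integral>\<^sup>+x. \<integral>\<^sup>+s. \<integral>\<^sup>+t. ?e (F (x(i := s))) (F (x(i := t))) \<partial>M i \<partial>M i \<partial>?P)
     = (\<integral>\<^sup>+x. \<integral>\<^sup>+s. \<integral>\<^sup>+t. ?e (F (x(i := s))) (F (x(i := t))) \<partial>M i \<partial>M i \<partial>PiM (insert i I) M)"
  proof (subst product_nn_integral_insert)
    note [measurable (raw)] = upd1[OF insertI1]
    show "(\<lambda>x. \<integral>\<^sup>+s. \<integral>\<^sup>+t. ?e (F (x(i := s))) (F (x(i := t))) \<partial>M i \<partial>M i) \<in> borel_measurable (PiM (insert i I) M)"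
      by measurable
  qed (use insert.hyps in \<open>auto simp: Mi.emeasure_space_1\<close>)
  show ?case unfolding sum.insert[OF insert.hyps(1,2)] last[symmetric]
    by (rule order_trans[OF two], subst add.commute, rule add_left_mono, rule rest)
qed

section \<open>The standard Gaussian measure on the line and on Euclidean space\<close>

abbreviation std_normal :: "real measure"
  where "std_normal \<equiv> density lborel std_normal_density"

lemma gaussian_poincare_line:
  fixes a f :: "real \<Rightarrow> real"
  assumes [measurable]: "a \<in> borel_measurable borel" "f \<in> borel_measurable borel"
    and ai: "\<And>x y. set_integrable lborel {y..x} a" "\<And>x y. set_integrable lborel {y..x} (\<lambda>t. (a t)\<^sup>2)"
    and f: "\<And>x y. y < x \<Longrightarrow> f x - f y = (LINT t:{y..x}|lborel. a t)"
  shows "(\<integral>\<^sup>+x. \<integral>\<^sup>+y. ennreal ((f x - f y)\<^sup>2) \<partial>std_normal \<partial>std_normal)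
     \<le> 2 * (\<integral>\<^sup>+t. ennreal ((a t)\<^sup>2) \<partial>std_normal)"
proof -
  have "(\<integral>\<^sup>+x. \<integral>\<^sup>+y. ennreal ((f x - f y)\<^sup>2) \<partial>std_normal \<partial>std_normal)
     = (\<integral>\<^sup>+x. \<integral>\<^sup>+y. ennreal ((f x - f y)\<^sup>2 * std_normal_density x * std_normal_density y) \<partial>lborel \<partial>lborel)"
    by (auto simp: nn_integral_density ennreal_mult nn_integral_cmult[symmetric] mult_ac intro!: nn_integral_cong)
  also have "\<dots> \<le> ennreal (2 * (\<integral>x. std_normal_density x \<partial>lborel))
      * (\<integral>\<^sup>+t. ennreal ((a t)\<^sup>2 * std_normal_density t) \<partial>lborel)"
    using monotone_score.brascamp_lieb_nn[OF std_normal_monotone_score assms(1,2) ai f] by simp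
  also have "\<dots> = 2 * (\<integral>\<^sup>+t. ennreal ((a t)\<^sup>2) \<partial>std_normal)"
    by (auto simp: nn_integral_density ennreal_mult mult_ac integral_normal_density)
  finally show ?thesis .
qed

text \<open>The image of a product measure is the form that Efron--Stein needs;
  \<open>std_gaussian_eq_density\<close> recovers the rotation invariant density, the form that
  polar coordinates need.\<close>

definition std_gaussian :: "'a::euclidean_space measure"
  where "std_gaussian = distr (\<Pi>\<^sub>M b\<in>Basis. std_normal) borel (\<lambda>f. \<Sum>b\<in>Basis. f b *\<^sub>R b)"

lemma sets_std_gaussian [simp, measurable_cong]: "sets std_gaussian = sets borel"
  by (simp add: std_gaussian_def)

lemma space_std_gaussian [simp]: "space std_gaussian = UNIV"
  by (simp add: std_gaussian_def)

lemma prob_space_std_normal: "prob_space std_normal"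
  by (rule prob_space_normal_density) simp

lemma prob_space_std_gaussian: "prob_space (std_gaussian :: 'a::euclidean_space measure)"
  unfolding std_gaussian_def
  by (rule prob_space.prob_space_distr[OF prob_space_PiM[OF prob_space_std_normal]]) measurable

text \<open>Efron--Stein reduces the claim to lines parallel to the axes, where
  \<open>gaussian_poincare_line\<close> applies. The derivative is required only away from the
  origin, because the functions of \<open>sphere_poincare\<close> are homogeneous of degree 1 and
  may have a cone point there; each line meets the origin at most once.\<close>

lemma gaussian_poincare:
  fixes F :: "'a::euclidean_space \<Rightarrow> real" and D :: "'a \<Rightarrow> 'a"
  assumes cont: "continuous_on UNIV F"
    and der: "\<And>z. z \<noteq> 0 \<Longrightarrow> (F has_derivative (\<lambda>v. D z \<bullet> v)) (at z)"
    and Dm [measurable]: "D \<in> borel_measurable borel" and B: "\<And>z. norm (D z) \<le> B"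
  shows "(\<integral>\<^sup>+x. \<integral>\<^sup>+y. ennreal ((F x - F y)\<^sup>2) \<partial>std_gaussian \<partial>std_gaussian)
    \<le> 2 * (\<integral>\<^sup>+z. ennreal ((norm (D z))\<^sup>2) \<partial>std_gaussian)"
proof -
  have [measurable]: "F \<in> borel_measurable borel"
    by (rule borel_measurable_continuous_onI[OF cont])
  let ?P = "\<Pi>\<^sub>M b\<in>(Basis::'a set). std_normal"
  define X where "X f = (\<Sum>b\<in>(Basis::'a set). f b *\<^sub>R b)" for f :: "'a \<Rightarrow> real"
  have [measurable]: "X \<in> ?P \<rightarrow>\<^sub>M borel" unfolding X_def by measurable
  interpret P: prob_space ?P by (intro prob_space_PiM prob_space_std_normal)
  interpret N: prob_space std_normal by (rule prob_space_std_normal)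
  interpret product_sigma_finite "\<lambda>_::'a. std_normal" ..
  \<comment> \<open>Turns the conditional energies of Efron--Stein back into integrals over the
    product: the coordinate \<open>b\<close> is independent of the others and has law
    \<open>std_normal\<close>.\<close>
  have resample: "(\<integral>\<^sup>+x. \<integral>\<^sup>+s. g (x(b := s)) \<partial>std_normal \<partial>?P) = (\<integral>\<^sup>+x. g x \<partial>?P)"
    if "b \<in> Basis" and [measurable]: "g \<in> borel_measurable ?P" for g b
  proof -
    define J where "J = Basis - {b}"
    have J: "insert b J = Basis" "finite J" "b \<notin> J" using that by (auto simp: J_def)
    have upd: "(\<lambda>z. g ((h z)(b := k z))) \<in> borel_measurable L"
      if "h \<in> L \<rightarrow>\<^sub>M ?P" "k \<in> L \<rightarrow>\<^sub>M std_normal" for L :: "'z measure" and h k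
      using \<open>b \<in> Basis\<close>
      by (intro measurable_compose[OF _ \<open>g \<in> borel_measurable ?P\<close>] measurable_fun_upd[OF _ that]) auto
    have "(\<lambda>x. \<integral>\<^sup>+s. g (x(b := s)) \<partial>std_normal) \<in> borel_measurable ?P"
      by (rule N.borel_measurable_nn_integral) (auto simp: split_beta' intro!: upd)
    moreover have "emeasure std_normal UNIV = 1" using N.emeasure_space_1 by simp
    ultimately show ?thesis
      using product_nn_integral_insert[OF J(2,3), of "\<lambda>x. \<integral>\<^sup>+s. g (x(b := s)) \<partial>std_normal"]
        product_nn_integral_insert[OF J(2,3), of g] that
      by (simp add: J)
  qed
  have line: "(\<integral>\<^sup>+s. \<integral>\<^sup>+t. ennreal ((F (X (x(b := s))) - F (X (x(b := t))))\<^sup>2) \<partial>std_normal \<partial>std_normal)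
     \<le> 2 * (\<integral>\<^sup>+s. ennreal ((D (X (x(b := s))) \<bullet> b)\<^sup>2) \<partial>std_normal)" if b: "b \<in> Basis" for x b
  proof -
    define p where "p = (\<Sum>c\<in>Basis - {b}. x c *\<^sub>R c)"
    have Xs: "X (x(b := s)) = p + s *\<^sub>R b" for s
      unfolding X_def p_def using b
      by (subst sum.remove[OF finite_Basis b]) (auto simp: add.commute intro!: sum.cong)
    define a where "a s = D (p + s *\<^sub>R b) \<bullet> b" for s
    define f where "f s = F (p + s *\<^sub>R b)" for s
    have [measurable]: "a \<in> borel_measurable borel" "f \<in> borel_measurable borel"
      unfolding a_def f_def by measurable
    have aB: "\<bar>a s\<bar> \<le> B" for s
      using Cauchy_Schwarz_ineq2[of "D (p + s *\<^sub>R b)" b] B[of "p + s *\<^sub>R b"] b by (simp add: a_def)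
    have bi: "set_integrable lborel {y..z} h" if "h \<in> borel_measurable borel" "\<And>s. \<bar>h s\<bar> \<le> C"
      for h :: "real \<Rightarrow> real" and C y z
      unfolding set_integrable_def
    proof (rule Bochner_Integration.integrable_bound)
      show "integrable lborel (\<lambda>x. indicator {y..z} x * C)"
        by (simp add: integrable_indicator_iff emeasure_lborel_Icc_eq)
      show "(\<lambda>x. indicator {y..z} x *\<^sub>R h x) \<in> borel_measurable lborel" using that by simp
      have "\<bar>h x\<bar> \<le> \<bar>C\<bar>" for x using that(2)[of x] by linarith
      thus "AE x in lborel. norm (indicator {y..z} x *\<^sub>R h x) \<le> norm (indicator {y..z} x * C)"
        by (auto simp: indicator_def)
    qed
    have ai: "set_integrable lborel {y..z} a" for y z by (rule bi[OF _ aB]) measurable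
    have a2: "set_integrable lborel {y..z} (\<lambda>t. (a t)\<^sup>2)" for y z
    proof (rule bi)
      show "\<bar>(a s)\<^sup>2\<bar> \<le> B\<^sup>2" for s using aB[of s] by (simp add: abs_le_square_iff[symmetric])
    qed measurable
    have f: "f z - f y = (LINT t:{y..z}|lborel. a t)" if "y < z" for y z
    proof -
      have "(a has_integral f z - f y) {y..z}"
      \<comment> \<open>If \<open>p + s *\<^sub>R b = 0\<close>, the inner product with
        \<open>b\<close> gives \<open>s = - (p \<bullet> b)\<close>, the only point at which
        \<open>f\<close> may fail to be differentiable.\<close>
      proof (rule fundamental_theorem_of_calculus_interior_strong[where S = "{- (p \<bullet> b)}"])
        show "continuous_on {y..z} f" unfolding f_def
          by (intro continuous_on_compose2[OF cont] continuous_intros) auto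
        fix s assume s: "s \<in> {y<..<z} - {- (p \<bullet> b)}"
        have nz: "p + s *\<^sub>R b \<noteq> 0"
        proof
          assume "p + s *\<^sub>R b = 0"
          hence "(p + s *\<^sub>R b) \<bullet> b = 0" by simp
          thus False using s b by (simp add: inner_add_left)
        qed
        have "(f has_derivative (\<lambda>v. D (p + s *\<^sub>R b) \<bullet> (v *\<^sub>R b))) (at s)"
          unfolding f_def
          by (rule has_derivative_compose[where f = "\<lambda>s. p + s *\<^sub>R b" and g = F and f' = "\<lambda>v. v *\<^sub>R b", OF _ der[OF nz]])
            (auto intro!: derivative_eq_intros)
        thus "(f has_vector_derivative a s) (at s)"
          by (simp add: has_vector_derivative_def a_def)
      qed (use that in auto)
      thus ?thesis
        using set_borel_integral_eq_integral(2)[OF ai[of y z]] by (simp add: integral_unique)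
    qed
    show ?thesis
      using gaussian_poincare_line[OF _ _ ai a2 f] by (simp add: Xs f_def a_def)
  qed
  have "(\<integral>\<^sup>+x. \<integral>\<^sup>+y. ennreal ((F x - F y)\<^sup>2) \<partial>std_gaussian \<partial>std_gaussian)
     = (\<integral>\<^sup>+x. \<integral>\<^sup>+y. ennreal ((F (X x) - F (X y))\<^sup>2) \<partial>?P \<partial>?P)"
    unfolding std_gaussian_def X_def[symmetric] by (simp add: nn_integral_distr)
  also have "\<dots> \<le> (\<Sum>b\<in>Basis. \<integral>\<^sup>+x. \<integral>\<^sup>+s. \<integral>\<^sup>+t. ennreal ((F (X (x(b := s))) - F (X (x(b := t))))\<^sup>2)
      \<partial>std_normal \<partial>std_normal \<partial>?P)"
    by (rule efron_stein[OF prob_space_std_normal finite_Basis]) measurable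
  also have "\<dots> \<le> (\<Sum>b\<in>Basis. \<integral>\<^sup>+x. 2 * (\<integral>\<^sup>+s. ennreal ((D (X (x(b := s))) \<bullet> b)\<^sup>2) \<partial>std_normal) \<partial>?P)"
    by (intro sum_mono nn_integral_mono line)
  also have "\<dots> = (\<Sum>b\<in>Basis. 2 * (\<integral>\<^sup>+x. ennreal ((D (X x) \<bullet> b)\<^sup>2) \<partial>?P))"
  proof (rule sum.cong[OF refl])
    fix b :: 'a assume b: "b \<in> Basis"
    have "(\<integral>\<^sup>+x. 2 * (\<integral>\<^sup>+s. ennreal ((D (X (x(b := s))) \<bullet> b)\<^sup>2) \<partial>std_normal) \<partial>?P)
       = (\<integral>\<^sup>+x. (\<integral>\<^sup>+s. 2 * ennreal ((D (X (x(b := s))) \<bullet> b)\<^sup>2) \<partial>std_normal) \<partial>?P)"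
    proof (intro nn_integral_cong nn_integral_cmult[symmetric])
      fix x assume "x \<in> space ?P"
      hence "(\<lambda>s. x(b := s)) \<in> borel \<rightarrow>\<^sub>M ?P"
        using b by (intro measurable_fun_upd[of _ Basis]) auto
      thus "(\<lambda>s. ennreal ((D (X (x(b := s))) \<bullet> b)\<^sup>2)) \<in> borel_measurable std_normal"
        by (simp add: measurable_compose[where g = "\<lambda>x. ennreal ((D (X x) \<bullet> b)\<^sup>2)"])
    qed
    also have "\<dots> = (\<integral>\<^sup>+x. 2 * ennreal ((D (X x) \<bullet> b)\<^sup>2) \<partial>?P)"
      by (rule resample[OF b, of "\<lambda>x. 2 * ennreal ((D (X x) \<bullet> b)\<^sup>2)"]) measurable
    also have "\<dots> = 2 * (\<integral>\<^sup>+x. ennreal ((D (X x) \<bullet> b)\<^sup>2) \<partial>?P)"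
      by (rule nn_integral_cmult) measurable
    finally show "(\<integral>\<^sup>+x. 2 * (\<integral>\<^sup>+s. ennreal ((D (X (x(b := s))) \<bullet> b)\<^sup>2) \<partial>std_normal) \<partial>?P)
       = 2 * (\<integral>\<^sup>+x. ennreal ((D (X x) \<bullet> b)\<^sup>2) \<partial>?P)" .
  qed
  also have "\<dots> = 2 * (\<integral>\<^sup>+x. (\<Sum>b\<in>Basis. ennreal ((D (X x) \<bullet> b)\<^sup>2)) \<partial>?P)"
    by (subst nn_integral_sum) (auto simp: sum_distrib_left)
  also have "\<dots> = 2 * (\<integral>\<^sup>+x. ennreal ((norm (D (X x)))\<^sup>2) \<partial>?P)"
    by (simp only: norm_sq_sum_Basis sum_ennreal zero_le_power2)
  also have "\<dots> = 2 * (\<integral>\<^sup>+z. ennreal ((norm (D z))\<^sup>2) \<partial>std_gaussian)"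
    unfolding std_gaussian_def X_def[symmetric] by (simp add: nn_integral_distr)
  finally show ?thesis .
qed

lemma std_gaussian_eq_density:
  "(std_gaussian :: 'a::euclidean_space measure)
     = density lborel (\<lambda>z. ennreal ((1 / sqrt (2 * pi)) ^ DIM('a) * exp (- (norm z)\<^sup>2 / 2)))"
proof -
  interpret product_sigma_finite "\<lambda>_::'a. lborel :: real measure" ..
  interpret N: product_sigma_finite "\<lambda>_::'a. std_normal"
    using prob_space_std_normal prob_space_imp_sigma_finite by (auto simp: product_sigma_finite_def)
  let ?d = "\<lambda>f. \<Prod>b\<in>(Basis::'a set). ennreal (std_normal_density (f b))"
  have "density (\<Pi>\<^sub>M b\<in>(Basis::'a set). lborel) ?d = (\<Pi>\<^sub>M b\<in>(Basis::'a set). std_normal)"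
  proof (rule N.PiM_eqI)
    fix A assume A: "\<And>b::'a. b \<in> Basis \<Longrightarrow> A b \<in> sets std_normal"
    have "emeasure (density (\<Pi>\<^sub>M b\<in>(Basis::'a set). lborel) ?d) (Pi\<^sub>E Basis A)
       = (\<integral>\<^sup>+f. (\<Prod>b\<in>(Basis::'a set). ennreal (std_normal_density (f b)) * indicator (A b) (f b)) \<partial>(\<Pi>\<^sub>M b\<in>(Basis::'a set). lborel))"
    proof (subst emeasure_density)
      show "(\<integral>\<^sup>+f. ?d f * indicator (Pi\<^sub>E Basis A) f \<partial>(\<Pi>\<^sub>M b\<in>(Basis::'a set). lborel))
        = (\<integral>\<^sup>+f. (\<Prod>b\<in>(Basis::'a set). ennreal (std_normal_density (f b)) * indicator (A b) (f b)) \<partial>(\<Pi>\<^sub>M b\<in>(Basis::'a set). lborel))"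
      proof (rule nn_integral_cong)
        fix f :: "'a \<Rightarrow> real" assume "f \<in> space (\<Pi>\<^sub>M b\<in>(Basis::'a set). lborel)"
        hence "f \<in> extensional Basis" by (auto simp: space_PiM PiE_def)
        hence "indicator (Pi\<^sub>E Basis A) f = (\<Prod>b\<in>(Basis::'a set). indicator (A b) (f b) :: ennreal)"
          by (auto simp: indicator_def PiE_def Pi_def prod_eq_1_iff intro!: prod_zero[symmetric])
        thus "?d f * indicator (Pi\<^sub>E Basis A) f = (\<Prod>b\<in>(Basis::'a set). ennreal (std_normal_density (f b)) * indicator (A b) (f b))"
          by (simp add: prod.distrib)
      qed
    qed (use A in \<open>auto intro!: sets_PiM_I_finite\<close>)
    also have "\<dots> = (\<Prod>b\<in>(Basis::'a set). emeasure std_normal (A b))"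
      using A by (subst product_nn_integral_prod) (auto simp: emeasure_density)
    finally show "emeasure (density (\<Pi>\<^sub>M b\<in>(Basis::'a set). lborel) ?d) (Pi\<^sub>E Basis A)
       = (\<Prod>b\<in>(Basis::'a set). emeasure std_normal (A b))" .
  qed (auto intro!: sets_PiM_cong)
  hence "(std_gaussian :: 'a measure) = distr (density (\<Pi>\<^sub>M b\<in>(Basis::'a set). lborel) ?d) borel (\<lambda>f. \<Sum>b\<in>Basis. f b *\<^sub>R b)"
    by (simp add: std_gaussian_def)
  also have "\<dots> = distr (density (\<Pi>\<^sub>M b\<in>(Basis::'a set). lborel)
      (\<lambda>f. (\<Prod>b\<in>(Basis::'a set). ennreal (std_normal_density ((\<Sum>b\<in>Basis. f b *\<^sub>R b) \<bullet> b))))) borel (\<lambda>f. \<Sum>b\<in>Basis. f b *\<^sub>R b)"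
    by (simp add: inner_sum_left_Basis)
  also have "\<dots> = density lborel (\<lambda>z. \<Prod>b\<in>(Basis::'a set). ennreal (std_normal_density (z \<bullet> b)))"
    unfolding lborel_eq[where 'a = 'a] by (subst density_distr) auto
  also have "(\<lambda>z. \<Prod>b\<in>(Basis::'a set). ennreal (std_normal_density (z \<bullet> b)))
     = (\<lambda>z. ennreal ((1 / sqrt (2 * pi)) ^ DIM('a) * exp (- (norm z)\<^sup>2 / 2)))"
  proof
    fix z :: 'a
    have "(\<Prod>b\<in>(Basis::'a set). std_normal_density (z \<bullet> b)) = (1 / sqrt (2 * pi)) ^ DIM('a) * exp (\<Sum>b\<in>Basis. - (z \<bullet> b)\<^sup>2 / 2)"
      by (simp add: std_normal_density_def prod.distrib exp_sum prod_dividef power_divide)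
    also have "(\<Sum>b\<in>Basis. - (z \<bullet> b)\<^sup>2 / 2) = - (norm z)\<^sup>2 / 2"
    proof -
      show ?thesis unfolding norm_sq_sum_Basis[of z] by (simp add: sum_negf flip: sum_divide_distrib)
    qed
    finally show "(\<Prod>b\<in>(Basis::'a set). ennreal (std_normal_density (z \<bullet> b))) = ennreal ((1 / sqrt (2 * pi)) ^ DIM('a) * exp (- (norm z)\<^sup>2 / 2))"
      by (simp add: prod_ennreal)
  qed
  finally show ?thesis .
qed

lemma std_gaussian_second_moment:
  "(\<integral>\<^sup>+z. ennreal ((norm z)\<^sup>2) \<partial>(std_gaussian :: 'a::euclidean_space measure)) = ennreal DIM('a)"
proof -
  let ?P = "\<Pi>\<^sub>M b\<in>(Basis::'a set). std_normal"
  interpret N: prob_space std_normal by (rule prob_space_std_normal)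
  interpret product_prob_space "\<lambda>_::'a. std_normal" Basis ..
  have "(\<integral>\<^sup>+z. ennreal ((norm z)\<^sup>2) \<partial>(std_gaussian :: 'a measure)) = (\<integral>\<^sup>+f. (\<Sum>b\<in>Basis. ennreal ((f b)\<^sup>2)) \<partial>?P)"
    unfolding std_gaussian_def
  proof (subst nn_integral_distr)
    have "(norm (\<Sum>b\<in>Basis. f b *\<^sub>R b))\<^sup>2 = (\<Sum>b\<in>Basis. (f b)\<^sup>2)" for f :: "'a \<Rightarrow> real"
      unfolding norm_sq_sum_Basis by (intro sum.cong) (auto simp: inner_sum_left_Basis)
    thus "(\<integral>\<^sup>+f. ennreal ((norm (\<Sum>b\<in>Basis. f b *\<^sub>R (b::'a)))\<^sup>2) \<partial>?P) = (\<integral>\<^sup>+f. (\<Sum>b\<in>Basis. ennreal ((f b)\<^sup>2)) \<partial>?P)"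
      by simp
  qed auto
  also have "\<dots> = (\<Sum>b\<in>Basis. \<integral>\<^sup>+f. ennreal ((f b)\<^sup>2) \<partial>?P)"
    by (rule nn_integral_sum) measurable
  also have "\<dots> = (\<Sum>b\<in>(Basis::'a set). 1)"
  proof (rule sum.cong[OF refl])
    fix b :: 'a assume b: "b \<in> Basis"
    have "(\<integral>\<^sup>+f. ennreal ((f b)\<^sup>2) \<partial>?P) = (\<integral>\<^sup>+s. ennreal (s\<^sup>2) \<partial>distr ?P std_normal (\<lambda>f. f b))"
      using b by (subst nn_integral_distr) auto
    also have "distr ?P std_normal (\<lambda>f. f b) = std_normal"
      by (rule distr_PiM_component) (use b prob_space_std_normal in auto)
    also have "(\<integral>\<^sup>+s. ennreal (s\<^sup>2) \<partial>std_normal) = (\<integral>\<^sup>+s. ennreal (std_normal_density s * s\<^sup>2) \<partial>lborel)"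
      by (simp add: nn_integral_density ennreal_mult)
    also have "\<dots> = 1"
      using std_normal_moment_even[of 1]
      by (subst nn_integral_eq_integral) (auto simp: has_bochner_integral_iff)
    finally show "(\<integral>\<^sup>+f. ennreal ((f b)\<^sup>2) \<partial>?P) = 1" .
  qed
  finally show ?thesis by (simp add: ennreal_of_nat_eq_real_of_nat)
qed

section \<open>Polar coordinates and the Poincare inequality on the sphere\<close>

text \<open>The uniform probability on the unit sphere, obtained by projecting the uniform
  distribution of the ball along rays. It is a measure on the whole space carried by the sphere, so
  \<open>norm \<omega> = 1\<close> is available almost everywhere; \<open>sgn 0 = 0\<close> affects
  only a null set.\<close>

definition sphere_measure :: "'a::euclidean_space measure"
  where "sphere_measure = distr (uniform_measure lborel (ball 0 1)) borel sgn"

definition unit_ball_volume :: "'a::euclidean_space itself \<Rightarrow> real"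
  where "unit_ball_volume _ = measure lborel (ball (0::'a) 1)"

lemma sets_sphere_measure [simp, measurable_cong]: "sets sphere_measure = sets borel"
  by (simp add: sphere_measure_def)

lemma space_sphere_measure [simp]: "space sphere_measure = UNIV"
  by (simp add: sphere_measure_def)

lemma unit_ball_volume_pos: "unit_ball_volume TYPE('a::euclidean_space) > 0"
  unfolding unit_ball_volume_def by (simp add: content_ball_pos)

lemma emeasure_unit_ball: "emeasure lborel (ball (0::'a::euclidean_space) 1) = ennreal (unit_ball_volume TYPE('a))"
  unfolding unit_ball_volume_def using emeasure_lborel_ball_finite[of "0::'a" 1]
  by (intro emeasure_eq_ennreal_measure) auto

lemma sgn_measurable [measurable]: "(sgn :: 'a::euclidean_space \<Rightarrow> 'a) \<in> borel_measurable borel"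
  unfolding sgn_div_norm[abs_def] by measurable

lemma prob_space_sphere_measure: "prob_space (sphere_measure :: 'a::euclidean_space measure)"
  unfolding sphere_measure_def
proof (rule prob_space.prob_space_distr)
  show "prob_space (uniform_measure lborel (ball (0::'a) 1))"
    using unit_ball_volume_pos[where 'a = 'a]
    by (intro prob_space_uniform_measure) (simp_all add: emeasure_unit_ball)
qed simp

lemma AE_sphere_measure: "AE \<omega> in sphere_measure. norm (\<omega>::'a::euclidean_space) = 1"
proof -
  have "AE y in lborel. y \<noteq> (0::'a)" by (rule AE_lborel_singleton)
  hence "AE y in uniform_measure lborel (ball (0::'a) 1). norm (sgn y) = 1"
    using unit_ball_volume_pos[where 'a = 'a]
    by (subst AE_uniform_measure) (auto simp: emeasure_unit_ball norm_sgn elim!: eventually_mono)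
  thus ?thesis
    unfolding sphere_measure_def by (subst AE_distr_iff) auto
qed

lemma emeasure_lborel_scale:
  fixes A :: "'a::euclidean_space set"
  assumes "t > 0" "A \<in> sets borel"
  shows "emeasure lborel ((\<lambda>x. t *\<^sub>R x) -` A) * ennreal (t ^ DIM('a)) = emeasure lborel A"
proof -
  have "emeasure lborel A = emeasure (density (distr lborel borel (\<lambda>x::'a. 0 + t *\<^sub>R x)) (\<lambda>_. ennreal (\<bar>t\<bar> ^ DIM('a)))) A"
    by (subst lborel_affine[where c = t and t = "0::'a", symmetric]) (use assms in auto)
  also have "\<dots> = emeasure lborel ((\<lambda>x. t *\<^sub>R x) -` A) * ennreal (t ^ DIM('a))"
    using assms by (subst mult.commute) (simp add: emeasure_density nn_integral_cmult_indicator emeasure_distr)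
  finally show ?thesis by simp
qed

lemma emeasure_sphere_measure:
  fixes B :: "'a::euclidean_space set"
  assumes "B \<in> sets borel"
  shows "ennreal (unit_ball_volume TYPE('a)) * emeasure sphere_measure B = emeasure lborel {y. norm y < 1 \<and> sgn y \<in> B}"
proof -
  have "emeasure sphere_measure B = emeasure lborel (ball 0 1 \<inter> sgn -` B) / emeasure lborel (ball (0::'a) 1)"
    unfolding sphere_measure_def using assms measurable_sets_borel[OF sgn_measurable assms]
    by (subst emeasure_distr) (auto simp: emeasure_uniform_measure)
  moreover have "ball 0 1 \<inter> sgn -` B = {y. norm y < 1 \<and> sgn y \<in> B}" by auto
  ultimately show ?thesis
    using unit_ball_volume_pos[where 'a = 'a]
    by (subst mult.commute) (simp add: emeasure_unit_ball ennreal_divide_times)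
qed

text \<open>The distribution of the norm under Lebesgue measure: the density is the derivative of
  the volume \<open>unit_ball_volume TYPE('a) * r ^ DIM('a)\<close> of the ball of radius
  \<open>r\<close>.\<close>

definition radial_lebesgue :: "'a::euclidean_space itself \<Rightarrow> real measure"
  where "radial_lebesgue _ = density lborel
    (\<lambda>r. ennreal (indicator {0<..} r * (unit_ball_volume TYPE('a) * (DIM('a) * r ^ (DIM('a) - 1)))))"

lemma sets_radial_lebesgue [simp, measurable_cong]: "sets (radial_lebesgue TYPE('a::euclidean_space)) = sets borel"
  by (simp add: radial_lebesgue_def)

lemma space_radial_lebesgue [simp]: "space (radial_lebesgue TYPE('a::euclidean_space)) = UNIV"
  by (simp add: radial_lebesgue_def)

lemma emeasure_radial_lebesgue_lessThan:
  "emeasure (radial_lebesgue TYPE('a::euclidean_space)) {..<t} = ennreal (unit_ball_volume TYPE('a) * (max 0 t) ^ DIM('a))"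
proof -
  let ?V = "unit_ball_volume TYPE('a)" and ?d = "DIM('a)"
  have V: "?V > 0" by (rule unit_ball_volume_pos)
  have "emeasure (radial_lebesgue TYPE('a)) {..<t}
     = (\<integral>\<^sup>+r. ennreal (?V * (?d * r ^ (?d - 1))) * indicator {0..max 0 t} r \<partial>lborel)"
    unfolding radial_lebesgue_def
  proof (subst emeasure_density, measurable, rule nn_integral_cong_AE)
    have "AE r in lborel. r \<noteq> 0" "AE r in lborel. r \<noteq> t" by (auto intro: AE_lborel_singleton)
    thus "AE r in lborel. ennreal (indicator {0<..} r * (?V * (?d * r ^ (?d - 1)))) * indicator {..<t} r
       = ennreal (?V * (?d * r ^ (?d - 1))) * indicator {0..max 0 t} r"
      by eventually_elim (auto simp: indicator_def)
  qed
  also have "\<dots> = ennreal (?V * (max 0 t) ^ ?d - ?V * 0 ^ ?d)"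
    by (rule nn_integral_FTC_Icc) (use V in \<open>auto intro!: derivative_eq_intros \<close>)
  finally show ?thesis by (simp add: zero_power)
qed

lemma sigma_finite_radial_lebesgue: "sigma_finite_measure (radial_lebesgue TYPE('a::euclidean_space))"
proof
  show "\<exists>A. countable A \<and> A \<subseteq> sets (radial_lebesgue TYPE('a)) \<and> \<Union> A = space (radial_lebesgue TYPE('a)) \<and>
      (\<forall>a\<in>A. emeasure (radial_lebesgue TYPE('a)) a \<noteq> \<infinity>)"
    by (rule exI[of _ "range (\<lambda>n. {..<real n})"])
       (auto simp: emeasure_radial_lebesgue_lessThan reals_Archimedean2)
qed

text \<open>It suffices to compare rectangles. For a fixed set \<open>B\<close> of directions, both
  sides are measures of the radius that agree on half-lines, because dilation by \<open>t\<close>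
  carries the cone over \<open>B\<close> inside the unit ball onto the one inside the ball of radius
  \<open>t\<close>.\<close>

lemma polar_measure:
  "distr lborel (borel \<Otimes>\<^sub>M borel) (\<lambda>y::'a::euclidean_space. (norm y, sgn y))
    = radial_lebesgue TYPE('a) \<Otimes>\<^sub>M sphere_measure"
proof (rule pair_measure_eqI[symmetric, OF sigma_finite_radial_lebesgue])
  interpret S: prob_space "sphere_measure :: 'a measure" by (rule prob_space_sphere_measure)
  show "sigma_finite_measure (sphere_measure :: 'a measure)" ..
  show "sets (radial_lebesgue TYPE('a) \<Otimes>\<^sub>M (sphere_measure :: 'a measure))
      = sets (distr lborel (borel \<Otimes>\<^sub>M borel) (\<lambda>y::'a. (norm y, sgn y)))"
    unfolding sets_distr by (intro sets_pair_measure_cong) auto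
  fix A :: "real set" and B :: "'a set"
  assume "A \<in> sets (radial_lebesgue TYPE('a))" "B \<in> sets sphere_measure"
  hence A: "A \<in> sets borel" and B[measurable]: "B \<in> sets borel" by auto
  define M where "M = distr (density lborel (indicator (sgn -` B))) borel (norm :: 'a \<Rightarrow> real)"
  define N where "N = density (radial_lebesgue TYPE('a)) (\<lambda>_. emeasure (sphere_measure :: 'a measure) B)"
  have sB[measurable]: "sgn -` B \<in> sets borel" by (rule measurable_sets_borel[OF sgn_measurable B])
  have Mem: "emeasure M C = emeasure lborel {y. norm y \<in> C \<and> sgn y \<in> B}" if [measurable]: "C \<in> sets borel" for C
  proof -
    have [measurable]: "norm -` C \<in> sets (borel :: 'a measure)"
      by (rule measurable_sets_borel[OF borel_measurable_norm that])
    have "emeasure M C = (\<integral>\<^sup>+y. indicator (sgn -` B) y * indicator (norm -` C) y \<partial>lborel)"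
      unfolding M_def by (subst emeasure_distr) (auto simp: emeasure_density)
    also have "\<dots> = (\<integral>\<^sup>+y. indicator {y. norm y \<in> C \<and> sgn y \<in> B} y \<partial>lborel)"
      by (intro nn_integral_cong) (auto simp: indicator_def)
    also have "\<dots> = emeasure lborel {y. norm y \<in> C \<and> sgn y \<in> B}"
      by (rule nn_integral_indicator) measurable
    finally show ?thesis .
  qed
  have Nem: "emeasure N C = emeasure (radial_lebesgue TYPE('a)) C * emeasure (sphere_measure :: 'a measure) B"
    if "C \<in> sets borel" for C
    using that unfolding N_def by (subst mult.commute) (simp add: emeasure_density nn_integral_cmult_indicator)
  have eq: "emeasure M {..<t} = emeasure N {..<t}" for t
  proof (cases "t > 0")
    case False
    hence e: "{y::'a. norm y < t \<and> sgn y \<in> B} = {}"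
      using norm_ge_zero[where 'a = 'a] by (auto simp: not_less intro: order_trans)
    show ?thesis using False by (simp add: Mem Nem e emeasure_radial_lebesgue_lessThan zero_power)
  next
    case t: True
    have "emeasure M {..<t} = emeasure lborel {y. norm y < t \<and> sgn y \<in> B}" by (simp add: Mem)
    also have "\<dots> = emeasure lborel ((\<lambda>x. t *\<^sub>R x) -` {y. norm y < t \<and> sgn y \<in> B}) * ennreal (t ^ DIM('a))"
      by (rule emeasure_lborel_scale[symmetric]) (use t in \<open>measurable\<close>)
    also have "(\<lambda>x. t *\<^sub>R x) -` {y. norm y < t \<and> sgn y \<in> B} = {y. norm y < 1 \<and> sgn y \<in> B}"
      using t by (auto simp: sgn_scaleR)
    also have "emeasure lborel {y. norm y < 1 \<and> sgn y \<in> B} = ennreal (unit_ball_volume TYPE('a)) * emeasure sphere_measure B"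
      by (rule emeasure_sphere_measure[symmetric]) (rule B)
    finally show ?thesis
      using t unit_ball_volume_pos[where 'a = 'a]
      by (simp add: Nem emeasure_radial_lebesgue_lessThan ennreal_mult' mult_ac)
  qed
  have "M = N"
  proof (rule measure_eqI_generator_eq[where E = "range lessThan" and \<Omega> = UNIV and A = "\<lambda>i. {..<real i}"])
    show "Int_stable (range lessThan :: real set set)"
    proof (rule Int_stableI_image)
      show "\<exists>k\<in>UNIV. {..<i} \<inter> {..<j} = {..<k}" for i j :: real
        by (rule bexI[of _ "min i j"]) auto
    qed
    show "sets M = sigma_sets UNIV (range lessThan)" "sets N = sigma_sets UNIV (range lessThan)"
      by (simp_all add: M_def N_def borel_Iio)
    show "(\<Union>i. {..<real i}) = UNIV" by (auto simp: reals_Archimedean2)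
    show "emeasure M {..<real i} \<noteq> \<infinity>" for i
      by (simp add: eq Nem emeasure_radial_lebesgue_lessThan ennreal_mult_eq_top_iff)
  qed (auto simp: eq)
  have "emeasure (distr lborel (borel \<Otimes>\<^sub>M borel) (\<lambda>y::'a. (norm y, sgn y))) (A \<times> B)
      = emeasure lborel {y. norm y \<in> A \<and> sgn y \<in> B}"
  proof (subst emeasure_distr)
    have "(\<lambda>y. (norm y, sgn y)) -` (A \<times> B) \<inter> space lborel = {y::'a. norm y \<in> A \<and> sgn y \<in> B}" by auto
    thus "emeasure lborel ((\<lambda>y. (norm y, sgn y)) -` (A \<times> B) \<inter> space lborel) = emeasure lborel {y::'a. norm y \<in> A \<and> sgn y \<in> B}"
      by simp
  qed (use A B in auto)
  also have "\<dots> = emeasure N A" using Mem[OF A] \<open>M = N\<close> by simp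
  finally show "emeasure (radial_lebesgue TYPE('a)) A * emeasure sphere_measure B
      = emeasure (distr lborel (borel \<Otimes>\<^sub>M borel) (\<lambda>y::'a. (norm y, sgn y))) (A \<times> B)"
    using Nem[OF A] by simp
qed

text \<open>Norm and direction of a Gaussian vector are independent since its density depends on the
  norm alone. The factor belonging to the norm is identified by admitting all directions in
  \<open>e\<close>, so no radial integral has to be evaluated.\<close>

lemma gaussian_polar:
  "distr std_gaussian (borel \<Otimes>\<^sub>M borel) (\<lambda>z::'a::euclidean_space. (norm z, sgn z))
    = distr std_gaussian borel (norm :: 'a \<Rightarrow> real) \<Otimes>\<^sub>M sphere_measure"
proof (rule pair_measure_eqI[symmetric])
  interpret G: prob_space "std_gaussian :: 'a measure" by (rule prob_space_std_gaussian)
  interpret S: prob_space "sphere_measure :: 'a measure" by (rule prob_space_sphere_measure)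
  interpret D: prob_space "distr std_gaussian borel (norm :: 'a \<Rightarrow> real)"
    by (rule G.prob_space_distr) simp
  show "sigma_finite_measure (sphere_measure :: 'a measure)" ..
  show "sigma_finite_measure (distr std_gaussian borel (norm :: 'a \<Rightarrow> real))" ..
  show "sets (distr std_gaussian borel (norm :: 'a \<Rightarrow> real) \<Otimes>\<^sub>M (sphere_measure :: 'a measure))
      = sets (distr std_gaussian (borel \<Otimes>\<^sub>M borel) (\<lambda>z::'a. (norm z, sgn z)))"
    unfolding sets_distr by (intro sets_pair_measure_cong) auto
  fix A :: "real set" and B :: "'a set"
  assume "A \<in> sets (distr std_gaussian borel (norm :: 'a \<Rightarrow> real))" "B \<in> sets sphere_measure"
  hence [measurable]: "A \<in> sets borel" "B \<in> sets borel" by auto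
  let ?c = "\<lambda>s. ennreal ((1 / sqrt (2 * pi)) ^ DIM('a) * exp (- s\<^sup>2 / 2))"
  have e: "emeasure std_gaussian {z::'a. norm z \<in> A \<and> sgn z \<in> C}
      = (\<integral>\<^sup>+s. ?c s * indicator A s \<partial>radial_lebesgue TYPE('a)) * emeasure sphere_measure C"
    if [measurable]: "C \<in> sets borel" for C
  proof -
    have "emeasure std_gaussian {z::'a. norm z \<in> A \<and> sgn z \<in> C}
        = (\<integral>\<^sup>+z. ?c (norm z) * indicator A (norm z) * indicator C (sgn z) \<partial>lborel)"
      unfolding std_gaussian_eq_density
      by (subst emeasure_density) (auto intro!: nn_integral_cong simp: indicator_def)
    also have "\<dots> = (\<integral>\<^sup>+p. ?c (fst p) * indicator A (fst p) * indicator C (snd p) \<partial>distr lborel (borel \<Otimes>\<^sub>M borel) (\<lambda>y::'a. (norm y, sgn y)))"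
      by (subst nn_integral_distr) auto
    also have "\<dots> = (\<integral>\<^sup>+s. \<integral>\<^sup>+\<omega>. ?c s * indicator A s * indicator C \<omega> \<partial>sphere_measure \<partial>radial_lebesgue TYPE('a))"
      unfolding polar_measure by (subst S.nn_integral_fst[symmetric]) auto
    also have "\<dots> = (\<integral>\<^sup>+s. ?c s * indicator A s * emeasure sphere_measure C \<partial>radial_lebesgue TYPE('a))"
      by (intro nn_integral_cong) (simp add: nn_integral_cmult_indicator)
    also have "\<dots> = (\<integral>\<^sup>+s. ?c s * indicator A s \<partial>radial_lebesgue TYPE('a)) * emeasure sphere_measure C"
      by (rule nn_integral_multc) measurable
    finally show ?thesis .
  qed
  have 1: "emeasure (distr std_gaussian borel (norm :: 'a \<Rightarrow> real)) A = emeasure std_gaussian {z::'a. norm z \<in> A \<and> sgn z \<in> UNIV}"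
    by (subst emeasure_distr) (auto simp: vimage_def)
  have 2: "emeasure (distr std_gaussian (borel \<Otimes>\<^sub>M borel) (\<lambda>z::'a. (norm z, sgn z))) (A \<times> B)
      = emeasure std_gaussian {z::'a. norm z \<in> A \<and> sgn z \<in> B}"
  proof (subst emeasure_distr)
    have "(\<lambda>y. (norm y, sgn y)) -` (A \<times> B) \<inter> space std_gaussian = {y::'a. norm y \<in> A \<and> sgn y \<in> B}" by auto
    thus "emeasure std_gaussian ((\<lambda>y. (norm y, sgn y)) -` (A \<times> B) \<inter> space std_gaussian)
        = emeasure std_gaussian {y::'a. norm y \<in> A \<and> sgn y \<in> B}" by simp
  qed auto
  show "emeasure (distr std_gaussian borel (norm :: 'a \<Rightarrow> real)) A * emeasure sphere_measure B
     = emeasure (distr std_gaussian (borel \<Otimes>\<^sub>M borel) (\<lambda>z::'a. (norm z, sgn z))) (A \<times> B)"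
    unfolding 1 2 by (subst (1 2) e) (use S.emeasure_space_1 in auto)
qed

section \<open>The Poincare inequality on spheres\<close>

lemma has_derivative_sgn:
  fixes z :: "'a::real_inner"
  assumes "z \<noteq> 0"
  shows "(sgn has_derivative (\<lambda>v. (v - (sgn z \<bullet> v) *\<^sub>R sgn z) /\<^sub>R norm z)) (at z)"
proof -
  have "((\<lambda>z::'a. inverse (norm z)) has_derivative (\<lambda>v. - (inverse (norm z) * (v \<bullet> sgn z) * inverse (norm z)))) (at z)"
    by (rule Deriv.has_derivative_inverse[OF _ has_derivative_norm[OF assms]]) (use assms in simp)
  from has_derivative_scaleR[OF this has_derivative_ident]
  have "((\<lambda>z::'a. z /\<^sub>R norm z) has_derivative (\<lambda>v. (v - (sgn z \<bullet> v) *\<^sub>R sgn z) /\<^sub>R norm z)) (at z)"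
    by (rule has_derivative_eq_rhs) (auto simp: fun_eq_iff sgn_div_norm algebra_simps inner_commute)
  thus ?thesis by (simp add: sgn_div_norm[abs_def])
qed

text \<open>The Gaussian Poincare inequality applied to \<open>z \<mapsto> |z| (f (r z / |z|) - c)\<close>, with \<open>c\<close> the spherical
  mean: under a Gaussian, \<open>|z|\<close> and \<open>z / |z|\<close> are independent and \<open>E |z|\<^sup>2\<close> is the dimension, and the
  radial derivative accounts for the loss of \<open>1\<close>.\<close>

lemma sphere_poincare:
  fixes f :: "'a::euclidean_space \<Rightarrow> real" and D :: "'a \<Rightarrow> 'a"
  assumes r: "0 < r"
    and fm [measurable]: "f \<in> borel_measurable borel" and Dm [measurable]: "D \<in> borel_measurable borel"
    and der: "\<And>y. norm y = r \<Longrightarrow> (f has_derivative (\<lambda>v. D y \<bullet> v)) (at y)"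
    and Dc: "continuous_on (sphere 0 r) D"
  shows "(real DIM('a) - 1) *
      ((\<integral>\<omega>. (f (r *\<^sub>R \<omega>))\<^sup>2 \<partial>sphere_measure) - (\<integral>\<omega>. f (r *\<^sub>R \<omega>) \<partial>sphere_measure)\<^sup>2)
    \<le> (\<integral>\<omega>. r\<^sup>2 * ((norm (D (r *\<^sub>R \<omega>)))\<^sup>2 - (D (r *\<^sub>R \<omega>) \<bullet> \<omega>)\<^sup>2) \<partial>sphere_measure)"
proof -
  interpret G: prob_space "std_gaussian :: 'a measure" by (rule prob_space_std_gaussian)
  interpret S: prob_space "sphere_measure :: 'a measure" by (rule prob_space_sphere_measure)
  let ?\<nu> = "sphere_measure :: 'a measure"
  let ?\<mu> = "distr std_gaussian borel (norm :: 'a \<Rightarrow> real)"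
  interpret M: prob_space ?\<mu> by (rule G.prob_space_distr) simp
  have fc: "continuous_on (sphere 0 r) f"
    by (intro continuous_at_imp_continuous_on ballI) (auto intro: has_derivative_continuous[OF der])
  obtain Cf where Cf: "\<And>y. y \<in> sphere 0 r \<Longrightarrow> norm (f y) \<le> Cf"
    using compact_imp_bounded[OF compact_continuous_image[OF fc compact_sphere]]
    unfolding bounded_iff by (meson imageI)
  obtain CD where CD: "\<And>y. y \<in> sphere 0 r \<Longrightarrow> norm (D y) \<le> CD"
    using compact_imp_bounded[OF compact_continuous_image[OF Dc compact_sphere]]
    unfolding bounded_iff by (meson imageI)
  have onS: "r *\<^sub>R \<omega> \<in> sphere 0 r" if "norm \<omega> = 1" for \<omega> :: 'a using r that by simp
  define g where "g \<omega> = f (r *\<^sub>R \<omega>)" for \<omega>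
  have [measurable]: "g \<in> borel_measurable borel" unfolding g_def by measurable
  have gb: "AE \<omega> in ?\<nu>. norm (g \<omega>) \<le> Cf"
    using AE_sphere_measure by eventually_elim (use Cf[OF onS] in \<open>auto simp: g_def\<close>)
  have gi: "integrable ?\<nu> g" by (rule S.integrable_const_bound[OF gb]) simp
  have g2i: "integrable ?\<nu> (\<lambda>\<omega>. (g \<omega>)\<^sup>2)"
  proof (rule S.integrable_const_bound)
    show "AE \<omega> in ?\<nu>. norm ((g \<omega>)\<^sup>2) \<le> Cf\<^sup>2"
      using gb by eventually_elim (auto simp: abs_le_square_iff[symmetric])
  qed simp
  define c where "c = (\<integral>\<omega>. g \<omega> \<partial>?\<nu>)"
  define V where "V = (\<integral>\<omega>. (g \<omega> - c)\<^sup>2 \<partial>?\<nu>)"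
  have e: "(\<lambda>\<omega>. (g \<omega> - c)\<^sup>2) = (\<lambda>\<omega>. (g \<omega>)\<^sup>2 - 2 * c * g \<omega> + c\<^sup>2)"
    by (auto simp: power2_eq_square algebra_simps)
  have Vi: "integrable ?\<nu> (\<lambda>\<omega>. (g \<omega> - c)\<^sup>2)" unfolding e using gi g2i by auto
  have V: "V = (\<integral>\<omega>. (g \<omega>)\<^sup>2 \<partial>?\<nu>) - c\<^sup>2"
    unfolding V_def e using gi g2i
    by (simp add: c_def[symmetric] S.prob_space[simplified] power2_eq_square)
  \<comment> \<open>The squared norm of the gradient, along the unit sphere, of
    \<open>\<omega> \<mapsto> f (r *\<^sub>R \<omega>)\<close>.\<close>
  define T where "T \<omega> = r\<^sup>2 * ((norm (D (r *\<^sub>R \<omega>)))\<^sup>2 - (D (r *\<^sub>R \<omega>) \<bullet> \<omega>)\<^sup>2)" for \<omega>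
  have [measurable]: "T \<in> borel_measurable borel" unfolding T_def by measurable
  have T0: "0 \<le> T \<omega>" if "norm \<omega> = 1" for \<omega>
    using Cauchy_Schwarz_ineq2[of "D (r *\<^sub>R \<omega>)" \<omega>] that
    by (auto simp: T_def abs_le_square_iff[symmetric] intro!: mult_nonneg_nonneg)
  have Ti: "integrable ?\<nu> T"
  proof (rule S.integrable_const_bound)
    show "AE \<omega> in ?\<nu>. norm (T \<omega>) \<le> r\<^sup>2 * CD\<^sup>2"
      using AE_sphere_measure
    proof eventually_elim
      case (elim \<omega>)
      have "norm (T \<omega>) = T \<omega>" using T0[OF elim] by simp
      also have "\<dots> \<le> r\<^sup>2 * CD\<^sup>2"
        unfolding T_def
      proof (rule mult_left_mono)
        show "(norm (D (r *\<^sub>R \<omega>)))\<^sup>2 - (D (r *\<^sub>R \<omega>) \<bullet> \<omega>)\<^sup>2 \<le> CD\<^sup>2"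
          using power_mono[OF CD[OF onS[OF elim]] norm_ge_zero, of 2] zero_le_power2[of "D (r *\<^sub>R \<omega>) \<bullet> \<omega>"]
          by linarith
      qed simp
      finally show ?case .
    qed
  qed simp
  define w where "w z = g (sgn z) - c" for z
  define F where "F z = norm z * w z" for z
  \<comment> \<open>\<open>F\<close> is homogeneous of degree 1, so its radial derivative is
    \<open>w z\<close>; in the tangential part the factor \<open>norm z\<close> cancels the inverse
    in the derivative of \<open>sgn\<close>. Hence \<open>DF\<close> depends on the direction only
    and is bounded. The value at 0 is a default.\<close>
  define DF where "DF z = (if z = 0 then 0 else w z *\<^sub>R sgn z
      + r *\<^sub>R (D (r *\<^sub>R sgn z) - (D (r *\<^sub>R sgn z) \<bullet> sgn z) *\<^sub>R sgn z))" for z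
  have [measurable]: "w \<in> borel_measurable borel" unfolding w_def by measurable
  have Fm [measurable]: "F \<in> borel_measurable borel" unfolding F_def by measurable
  have [measurable]: "DF \<in> borel_measurable borel" unfolding DF_def by measurable
  have wb: "\<bar>w z\<bar> \<le> Cf + \<bar>c\<bar>" if "z \<noteq> 0" for z
    using Cf[OF onS[of "sgn z"]] that by (simp add: w_def g_def norm_sgn)
  have derF: "(F has_derivative (\<lambda>v. DF z \<bullet> v)) (at z)" if z: "z \<noteq> 0" for z
  proof -
    have "((\<lambda>z. r *\<^sub>R sgn z) has_derivative (\<lambda>v. r *\<^sub>R ((v - (sgn z \<bullet> v) *\<^sub>R sgn z) /\<^sub>R norm z))) (at z)"
      by (intro has_derivative_scaleR_right has_derivative_sgn z)
    moreover have "(f has_derivative (\<lambda>v. D (r *\<^sub>R sgn z) \<bullet> v)) (at (r *\<^sub>R sgn z))"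
      by (rule der) (use r z in \<open>simp add: norm_sgn\<close>)
    ultimately have "((\<lambda>z. f (r *\<^sub>R sgn z)) has_derivative
        (\<lambda>v. D (r *\<^sub>R sgn z) \<bullet> (r *\<^sub>R ((v - (sgn z \<bullet> v) *\<^sub>R sgn z) /\<^sub>R norm z)))) (at z)"
      by (rule has_derivative_compose)
    hence "((\<lambda>z. f (r *\<^sub>R sgn z) - c) has_derivative
        (\<lambda>v. D (r *\<^sub>R sgn z) \<bullet> (r *\<^sub>R ((v - (sgn z \<bullet> v) *\<^sub>R sgn z) /\<^sub>R norm z)) - 0)) (at z)"
      by (intro has_derivative_diff has_derivative_const)
    have inv: "norm z * (inverse (norm z) * a) = a" for a using z by simp
    from has_derivative_mult[OF has_derivative_norm[OF z] \<open>((\<lambda>z. f (r *\<^sub>R sgn z) - c) has_derivative _) _\<close>]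
    show ?thesis
      unfolding F_def w_def g_def
      by (rule has_derivative_eq_rhs)
         (use z in \<open>auto simp: DF_def w_def g_def inner_diff_left inner_diff_right inner_add_left fun_eq_iff inner_commute inv algebra_simps\<close>)
  qed
  have F0: "F 0 = 0" by (simp add: F_def)
  have Fb: "\<bar>F z\<bar> \<le> (Cf + \<bar>c\<bar>) * norm z" for z
    using wb[of z] by (cases "z = 0") (auto simp: F_def abs_mult mult.commute intro: mult_left_mono)
  have contF: "continuous_on UNIV F"
  proof (intro continuous_at_imp_continuous_on ballI)
    fix z :: 'a
    show "isCont F z"
    proof (cases "z = 0")
      case False
      thus ?thesis using has_derivative_continuous[OF derF] by blast
    next
      case True
      have "(F \<longlongrightarrow> 0) (at 0)"
      proof (rule Lim_null_comparison)
        show "\<forall>\<^sub>F x in at 0. norm (F x) \<le> (Cf + \<bar>c\<bar>) * norm x" using Fb by simp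
        show "((\<lambda>x::'a. (Cf + \<bar>c\<bar>) * norm x) \<longlongrightarrow> 0) (at 0)"
          by (auto intro!: tendsto_eq_intros)
      qed
      thus ?thesis using True by (simp add: isCont_def F0)
    qed
  qed
  have sqDF: "(norm (DF z))\<^sup>2 = (g (sgn z) - c)\<^sup>2 + T (sgn z)" if z: "z \<noteq> 0" for z
  proof -
    let ?D = "D (r *\<^sub>R sgn z)" and ?s = "sgn z"
    have s1: "?s \<bullet> ?s = 1" using z by (simp add: norm_sgn dot_square_norm)
    show ?thesis using z
      unfolding power2_norm_eq_inner DF_def T_def w_def
      by (simp add: inner_add_left inner_add_right inner_diff_left inner_diff_right s1 inner_commute
          power2_eq_square algebra_simps)
  qed
  have DFb: "norm (DF z) \<le> (Cf + \<bar>c\<bar>) + r * (2 * CD)" for z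
  proof (cases "z = 0")
    case True
    \<comment> \<open>A basis vector provides a point of the sphere, which forces the bounds to be
      nonnegative.\<close>
    have "0 \<le> Cf + \<bar>c\<bar>" "0 \<le> CD"
      using Cf[OF onS[OF norm_Basis[of "SOME b. b \<in> Basis"]]] CD[OF onS[OF norm_Basis[of "SOME b. b \<in> Basis"]]] some_in_eq[of "Basis :: 'a set"]
      by (auto intro: order_trans[OF norm_ge_zero] order_trans[OF abs_ge_zero] add_nonneg_nonneg)
    thus ?thesis using True r by (simp add: DF_def)
  next
    case False
    let ?D = "D (r *\<^sub>R sgn z)"
    have D: "norm ?D \<le> CD" using CD[OF onS] False by (simp add: norm_sgn)
    have "\<bar>?D \<bullet> sgn z\<bar> \<le> norm ?D" using Cauchy_Schwarz_ineq2[of ?D "sgn z"] False by (simp add: norm_sgn)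
    hence "norm (?D - (?D \<bullet> sgn z) *\<^sub>R sgn z) \<le> 2 * CD"
      using D norm_triangle_ineq4[of ?D "(?D \<bullet> sgn z) *\<^sub>R sgn z"] False by (simp add: norm_sgn)
    hence n2: "norm (r *\<^sub>R (?D - (?D \<bullet> sgn z) *\<^sub>R sgn z)) \<le> r * (2 * CD)"
      using r by (simp add: mult_left_mono)
    have n1: "norm (w z *\<^sub>R sgn z) \<le> Cf + \<bar>c\<bar>" using wb[OF False] False by (simp add: norm_sgn)
    have "DF z = w z *\<^sub>R sgn z + r *\<^sub>R (?D - (?D \<bullet> sgn z) *\<^sub>R sgn z)" using False by (simp add: DF_def)
    thus ?thesis by (simp only:) (rule order_trans[OF norm_triangle_ineq add_mono[OF n1 n2]])
  qed
  have norm2: "integrable std_gaussian (\<lambda>z::'a. (norm z)\<^sup>2)" "(\<integral>z. (norm z)\<^sup>2 \<partial>(std_gaussian :: 'a measure)) = DIM('a)"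
    using std_gaussian_second_moment[where 'a = 'a] nn_integral_eq_integrable[of "\<lambda>z. (norm z)\<^sup>2" "std_gaussian :: 'a measure" "DIM('a)"]
    by auto
  have F2i: "integrable std_gaussian (\<lambda>z. (F z)\<^sup>2)"
  proof (rule Bochner_Integration.integrable_bound)
    show "integrable std_gaussian (\<lambda>z::'a. (Cf + \<bar>c\<bar>)\<^sup>2 * (norm z)\<^sup>2)" using norm2 by simp
    have "(F z)\<^sup>2 \<le> (Cf + \<bar>c\<bar>)\<^sup>2 * (norm z)\<^sup>2" for z
      using power_mono[OF Fb[of z], of 2] by (simp add: power_mult_distrib)
    thus "AE z in std_gaussian. norm ((F z)\<^sup>2) \<le> norm ((Cf + \<bar>c\<bar>)\<^sup>2 * (norm z)\<^sup>2)" by simp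
  qed simp
  have Fi: "integrable std_gaussian F"
    by (rule G.square_integrable_imp_integrable[OF _ F2i]) simp
  define H where "H = (\<lambda>(s::real, \<omega>::'a). s * (g \<omega> - c))"
  have [measurable]: "H \<in> borel_measurable (borel \<Otimes>\<^sub>M borel)" unfolding H_def by measurable
  have FH: "F z = H (norm z, sgn z)" for z by (simp add: F_def H_def w_def)
  interpret MS: pair_sigma_finite ?\<mu> ?\<nu> ..
  have "integrable (?\<mu> \<Otimes>\<^sub>M ?\<nu>) H"
    unfolding gaussian_polar[symmetric] using Fi unfolding FH by (subst integrable_distr_eq) auto
  hence Hi: "(\<integral>p. H p \<partial>(?\<mu> \<Otimes>\<^sub>M ?\<nu>)) = (\<integral>s. \<integral>\<omega>. H (s, \<omega>) \<partial>?\<nu> \<partial>?\<mu>)"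
    by (rule MS.integral_fst'[symmetric])
  have "(\<integral>z. F z \<partial>std_gaussian) = (\<integral>p. H p \<partial>(?\<mu> \<Otimes>\<^sub>M ?\<nu>))"
    unfolding FH gaussian_polar[symmetric] by (subst integral_distr) auto
  also have "\<dots> = (\<integral>s. \<integral>\<omega>. s * (g \<omega> - c) \<partial>?\<nu> \<partial>?\<mu>)" unfolding Hi by (simp add: H_def)
  also have "(\<lambda>s. \<integral>\<omega>. s * (g \<omega> - c) \<partial>?\<nu>) = (\<lambda>s. 0)"
    using gi by (auto simp: fun_eq_iff c_def[symmetric] S.prob_space[simplified])
  finally have mean: "(\<integral>z. F z \<partial>std_gaussian) = 0" by simp
  have "integrable (?\<mu> \<Otimes>\<^sub>M ?\<nu>) (\<lambda>p. (H p)\<^sup>2)"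
    unfolding gaussian_polar[symmetric] using F2i unfolding FH by (subst integrable_distr_eq) auto
  hence Hi2: "(\<integral>p. (H p)\<^sup>2 \<partial>(?\<mu> \<Otimes>\<^sub>M ?\<nu>)) = (\<integral>s. \<integral>\<omega>. (H (s, \<omega>))\<^sup>2 \<partial>?\<nu> \<partial>?\<mu>)"
    by (rule MS.integral_fst'[symmetric])
  have "(\<integral>z. (F z)\<^sup>2 \<partial>std_gaussian) = (\<integral>p. (H p)\<^sup>2 \<partial>(?\<mu> \<Otimes>\<^sub>M ?\<nu>))"
    unfolding FH gaussian_polar[symmetric] by (subst integral_distr) auto
  also have "\<dots> = (\<integral>s. s\<^sup>2 * V \<partial>?\<mu>)"
    unfolding Hi2 by (simp add: H_def power_mult_distrib V_def)
  also have "\<dots> = DIM('a) * V"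
    using norm2 by (subst integral_distr) auto
  finally have F2: "(\<integral>z. (F z)\<^sup>2 \<partial>std_gaussian) = DIM('a) * V" .
  have "(\<integral>\<^sup>+x. \<integral>\<^sup>+y. ennreal ((F x - F y)\<^sup>2) \<partial>std_gaussian \<partial>std_gaussian) = ennreal (2 * (DIM('a) * V))"
    using nn_integral_square_diff[OF _ Fi F2i] G.finite_measure_axioms G.prob_space
    by (simp add: mean F2)
  moreover have "(\<integral>\<^sup>+z. ennreal ((norm (DF z))\<^sup>2) \<partial>std_gaussian) = ennreal (V + (\<integral>\<omega>. T \<omega> \<partial>?\<nu>))"
  proof -
    have "AE z in lborel. z \<noteq> (0::'a)" by (rule AE_lborel_singleton)
    hence "AE z in std_gaussian. z \<noteq> (0::'a)"
      unfolding std_gaussian_eq_density by (subst AE_density) auto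
    hence "(\<integral>\<^sup>+z. ennreal ((norm (DF z))\<^sup>2) \<partial>std_gaussian) = (\<integral>\<^sup>+z. ennreal ((g (sgn z) - c)\<^sup>2 + T (sgn z)) \<partial>std_gaussian)"
      by (intro nn_integral_cong_AE) (auto elim!: eventually_mono simp: sqDF)
    also have "\<dots> = (\<integral>\<^sup>+p. ennreal ((g (snd p) - c)\<^sup>2 + T (snd p)) \<partial>(?\<mu> \<Otimes>\<^sub>M ?\<nu>))"
      unfolding gaussian_polar[symmetric] by (subst nn_integral_distr) auto
    also have "\<dots> = (\<integral>\<^sup>+\<omega>. ennreal ((g \<omega> - c)\<^sup>2 + T \<omega>) \<partial>?\<nu>)"
      using M.emeasure_space_1 by (subst S.nn_integral_fst[symmetric]) auto
    also have "\<dots> = ennreal (\<integral>\<omega>. (g \<omega> - c)\<^sup>2 + T \<omega> \<partial>?\<nu>)"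
      by (rule nn_integral_eq_integral)
         (use Vi Ti AE_sphere_measure T0 in \<open>auto elim!: eventually_mono\<close>)
    also have "(\<integral>\<omega>. (g \<omega> - c)\<^sup>2 + T \<omega> \<partial>?\<nu>) = V + (\<integral>\<omega>. T \<omega> \<partial>?\<nu>)"
      unfolding V_def by (rule Bochner_Integration.integral_add[OF Vi Ti])
    finally show ?thesis .
  qed
  ultimately have "ennreal (2 * (DIM('a) * V)) \<le> 2 * ennreal (V + (\<integral>\<omega>. T \<omega> \<partial>?\<nu>))"
    using gaussian_poincare[OF contF derF _ DFb] by simp
  moreover have "0 \<le> V" unfolding V_def by simp
  moreover have "0 \<le> (\<integral>\<omega>. T \<omega> \<partial>?\<nu>)"
    by (rule integral_nonneg_AE) (use AE_sphere_measure T0 in \<open>auto elim!: eventually_mono\<close>)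
  ultimately have "ennreal (2 * (DIM('a) * V)) \<le> ennreal (2 * (V + (\<integral>\<omega>. T \<omega> \<partial>?\<nu>)))" and TV: "0 \<le> V + (\<integral>\<omega>. T \<omega> \<partial>?\<nu>)"
    using ennreal_mult'[of 2 "V + (\<integral>\<omega>. T \<omega> \<partial>?\<nu>)"] by simp_all
  hence "2 * (DIM('a) * V) \<le> 2 * (V + (\<integral>\<omega>. T \<omega> \<partial>?\<nu>))"
    by (subst (asm) ennreal_le_iff) auto
  thus ?thesis unfolding V T_def g_def c_def by (simp add: algebra_simps)
qed

section \<open>Convexity estimates for the profile\<close>

text \<open>One step of a Taylor estimate by the mean value inequality. The factor
  \<open>1 / Suc m\<close> of an exact integration is given up, which keeps the same
  \<open>B\<close> at every order.\<close>

lemma abs_le_power_Suc_if_deriv_le: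
  fixes k k' :: "real \<Rightarrow> real"
  assumes der: "\<And>x. x \<in> {0..R} \<Longrightarrow> (k has_real_derivative k' x) (at x within {0..R})"
    and "k 0 = 0" and b: "\<And>x. x \<in> {0..R} \<Longrightarrow> \<bar>k' x\<bar> \<le> B * x ^ m" and B: "0 \<le> B" and r: "r \<in> {0..R}"
  shows "\<bar>k r\<bar> \<le> B * r ^ Suc m"
proof -
  have "norm (k r - k 0) \<le> (B * r ^ m) * norm (r - 0)"
  proof (rule field_differentiable_bound[where S = "{0..r}" and f' = k'])
    show "(k has_real_derivative k' x) (at x within {0..r})" if "x \<in> {0..r}" for x
      using der[of x] that r by (auto intro: DERIV_subset)
    show "norm (k' x) \<le> B * r ^ m" if "x \<in> {0..r}" for x
      using b[of x] that r B by (auto intro!: order_trans[OF b] mult_left_mono power_mono)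
  qed (use r in auto)
  thus ?thesis using assms(2) r by (simp add: mult_ac)
qed

lemma continuous_on_near_endpoints:
  fixes g :: "real \<Rightarrow> real"
  assumes g: "continuous_on {0..R} g" and "0 < R" and "c < g 0" "c < g R"
  obtains d where "0 < d" "d < R / 2" "\<And>r. r \<in> {0..d} \<Longrightarrow> c < g r" "\<And>r. r \<in> {R - d..R} \<Longrightarrow> c < g r"
proof -
  obtain d0 where d0: "d0 > 0" "\<And>x. x \<in> {0..R} \<Longrightarrow> dist x 0 < d0 \<Longrightarrow> dist (g x) (g 0) < g 0 - c"
    using g assms unfolding continuous_on_iff by (metis atLeastAtMost_iff diff_gt_0_iff_gt less_eq_real_def order_refl)
  obtain d1 where d1: "d1 > 0" "\<And>x. x \<in> {0..R} \<Longrightarrow> dist x R < d1 \<Longrightarrow> dist (g x) (g R) < g R - c"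
    using g assms unfolding continuous_on_iff by (metis atLeastAtMost_iff diff_gt_0_iff_gt less_eq_real_def order_refl)
  show ?thesis
  proof (rule that[of "min (min (d0/2) (d1/2)) (R/3)"])
    fix r assume "r \<in> {0..min (min (d0/2) (d1/2)) (R/3)}"
    thus "c < g r" using d0(2)[of r] d0(1) assms(2) by (auto simp: dist_real_def)
  next
    fix r assume "r \<in> {R - min (min (d0/2) (d1/2)) (R/3)..R}"
    thus "c < g r" using d1(2)[of r] d1(1) assms(2) by (auto simp: dist_real_def min_def split: if_splits)
  qed (use d0 d1 assms in auto)
qed

text \<open>Fixes the derivatives of \<open>\<theta>\<close>, one-sided at the ends, so that
  \<open>d 1\<close> and \<open>d 2\<close> can be named. Nothing is assumed of
  \<open>\<theta>\<close> outside \<open>{0..R}\<close>, which is why it is cut off whenever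
  measurability on the line is at stake.\<close>

locale profile =
  fixes R :: real and \<theta> :: "real \<Rightarrow> real" and d :: "nat \<Rightarrow> real \<Rightarrow> real"
  assumes R: "0 < R" and pos: "\<And>r. 0 < r \<Longrightarrow> r < R \<Longrightarrow> 0 < \<theta> r"
    and ends: "\<theta> 0 = 0" "\<theta> R = 0" and d0: "d 0 = \<theta>"
    and der: "\<And>k r. r \<in> {0..R} \<Longrightarrow> (d k has_real_derivative d (Suc k) r) (at r within {0..R})"
    and d_ends: "d 1 0 = 1" "d 1 R = -1" "d 2 0 = 0" "d 2 R = 0"
begin

lemma d_cont: "continuous_on {0..R} (d k)"
  using der[of _ k] by (meson DERIV_continuous_on)

lemma \<theta>_cont: "continuous_on {0..R} \<theta>"
  using d_cont[of 0] by (simp add: d0)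

lemma d_at: "0 < r \<Longrightarrow> r < R \<Longrightarrow> (d k has_real_derivative d (Suc k) r) (at r)"
  using der[of r k] by (simp add: at_within_Icc_at)

lemma \<theta>_at: "0 < r \<Longrightarrow> r < R \<Longrightarrow> (\<theta> has_real_derivative d 1 r) (at r)"
  using d_at[of r 0] by (simp add: d0)

lemma d1_at: "0 < r \<Longrightarrow> r < R \<Longrightarrow> (d 1 has_real_derivative d 2 r) (at r)"
  using d_at[of r 1] by (simp add: numeral_2_eq_2)

lemma \<theta>_mvt:
  assumes "0 \<le> a" "a < b" "b \<le> R"
  obtains x where "a < x" "x < b" "\<theta> b - \<theta> a = (b - a) * d 1 x"
proof -
  have "(\<theta> has_derivative (\<lambda>v. d 1 x * v)) (at x within {a..b})" if "a \<le> x" "x \<le> b" for x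
    using DERIV_subset[OF der[of x 0], of "{a..b}"] that assms
    by (auto simp: d0 has_field_derivative_def)
  from mvt_simple[OF assms(2) this] show ?thesis
    using that by (auto simp: mult.commute)
qed

lemma near_ends:
  obtains \<delta> where "0 < \<delta>" "\<delta> < R / 2"
    "\<And>r. r \<in> {0<..\<delta>} \<Longrightarrow> r / 2 \<le> \<theta> r \<and> 1 / 4 \<le> (d 1 r)\<^sup>2 - \<theta> r * d 2 r"
    "\<And>r. r \<in> {R - \<delta>..<R} \<Longrightarrow> \<theta> r \<le> 2 * (R - r) \<and> d 1 r \<le> 0 \<and> 1 / 4 \<le> (d 1 r)\<^sup>2 - \<theta> r * d 2 r"
proof -
  have c1: "continuous_on {0..R} (\<lambda>r. (d 1 r)\<^sup>2 - \<theta> r * d 2 r)"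
    by (intro continuous_intros d_cont \<theta>_cont)
  obtain a where a: "0 < a" "a < R/2" "\<And>r. r \<in> {0..a} \<Longrightarrow> 1/4 < (d 1 r)\<^sup>2 - \<theta> r * d 2 r"
      "\<And>r. r \<in> {R - a..R} \<Longrightarrow> 1/4 < (d 1 r)\<^sup>2 - \<theta> r * d 2 r"
    by (rule continuous_on_near_endpoints[OF c1 R, of "1/4"]) (use ends d_ends in auto)
  \<comment> \<open>The affine function from 1 at 0 to -1 at \<open>R\<close> allows both ends to be
    treated at once; within \<open>R / 8\<close> of an end it moves by at most 1/4.\<close>
  have c4: "continuous_on {0..R} (\<lambda>r. - \<bar>d 1 r - (1 - 2 * r / R)\<bar>)"
    by (intro continuous_intros d_cont) (use R in auto)
  obtain b where b: "0 < b" "b < R/2"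
      "\<And>r. r \<in> {0..b} \<Longrightarrow> -1/4 < - \<bar>d 1 r - (1 - 2 * r / R)\<bar>"
      "\<And>r. r \<in> {R - b..R} \<Longrightarrow> -1/4 < - \<bar>d 1 r - (1 - 2 * r / R)\<bar>"
    by (rule continuous_on_near_endpoints[OF c4 R, of "-1/4"]) (use ends d_ends R in auto)
  define \<delta> where "\<delta> = min a (min b (R / 8))"
  have \<delta>: "0 < \<delta>" "\<delta> < R/2" "\<delta> \<le> a" "\<delta> \<le> b" "\<delta> \<le> R / 8" using a b R by (auto simp: \<delta>_def)
  have d1lo: "1/2 \<le> d 1 r" if "r \<in> {0..\<delta>}" for r
  proof -
    have "2 * r / R \<le> 1/4" using that \<delta> R by (simp add: field_simps)
    moreover have "r \<in> {0..b}" using that \<delta> by auto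
    ultimately show ?thesis using b(3)[of r] by linarith
  qed
  have d1hi: "-2 \<le> d 1 r \<and> d 1 r \<le> 0" if "r \<in> {R - \<delta>..R}" for r
  proof -
    have r: "r \<le> R" "R - \<delta> \<le> r" "0 \<le> r" using that \<delta> R by auto
    have "7/4 \<le> 2 * r / R" "2 * r / R \<le> 2" using r \<delta> R by (simp_all add: field_simps)
    moreover have "r \<in> {R - b..R}" using r \<delta> by auto
    ultimately show ?thesis using b(4)[of r] by linarith
  qed
  have lo: "r / 2 \<le> \<theta> r" if "r \<in> {0<..\<delta>}" for r
  proof -
    note r = that
    obtain x where "0 < x" "x < r" "\<theta> r - \<theta> 0 = (r - 0) * d 1 x"
      by (rule \<theta>_mvt[of 0 r]) (use r \<delta> R in auto)
    hence x: "0 < x" "x < r" "\<theta> r = r * d 1 x" using ends by auto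
    have "r * (1/2) \<le> r * d 1 x" using d1lo[of x] x that \<delta> by (intro mult_left_mono) auto
    thus ?thesis using x by simp
  qed
  have hi: "\<theta> r \<le> 2 * (R - r)" if "r \<in> {R - \<delta>..<R}" for r
  proof -
    note r = that
    obtain x where "r < x" "x < R" "\<theta> R - \<theta> r = (R - r) * d 1 x"
      by (rule \<theta>_mvt[of r R]) (use r \<delta> R in auto)
    hence x: "r < x" "x < R" "- \<theta> r = (R - r) * d 1 x" using ends by auto
    have "(R - r) * (-2) \<le> (R - r) * d 1 x" using d1hi[of x] x that \<delta> by (intro mult_left_mono) auto
    thus ?thesis using x by simp
  qed
  show ?thesis
  proof (rule that[OF \<delta>(1,2)])
    show "r / 2 \<le> \<theta> r \<and> 1 / 4 \<le> (d 1 r)\<^sup>2 - \<theta> r * d 2 r" if "r \<in> {0<..\<delta>}" for r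
      using lo[OF that] a(3)[of r] that \<delta> by auto
    show "\<theta> r \<le> 2 * (R - r) \<and> d 1 r \<le> 0 \<and> 1 / 4 \<le> (d 1 r)\<^sup>2 - \<theta> r * d 2 r" if "r \<in> {R - \<delta>..<R}" for r
      using hi[OF that] d1hi[of r] a(4)[of r] that \<delta> by auto
  qed
qed

lemma middle_bound:
  assumes "0 < \<delta>" and g: "continuous_on {\<delta>..R - \<delta>} g"
  obtains C where "0 \<le> C" "\<And>r. r \<in> {\<delta>..R - \<delta>} \<Longrightarrow> - C \<le> (g r :: real)"
proof -
  have "bounded (g ` {\<delta>..R - \<delta>})"
    by (intro compact_imp_bounded compact_continuous_image g) auto
  then obtain C where C: "\<And>r. r \<in> {\<delta>..R - \<delta>} \<Longrightarrow> \<bar>g r\<bar> \<le> C" unfolding bounded_iff real_norm_def by (meson imageI)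
  show ?thesis by (rule that[of "\<bar>C\<bar>"]) (use C in \<open>force\<close>)+
qed

text \<open>The quotient is the derivative of \<open>- (d 1 r / \<theta> r)\<close>. Towards both
  ends it tends to plus infinity, the favourable direction, so a constant is lost only on a compact
  interval in between.\<close>

lemma radial_curvature_bound:
  obtains C where "0 \<le> C" "\<And>r. 0 < r \<Longrightarrow> r < R \<Longrightarrow> - C \<le> ((d 1 r)\<^sup>2 - \<theta> r * d 2 r) / (\<theta> r)\<^sup>2"
proof -
  obtain \<delta> where \<delta>: "0 < \<delta>" "\<delta> < R / 2"
    "\<And>r. r \<in> {0<..\<delta>} \<Longrightarrow> r / 2 \<le> \<theta> r \<and> 1 / 4 \<le> (d 1 r)\<^sup>2 - \<theta> r * d 2 r"
    "\<And>r. r \<in> {R - \<delta>..<R} \<Longrightarrow> \<theta> r \<le> 2 * (R - r) \<and> d 1 r \<le> 0 \<and> 1 / 4 \<le> (d 1 r)\<^sup>2 - \<theta> r * d 2 r"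
    by (rule near_ends, rule that)
  have nz: "\<theta> r \<noteq> 0" "r \<noteq> 0" if "r \<in> {\<delta>..R - \<delta>}" for r
    using pos[of r] that \<delta> by auto
  have "continuous_on {\<delta>..R - \<delta>} (\<lambda>r. ((d 1 r)\<^sup>2 - \<theta> r * d 2 r) / (\<theta> r)\<^sup>2)"
    by (intro continuous_intros continuous_on_subset[OF d_cont] continuous_on_subset[OF \<theta>_cont])
       (use \<delta> nz in auto)
  from middle_bound[OF \<delta>(1) this] obtain C where
    C: "0 \<le> C" "\<And>r. r \<in> {\<delta>..R - \<delta>} \<Longrightarrow> - C \<le> ((d 1 r)\<^sup>2 - \<theta> r * d 2 r) / (\<theta> r)\<^sup>2" by blast
  show ?thesis
  proof (rule that[OF C(1)])
    fix r assume r: "0 < r" "r < R"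
    consider "r \<in> {\<delta>..R - \<delta>}" | "r \<in> {0<..\<delta>}" | "r \<in> {R - \<delta>..<R}" using r by force
    thus "- C \<le> ((d 1 r)\<^sup>2 - \<theta> r * d 2 r) / (\<theta> r)\<^sup>2"
    proof cases
      case 1 thus ?thesis by (rule C)
    next
      case 2
      hence "0 \<le> ((d 1 r)\<^sup>2 - \<theta> r * d 2 r) / (\<theta> r)\<^sup>2" using \<delta>(3)[OF 2] by (intro divide_nonneg_nonneg) auto
      thus ?thesis using C by linarith
    next
      case 3
      hence "0 \<le> ((d 1 r)\<^sup>2 - \<theta> r * d 2 r) / (\<theta> r)\<^sup>2" using \<delta>(4)[OF 3] by (intro divide_nonneg_nonneg) auto
      thus ?thesis using C by linarith
    qed
  qed
qed

text \<open>The function \<open>r - \<theta> r * d 1 r\<close> and its first two derivatives vanish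
  at 0, by the values 0, 1, 0 of \<open>\<theta>\<close>, \<open>d 1\<close>, \<open>d 2\<close>
  there; \<open>k3\<close> is its third derivative. The estimates \<open>2\<close>, \<open>1\<close>
  and \<open>0\<close> descend through these derivatives.\<close>

lemma angular_defect:
  obtains B where "0 \<le> B" "\<And>r. r \<in> {0..R} \<Longrightarrow> \<bar>r - \<theta> r * d 1 r\<bar> \<le> B * r ^ 3"
proof -
  define k3 where "k3 r = - 3 * (d 2 r)\<^sup>2 - 4 * d 1 r * d 3 r - \<theta> r * d 4 r" for r
  have "bounded (k3 ` {0..R})" unfolding k3_def
    by (intro compact_imp_bounded compact_continuous_image continuous_intros d_cont \<theta>_cont) auto
  then obtain B where B: "\<And>r. r \<in> {0..R} \<Longrightarrow> \<bar>k3 r\<bar> \<le> B" unfolding bounded_iff real_norm_def by (meson imageI)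
  have B0: "0 \<le> B" using B[of 0] R by (auto intro: order_trans[OF abs_ge_zero])
  have der': "r \<in> {0..R} \<Longrightarrow> (\<theta> has_real_derivative d 1 r) (at r within {0..R})"
     "r \<in> {0..R} \<Longrightarrow> (d 1 has_real_derivative d 2 r) (at r within {0..R})"
     "r \<in> {0..R} \<Longrightarrow> (d 2 has_real_derivative d 3 r) (at r within {0..R})"
     "r \<in> {0..R} \<Longrightarrow> (d 3 has_real_derivative d 4 r) (at r within {0..R})" for r
    using der[of r 0] der[of r 1] der[of r 2] der[of r 3] by (simp_all add: d0 eval_nat_numeral)
  have 2: "\<bar>- 3 * d 1 r * d 2 r - \<theta> r * d 3 r\<bar> \<le> B * r ^ Suc 0" if "r \<in> {0..R}" for r
  proof (rule abs_le_power_Suc_if_deriv_le[OF _ _ _ B0 that])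
    show "((\<lambda>r. - 3 * d 1 r * d 2 r - \<theta> r * d 3 r) has_real_derivative k3 x) (at x within {0..R})" if "x \<in> {0..R}" for x
      by (rule derivative_eq_intros der'[OF that] refl)+ (simp add: k3_def power2_eq_square algebra_simps)
  qed (use B ends d_ends in auto)
  have 1: "\<bar>1 - (d 1 r)\<^sup>2 - \<theta> r * d 2 r\<bar> \<le> B * r ^ Suc 1" if "r \<in> {0..R}" for r
  proof (rule abs_le_power_Suc_if_deriv_le[OF _ _ _ B0 that])
    show "((\<lambda>r. 1 - (d 1 r)\<^sup>2 - \<theta> r * d 2 r) has_real_derivative - 3 * d 1 x * d 2 x - \<theta> x * d 3 x) (at x within {0..R})" if "x \<in> {0..R}" for x
      by (rule derivative_eq_intros der'[OF that] refl)+ (simp add: power2_eq_square algebra_simps)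
  qed (use 2 ends d_ends in auto)
  have 0: "\<bar>r - \<theta> r * d 1 r\<bar> \<le> B * r ^ Suc 2" if "r \<in> {0..R}" for r
  proof (rule abs_le_power_Suc_if_deriv_le[OF _ _ _ B0 that])
    show "((\<lambda>r. r - \<theta> r * d 1 r) has_real_derivative 1 - (d 1 x)\<^sup>2 - \<theta> x * d 2 x) (at x within {0..R})" if "x \<in> {0..R}" for x
      by (rule derivative_eq_intros der'[OF that] refl)+ (simp add: power2_eq_square algebra_simps)
  qed (use 1 ends d_ends in \<open>auto simp: numeral_2_eq_2\<close>)
  show ?thesis by (rule that[OF B0]) (use 0 in \<open>auto simp: eval_nat_numeral\<close>)
qed

text \<open>Both terms have a pole of second order at 0; their difference is
  \<open>(r - \<theta> r * d 1 r) / (r * (\<theta> r)\<^sup>2)\<close>, bounded there by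
  \<open>angular_defect\<close> and \<open>r / 2 \<le> \<theta> r\<close>. Near \<open>R\<close> the
  sign of \<open>d 1\<close> makes both contributions nonnegative.\<close>

lemma angular_bound:
  obtains C where "0 \<le> C" "\<And>r. 0 < r \<Longrightarrow> r < R \<Longrightarrow> - C \<le> 1 / (\<theta> r)\<^sup>2 - d 1 r / (r * \<theta> r)"
proof -
  obtain \<delta> where \<delta>: "0 < \<delta>" "\<delta> < R / 2"
    "\<And>r. r \<in> {0<..\<delta>} \<Longrightarrow> r / 2 \<le> \<theta> r \<and> 1 / 4 \<le> (d 1 r)\<^sup>2 - \<theta> r * d 2 r"
    "\<And>r. r \<in> {R - \<delta>..<R} \<Longrightarrow> \<theta> r \<le> 2 * (R - r) \<and> d 1 r \<le> 0 \<and> 1 / 4 \<le> (d 1 r)\<^sup>2 - \<theta> r * d 2 r"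
    by (rule near_ends, rule that)
  obtain B where B: "0 \<le> B" "\<And>r. r \<in> {0..R} \<Longrightarrow> \<bar>r - \<theta> r * d 1 r\<bar> \<le> B * r ^ 3" by (rule angular_defect, rule that)
  have nz: "\<theta> r \<noteq> 0" "r \<noteq> 0" if "r \<in> {\<delta>..R - \<delta>}" for r
    using pos[of r] that \<delta> by auto
  have "continuous_on {\<delta>..R - \<delta>} (\<lambda>r. 1 / (\<theta> r)\<^sup>2 - d 1 r / (r * \<theta> r))"
    by (intro continuous_intros continuous_on_subset[OF d_cont] continuous_on_subset[OF \<theta>_cont])
       (use \<delta> nz in auto)
  from middle_bound[OF \<delta>(1) this] obtain C where
    C: "0 \<le> C" "\<And>r. r \<in> {\<delta>..R - \<delta>} \<Longrightarrow> - C \<le> 1 / (\<theta> r)\<^sup>2 - d 1 r / (r * \<theta> r)" by blast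
  show ?thesis
  proof (rule that[of "max C (4 * B)"])
    fix r assume r: "0 < r" "r < R"
    consider "r \<in> {\<delta>..R - \<delta>}" | "r \<in> {0<..\<delta>}" | "r \<in> {R - \<delta>..<R}" using r by force
    thus "- max C (4 * B) \<le> 1 / (\<theta> r)\<^sup>2 - d 1 r / (r * \<theta> r)"
    proof cases
      case 1 thus ?thesis using C(2)[OF 1] by auto
    next
      case 2
      have t: "0 < \<theta> r" by (rule pos[OF r])
      have "1 / (\<theta> r)\<^sup>2 - d 1 r / (r * \<theta> r) = (r - \<theta> r * d 1 r) / (r * (\<theta> r)\<^sup>2)"
        using r t by (simp add: field_simps power2_eq_square)
      also have "\<dots> \<ge> - (B * r ^ 3) / (r * (\<theta> r)\<^sup>2)"
        using B(2)[of r] r t by (intro divide_right_mono) auto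
      also have "- (B * r ^ 3) / (r * (\<theta> r)\<^sup>2) = - (B * (r\<^sup>2 / (\<theta> r)\<^sup>2))"
        using r t by (simp add: field_simps power2_eq_square power3_eq_cube)
      also have "r\<^sup>2 / (\<theta> r)\<^sup>2 \<le> 4"
        using power_mono[of "r / 2" "\<theta> r" 2] \<delta>(3)[OF 2] r t by (simp add: field_simps power_divide)
      from mult_left_mono[OF this B(1)] have "- (B * (r\<^sup>2 / (\<theta> r)\<^sup>2)) \<ge> - (B * 4)" by linarith
      finally show ?thesis by linarith
    next
      case 3
      have t: "0 < \<theta> r" by (rule pos[OF r])
      have "d 1 r / (r * \<theta> r) \<le> 0" using \<delta>(4)[OF 3] r t by (intro divide_nonpos_nonneg) auto
      moreover have "0 \<le> 1 / (\<theta> r)\<^sup>2" by simp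
      ultimately show ?thesis using C by linarith
    qed
  qed (use C in auto)
qed

end

text \<open>The truncated square is C^1 across \<open>c\<close>, so that \<open>h_fun\<close> and
  \<open>h_deriv\<close> are given by one formula on both branches.\<close>

lemma max_0_square_deriv:
  "((\<lambda>x::real. (max 0 (x - c))\<^sup>2) has_real_derivative 2 * max 0 (r - c)) (at r)"
proof -
  consider "r < c" | "r > c" | "r = c" by linarith
  thus ?thesis
  proof cases
    case 1
    have "((\<lambda>x::real. 0) has_real_derivative 2 * max 0 (r - c)) (at r)" using 1 by simp
    moreover have "\<forall>\<^sub>F x in nhds r. 0 = (max 0 (x - c))\<^sup>2"
      using eventually_nhds_in_open[of "{..<c}" r] 1 by (auto elim!: eventually_mono)
    ultimately show ?thesis by (subst DERIV_cong_ev[OF refl _ refl, of _ _ r, symmetric]) auto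
  next
    case 2
    have "((\<lambda>x::real. (x - c)\<^sup>2) has_real_derivative 2 * max 0 (r - c)) (at r)"
      using 2 by (auto intro!: derivative_eq_intros)
    moreover have "\<forall>\<^sub>F x in nhds r. (x - c)\<^sup>2 = (max 0 (x - c))\<^sup>2"
      using eventually_nhds_in_open[of "{c<..}" r] 2 by (auto elim!: eventually_mono)
    ultimately show ?thesis by (subst DERIV_cong_ev[OF refl _ refl, of _ _ r, symmetric]) auto
  next
    case 3
    have "((\<lambda>h. ((max 0 (r + h - c))\<^sup>2 - (max 0 (r - c))\<^sup>2) / h) \<longlongrightarrow> 0) (at 0)"
    proof (rule Lim_null_comparison)
      show "\<forall>\<^sub>F h in at 0. norm (((max 0 (r + h - c))\<^sup>2 - (max 0 (r - c))\<^sup>2) / h) \<le> norm h"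
        using 3 by (intro always_eventually allI) (auto simp: max_def power2_eq_square)
      show "((\<lambda>h::real. norm h) \<longlongrightarrow> 0) (at 0)" by (auto intro!: tendsto_eq_intros)
    qed
    thus ?thesis using 3 by (simp add: DERIV_def)
  qed
qed

text \<open>For \<open>\<alpha> * real j > 0\<close> this is 1 up to
  \<open>R - 1 / (\<alpha> * real j)\<close> and then falls linearly to 0 at \<open>R\<close>, which
  makes the density C^1 at \<open>S\<close>.\<close>

definition h_deriv :: "real \<Rightarrow> real \<Rightarrow> nat \<Rightarrow> real \<Rightarrow> real" where
  "h_deriv R \<alpha> j r = 1 - \<alpha> * real j * max 0 (r - (R - 1 / (\<alpha> * real j)))"

lemma h_fun_eq: "h_fun R \<alpha> j r = r - \<alpha> * real j / 2 * (max 0 (r - (R - 1 / (\<alpha> * real j))))\<^sup>2"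
  by (auto simp: h_fun_def Let_def max_def)

lemma h_fun_deriv: "(h_fun R \<alpha> j has_real_derivative h_deriv R \<alpha> j r) (at r)"
  unfolding h_fun_eq[abs_def] h_deriv_def
  by (rule derivative_eq_intros max_0_square_deriv refl)+ simp

context profile begin

definition score :: "real \<Rightarrow> nat \<Rightarrow> nat \<Rightarrow> real \<Rightarrow> real" where
  "score \<alpha> j m r = 2 * real j * h_fun R \<alpha> j r * h_deriv R \<alpha> j r - real m * d 1 r / \<theta> r"

text \<open>Where \<open>h r = r\<close>, the derivative of the score is \<open>2 j\<close> plus the curvature term
  \<open>m ((\<theta>')\<^sup>2 - \<theta> \<theta>'') / \<theta>\<^sup>2\<close>, which is bounded below. On the last interval, of length \<open>1 / (\<alpha> j)\<close>,
  \<open>j (h\<^sup>2)''\<close> may be as negative as \<open>- 2 \<alpha> R j\<^sup>2\<close>, but there \<open>\<theta> \<le> 2 / (\<alpha> j)\<close> makes the curvature term at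
  least \<open>m \<alpha>\<^sup>2 j\<^sup>2 / 16\<close>.\<close>

lemma convexity_estimates:
  fixes \<alpha> :: real and m :: nat
  assumes \<alpha>: "1 \<le> \<alpha>" and m: "1 \<le> m" and cond: "real m * \<alpha>\<^sup>2 / 16 - 2 * \<alpha> * R \<ge> 2"
  obtains j\<^sub>0 :: nat and C :: real where
    "0 < j\<^sub>0" "0 < R - 1 / (\<alpha> * real j\<^sub>0)"
    "\<And>j. j\<^sub>0 \<le> j \<Longrightarrow> 0 \<le> 2 * real j + C"
    "\<And>j x y. j\<^sub>0 \<le> j \<Longrightarrow> 0 < y \<Longrightarrow> y < x \<Longrightarrow> x < R \<Longrightarrow>
       (2 * real j + C) * (x - y) \<le> score \<alpha> j m x - score \<alpha> j m y"
    "\<And>j r. j\<^sub>0 \<le> j \<Longrightarrow> 0 < r \<Longrightarrow> r < R \<Longrightarrow>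
       2 * real j + C \<le> score \<alpha> j m r / r + real m / (\<theta> r)\<^sup>2"
proof -
  obtain \<delta> where \<delta>: "0 < \<delta>" "\<delta> < R / 2"
    "\<And>r. r \<in> {0<..\<delta>} \<Longrightarrow> r / 2 \<le> \<theta> r \<and> 1 / 4 \<le> (d 1 r)\<^sup>2 - \<theta> r * d 2 r"
    "\<And>r. r \<in> {R - \<delta>..<R} \<Longrightarrow> \<theta> r \<le> 2 * (R - r) \<and> d 1 r \<le> 0 \<and> 1 / 4 \<le> (d 1 r)\<^sup>2 - \<theta> r * d 2 r"
    by (rule near_ends, rule that)
  obtain C1 where C1: "0 \<le> C1" "\<And>r. 0 < r \<Longrightarrow> r < R \<Longrightarrow> - C1 \<le> ((d 1 r)\<^sup>2 - \<theta> r * d 2 r) / (\<theta> r)\<^sup>2"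
    by (rule radial_curvature_bound, rule that)
  obtain C2 where C2: "0 \<le> C2" "\<And>r. 0 < r \<Longrightarrow> r < R \<Longrightarrow> - C2 \<le> 1 / (\<theta> r)\<^sup>2 - d 1 r / (r * \<theta> r)"
    by (rule angular_bound, rule that)
  define C where "C = - (real m * max C1 C2)"
  have C0: "C \<le> 0" using C1 C2 by (simp add: C_def)
  \<comment> \<open>Three demands on \<open>j\<close> are met at once:
    \<open>1 / (\<alpha> * real j) < \<delta>\<close> places the last interval inside the range of
    \<open>near_ends\<close>, \<open>8 \<le> real j\<close> is used in the angular estimate near
    \<open>S\<close>, and \<open>2 * real j + C\<close> becomes nonnegative.\<close>
  obtain N :: nat where N: "real N > 1 / \<delta> + 8 - C" using reals_Archimedean2 by blast
  define j0 where "j0 = N + 8"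
  let ?P = "\<lambda>r. - (d 1 r / \<theta> r)"
  have dP: "(?P has_real_derivative ((d 1 r)\<^sup>2 - \<theta> r * d 2 r) / (\<theta> r)\<^sup>2) (at r)" if "0 < r" "r < R" for r
    using pos[OF that] by (auto intro!: derivative_eq_intros \<theta>_at[OF that, unfolded One_nat_def] d1_at[OF that, unfolded One_nat_def] simp: power2_eq_square divide_simps)
  have jb: "1 / (\<alpha> * real j) < \<delta>" "0 < real j" "8 \<le> real j" "1 \<le> \<alpha> * real j" if "j0 \<le> j" for j
  proof -
    have j: "real j > 1 / \<delta>" "8 \<le> real j" using that N C0 \<delta> by (auto simp: j0_def)
    have aj: "real j \<le> \<alpha> * real j" using \<alpha> j by simp
    have "1 / (\<alpha> * real j) \<le> 1 / real j" using aj j by (intro divide_left_mono) auto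
    also have "\<dots> < \<delta>" using j \<delta> by (simp add: field_simps)
    finally show "1 / (\<alpha> * real j) < \<delta>" .
    show "0 < real j" "8 \<le> real j" "1 \<le> \<alpha> * real j" using j aj by linarith+
  qed
  have \<theta>j: "real m * ((1 / 4) / (\<theta> r)\<^sup>2) \<ge> real m * (\<alpha>\<^sup>2 * (real j)\<^sup>2 / 16)"
    if j: "j0 \<le> j" and r: "R - 1 / (\<alpha> * real j) \<le> r" "r < R" for j r
  proof -
    note b = jb[OF j]
    have rR: "0 < r" using r b \<delta> by linarith
    have "\<theta> r \<le> 2 * (R - r)" using \<delta>(4)[of r] r b by auto
    also have "\<dots> \<le> 2 * (1 / (\<alpha> * real j))" using r by auto
    finally have "\<theta> r * (\<alpha> * real j) \<le> 2" using b by (simp add: field_simps)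
    from power_mono[OF this, of 2] have "(\<theta> r)\<^sup>2 * (\<alpha>\<^sup>2 * (real j)\<^sup>2) \<le> 4"
      using pos[OF rR r(2)] b by (simp add: power_mult_distrib)
    hence "\<alpha>\<^sup>2 * (real j)\<^sup>2 / 16 \<le> (1/4) / (\<theta> r)\<^sup>2" using pos[OF rR r(2)] by (simp add: field_simps)
    thus ?thesis by (rule mult_left_mono) simp
  qed
  show ?thesis
  proof (rule that[of j0 C])
    show "0 < j0" by (simp add: j0_def)
    show "0 < R - 1 / (\<alpha> * real j0)" using jb(1)[OF order_refl] \<delta> by linarith
  next
    fix j assume "j0 \<le> j"
    hence "real N \<le> real j" by (simp add: j0_def)
    moreover have "0 < 1 / \<delta>" using \<delta> by simp
    ultimately show "0 \<le> 2 * real j + C" using N C0 by linarith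
  next
    fix j r assume j: "j0 \<le> j" and r: "0 < r" "r < R"
    note b = jb[OF j]
    have t: "0 < \<theta> r" by (rule pos[OF r])
    show "2 * real j + C \<le> score \<alpha> j m r / r + real m / (\<theta> r)\<^sup>2"
    proof (cases "r \<le> R - 1 / (\<alpha> * real j)")
      case True
      hence "score \<alpha> j m r / r + real m / (\<theta> r)\<^sup>2 = 2 * real j + real m * (1 / (\<theta> r)\<^sup>2 - d 1 r / (r * \<theta> r))"
        using r t by (simp add: score_def h_fun_eq h_deriv_def field_simps)
      moreover have "real m * (- max C1 C2) \<le> real m * (1 / (\<theta> r)\<^sup>2 - d 1 r / (r * \<theta> r))"
        using C2(2)[OF r] by (intro mult_left_mono) auto
      ultimately show ?thesis by (simp add: C_def)
    next
      case False
      hence r': "R - 1 / (\<alpha> * real j) \<le> r" by simp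
      define s where "s = r - (R - 1 / (\<alpha> * real j))"
      have "\<alpha> * real j * s = \<alpha> * real j * (r - R) + 1" using b \<alpha> by (simp add: s_def field_simps)
      moreover have "\<alpha> * real j * (r - R) \<le> 0" using b r by (intro mult_nonneg_nonpos) auto
      ultimately have s: "0 \<le> s" "\<alpha> * real j * s \<le> 1" using False by (auto simp: s_def)
      have "s \<le> 1 / (\<alpha> * real j)" using s b by (simp add: field_simps)
      hence sr: "s \<le> r" using b \<delta> r' by linarith
      have "\<alpha> * real j / 2 * s\<^sup>2 = (\<alpha> * real j * s) * (s / 2)" by (simp add: power2_eq_square)
      also have "\<dots> \<le> 1 * (s / 2)" using s by (intro mult_right_mono) auto
      finally have "\<alpha> * real j / 2 * s\<^sup>2 \<le> s / 2" by simp
      hence h0: "0 \<le> h_fun R \<alpha> j r" using s sr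
        by (simp add: h_fun_eq s_def[symmetric])
      have h1: "0 \<le> h_deriv R \<alpha> j r" using s by (simp add: h_deriv_def s_def[symmetric])
      have "0 \<le> - d 1 r" using \<delta>(4)[of r] r r' b by auto
      hence "real m * d 1 r / \<theta> r \<le> 0" using t by (intro divide_nonpos_nonneg mult_nonneg_nonpos) auto
      moreover have "0 \<le> 2 * real j * h_fun R \<alpha> j r * h_deriv R \<alpha> j r"
        using h0 h1 by (intro mult_nonneg_nonneg) auto
      ultimately have "0 \<le> score \<alpha> j m r" unfolding score_def by linarith
      hence "0 \<le> score \<alpha> j m r / r" using r by simp
      \<comment> \<open>Near \<open>S\<close> the score is nonnegative and the angular term suffices
        alone: by \<open>\<theta>j\<close> it is at least m \<alpha>^2 j^2 / 4, hence at least 2 j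
        once j is at least 8.\<close>
      moreover have "2 * real j \<le> real m / (\<theta> r)\<^sup>2"
      proof -
        have "8 * real j \<le> real j * real j" using b by (intro mult_right_mono) auto
        also have "\<dots> \<le> \<alpha>\<^sup>2 * (real j)\<^sup>2" using \<alpha> by (simp add: power2_eq_square mult_le_cancel_right1 mult_ge1_I)
        also have "\<dots> \<le> real m * (\<alpha>\<^sup>2 * (real j)\<^sup>2)" using mult_right_mono[of 1 "real m" "\<alpha>\<^sup>2 * (real j)\<^sup>2"] m by simp
        finally show ?thesis using \<theta>j[OF j r' r(2)] by simp
      qed
      ultimately show ?thesis using C0 by linarith
    qed
  next
    fix j x y assume j: "j0 \<le> j" and xy: "0 < y" "y < x" "x < R"
    note b = jb[OF j]
    let ?rj = "R - 1 / (\<alpha> * real j)"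
    \<comment> \<open>The estimate on differences says that \<open>Q\<close> is nondecreasing. As
      \<open>score\<close> has a corner at \<open>?rj\<close>, this is shown by derivatives on
      either side and joined there.\<close>
    define Q where "Q r = score \<alpha> j m r - (2 * real j + C) * r" for r
    have left: "Q y \<le> Q x" if "0 < y" "y \<le> x" "x \<le> ?rj" for x y
    proof -
      have "0 < 1 / (\<alpha> * real j)" using b by (intro divide_pos_pos) auto
      hence xR: "x < R" using that by linarith
      have "?P y - (- C1) * y \<le> ?P x - (- C1) * x"
      proof (rule DERIV_nonneg_imp_nondecreasing[OF that(2)])
        fix r assume "y \<le> r" "r \<le> x"
        hence r: "0 < r" "r < R" using that xR by auto
        show "\<exists>z. ((\<lambda>r. ?P r - (- C1) * r) has_real_derivative z) (at r) \<and> 0 \<le> z"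
          by (rule exI, rule conjI, rule DERIV_diff[OF dP[OF r] DERIV_cmult[OF DERIV_ident]]) (use C1(2)[OF r] in simp)
      qed
      hence "0 \<le> ?P x - ?P y + C1 * (x - y)" by (simp add: algebra_simps)
      also have "C1 * (x - y) \<le> max C1 C2 * (x - y)" using that by (intro mult_right_mono) auto
      finally have "0 \<le> real m * (?P x - ?P y + max C1 C2 * (x - y))" by (intro mult_nonneg_nonneg) auto
      also have "\<dots> = Q x - Q y"
        using that by (simp add: Q_def score_def h_fun_eq h_deriv_def C_def algebra_simps)
      finally show ?thesis by simp
    qed
    have right: "Q y \<le> Q x" if "?rj \<le> y" "y \<le> x" "x < R" for x y
    proof -
      let ?q = "\<lambda>r. 2 * real j * ((r - \<alpha> * real j / 2 * (r - ?rj)\<^sup>2) * (1 - \<alpha> * real j * (r - ?rj))) + real m * ?P r - (2 * real j + C) * r"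
      have Qq: "Q r = ?q r" if "?rj \<le> r" for r
      proof -
        have "max 0 (r - ?rj) = r - ?rj" using that by simp
        thus ?thesis unfolding Q_def score_def h_fun_eq h_deriv_def by (simp only:) (simp add: mult.assoc)
      qed
      have "?q y \<le> ?q x"
      proof (rule DERIV_nonneg_imp_nondecreasing[OF that(2)])
        fix r assume "y \<le> r" "r \<le> x"
        hence r': "?rj \<le> r" and rR: "r < R" using that by auto
        hence r0: "0 < r" using b \<delta> by linarith
        let ?h = "r - \<alpha> * real j / 2 * (r - ?rj)\<^sup>2" and ?h' = "1 - \<alpha> * real j * (r - ?rj)"
        have D: "(?q has_real_derivative 2 * real j * (?h' * ?h' + ?h * (- (\<alpha> * real j)))
            + real m * (((d 1 r)\<^sup>2 - \<theta> r * d 2 r) / (\<theta> r)\<^sup>2) - (2 * real j + C)) (at r)"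
        proof -
          have "((\<lambda>r. a * ((r - b / 2 * (r - c)\<^sup>2) * (1 - b * (r - c)))) has_real_derivative
              a * ((1 - b * (r - c)) * (1 - b * (r - c)) + (r - b / 2 * (r - c)\<^sup>2) * (- b))) (at r)" for a b c :: real
            by (rule derivative_eq_intros refl)+ (simp add: field_simps power2_eq_square)
          note A = this[of "2 * real j" "\<alpha> * real j" ?rj]
          show ?thesis
            by (rule DERIV_cong[OF DERIV_diff[OF DERIV_add[OF A DERIV_cmult[OF dP[OF r0 rR]]] DERIV_cmult[OF DERIV_ident]]]) simp
        qed
        have "0 \<le> \<alpha> * real j / 2 * (r - ?rj)\<^sup>2" using b by (intro mult_nonneg_nonneg) auto
        hence "?h \<le> R" using rR by linarith
        hence hB: "\<alpha> * real j * ?h \<le> \<alpha> * real j * R" using b by (intro mult_left_mono) auto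
        have "0 \<le> ?h' * ?h'" by (rule zero_le_square)
        moreover have "?h * (- (\<alpha> * real j)) = - (\<alpha> * real j * ?h)"
          by (subst mult_minus_right) (rule arg_cong[where f = uminus], rule mult.commute)
        ultimately have "- (\<alpha> * real j * R) \<le> ?h' * ?h' + ?h * (- (\<alpha> * real j))" using hB by linarith
        from mult_left_mono[OF this, of "2 * real j"] b
        have e1: "- (2 * \<alpha> * R) * (real j)\<^sup>2 \<le> 2 * real j * (?h' * ?h' + ?h * (- (\<alpha> * real j)))"
          by (simp add: power2_eq_square mult_ac)
        have "1 / 4 \<le> (d 1 r)\<^sup>2 - \<theta> r * d 2 r" using \<delta>(4)[of r] r' rR b by auto
        hence "(1 / 4) / (\<theta> r)\<^sup>2 \<le> ((d 1 r)\<^sup>2 - \<theta> r * d 2 r) / (\<theta> r)\<^sup>2" by (intro divide_right_mono) auto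
        hence "real m * ((1 / 4) / (\<theta> r)\<^sup>2) \<le> real m * (((d 1 r)\<^sup>2 - \<theta> r * d 2 r) / (\<theta> r)\<^sup>2)"
          by (rule mult_left_mono) simp
        with \<theta>j[OF j r' rR]
        have e2: "real m * (\<alpha>\<^sup>2 * (real j)\<^sup>2 / 16) \<le> real m * (((d 1 r)\<^sup>2 - \<theta> r * d 2 r) / (\<theta> r)\<^sup>2)"
          by linarith
        \<comment> \<open>The 2 in \<open>cond\<close> leaves a surplus of 2 j^2 over the concavity
          of the exponent, and 2 j^2 dominates 2 j + C because C is at most 0.\<close>
        have "2 * real j \<le> 2 * (real j)\<^sup>2" using b by (simp add: power2_eq_square)
        also have "\<dots> \<le> (real m * \<alpha>\<^sup>2 / 16 - 2 * \<alpha> * R) * (real j)\<^sup>2" using cond by (intro mult_right_mono) auto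
        also have "\<dots> = - (2 * \<alpha> * R) * (real j)\<^sup>2 + real m * (\<alpha>\<^sup>2 * (real j)\<^sup>2 / 16)" by (simp add: algebra_simps)
        finally have "0 \<le> 2 * real j * (?h' * ?h' + ?h * (- (\<alpha> * real j)))
            + real m * (((d 1 r)\<^sup>2 - \<theta> r * d 2 r) / (\<theta> r)\<^sup>2) - (2 * real j + C)"
          using e1 e2 C0 by linarith
        with D show "\<exists>z. (?q has_real_derivative z) (at r) \<and> 0 \<le> z" by blast
      qed
      thus ?thesis using Qq that by simp
    qed
    have "Q y \<le> Q x"
    proof (cases "x \<le> ?rj \<or> ?rj \<le> y")
      case True thus ?thesis using left[of y x] right[of y x] xy by auto
    next
      case False
      thus ?thesis using left[of y ?rj] right[of ?rj x] xy by auto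
    qed
    thus "(2 * real j + C) * (x - y) \<le> score \<alpha> j m x - score \<alpha> j m y"
      by (simp add: Q_def algebra_simps)
  qed
qed

end

section \<open>Radial weights\<close>

lemma integrable_bounded_finite_measure:
  fixes f :: "'a \<Rightarrow> real"
  assumes "finite_measure M" "f \<in> borel_measurable M" "\<And>x. \<bar>f x\<bar> \<le> B"
  shows "integrable M f"
  using assms by (intro finite_measure.integrable_const_bound[where B = B]) auto

lemma integrable_bounded_interval:
  fixes f :: "real \<Rightarrow> real"
  assumes [measurable]: "f \<in> borel_measurable borel" and b: "\<And>x. \<bar>f x\<bar> \<le> B" and z: "\<And>x. x \<notin> {l..u} \<Longrightarrow> f x = 0"
  shows "integrable lborel f"
proof (rule Bochner_Integration.integrable_bound)
  show "integrable lborel (\<lambda>x. indicator {l..u} x * B)"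
    by (simp add: integrable_indicator_iff emeasure_lborel_Icc_eq)
  have "norm (f x) \<le> norm (indicator {l..u} x * B)" for x
    using b[of x] z[of x] by (auto simp: indicator_def)
  thus "AE x in lborel. norm (f x) \<le> norm (indicator {l..u} x * B)" by simp
qed simp

lemma Fubini_bounded_interval:
  fixes g :: "real \<Rightarrow> 'b \<Rightarrow> real"
  assumes "finite_measure N" and gm [measurable]: "(\<lambda>(t, w). g t w) \<in> borel_measurable (borel \<Otimes>\<^sub>M N)"
    and b: "\<And>t w. \<bar>g t w\<bar> \<le> B"
  shows "(\<integral>w. (LINT t:{x..y}|lborel. g t w) \<partial>N) = (LINT t:{x..y}|lborel. (\<integral>w. g t w \<partial>N))"
    and "integrable N (\<lambda>w. LINT t:{x..y}|lborel. g t w)"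
proof -
  interpret N: finite_measure N by fact
  interpret P: pair_sigma_finite lborel N ..
  let ?f = "\<lambda>t w. indicator {x..y} t *\<^sub>R g t w"
  have i: "integrable (lborel \<Otimes>\<^sub>M N) (\<lambda>(t, w). ?f t w)"
  proof (rule Bochner_Integration.integrable_bound)
    show "integrable (lborel \<Otimes>\<^sub>M N) (\<lambda>p. indicator ({x..y} \<times> space N) p * B)"
      by (simp add: integrable_indicator_iff N.emeasure_pair_measure_Times emeasure_lborel_Icc_eq
          ennreal_mult_less_top N.emeasure_eq_measure)
    have "norm (case p of (t, w) \<Rightarrow> ?f t w) \<le> norm (indicator ({x..y} \<times> space N) p * B)"
      if "p \<in> space (lborel \<Otimes>\<^sub>M N)" for p
      using b that by (auto simp: indicator_def space_pair_measure split: prod.splits intro: order_trans[OF _ abs_ge_self])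
    thus "AE p in lborel \<Otimes>\<^sub>M N. norm (case p of (t, w) \<Rightarrow> ?f t w) \<le> norm (indicator ({x..y} \<times> space N) p * B)"
      by (rule AE_I2)
  qed measurable
  show "(\<integral>w. (LINT t:{x..y}|lborel. g t w) \<partial>N) = (LINT t:{x..y}|lborel. (\<integral>w. g t w \<partial>N))"
    unfolding set_lebesgue_integral_def using P.Fubini_integral[OF i] by simp
  show "integrable N (\<lambda>w. LINT t:{x..y}|lborel. g t w)"
    unfolding set_lebesgue_integral_def using P.integrable_snd[OF i] by simp
qed

section \<open>The radial weight, its score, and a Hardy inequality\<close>

context profile begin

definition weight :: "real \<Rightarrow> nat \<Rightarrow> nat \<Rightarrow> real \<Rightarrow> real" where
  "weight \<alpha> j m r = (if 0 < r \<and> r < R then \<theta> r ^ m * radial_density R \<alpha> j r else 0)"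

lemma density_deriv:
  "(radial_density R \<alpha> j has_real_derivative
      - (2 * real j * h_fun R \<alpha> j r * h_deriv R \<alpha> j r) * radial_density R \<alpha> j r) (at r)"
  unfolding radial_density_def[abs_def]
  by (rule derivative_eq_intros h_fun_deriv refl)+ (simp add: algebra_simps)

lemma density_cont: "continuous_on A (radial_density R \<alpha> j)"
  by (intro continuous_at_imp_continuous_on ballI DERIV_isCont[OF density_deriv])

lemma h_fun_cont: "continuous_on A (h_fun R \<alpha> j)"
  by (intro continuous_at_imp_continuous_on ballI DERIV_isCont[OF h_fun_deriv])

lemma h_deriv_cont: "continuous_on A (h_deriv R \<alpha> j)"
  unfolding h_deriv_def[abs_def] by (intro continuous_intros)

lemma density_pos: "0 < radial_density R \<alpha> j r"
  by (simp add: radial_density_def)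

lemma density_le_1: "radial_density R \<alpha> j r \<le> 1"
  by (simp add: radial_density_def)

lemma weight_nonneg: "0 \<le> weight \<alpha> j m r"
  using pos[of r] density_pos[of \<alpha> j r] by (auto simp: weight_def)

lemma measurable_on_open_interval:
  assumes "continuous_on {0<..<R} g"
  shows "(\<lambda>r. if 0 < r \<and> r < R then g r else 0) \<in> borel_measurable (borel :: real measure)"
  using borel_measurable_continuous_on_if[of "{0<..<R}" g "\<lambda>_. 0"] assms
  by (simp add: greaterThanLessThan_iff)

lemma weight_measurable [measurable]: "weight \<alpha> j m \<in> borel_measurable borel"
proof -
  have "continuous_on {0<..<R} (\<lambda>r. \<theta> r ^ m * radial_density R \<alpha> j r)"
    by (intro continuous_on_mult continuous_on_power continuous_on_subset[OF \<theta>_cont] density_cont) auto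
  from measurable_on_open_interval[OF this] show ?thesis
    unfolding weight_def[abs_def] .
qed

lemma weight_bounded: obtains B where "\<And>r. \<bar>weight \<alpha> j m r\<bar> \<le> B"
proof -
  have "bounded ((\<lambda>r. \<theta> r ^ m * radial_density R \<alpha> j r) ` {0..R})"
    by (intro compact_imp_bounded compact_continuous_image continuous_intros \<theta>_cont density_cont) auto
  then obtain B where B: "\<And>r. r \<in> {0..R} \<Longrightarrow> \<bar>\<theta> r ^ m * radial_density R \<alpha> j r\<bar> \<le> B"
    unfolding bounded_iff real_norm_def by (meson imageI)
  show ?thesis
  proof (rule that)
    show "\<bar>weight \<alpha> j m r\<bar> \<le> \<bar>B\<bar>" for r using B[of r] by (auto simp: weight_def)
  qed
qed

lemma weight_times_bounded_integrable:
  assumes [measurable]: "f \<in> borel_measurable borel" and b: "\<And>r. 0 < r \<Longrightarrow> r < R \<Longrightarrow> \<bar>f r\<bar> \<le> B"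
  shows "integrable lborel (\<lambda>r. f r * weight \<alpha> j m r)"
proof -
  obtain C where C: "\<And>r. \<bar>weight \<alpha> j m r\<bar> \<le> C" using weight_bounded by blast
  show ?thesis
  proof (rule integrable_bounded_interval[where l = 0 and u = R])
    show "\<bar>f x * weight \<alpha> j m x\<bar> \<le> \<bar>B\<bar> * C" for x
    proof (cases "0 < x \<and> x < R")
      case True
      thus ?thesis unfolding abs_mult using b[of x] C[of x] by (intro mult_mono) auto
    next
      case False
      have "0 \<le> C" using C[of 0] by (rule order_trans[OF abs_ge_zero])
      thus ?thesis using False by (auto simp: weight_def)
    qed
    show "f x * weight \<alpha> j m x = 0" if "x \<notin> {0..R}" for x using that by (auto simp: weight_def)
  qed measurable
qed

lemma weight_integrable: "integrable lborel (weight \<alpha> j m)"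
  using weight_times_bounded_integrable[of "\<lambda>_. 1" 1] by simp

lemma weight_deriv:
  assumes m: "1 \<le> m" and r: "0 < r" "r < R"
  shows "(weight \<alpha> j m has_real_derivative - (score \<alpha> j m r * weight \<alpha> j m r)) (at r)"
proof -
  have t: "0 < \<theta> r" by (rule pos[OF r])
  have p: "\<theta> r ^ m = \<theta> r * \<theta> r ^ (m - 1)" using m by (cases m) auto
  have "((\<lambda>r. \<theta> r ^ m * radial_density R \<alpha> j r) has_real_derivative
      - (score \<alpha> j m r * weight \<alpha> j m r)) (at r)"
    by (rule derivative_eq_intros \<theta>_at[OF r] density_deriv refl)+
       (use r t in \<open>simp add: weight_def score_def p algebra_simps\<close>)
  moreover have "\<forall>\<^sub>F x in nhds r. \<theta> x ^ m * radial_density R \<alpha> j x = weight \<alpha> j m x"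
    using eventually_nhds_in_open[of "{0<..<R}" r] r by (auto elim!: eventually_mono simp: weight_def)
  ultimately show ?thesis by (subst DERIV_cong_ev[OF refl _ refl, of _ _ r, symmetric]) auto
qed

lemma weight_tendsto:
  assumes m: "1 \<le> m"
  shows "(weight \<alpha> j m \<longlongrightarrow> 0) (at_right 0)" "(weight \<alpha> j m \<longlongrightarrow> 0) (at_left R)"
proof -
  let ?w = "\<lambda>r. \<theta> r ^ m * radial_density R \<alpha> j r"
  have c: "continuous_on {0..R} ?w" by (intro continuous_intros \<theta>_cont density_cont)
  have w: "?w 0 = 0" "?w R = 0" using ends m by auto
  have "(?w \<longlongrightarrow> 0) (at_right 0)"
    using continuous_on_Icc_at_rightD[OF c R] unfolding w .
  thus "(weight \<alpha> j m \<longlongrightarrow> 0) (at_right 0)"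
    by (rule Lim_transform_eventually)
       (use R in \<open>auto simp: weight_def eventually_at_right intro!: exI[of _ R]\<close>)
  have "(?w \<longlongrightarrow> 0) (at_left R)"
    using continuous_on_Icc_at_leftD[OF c R] unfolding w .
  thus "(weight \<alpha> j m \<longlongrightarrow> 0) (at_left R)"
    by (rule Lim_transform_eventually)
       (use R in \<open>auto simp: weight_def eventually_at_left intro!: exI[of _ 0]\<close>)
qed

lemma score_cont: "continuous_on {0<..<R} (score \<alpha> j m)"
  unfolding score_def[abs_def]
  by (intro continuous_intros h_fun_cont h_deriv_cont continuous_on_subset[OF d_cont] continuous_on_subset[OF \<theta>_cont])
     (use pos in \<open>auto simp: less_le\<close>)

lemma weight_monotone_score:
  assumes m: "1 \<le> m" and K: "0 \<le> K"
    and mono: "\<And>x y. 0 < y \<Longrightarrow> y < x \<Longrightarrow> x < R \<Longrightarrow> K * (x - y) \<le> score \<alpha> j m x - score \<alpha> j m y"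
  shows "monotone_score 0 R (weight \<alpha> j m) (\<lambda>r. if 0 < r \<and> r < R then score \<alpha> j m r else 0) K"
proof
  let ?G = "\<lambda>r. if 0 < r \<and> r < R then score \<alpha> j m r else 0"
  show "(0::ereal) < ereal R" using R by simp
  show "0 \<le> weight \<alpha> j m x" for x by (rule weight_nonneg)
  show "x \<notin> einterval 0 (ereal R) \<Longrightarrow> weight \<alpha> j m x = 0" for x
    by (auto simp: einterval_def weight_def)
  show Gm[measurable]: "?G \<in> borel_measurable borel" by (rule measurable_on_open_interval[OF score_cont])
  show "integrable lborel (weight \<alpha> j m)" by (rule weight_integrable)
  show "integrable lborel (\<lambda>x. ?G x * weight \<alpha> j m x)"
  proof -
    \<comment> \<open>One factor of \<open>\<theta> r ^ m\<close> cancels the pole of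
      \<open>d 1 r / \<theta> r\<close>, so the product of score and weight extends continuously to
      the closed interval and is bounded.\<close>
    let ?g = "\<lambda>r. 2 * real j * h_fun R \<alpha> j r * h_deriv R \<alpha> j r * \<theta> r ^ m * radial_density R \<alpha> j r
        - real m * d 1 r * \<theta> r ^ (m - 1) * radial_density R \<alpha> j r"
    have "bounded (?g ` {0..R})"
      by (intro compact_imp_bounded compact_continuous_image continuous_intros \<theta>_cont d_cont density_cont h_fun_cont h_deriv_cont) auto
    then obtain B where B: "\<And>r. r \<in> {0..R} \<Longrightarrow> \<bar>?g r\<bar> \<le> B" unfolding bounded_iff real_norm_def by (meson imageI)
    have p: "\<theta> r ^ m = \<theta> r * \<theta> r ^ (m - 1)" for r using m by (cases m) auto
    have eq: "?G r * weight \<alpha> j m r = ?g r" if "0 < r" "r < R" for r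
      using that pos[OF that] by (simp add: weight_def score_def p algebra_simps)
    show ?thesis
    proof (rule integrable_bounded_interval[where l = 0 and u = R])
      show "\<bar>?G x * weight \<alpha> j m x\<bar> \<le> \<bar>B\<bar>" for x
      proof (cases "0 < x \<and> x < R")
        case True
        thus ?thesis using eq[of x] B[of x] by auto
      qed auto
    qed auto
  qed
  show "(weight \<alpha> j m has_real_derivative - (?G x * weight \<alpha> j m x)) (at x)" if "x \<in> einterval 0 (ereal R)" for x
    using weight_deriv[OF m, of x] that by (auto simp: einterval_def)
  show "isCont ?G x" if x: "x \<in> einterval 0 (ereal R)" for x
  proof -
    have x': "x \<in> {0<..<R}" using x by (auto simp: einterval_def)
    have "isCont (score \<alpha> j m) x" using score_cont x' by (simp add: continuous_on_eq_continuous_at)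
    moreover have "\<forall>\<^sub>F y in nhds x. ?G y = score \<alpha> j m y"
      using eventually_nhds_in_open[of "{0<..<R}" x] x' by (auto elim!: eventually_mono)
    ultimately show ?thesis by (subst isCont_cong) auto
  qed
  show "((weight \<alpha> j m \<circ> real_of_ereal) \<longlongrightarrow> 0) (at_right 0)"
    unfolding zero_ereal_def ereal_tendsto_simps by (rule weight_tendsto[OF m])
  show "((weight \<alpha> j m \<circ> real_of_ereal) \<longlongrightarrow> 0) (at_left (ereal R))"
    unfolding ereal_tendsto_simps by (rule weight_tendsto[OF m])
  show "0 \<le> K" by (rule K)
  show "K * (x - y) \<le> ?G x - ?G y" if "x \<in> einterval 0 (ereal R)" "y \<in> einterval 0 (ereal R)" "y < x" for x y
    using mono[of y x] that by (auto simp: einterval_def)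
qed

text \<open>By the mean value theorem \<open>\<theta> r / r\<close> is bounded. This controls the
  boundary term of the Hardy inequality at 0: for \<open>m = 1\<close> the quotient need not decay
  there, and the decay has to come from the other factor.\<close>

lemma weight_over_r_bounded:
  assumes m: "1 \<le> m"
  obtains B where "\<And>r. 0 < r \<Longrightarrow> r < R \<Longrightarrow> weight \<alpha> j m r / r \<le> B"
proof -
  have "bounded (d 1 ` {0..R})" by (intro compact_imp_bounded compact_continuous_image d_cont) auto
  then obtain D where D: "\<And>r. r \<in> {0..R} \<Longrightarrow> \<bar>d 1 r\<bar> \<le> D" unfolding bounded_iff real_norm_def by (meson imageI)
  obtain C where C: "\<And>r. \<bar>weight \<alpha> j (m - 1) r\<bar> \<le> C" using weight_bounded by blast
  show ?thesis
  proof (rule that[of "D * C"])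
    fix r assume r: "0 < r" "r < R"
    obtain x where "0 < x" "x < r" "\<theta> r - \<theta> 0 = (r - 0) * d 1 x"
      by (rule \<theta>_mvt[of 0 r]) (use r in auto)
    hence "\<theta> r / r \<le> D" using D[of x] r ends by auto
    moreover have "weight \<alpha> j m r / r = \<theta> r / r * weight \<alpha> j (m - 1) r"
      using m r by (cases m) (auto simp: weight_def)
    moreover have "0 \<le> D" using D[of 0] R by (auto intro: order_trans[OF abs_ge_zero])
    ultimately show "weight \<alpha> j m r / r \<le> D * C"
      using C[of r] weight_nonneg[of \<alpha> j "m - 1" r] by (simp only:) (intro mult_mono; simp)
  qed
qed

lemma hardy_primitive_deriv:
  fixes w q :: "real \<Rightarrow> real"
  assumes "(w has_real_derivative w') (at r)" "(q has_real_derivative q') (at r)" "r \<noteq> 0"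
  shows "((\<lambda>r. w r / r * (q r)\<^sup>2) has_real_derivative
    w' / r * (q r)\<^sup>2 - w r / r\<^sup>2 * (q r)\<^sup>2 + w r / r * (2 * q r * q')) (at r)"
proof -
  have "((\<lambda>r. w r / r) has_real_derivative (w' * r - w r * 1) / (r * r)) (at r)"
    by (rule DERIV_divide[OF assms(1) DERIV_ident assms(3)])
  from DERIV_mult[OF this DERIV_power[OF assms(2), of 2]] show ?thesis
    by (rule DERIV_cong) (use assms(3) in \<open>simp add: field_simps power2_eq_square\<close>)
qed

text \<open>Completing the square \<open>(q' - q / r)\<^sup>2 \<ge> 0\<close> is the ground state substitution \<open>q = r p\<close>,
  with \<open>r\<close> the radial part of a linear function on Euclidean space.\<close>

lemma angular_hardy:
  fixes q q' :: "real \<Rightarrow> real"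
  assumes m: "1 \<le> m" and st: "0 < s" "s \<le> t" "t < R"
    and P: "\<And>r. 0 < r \<Longrightarrow> r < R \<Longrightarrow> K \<le> score \<alpha> j m r / r + real m / (\<theta> r)\<^sup>2"
    and q: "\<And>r. r \<in> {s..t} \<Longrightarrow> (q has_real_derivative q' r) (at r)"
    and int: "set_integrable lborel {s..t} (\<lambda>r. ((q' r)\<^sup>2 + real m / (\<theta> r)\<^sup>2 * (q r)\<^sup>2 - K * (q r)\<^sup>2) * weight \<alpha> j m r)"
  shows "weight \<alpha> j m t / t * (q t)\<^sup>2 - weight \<alpha> j m s / s * (q s)\<^sup>2
    \<le> (LINT r:{s..t}|lborel. ((q' r)\<^sup>2 + real m / (\<theta> r)\<^sup>2 * (q r)\<^sup>2 - K * (q r)\<^sup>2) * weight \<alpha> j m r)"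
proof -
  let ?w = "weight \<alpha> j m"
  let ?F = "\<lambda>r. ?w r / r * (q r)\<^sup>2"
  let ?F' = "\<lambda>r. - score \<alpha> j m r * ?w r / r * (q r)\<^sup>2 - ?w r / r\<^sup>2 * (q r)\<^sup>2 + ?w r / r * (2 * q r * q' r)"
  let ?g = "\<lambda>r. ((q' r)\<^sup>2 + real m / (\<theta> r)\<^sup>2 * (q r)\<^sup>2 - K * (q r)\<^sup>2) * ?w r"
  have "(?F' has_integral ?F t - ?F s) {s..t}"
  proof (rule fundamental_theorem_of_calculus)
    fix r assume r: "r \<in> {s..t}"
    hence r': "0 < r" "r < R" using st by auto
    have "(?F has_real_derivative ?F' r) (at r)"
      using hardy_primitive_deriv[OF weight_deriv[OF m r'] q[OF r]] r' by simp
    thus "(?F has_vector_derivative ?F' r) (at r within {s..t})"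
      by (simp add: has_real_derivative_iff_has_vector_derivative[symmetric] has_field_derivative_at_within)
  qed (use st in simp)
  moreover have "(?g has_integral (LINT r:{s..t}|lborel. ?g r)) {s..t}"
    using set_borel_integral_eq_integral[OF int] by (simp add: has_integral_iff)
  ultimately show ?thesis
  proof (rule has_integral_le)
    fix r assume r: "r \<in> {s..t}"
    hence r': "0 < r" "r < R" using st by auto
    have "0 \<le> ((q' r - q r / r)\<^sup>2 + (score \<alpha> j m r / r + real m / (\<theta> r)\<^sup>2 - K) * (q r)\<^sup>2) * ?w r"
      using P[OF r'] by (intro mult_nonneg_nonneg add_nonneg_nonneg weight_nonneg) auto
    also have "\<dots> = ?g r - ?F' r" using r' by (simp add: field_simps power2_eq_square)
    finally show "?F' r \<le> ?g r" by simp
  qed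
qed

end

section \<open>The Poincare inequality in polar coordinates\<close>

lemma integral_square_diff_pair:
  fixes g :: "'a \<Rightarrow> real"
  assumes "prob_space M" and [measurable]: "g \<in> borel_measurable M" and b: "\<And>x. \<bar>g x\<bar> \<le> B"
  shows "(\<integral>p. (g (fst p) - g (snd p))\<^sup>2 \<partial>(M \<Otimes>\<^sub>M M)) = 2 * ((\<integral>x. (g x)\<^sup>2 \<partial>M) - (\<integral>x. g x \<partial>M)\<^sup>2)"
    and "0 \<le> (\<integral>x. (g x)\<^sup>2 \<partial>M) - (\<integral>x. g x \<partial>M)\<^sup>2"
proof -
  interpret prob_space M by fact
  have i: "integrable M g" by (rule integrable_bounded_finite_measure[OF finite_measure_axioms _ b]) simp
  have i2: "integrable M (\<lambda>x. (g x)\<^sup>2)"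
  proof (rule integrable_bounded_finite_measure[OF finite_measure_axioms])
    show "\<bar>(g x)\<^sup>2\<bar> \<le> B\<^sup>2" for x using b[of x] by (simp add: abs_le_square_iff[symmetric])
  qed simp
  have e: "(\<lambda>x. (g x - expectation g)\<^sup>2) = (\<lambda>x. (g x)\<^sup>2 - 2 * expectation g * g x + (expectation g)\<^sup>2)"
    by (auto simp: power2_eq_square algebra_simps)
  have "0 \<le> (\<integral>x. (g x - expectation g)\<^sup>2 \<partial>M)" by simp
  also have "\<dots> = (\<integral>x. (g x)\<^sup>2 \<partial>M) - (\<integral>x. g x \<partial>M)\<^sup>2"
    unfolding e using i i2 by (simp add: prob_space power2_eq_square)
  finally show nonneg: "0 \<le> (\<integral>x. (g x)\<^sup>2 \<partial>M) - (\<integral>x. g x \<partial>M)\<^sup>2" .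
  have "(\<integral>\<^sup>+p. ennreal ((g (fst p) - g (snd p))\<^sup>2) \<partial>(M \<Otimes>\<^sub>M M)) = (\<integral>\<^sup>+x. \<integral>\<^sup>+y. ennreal ((g x - g y)\<^sup>2) \<partial>M \<partial>M)"
    by (subst nn_integral_fst[symmetric]) auto
  also have "\<dots> = ennreal (2 * ((\<integral>x. (g x)\<^sup>2 \<partial>M) - (\<integral>x. g x \<partial>M)\<^sup>2))"
    using nn_integral_square_diff[OF finite_measure_axioms i i2] by (simp add: prob_space)
  finally show "(\<integral>p. (g (fst p) - g (snd p))\<^sup>2 \<partial>(M \<Otimes>\<^sub>M M)) = 2 * ((\<integral>x. (g x)\<^sup>2 \<partial>M) - (\<integral>x. g x \<partial>M)\<^sup>2)"
    using nonneg by (subst integral_eq_nn_integral) auto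
qed

lemma indicator_sequence_exhausts:
  fixes R :: real
  assumes "0 < R" and z: "\<And>r. \<not> (0 < r \<and> r < R) \<Longrightarrow> g r = 0"
  shows "(\<lambda>k. indicator {R / (real k + 3)..R - R / (real k + 3)} r *\<^sub>R (g r :: real)) \<longlonglongrightarrow> g r"
proof (cases "0 < r \<and> r < R")
  case False thus ?thesis using z by simp
next
  case True
  have l: "(\<lambda>k. R / (real k + 3)) \<longlonglongrightarrow> 0" by real_asymp
  have "\<forall>\<^sub>F k in sequentially. R / (real k + 3) < min r (R - r)"
    using order_tendstoD(2)[OF l, of "min r (R - r)"] True by auto
  hence "\<forall>\<^sub>F k in sequentially. g r = indicator {R / (real k + 3)..R - R / (real k + 3)} r *\<^sub>R g r"
    by eventually_elim (auto simp: indicator_def)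
  thus ?thesis by (rule Lim_transform_eventually[OF tendsto_const])
qed

text \<open>The squared gradient for the metric dr^2 + \<theta>^2 g_S, in terms of the Euclidean
  gradient \<open>D\<close> in the coordinate y = r \<omega>: vectors tangent to the sphere are
  stretched by \<theta> / r, so tangential gradients are multiplied by r / \<theta>.\<close>

definition polar_energy :: "(real \<Rightarrow> real) \<Rightarrow> ('a::euclidean_space \<Rightarrow> 'a) \<Rightarrow> real \<Rightarrow> 'a \<Rightarrow> real" where
  "polar_energy \<theta> D r \<omega> = (D (r *\<^sub>R \<omega>) \<bullet> \<omega>)\<^sup>2
     + (r / \<theta> r)\<^sup>2 * ((norm (D (r *\<^sub>R \<omega>)))\<^sup>2 - (D (r *\<^sub>R \<omega>) \<bullet> \<omega>)\<^sup>2)"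

lemma square_bound: "\<bar>z\<^sup>2\<bar> \<le> c\<^sup>2" if "\<bar>z\<bar> \<le> c" for z c :: real
  using that by (simp add: abs_le_square_iff[symmetric])

text \<open>The analytic content of the Poincare inequality, separated from the manifold: a bounded
  function on a punctured ball with limit \<open>f0\<close> at the pole \<open>N\<close> and bounded
  energy. Nothing is prescribed at the outer sphere, which represents \<open>S\<close>, since the
  weight vanishes there.\<close>

locale polar_function = profile R \<theta> d for R :: real and \<theta> :: "real \<Rightarrow> real" and d :: "nat \<Rightarrow> real \<Rightarrow> real" +
  fixes \<alpha> :: real and j m :: nat and K Bf f0 Bg :: real
    and f :: "'a::euclidean_space \<Rightarrow> real" and D :: "'a \<Rightarrow> 'a"
  assumes dim: "DIM('a) = Suc m" and m: "1 \<le> m" and K: "0 \<le> K"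
    and mono: "\<And>x y. 0 < y \<Longrightarrow> y < x \<Longrightarrow> x < R \<Longrightarrow> K * (x - y) \<le> score \<alpha> j m x - score \<alpha> j m y"
    and P: "\<And>r. 0 < r \<Longrightarrow> r < R \<Longrightarrow> K \<le> score \<alpha> j m r / r + real m / (\<theta> r)\<^sup>2"
    and fm [measurable]: "f \<in> borel_measurable borel" and Dm [measurable]: "D \<in> borel_measurable borel"
    and f_der: "\<And>y. 0 < norm y \<Longrightarrow> norm y < R \<Longrightarrow> (f has_derivative (\<lambda>v. D y \<bullet> v)) (at y)"
    and Dc: "continuous_on {y. 0 < norm y \<and> norm y < R} D"
    and fb: "\<And>y. \<bar>f y\<bar> \<le> Bf" and lim: "(f \<longlongrightarrow> f0) (at 0)"
    and Eb: "\<And>r \<omega>. 0 < r \<Longrightarrow> r < R \<Longrightarrow> norm \<omega> = 1 \<Longrightarrow> polar_energy \<theta> D r \<omega> \<le> Bg"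
begin

abbreviation \<nu> :: "'a measure" where "\<nu> \<equiv> sphere_measure"

abbreviation w :: "real \<Rightarrow> real" where "w \<equiv> weight \<alpha> j m"

interpretation S: prob_space \<nu> by (rule prob_space_sphere_measure)

lemma [measurable]: "(\<lambda>r. if 0 < r \<and> r < R then \<theta> r else 0) \<in> borel_measurable borel"
  by (rule measurable_on_open_interval) (auto intro: continuous_on_subset[OF \<theta>_cont])

text \<open>A cut-off and not a derivative: \<open>\<theta>\<close> is arbitrary outside
  \<open>{0..R}\<close>, and this version is Borel on the whole line.\<close>

definition \<theta>' where "\<theta>' r = (if 0 < r \<and> r < R then \<theta> r else 0)"

lemma [measurable]: "\<theta>' \<in> borel_measurable borel" unfolding \<theta>'_def by measurable

text \<open>Cutting \<open>radial_deriv\<close> and \<open>tangential\<close> off outside these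
  points makes their bounds hold everywhere and not only almost everywhere;
  \<open>sphere_measure\<close> is carried by the unit sphere, so integrals over directions do not
  change.\<close>

definition in_shell :: "real \<Rightarrow> 'a \<Rightarrow> bool" where "in_shell t \<omega> \<longleftrightarrow> 0 < t \<and> t < R \<and> norm \<omega> = 1"

definition ray_value where "ray_value t \<omega> = (if norm \<omega> = 1 then f (t *\<^sub>R \<omega>) else 0)"

definition radial_deriv where "radial_deriv t \<omega> = (if in_shell t \<omega> then D (t *\<^sub>R \<omega>) \<bullet> \<omega> else 0)"

text \<open>The squared gradient of \<open>ray_value t\<close> along the unit sphere, as it occurs
  in \<open>sphere_poincare\<close>.\<close>

definition tangential where "tangential t \<omega> = (if in_shell t \<omega> then t\<^sup>2 * ((norm (D (t *\<^sub>R \<omega>)))\<^sup>2 - (D (t *\<^sub>R \<omega>) \<bullet> \<omega>)\<^sup>2) else 0)"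

lemma ray_value_measurable [measurable]: "(\<lambda>(t, \<omega>). ray_value t \<omega>) \<in> borel_measurable (borel \<Otimes>\<^sub>M borel)" unfolding ray_value_def by measurable

lemma radial_deriv_measurable [measurable]: "(\<lambda>(t, \<omega>). radial_deriv t \<omega>) \<in> borel_measurable (borel \<Otimes>\<^sub>M borel)" unfolding radial_deriv_def in_shell_def by measurable

lemma tangential_measurable [measurable]: "(\<lambda>(t, \<omega>). tangential t \<omega>) \<in> borel_measurable (borel \<Otimes>\<^sub>M borel)" unfolding tangential_def in_shell_def by measurable

lemma ray_value_measurable' [measurable]: "ray_value t \<in> borel_measurable borel"
  and tangential_measurable' [measurable]: "tangential t \<in> borel_measurable borel" for t
  unfolding ray_value_def tangential_def in_shell_def by measurable

lemma energy_split: "polar_energy \<theta> D t \<omega> = (radial_deriv t \<omega>)\<^sup>2 + tangential t \<omega> / (\<theta> t)\<^sup>2" if "in_shell t \<omega>" for t \<omega>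
  using that by (simp add: polar_energy_def radial_deriv_def tangential_def in_shell_def power_divide)

lemma tangential_nonneg: "0 \<le> tangential t \<omega>" for t \<omega>
  using Cauchy_Schwarz_ineq2[of "D (t *\<^sub>R \<omega>)" \<omega>]
  by (auto simp: tangential_def in_shell_def abs_le_square_iff[symmetric] intro!: mult_nonneg_nonneg)

lemma energy_le: "(radial_deriv t \<omega>)\<^sup>2 + tangential t \<omega> / (\<theta> t)\<^sup>2 \<le> \<bar>Bg\<bar>" for t \<omega>
proof (cases "in_shell t \<omega>")
  case True
  thus ?thesis using Eb[of t \<omega>] energy_split[OF True] by (auto simp: in_shell_def)
qed (auto simp: radial_deriv_def tangential_def)

lemma tangential_div_nonneg: "0 \<le> tangential t \<omega> / (\<theta> t)\<^sup>2" for t \<omega> using tangential_nonneg by simp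

lemma tangential_le: "tangential t \<omega> / (\<theta> t)\<^sup>2 \<le> \<bar>Bg\<bar>" for t \<omega> using energy_le[of t \<omega>] zero_le_power2[of "radial_deriv t \<omega>"] by linarith

lemma radial_deriv_sq_le: "(radial_deriv t \<omega>)\<^sup>2 \<le> \<bar>Bg\<bar>" for t \<omega> using energy_le[of t \<omega>] tangential_div_nonneg[of t \<omega>] by linarith

definition Bd where "Bd = sqrt \<bar>Bg\<bar>"

lemma Bd_nonneg: "0 \<le> Bd" by (simp add: Bd_def)

lemma radial_deriv_bound: "\<bar>radial_deriv t \<omega>\<bar> \<le> Bd" for t \<omega>
  using real_sqrt_le_mono[OF radial_deriv_sq_le[of t \<omega>]] by (simp add: Bd_def)

lemma Bf_nonneg: "0 \<le> Bf" using fb[of 0] by (rule order_trans[OF abs_ge_zero])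

lemma ray_value_bound: "\<bar>ray_value t \<omega>\<bar> \<le> Bf" for t \<omega> using fb Bf_nonneg by (simp add: ray_value_def)

lemmas sphere_integrable = integrable_bounded_finite_measure[OF S.finite_measure_axioms]

lemma ray_value_integrable: "integrable \<nu> (ray_value t)" and radial_deriv_integrable: "integrable \<nu> (radial_deriv t)" for t
  by (rule sphere_integrable[OF _ ray_value_bound], simp) (rule sphere_integrable[OF _ radial_deriv_bound], simp)

lemma ray_value_sq_integrable: "integrable \<nu> (\<lambda>\<omega>. (ray_value t \<omega>)\<^sup>2)" for t
proof (rule sphere_integrable)
  show "\<bar>(ray_value t \<omega>)\<^sup>2\<bar> \<le> Bf\<^sup>2" for \<omega> using ray_value_bound[of t \<omega>] by (simp add: abs_le_square_iff[symmetric])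
qed simp

lemma radial_deriv_sq_integrable: "integrable \<nu> (\<lambda>\<omega>. (radial_deriv t \<omega>)\<^sup>2)" for t
proof (rule sphere_integrable)
  show "\<bar>(radial_deriv t \<omega>)\<^sup>2\<bar> \<le> \<bar>Bg\<bar>" for \<omega> using radial_deriv_sq_le[of t \<omega>] by simp
qed simp

lemma tangential_integrable: "integrable \<nu> (\<lambda>\<omega>. tangential t \<omega> / (\<theta> t)\<^sup>2)" for t
proof (rule sphere_integrable)
  show "\<bar>tangential t \<omega> / (\<theta> t)\<^sup>2\<bar> \<le> \<bar>Bg\<bar>" for \<omega> using tangential_le[of t \<omega>] tangential_div_nonneg[of t \<omega>] by simp
qed simp

section \<open>Means and variances over directions at a fixed radius\<close>

definition mean where "mean t = (\<integral>\<omega>. ray_value t \<omega> \<partial>\<nu>)"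

definition mean_sq where "mean_sq t = (\<integral>\<omega>. (ray_value t \<omega>)\<^sup>2 \<partial>\<nu>)"

definition mean_deriv where "mean_deriv t = (\<integral>\<omega>. radial_deriv t \<omega> \<partial>\<nu>)"

definition mean_deriv_sq where "mean_deriv_sq t = (\<integral>\<omega>. (radial_deriv t \<omega>)\<^sup>2 \<partial>\<nu>)"

definition mean_tangential where "mean_tangential t = (\<integral>\<omega>. tangential t \<omega> \<partial>\<nu>)"

lemma [measurable]: "mean \<in> borel_measurable borel" "mean_sq \<in> borel_measurable borel" "mean_deriv \<in> borel_measurable borel"
  "mean_deriv_sq \<in> borel_measurable borel" "mean_tangential \<in> borel_measurable borel"
  unfolding mean_def mean_sq_def mean_deriv_def mean_deriv_sq_def mean_tangential_def
  by (rule S.borel_measurable_lebesgue_integral, simp add: sets_pair_measure_cong[OF refl sets_sphere_measure] cong: measurable_cong_sets, measurable)+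

definition var_ray where "var_ray t = mean_sq t - (mean t)\<^sup>2"

definition var_deriv where "var_deriv t = mean_deriv_sq t - (mean_deriv t)\<^sup>2"

lemma [measurable]: "var_ray \<in> borel_measurable borel" "var_deriv \<in> borel_measurable borel" unfolding var_ray_def var_deriv_def by measurable

lemma var_ray_nonneg: "0 \<le> var_ray t" and var_ray_pair: "(\<integral>p. (ray_value t (fst p) - ray_value t (snd p))\<^sup>2 \<partial>(\<nu> \<Otimes>\<^sub>M \<nu>)) = 2 * var_ray t" for t
  unfolding var_ray_def mean_sq_def mean_def
  using integral_square_diff_pair[where g = "ray_value t" and B = Bf, OF S.prob_space_axioms _ ray_value_bound] by simp_all

lemma var_deriv_nonneg: "0 \<le> var_deriv t" and var_deriv_pair: "(\<integral>p. (radial_deriv t (fst p) - radial_deriv t (snd p))\<^sup>2 \<partial>(\<nu> \<Otimes>\<^sub>M \<nu>)) = 2 * var_deriv t" for t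
  unfolding var_deriv_def mean_deriv_sq_def mean_deriv_def
  using integral_square_diff_pair[where g = "radial_deriv t" and B = Bd, OF S.prob_space_axioms _ radial_deriv_bound] by simp_all

lemma ray_value_sq_le: "(ray_value t \<omega>)\<^sup>2 \<le> Bf\<^sup>2" for t \<omega> using ray_value_bound[of t \<omega>] Bf_nonneg by (simp add: abs_le_square_iff[symmetric])

lemma mean_sq_le: "mean_sq t \<le> Bf\<^sup>2" for t
  unfolding mean_sq_def by (rule S.integral_le_const[OF ray_value_sq_integrable]) (simp add: ray_value_sq_le)

lemma mean_deriv_sq_le: "mean_deriv_sq t \<le> \<bar>Bg\<bar>" for t
  unfolding mean_deriv_sq_def by (rule S.integral_le_const[OF radial_deriv_sq_integrable]) (simp add: radial_deriv_sq_le)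

lemma mean_tangential_bounds: "mean_tangential t / (\<theta> t)\<^sup>2 \<le> \<bar>Bg\<bar>" "0 \<le> mean_tangential t / (\<theta> t)\<^sup>2" for t
proof -
  have e: "mean_tangential t / (\<theta> t)\<^sup>2 = (\<integral>\<omega>. tangential t \<omega> / (\<theta> t)\<^sup>2 \<partial>\<nu>)" by (simp add: mean_tangential_def)
  show "mean_tangential t / (\<theta> t)\<^sup>2 \<le> \<bar>Bg\<bar>" unfolding e by (rule S.integral_le_const[OF tangential_integrable]) (simp add: tangential_le)
  show "0 \<le> mean_tangential t / (\<theta> t)\<^sup>2" unfolding e by (rule Bochner_Integration.integral_nonneg) (rule tangential_div_nonneg)
qed

lemma mean_eq: "(\<integral>\<omega>. f (t *\<^sub>R \<omega>) \<partial>\<nu>) = mean t" for t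
  unfolding mean_def
proof (rule integral_cong_AE)
  show "AE \<omega> in \<nu>. f (t *\<^sub>R \<omega>) = ray_value t \<omega>"
    using AE_sphere_measure by eventually_elim (simp add: ray_value_def)
qed measurable

lemma mean_sq_eq: "(\<integral>\<omega>. (f (t *\<^sub>R \<omega>))\<^sup>2 \<partial>\<nu>) = mean_sq t" for t
  unfolding mean_sq_def
proof (rule integral_cong_AE)
  show "AE \<omega> in \<nu>. (f (t *\<^sub>R \<omega>))\<^sup>2 = (ray_value t \<omega>)\<^sup>2"
    using AE_sphere_measure by eventually_elim (simp add: ray_value_def)
qed measurable

text \<open>The factor \<open>m\<close> is the first nonzero eigenvalue of the unit sphere of
  dimension \<open>m\<close>.\<close>

lemma sphere_variance: "real m * var_ray t \<le> mean_tangential t" if t: "0 < t" "t < R" for t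
proof -
  have "(real DIM('a) - 1) * ((\<integral>\<omega>. (f (t *\<^sub>R \<omega>))\<^sup>2 \<partial>\<nu>) - (\<integral>\<omega>. f (t *\<^sub>R \<omega>) \<partial>\<nu>)\<^sup>2)
    \<le> (\<integral>\<omega>. t\<^sup>2 * ((norm (D (t *\<^sub>R \<omega>)))\<^sup>2 - (D (t *\<^sub>R \<omega>) \<bullet> \<omega>)\<^sup>2) \<partial>\<nu>)"
    by (rule sphere_poincare[OF t(1) fm Dm]) (use t in \<open>auto intro!: f_der continuous_on_subset[OF Dc]\<close>)
  also have "\<dots> = mean_tangential t"
    unfolding mean_tangential_def
  proof (rule integral_cong_AE)
    show "AE \<omega> in \<nu>. t\<^sup>2 * ((norm (D (t *\<^sub>R \<omega>)))\<^sup>2 - (D (t *\<^sub>R \<omega>) \<bullet> \<omega>)\<^sup>2) = tangential t \<omega>"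
      using AE_sphere_measure by eventually_elim (use t in \<open>auto simp: tangential_def in_shell_def\<close>)
  qed measurable
  also have "(\<integral>\<omega>. (f (t *\<^sub>R \<omega>))\<^sup>2 \<partial>\<nu>) = mean_sq t" by (rule mean_sq_eq)
  also have "(\<integral>\<omega>. f (t *\<^sub>R \<omega>) \<partial>\<nu>) = mean t" by (rule mean_eq)
  finally show ?thesis using dim by (simp add: var_ray_def)
qed

lemma ray_value_deriv: "((\<lambda>t. ray_value t \<omega>) has_real_derivative radial_deriv t \<omega>) (at t)" if t: "0 < t" "t < R" for t \<omega>
proof (cases "norm \<omega> = 1")
  case True
  have "(f has_derivative (\<lambda>v. D (t *\<^sub>R \<omega>) \<bullet> v)) (at (t *\<^sub>R \<omega>))"
    by (rule f_der) (use t True in auto)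
  from has_derivative_compose[where f = "\<lambda>t. t *\<^sub>R \<omega>" and g = f and f' = "\<lambda>v. v *\<^sub>R \<omega>"
      and x = t and s = UNIV, OF has_derivative_scaleR_left[OF has_derivative_ident] this]
  have "((\<lambda>t. f (t *\<^sub>R \<omega>)) has_derivative (\<lambda>v. D (t *\<^sub>R \<omega>) \<bullet> (v *\<^sub>R \<omega>))) (at t)" .
  moreover have "(\<lambda>v. D (t *\<^sub>R \<omega>) \<bullet> (v *\<^sub>R \<omega>)) = (*) (D (t *\<^sub>R \<omega>) \<bullet> \<omega>)" by (auto simp: fun_eq_iff)
  ultimately have "((\<lambda>t. f (t *\<^sub>R \<omega>)) has_real_derivative D (t *\<^sub>R \<omega>) \<bullet> \<omega>) (at t)"
    by (simp only: has_field_derivative_def)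
  thus ?thesis
    using t True by (simp add: ray_value_def radial_deriv_def in_shell_def)
qed (simp add: ray_value_def radial_deriv_def in_shell_def)

lemma ray_increment: "(LINT t:{y..x}|lborel. radial_deriv t \<omega>) = ray_value x \<omega> - ray_value y \<omega>"
  if xy: "0 < y" "y \<le> x" "x < R" for x y \<omega>
proof -
  have "((\<lambda>t. radial_deriv t \<omega>) has_integral ray_value x \<omega> - ray_value y \<omega>) {y..x}"
    by (rule fundamental_theorem_of_calculus[OF xy(2)])
       (use ray_value_deriv xy in \<open>auto simp: has_real_derivative_iff_has_vector_derivative[symmetric] intro: has_field_derivative_at_within\<close>)
  moreover have "set_integrable lborel {y..x} (\<lambda>t. radial_deriv t \<omega>)"
  proof -
    have [measurable]: "(\<lambda>t. radial_deriv t \<omega>) \<in> borel_measurable borel" unfolding radial_deriv_def in_shell_def by measurable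
    show ?thesis unfolding set_integrable_def
      by (rule integrable_bounded_interval[where l = y and u = x and B = Bd])
         (use radial_deriv_bound Bd_nonneg in \<open>auto simp: indicator_def\<close>)
  qed
  ultimately show ?thesis by (simp add: set_borel_integral_eq_integral(2) integral_unique)
qed

text \<open>\<open>brascamp_lieb\<close> asks for increments and not for derivatives, so Fubini
  replaces differentiation under the integral.\<close>

lemma mean_increment: "mean x - mean y = (LINT t:{y..x}|lborel. mean_deriv t)" if xy: "0 < y" "y < x" "x < R" for x y
proof -
  have "mean x - mean y = (\<integral>\<omega>. ray_value x \<omega> - ray_value y \<omega> \<partial>\<nu>)"
    unfolding mean_def using ray_value_integrable by (simp add: Bochner_Integration.integral_diff)
  also have "\<dots> = (\<integral>\<omega>. (LINT t:{y..x}|lborel. radial_deriv t \<omega>) \<partial>\<nu>)"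
    using ray_increment[of y x] xy by simp
  also have "\<dots> = (LINT t:{y..x}|lborel. (\<integral>\<omega>. radial_deriv t \<omega> \<partial>\<nu>))"
    by (rule Fubini_bounded_interval(1)[OF S.finite_measure_axioms _ radial_deriv_bound])
       (use radial_deriv_measurable in \<open>simp add: sets_pair_measure_cong[OF refl sets_sphere_measure] cong: measurable_cong_sets\<close>)
  finally show ?thesis by (simp add: mean_deriv_def)
qed

lemma mean_deriv_bound: "\<bar>mean_deriv t\<bar> \<le> Bd" for t
proof -
  have "\<bar>mean_deriv t\<bar> \<le> (\<integral>\<omega>. \<bar>radial_deriv t \<omega>\<bar> \<partial>\<nu>)" unfolding mean_deriv_def by (rule integral_abs_bound)
  also have "\<dots> \<le> Bd" by (rule S.integral_le_const) (use radial_deriv_integrable radial_deriv_bound in auto)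
  finally show ?thesis .
qed

lemma mean_bound: "\<bar>mean t\<bar> \<le> Bf" for t
proof -
  have "\<bar>mean t\<bar> \<le> (\<integral>\<omega>. \<bar>ray_value t \<omega>\<bar> \<partial>\<nu>)" unfolding mean_def by (rule integral_abs_bound)
  also have "\<dots> \<le> Bf" by (rule S.integral_le_const) (use ray_value_integrable ray_value_bound in auto)
  finally show ?thesis .
qed

lemma mean_deriv_set_integrable: "set_integrable lborel {y..x} mean_deriv" "set_integrable lborel {y..x} (\<lambda>t. (mean_deriv t)\<^sup>2)" for x y
  unfolding set_integrable_def
  by (rule integrable_bounded_interval[where l = y and u = x and B = Bd]; use mean_deriv_bound Bd_nonneg in \<open>auto simp: indicator_def\<close>)
     (rule integrable_bounded_interval[where l = y and u = x and B = "Bd\<^sup>2"]; use square_bound[OF mean_deriv_bound] in \<open>auto simp: indicator_def\<close>)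

lemmas times_weight_integrable = weight_times_bounded_integrable[where \<alpha> = \<alpha> and j = j and m = m]

lemma mean_deriv_sq_weighted: "integrable lborel (\<lambda>r. (mean_deriv r)\<^sup>2 * w r)" by (rule times_weight_integrable[of _ "Bd\<^sup>2"]) (use square_bound[OF mean_deriv_bound] in auto)

lemma mean_weighted: "integrable lborel (\<lambda>r. (mean r)\<^sup>2 * w r)" by (rule times_weight_integrable[of _ "Bf\<^sup>2"]) (use square_bound[OF mean_bound] in auto)

lemma radial_part: "K * ((\<integral>r. w r \<partial>lborel) * (\<integral>r. (mean r)\<^sup>2 * w r \<partial>lborel) - (\<integral>r. mean r * w r \<partial>lborel)\<^sup>2)
   \<le> (\<integral>r. w r \<partial>lborel) * (\<integral>r. (mean_deriv r)\<^sup>2 * w r \<partial>lborel)"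
  by (rule monotone_score.brascamp_lieb[OF weight_monotone_score[OF m K mono]])
     (use mean_deriv_set_integrable mean_increment mean_deriv_sq_weighted mean_weighted times_weight_integrable[of mean Bf] mean_bound in \<open>auto simp: einterval_def\<close>)

text \<open>The gap of the angular inequality at radius \<open>r\<close>. No sign is claimed at a
  single radius; the inequality is the nonnegativity of the integral.\<close>

definition excess where "excess r = (var_deriv r + real m * var_ray r / (\<theta>' r)\<^sup>2 - K * var_ray r) * w r"

lemma [measurable]: "excess \<in> borel_measurable borel" unfolding excess_def by measurable

lemma scaled_var_bounds: "0 \<le> real m * var_ray r / (\<theta>' r)\<^sup>2" "real m * var_ray r / (\<theta>' r)\<^sup>2 \<le> mean_tangential r / (\<theta> r)\<^sup>2" if "0 < r" "r < R" for r
  using that sphere_variance[OF that] var_ray_nonneg[of r] by (auto simp: \<theta>'_def divide_right_mono)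

lemma var_ray_le: "var_ray r \<le> Bf\<^sup>2" for r using mean_sq_le[of r] zero_le_power2[of "mean r"] unfolding var_ray_def by linarith

lemma var_deriv_le: "var_deriv r \<le> \<bar>Bg\<bar>" for r using mean_deriv_sq_le[of r] zero_le_power2[of "mean_deriv r"] unfolding var_deriv_def by linarith

lemma var_deriv_weighted: "integrable lborel (\<lambda>r. var_deriv r * w r)" by (rule times_weight_integrable[of _ "\<bar>Bg\<bar>"]) (use var_deriv_le var_deriv_nonneg in auto)

lemma var_ray_weighted: "integrable lborel (\<lambda>r. var_ray r * w r)" by (rule times_weight_integrable[of _ "Bf\<^sup>2"]) (use var_ray_le var_ray_nonneg in auto)

lemma scaled_var_weighted: "integrable lborel (\<lambda>r. real m * var_ray r / (\<theta>' r)\<^sup>2 * w r)"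
proof (rule times_weight_integrable[of _ "\<bar>Bg\<bar>"])
  show "\<bar>real m * var_ray r / (\<theta>' r)\<^sup>2\<bar> \<le> \<bar>Bg\<bar>" if "0 < r" "r < R" for r
    using scaled_var_bounds[OF that] mean_tangential_bounds[of r] by linarith
qed measurable

lemma excess_eq: "excess = (\<lambda>r. var_deriv r * w r + real m * var_ray r / (\<theta>' r)\<^sup>2 * w r - K * (var_ray r * w r))"
  by (auto simp: excess_def algebra_simps)

lemma excess_integrable: "integrable lborel excess" unfolding excess_eq using var_deriv_weighted var_ray_weighted scaled_var_weighted by auto

lemma integral_excess: "(\<integral>r. excess r \<partial>lborel) = (\<integral>r. var_deriv r * w r \<partial>lborel) + (\<integral>r. real m * var_ray r / (\<theta>' r)\<^sup>2 * w r \<partial>lborel) - K * (\<integral>r. var_ray r * w r \<partial>lborel)"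
  unfolding excess_eq using var_deriv_weighted var_ray_weighted scaled_var_weighted by simp

text \<open>The angular variance is half the mean square of the difference along two independent rays, to which
  the one-dimensional Hardy inequality applies.\<close>

lemma hardy_interval: "2 * (w t / t * var_ray t - w s / s * var_ray s) \<le> (LINT r:{s..t}|lborel. 2 * excess r)"
  if st: "0 < s" "s \<le> t" "t < R" for s t
proof -
  let ?N = "\<nu> \<Otimes>\<^sub>M \<nu>"
  interpret N: prob_space ?N by (rule prob_space_pair[OF S.prob_space_axioms S.prob_space_axioms])
  have [measurable_cong]: "sets ?N = sets (borel \<Otimes>\<^sub>M borel)" by (intro sets_pair_measure_cong) auto
  define q where "q r p = ray_value r (fst p) - ray_value r (snd p)" for r p
  define q' where "q' r p = radial_deriv r (fst p) - radial_deriv r (snd p)" for r p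
  have qB: "\<bar>q r p\<bar> \<le> 2 * Bf" "\<bar>q' r p\<bar> \<le> 2 * Bd" for r p
    using ray_value_bound[of r "fst p"] ray_value_bound[of r "snd p"] radial_deriv_bound[of r "fst p"] radial_deriv_bound[of r "snd p"] by (auto simp: q_def q'_def)
  have q2B: "\<bar>(q r p)\<^sup>2\<bar> \<le> (2 * Bf)\<^sup>2" "\<bar>(q' r p)\<^sup>2\<bar> \<le> (2 * Bd)\<^sup>2" for r p
    by (rule square_bound[OF qB(1)], rule square_bound[OF qB(2)])
  have [measurable]: "q r \<in> borel_measurable ?N" "q' r \<in> borel_measurable ?N" for r
    unfolding q_def q'_def by measurable
  have qi: "integrable ?N (\<lambda>p. (q r p)\<^sup>2)" "integrable ?N (\<lambda>p. (q' r p)\<^sup>2)" for r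
    by (rule integrable_bounded_finite_measure[OF N.finite_measure_axioms _ q2B(1)], measurable)
       (rule integrable_bounded_finite_measure[OF N.finite_measure_axioms _ q2B(2)], measurable)
  have qv: "(\<integral>p. (q r p)\<^sup>2 \<partial>?N) = 2 * var_ray r" "(\<integral>p. (q' r p)\<^sup>2 \<partial>?N) = 2 * var_deriv r" for r
    using var_ray_pair var_deriv_pair by (auto simp: q_def q'_def)
  \<comment> \<open>On \<open>{s..t}\<close> the profile stays away from 0; cutting off outside
    yields the uniform bound \<open>\<Phi>B\<close> that Fubini requires.\<close>
  define \<Phi> where "\<Phi> r p = (if r \<in> {s..t} then ((q' r p)\<^sup>2 + real m / (\<theta>' r)\<^sup>2 * (q r p)\<^sup>2 - K * (q r p)\<^sup>2) * w r else 0)" for r p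
  have \<Phi>m: "(\<lambda>(r, p). \<Phi> r p) \<in> borel_measurable (borel \<Otimes>\<^sub>M ?N)"
    unfolding \<Phi>_def q_def q'_def by measurable
  obtain Bw where Bw: "\<And>r. \<bar>w r\<bar> \<le> Bw" using weight_bounded by blast
  have \<theta>_nz: "\<theta> r \<noteq> 0" if "r \<in> {s..t}" for r using pos[of r] that st by auto
  have "bounded ((\<lambda>r. real m / (\<theta> r)\<^sup>2) ` {s..t})"
    by (intro compact_imp_bounded compact_continuous_image continuous_intros continuous_on_subset[OF \<theta>_cont])
       (use st \<theta>_nz in auto)
  then obtain C where C: "\<And>r. r \<in> {s..t} \<Longrightarrow> \<bar>real m / (\<theta> r)\<^sup>2\<bar> \<le> C"
    unfolding bounded_iff real_norm_def by (meson imageI)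
  have \<Phi>B: "\<bar>\<Phi> r p\<bar> \<le> ((2 * Bd)\<^sup>2 + \<bar>C\<bar> * (2 * Bf)\<^sup>2 + K * (2 * Bf)\<^sup>2) * Bw" for r p
  proof (cases "r \<in> {s..t}")
    case True
    hence th: "\<theta>' r = \<theta> r" using st by (auto simp: \<theta>'_def)
    have tri: "\<bar>x + y - z\<bar> \<le> \<bar>x\<bar> + \<bar>y\<bar> + \<bar>z\<bar>" for x y z :: real by linarith
    have "\<bar>(q' r p)\<^sup>2 + real m / (\<theta> r)\<^sup>2 * (q r p)\<^sup>2 - K * (q r p)\<^sup>2\<bar>
       \<le> \<bar>(q' r p)\<^sup>2\<bar> + \<bar>real m / (\<theta> r)\<^sup>2 * (q r p)\<^sup>2\<bar> + \<bar>K * (q r p)\<^sup>2\<bar>" by (rule tri)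
    also have "\<dots> \<le> (2 * Bd)\<^sup>2 + \<bar>C\<bar> * (2 * Bf)\<^sup>2 + K * (2 * Bf)\<^sup>2"
      unfolding abs_mult[of "real m / (\<theta> r)\<^sup>2"] abs_mult[of K] using q2B K C[OF True]
      by (intro add_mono mult_mono) auto
    finally have "\<bar>((q' r p)\<^sup>2 + real m / (\<theta> r)\<^sup>2 * (q r p)\<^sup>2 - K * (q r p)\<^sup>2) * w r\<bar>
      \<le> ((2 * Bd)\<^sup>2 + \<bar>C\<bar> * (2 * Bf)\<^sup>2 + K * (2 * Bf)\<^sup>2) * Bw"
      unfolding abs_mult[of "_ - _"] using Bw[of r] K by (intro mult_mono) auto
    thus ?thesis using True by (simp add: \<Phi>_def th)
  next
    case False
    have "0 \<le> Bw" using Bw[of 0] by (rule order_trans[OF abs_ge_zero])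
    thus ?thesis using False K by (auto simp: \<Phi>_def)
  qed
  have pw: "w t / t * (q t p)\<^sup>2 - w s / s * (q s p)\<^sup>2 \<le> (LINT r:{s..t}|lborel. \<Phi> r p)" for p
  proof -
    have [measurable]: "(\<lambda>r. ray_value r \<omega>) \<in> borel_measurable borel" "(\<lambda>r. radial_deriv r \<omega>) \<in> borel_measurable borel" for \<omega>
      unfolding ray_value_def radial_deriv_def in_shell_def by measurable
    have [measurable]: "(\<lambda>r. \<Phi> r p) \<in> borel_measurable borel" unfolding \<Phi>_def q_def q'_def by measurable
    have fi: "set_integrable lborel {s..t} (\<lambda>r. \<Phi> r p)"
      unfolding set_integrable_def
    proof (rule integrable_bounded_interval[where l = s and u = t])
      show "\<bar>indicator {s..t} r *\<^sub>R \<Phi> r p\<bar> \<le> ((2 * Bd)\<^sup>2 + \<bar>C\<bar> * (2 * Bf)\<^sup>2 + K * (2 * Bf)\<^sup>2) * Bw" for r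
        using \<Phi>B[of r p] by (auto simp: indicator_def intro: order_trans[OF abs_ge_zero])
    qed auto
    have e: "indicator {s..t} r *\<^sub>R \<Phi> r p
       = indicator {s..t} r *\<^sub>R (((q' r p)\<^sup>2 + real m / (\<theta> r)\<^sup>2 * (q r p)\<^sup>2 - K * (q r p)\<^sup>2) * w r)" for r
      using st by (auto simp: \<Phi>_def indicator_def \<theta>'_def)
    have i: "set_integrable lborel {s..t} (\<lambda>r. ((q' r p)\<^sup>2 + real m / (\<theta> r)\<^sup>2 * (q r p)\<^sup>2 - K * (q r p)\<^sup>2) * w r)"
      using fi unfolding set_integrable_def e .
    have "w t / t * (q t p)\<^sup>2 - w s / s * (q s p)\<^sup>2
       \<le> (LINT r:{s..t}|lborel. ((q' r p)\<^sup>2 + real m / (\<theta> r)\<^sup>2 * (q r p)\<^sup>2 - K * (q r p)\<^sup>2) * w r)"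
      by (rule angular_hardy[OF m st P _ i]) (use st in \<open>auto simp: q_def q'_def intro!: DERIV_diff ray_value_deriv\<close>)
    also have "\<dots> = (LINT r:{s..t}|lborel. \<Phi> r p)"
      unfolding set_lebesgue_integral_def e ..
    finally show ?thesis .
  qed
  have "2 * (w t / t * var_ray t - w s / s * var_ray s) = (\<integral>p. w t / t * (q t p)\<^sup>2 - w s / s * (q s p)\<^sup>2 \<partial>?N)"
    using qi by (simp add: qv algebra_simps)
  also have "\<dots> \<le> (\<integral>p. (LINT r:{s..t}|lborel. \<Phi> r p) \<partial>?N)"
    by (rule integral_mono[OF _ Fubini_bounded_interval(2)[OF N.finite_measure_axioms \<Phi>m \<Phi>B] pw]) (use qi in auto)
  also have "\<dots> = (LINT r:{s..t}|lborel. (\<integral>p. \<Phi> r p \<partial>?N))"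
    by (rule Fubini_bounded_interval(1)[OF N.finite_measure_axioms \<Phi>m \<Phi>B])
  also have "\<dots> = (LINT r:{s..t}|lborel. 2 * excess r)"
  proof -
    have "(\<integral>p. \<Phi> r p \<partial>?N) = 2 * excess r" if "r \<in> {s..t}" for r
    proof -
      have "(\<integral>p. \<Phi> r p \<partial>?N) = (\<integral>p. (q' r p)\<^sup>2 + real m / (\<theta>' r)\<^sup>2 * (q r p)\<^sup>2 - K * (q r p)\<^sup>2 \<partial>?N) * w r"
        using that by (simp add: \<Phi>_def)
      also have "(\<integral>p. (q' r p)\<^sup>2 + real m / (\<theta>' r)\<^sup>2 * (q r p)\<^sup>2 - K * (q r p)\<^sup>2 \<partial>?N)
          = 2 * var_deriv r + real m / (\<theta>' r)\<^sup>2 * (2 * var_ray r) - K * (2 * var_ray r)"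
        using qi by (simp add: qv)
      finally show ?thesis by (simp add: excess_def algebra_simps)
    qed
    thus ?thesis unfolding set_lebesgue_integral_def
      by (intro Bochner_Integration.integral_cong) (auto simp: indicator_def)
  qed
  finally show ?thesis .
qed

text \<open>The limit of \<open>hardy_interval\<close> as the intervals exhaust the open interval
  from 0 to \<open>R\<close>. At \<open>R\<close> the boundary term vanishes with the weight; at 0
  the weight divided by \<open>r\<close> is bounded and the variance tends to 0, because
  \<open>f\<close> is nearly constant on small spheres around the pole.\<close>

lemma angular_part: "K * (\<integral>r. var_ray r * w r \<partial>lborel)
   \<le> (\<integral>r. var_deriv r * w r \<partial>lborel) + (\<integral>r. real m * var_ray r / (\<theta>' r)\<^sup>2 * w r \<partial>lborel)"
proof -
  \<comment> \<open>The shift by 3 keeps \<open>s k \<le> R / 3\<close>, so no interval is empty and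
    \<open>R / 2 \<le> t k\<close> for all \<open>k\<close>.\<close>
  define s t where "s k = R / (real k + 3)" and "t k = R - R / (real k + 3)" for k :: nat
  have st: "0 < s k" "s k \<le> t k" "t k < R" "R / 2 \<le> t k" "s k < R" for k
  proof -
    have "R / (real k + 3) \<le> R / 3" by (rule divide_left_mono) (use R in auto)
    moreover have "0 < R / (real k + 3)" using R by simp
    ultimately show "0 < s k" "s k \<le> t k" "t k < R" "R / 2 \<le> t k" "s k < R"
      using R unfolding s_def t_def by linarith+
  qed
  have s_lim: "s \<longlonglongrightarrow> 0" and t_lim: "t \<longlonglongrightarrow> R" unfolding s_def[abs_def] t_def[abs_def] by real_asymp+
  have rhs: "(\<lambda>k. LINT r:{s k..t k}|lborel. 2 * excess r) \<longlonglongrightarrow> (\<integral>r. 2 * excess r \<partial>lborel)"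
    unfolding set_lebesgue_integral_def
  proof (rule integral_dominated_convergence[where w = "\<lambda>r. \<bar>2 * excess r\<bar>"])
    show "AE r in lborel. (\<lambda>k. indicator {s k..t k} r *\<^sub>R (2 * excess r)) \<longlonglongrightarrow> 2 * excess r"
      unfolding s_def t_def
      by (intro AE_I2 indicator_sequence_exhausts R) (auto simp: excess_def weight_def)
  qed (use excess_integrable in \<open>auto simp: indicator_def\<close>)
  have "(\<lambda>k. w (t k)) \<longlonglongrightarrow> 0"
    by (rule filterlim_compose[OF weight_tendsto(2)[OF m]]) (use t_lim st in \<open>auto simp: filterlim_at intro!: always_eventually less_imp_neq\<close>)
  from tendsto_mult_left[OF this, of "Bf\<^sup>2 * (2 / R)"]
  have "(\<lambda>k. Bf\<^sup>2 * (2 / R) * w (t k)) \<longlonglongrightarrow> 0" by simp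
  hence Lt: "(\<lambda>k. w (t k) / t k * var_ray (t k)) \<longlonglongrightarrow> 0"
  proof (rule Lim_null_comparison[OF always_eventually, rotated], intro allI)
    fix k
    have "w (t k) / t k * var_ray (t k) \<le> w (t k) / (R / 2) * Bf\<^sup>2"
      using weight_nonneg[of \<alpha> j m "t k"] st[of k] var_ray_le var_ray_nonneg R
      by (intro mult_mono divide_left_mono divide_nonneg_nonneg) auto
    moreover have "0 \<le> w (t k) / t k * var_ray (t k)"
      using weight_nonneg[of \<alpha> j m "t k"] st[of k] var_ray_nonneg R by (intro mult_nonneg_nonneg divide_nonneg_nonneg) auto
    ultimately show "norm (w (t k) / t k * var_ray (t k)) \<le> Bf\<^sup>2 * (2 / R) * w (t k)" by (simp add: mult_ac)
  qed
  \<comment> \<open>A variance is at most the mean squared distance to any constant; the choice of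
    the limit \<open>f0\<close> makes dominated convergence applicable.\<close>
  have Vs: "var_ray r \<le> (\<integral>\<omega>. (ray_value r \<omega> - f0)\<^sup>2 \<partial>\<nu>)" for r
  proof -
    have "(\<lambda>\<omega>. (ray_value r \<omega> - f0)\<^sup>2) = (\<lambda>\<omega>. (ray_value r \<omega>)\<^sup>2 - 2 * f0 * ray_value r \<omega> + f0\<^sup>2)"
      by (auto simp: power2_eq_square algebra_simps)
    hence "(\<integral>\<omega>. (ray_value r \<omega> - f0)\<^sup>2 \<partial>\<nu>) = mean_sq r - 2 * f0 * mean r + f0\<^sup>2"
      using ray_value_integrable ray_value_sq_integrable S.prob_space by (simp add: mean_sq_def mean_def)
    moreover have "0 \<le> (mean r - f0)\<^sup>2" by simp
    ultimately show ?thesis by (simp add: var_ray_def power2_eq_square algebra_simps)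
  qed
  have "(\<lambda>k. \<integral>\<omega>. (ray_value (s k) \<omega> - f0)\<^sup>2 \<partial>\<nu>) \<longlonglongrightarrow> (\<integral>\<omega>. 0 \<partial>\<nu>)"
  proof (rule integral_dominated_convergence[where w = "\<lambda>_. (Bf + \<bar>f0\<bar>)\<^sup>2"])
    show "AE \<omega> in \<nu>. (\<lambda>k. (ray_value (s k) \<omega> - f0)\<^sup>2) \<longlonglongrightarrow> 0"
      using AE_sphere_measure
    proof eventually_elim
      case (elim \<omega>)
      have "(\<lambda>k. s k *\<^sub>R \<omega>) \<longlonglongrightarrow> 0" using tendsto_scaleR[OF s_lim tendsto_const[of \<omega>]] by simp
      hence "filterlim (\<lambda>k. s k *\<^sub>R \<omega>) (at 0) sequentially"
        using st(1) elim by (auto simp: filterlim_at intro!: always_eventually) (metis less_irrefl)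
      hence "(\<lambda>k. f (s k *\<^sub>R \<omega>)) \<longlonglongrightarrow> f0" by (rule filterlim_compose[OF lim])
      from tendsto_power[OF tendsto_diff[OF this tendsto_const[of f0]], of 2]
      show ?case using elim by (simp add: ray_value_def)
    qed
    have "\<bar>ray_value (s k) \<omega> - f0\<bar> \<le> Bf + \<bar>f0\<bar>" for k \<omega> using ray_value_bound[of "s k" \<omega>] by linarith
    from square_bound[OF this] show "AE \<omega> in \<nu>. norm ((ray_value (s k) \<omega> - f0)\<^sup>2) \<le> (Bf + \<bar>f0\<bar>)\<^sup>2" for k by simp
  qed auto
  hence Vlim: "(\<lambda>k. \<integral>\<omega>. (ray_value (s k) \<omega> - f0)\<^sup>2 \<partial>\<nu>) \<longlonglongrightarrow> 0" by simp
  obtain Bo where Bo: "\<And>r. 0 < r \<Longrightarrow> r < R \<Longrightarrow> w r / r \<le> Bo" using weight_over_r_bounded[OF m] by blast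
  from tendsto_mult_left[OF Vlim, of Bo]
  have "(\<lambda>k. Bo * (\<integral>\<omega>. (ray_value (s k) \<omega> - f0)\<^sup>2 \<partial>\<nu>)) \<longlonglongrightarrow> 0" by simp
  hence Ls: "(\<lambda>k. w (s k) / s k * var_ray (s k)) \<longlonglongrightarrow> 0"
  proof (rule Lim_null_comparison[OF always_eventually, rotated], intro allI)
    fix k
    have w0: "0 \<le> w (s k) / s k" using weight_nonneg[of \<alpha> j m "s k"] st[of k] by (intro divide_nonneg_nonneg) auto
    hence "w (s k) / s k * var_ray (s k) \<le> Bo * (\<integral>\<omega>. (ray_value (s k) \<omega> - f0)\<^sup>2 \<partial>\<nu>)"
      using Bo[OF st(1,5), of k] Vs var_ray_nonneg by (intro mult_mono) auto
    thus "norm (w (s k) / s k * var_ray (s k)) \<le> Bo * (\<integral>\<omega>. (ray_value (s k) \<omega> - f0)\<^sup>2 \<partial>\<nu>)"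
      using mult_nonneg_nonneg[OF w0 var_ray_nonneg[of "s k"]] by (simp only: real_norm_def abs_of_nonneg)
  qed
  have "(\<lambda>k. 2 * (w (t k) / t k * var_ray (t k) - w (s k) / s k * var_ray (s k))) \<longlonglongrightarrow> 2 * (0 - 0)"
    by (intro tendsto_intros Lt Ls)
  from LIMSEQ_le[OF this rhs] hardy_interval[OF st(1,2,3)]
  have "0 \<le> (\<integral>r. excess r \<partial>lborel)" by auto
  thus ?thesis unfolding integral_excess by simp
qed

section \<open>Joining the radial and the angular part\<close>

definition mean_energy where "mean_energy r = (\<integral>\<omega>. polar_energy \<theta> D r \<omega> \<partial>\<nu>)"

lemma mean_energy: "mean_energy r = mean_deriv_sq r + mean_tangential r / (\<theta>' r)\<^sup>2" if r: "0 < r" "r < R" for r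
proof -
  have "mean_energy r = (\<integral>\<omega>. (radial_deriv r \<omega>)\<^sup>2 + tangential r \<omega> / (\<theta> r)\<^sup>2 \<partial>\<nu>)"
    unfolding mean_energy_def
  proof (rule integral_cong_AE)
    show "AE \<omega> in \<nu>. polar_energy \<theta> D r \<omega> = (radial_deriv r \<omega>)\<^sup>2 + tangential r \<omega> / (\<theta> r)\<^sup>2"
      using AE_sphere_measure by eventually_elim (rule energy_split, use r in \<open>simp add: in_shell_def\<close>)
    show "polar_energy \<theta> D r \<in> borel_measurable \<nu>"
      unfolding polar_energy_def[abs_def] by measurable
  qed measurable
  also have "\<dots> = mean_deriv_sq r + mean_tangential r / (\<theta> r)\<^sup>2"
    using radial_deriv_sq_integrable tangential_integrable by (simp add: mean_deriv_sq_def mean_tangential_def)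
  finally show ?thesis using r by (simp add: \<theta>'_def)
qed

lemma integral_mean_energy: "(\<integral>r. mean_energy r * w r \<partial>lborel) = (\<integral>r. (mean_deriv_sq r + mean_tangential r / (\<theta>' r)\<^sup>2) * w r \<partial>lborel)"
  by (intro Bochner_Integration.integral_cong) (auto simp: mean_energy weight_def)

text \<open>At each radius the mean of the squared radial derivative splits into the square of its
  mean and its variance, and the tangential term dominates \<open>real m * var_ray r\<close> by
  \<open>sphere_variance\<close>.\<close>

lemma mean_energy_lower: "(\<integral>r. (mean_deriv r)\<^sup>2 * w r \<partial>lborel) + (\<integral>r. var_deriv r * w r \<partial>lborel)
    + (\<integral>r. real m * var_ray r / (\<theta>' r)\<^sup>2 * w r \<partial>lborel) \<le> (\<integral>r. mean_energy r * w r \<partial>lborel)"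
proof -
  have "(\<integral>r. (mean_deriv r)\<^sup>2 * w r \<partial>lborel) + (\<integral>r. var_deriv r * w r \<partial>lborel) + (\<integral>r. real m * var_ray r / (\<theta>' r)\<^sup>2 * w r \<partial>lborel)
     = (\<integral>r. (mean_deriv r)\<^sup>2 * w r + var_deriv r * w r + real m * var_ray r / (\<theta>' r)\<^sup>2 * w r \<partial>lborel)"
    using mean_deriv_sq_weighted var_deriv_weighted scaled_var_weighted by simp
  also have "\<dots> \<le> (\<integral>r. mean_energy r * w r \<partial>lborel)"
    unfolding integral_mean_energy
  proof (rule integral_mono)
    show "integrable lborel (\<lambda>r. (mean_deriv r)\<^sup>2 * w r + var_deriv r * w r + real m * var_ray r / (\<theta>' r)\<^sup>2 * w r)"
      using mean_deriv_sq_weighted var_deriv_weighted scaled_var_weighted by simp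
    show "integrable lborel (\<lambda>r. (mean_deriv_sq r + mean_tangential r / (\<theta>' r)\<^sup>2) * w r)"
    proof (rule times_weight_integrable[of _ "2 * \<bar>Bg\<bar>"])
      fix r assume r: "0 < r" "r < R"
      have "0 \<le> mean_deriv_sq r" unfolding mean_deriv_sq_def by simp
      thus "\<bar>mean_deriv_sq r + mean_tangential r / (\<theta>' r)\<^sup>2\<bar> \<le> 2 * \<bar>Bg\<bar>" using mean_deriv_sq_le[of r] mean_tangential_bounds[of r] r by (simp add: \<theta>'_def)
    qed measurable
    fix r
    show "(mean_deriv r)\<^sup>2 * w r + var_deriv r * w r + real m * var_ray r / (\<theta>' r)\<^sup>2 * w r \<le> (mean_deriv_sq r + mean_tangential r / (\<theta>' r)\<^sup>2) * w r"
    proof (cases "0 < r \<and> r < R")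
      case True
      hence "(mean_deriv r)\<^sup>2 + var_deriv r + real m * var_ray r / (\<theta>' r)\<^sup>2 \<le> mean_deriv_sq r + mean_tangential r / (\<theta>' r)\<^sup>2"
        using scaled_var_bounds(2)[of r] by (simp add: var_deriv_def \<theta>'_def)
      from mult_right_mono[OF this weight_nonneg] show ?thesis by (simp only: distrib_right)
    next
      case False
      hence "w r = 0" by (auto simp: weight_def)
      thus ?thesis by simp
    qed
  qed
  finally show ?thesis .
qed

text \<open>Total variance is the variance of the spherical mean plus the mean of the variances on
  the spheres; \<open>radial_part\<close> treats the first summand and \<open>angular_part\<close>
  the second.\<close>

lemma product_poincare:
  "K * ((\<integral>r. w r \<partial>lborel) *
      (\<integral>r. (\<integral>\<omega>. (f (r *\<^sub>R \<omega>))\<^sup>2 \<partial>sphere_measure) * w r \<partial>lborel)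
    - (\<integral>r. (\<integral>\<omega>. f (r *\<^sub>R \<omega>) \<partial>sphere_measure) * w r \<partial>lborel)\<^sup>2)
  \<le> (\<integral>r. w r \<partial>lborel) *
      (\<integral>r. (\<integral>\<omega>. polar_energy \<theta> D r \<omega> \<partial>sphere_measure) * w r \<partial>lborel)"
proof -
  define W where "W = (\<integral>r. w r \<partial>lborel)"
  have W0: "0 \<le> W" unfolding W_def using weight_nonneg by simp
  have mean_sq_split: "(\<integral>r. mean_sq r * w r \<partial>lborel) = (\<integral>r. (mean r)\<^sup>2 * w r \<partial>lborel) + (\<integral>r. var_ray r * w r \<partial>lborel)"
    using mean_weighted var_ray_weighted by (subst Bochner_Integration.integral_add[symmetric]) (auto simp: var_ray_def algebra_simps)
  have "K * (W * (\<integral>r. mean_sq r * w r \<partial>lborel) - (\<integral>r. mean r * w r \<partial>lborel)\<^sup>2)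
     = K * (W * (\<integral>r. (mean r)\<^sup>2 * w r \<partial>lborel) - (\<integral>r. mean r * w r \<partial>lborel)\<^sup>2) + W * (K * (\<integral>r. var_ray r * w r \<partial>lborel))"
    unfolding mean_sq_split by (simp add: algebra_simps)
  also have "\<dots> \<le> W * (\<integral>r. (mean_deriv r)\<^sup>2 * w r \<partial>lborel)
      + W * ((\<integral>r. var_deriv r * w r \<partial>lborel) + (\<integral>r. real m * var_ray r / (\<theta>' r)\<^sup>2 * w r \<partial>lborel))"
    using radial_part W0 angular_part by (intro add_mono mult_left_mono) (auto simp: W_def)
  also have "\<dots> \<le> W * (\<integral>r. mean_energy r * w r \<partial>lborel)"
    unfolding distrib_left[symmetric] using mean_energy_lower W0 by (intro mult_left_mono) (auto simp: add.assoc)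
  finally show ?thesis
    unfolding W_def mean_sq_eq mean_eq mean_energy_def .
qed

end

section \<open>Change of variables\<close>

text \<open>The change of variables theorem of the library asks for a wellordered index type.\<close>

typedef 'a wo = "UNIV :: 'a set" morphisms of_wo to_wo by auto

lemma to_wo_of_wo [simp]: "to_wo (of_wo x) = x" and of_wo_to_wo [simp]: "of_wo (to_wo y) = y"
  by (simp_all add: of_wo_inverse to_wo_inverse)

lemma bij_to_wo: "bij to_wo" by (rule bijI') (auto simp: to_wo_inject intro: exI[of _ "of_wo _"])

lemma bij_of_wo: "bij of_wo" by (rule bijI') (auto simp: of_wo_inject intro: exI[of _ "to_wo _"])

instance wo :: (finite) finite
proof
  have "finite (range (to_wo :: 'a \<Rightarrow> 'a wo))" by simp
  moreover have "range (to_wo :: 'a \<Rightarrow> 'a wo) = UNIV" by (rule bij_is_surj[OF bij_to_wo])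
  ultimately show "finite (UNIV :: 'a wo set)" by simp
qed

definition wo_rank :: "'a::finite wo \<Rightarrow> nat" where "wo_rank = (SOME f. inj f)"

lemma inj_wo_rank: "inj (wo_rank :: 'a::finite wo \<Rightarrow> nat)"
proof -
  have "\<exists>f :: 'a wo \<Rightarrow> nat. inj f"
    using finite_imp_inj_to_nat_seg[of "UNIV :: 'a wo set"] by auto
  thus ?thesis unfolding wo_rank_def by (rule someI_ex)
qed

instantiation wo :: (finite) wellorder
begin

definition less_eq_wo :: "'a wo \<Rightarrow> 'a wo \<Rightarrow> bool" where "x \<le> y \<longleftrightarrow> wo_rank x \<le> wo_rank y"

definition less_wo :: "'a wo \<Rightarrow> 'a wo \<Rightarrow> bool" where "x < y \<longleftrightarrow> wo_rank x < wo_rank y"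

instance
proof
  fix P :: "'a wo \<Rightarrow> bool" and a
  assume step: "\<And>x. (\<And>y. y < x \<Longrightarrow> P y) \<Longrightarrow> P x"
  show "P a"
    by (induction a rule: measure_induct_rule[where f = wo_rank]) (rule step, simp add: less_wo_def)
qed (use inj_wo_rank in \<open>auto simp: less_eq_wo_def less_wo_def inj_def\<close>)

end

definition reindex :: "real ^ 'n \<Rightarrow> real ^ ('n::finite) wo" where "reindex x = (\<chi> i. x $ of_wo i)"

definition unindex :: "real ^ ('n::finite) wo \<Rightarrow> real ^ 'n" where "unindex y = (\<chi> i. y $ to_wo i)"

lemma unindex_reindex [simp]: "unindex (reindex x) = x" and reindex_unindex [simp]: "reindex (unindex y) = y"
  by (simp_all add: reindex_def unindex_def vec_eq_iff)

lemma bounded_linear_reindex: "bounded_linear (reindex :: real ^ 'n::finite \<Rightarrow> _)"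
  and bounded_linear_unindex: "bounded_linear (unindex :: _ \<Rightarrow> real ^ 'n::finite)"
  by (intro linear_conv_bounded_linear[THEN iffD1] linearI; simp add: reindex_def unindex_def vec_eq_iff)+

lemma prod_Basis_cart:
  fixes f :: "real ^ 'n::finite \<Rightarrow> real"
  shows "(\<Prod>b\<in>Basis. f b) = (\<Prod>i\<in>UNIV. f (axis i 1))"
proof -
  have "(Basis :: (real ^ 'n) set) = range (\<lambda>i. axis i 1)" by (auto simp: Basis_vec_def)
  hence "(\<Prod>b\<in>Basis. f b) = (\<Prod>b\<in>range (\<lambda>i. axis i 1). f b)" by (simp only:)
  also have "\<dots> = (\<Prod>i\<in>UNIV. f (axis i 1))"
    by (subst prod.reindex) (auto simp: inj_def axis_eq_axis)
  finally show ?thesis .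
qed

lemma lborel_reindex: "distr lborel borel (unindex :: _ \<Rightarrow> real ^ 'n::finite) = lborel"
proof (rule lborel_eqI[symmetric])
  fix l u :: "real ^ 'n" assume lu: "\<And>b. b \<in> Basis \<Longrightarrow> l \<bullet> b \<le> u \<bullet> b"
  hence lu': "l $ i \<le> u $ i" for i using lu[of "axis i 1"] by (auto simp: Basis_vec_def inner_axis)
  have "unindex -` box l u = box (reindex l) (reindex u)"
  proof (intro set_eqI)
    fix x :: "real ^ 'n wo"
    have "(\<forall>i. l $ i < x $ to_wo i \<and> x $ to_wo i < u $ i) \<longleftrightarrow> (\<forall>i. l $ of_wo i < x $ i \<and> x $ i < u $ of_wo i)"
      by (metis of_wo_to_wo to_wo_of_wo)
    thus "x \<in> unindex -` box l u \<longleftrightarrow> x \<in> box (reindex l) (reindex u)"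
      by (simp add: mem_box_cart unindex_def reindex_def)
  qed
  moreover have "(unindex :: _ \<Rightarrow> real ^ 'n) \<in> borel_measurable borel"
    by (intro borel_measurable_continuous_onI linear_continuous_on bounded_linear_unindex)
  ultimately have "emeasure (distr lborel borel (unindex :: _ \<Rightarrow> real ^ 'n)) (box l u) = emeasure lborel (box (reindex l) (reindex u))"
    by (subst emeasure_distr) auto
  also have "\<dots> = ennreal (\<Prod>b\<in>Basis. (reindex u - reindex l) \<bullet> b)"
    using lu' by (intro emeasure_lborel_box) (auto simp: Basis_vec_def inner_axis reindex_def)
  also have "(\<Prod>b\<in>Basis. (reindex u - reindex l) \<bullet> b) = (\<Prod>i\<in>UNIV. (u - l) $ of_wo i)"
    by (simp add: prod_Basis_cart inner_axis reindex_def)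
  also have "(\<Prod>i\<in>UNIV. (u - l) $ of_wo i) = (\<Prod>i\<in>UNIV. (u - l) $ i)"
    by (rule prod.reindex_bij_betw[OF bij_of_wo])
  finally show "emeasure (distr lborel borel (unindex :: _ \<Rightarrow> real ^ 'n)) (box l u) = ennreal (\<Prod>b\<in>Basis. (u - l) \<bullet> b)"
    by (simp add: prod_Basis_cart inner_axis)
qed simp

text \<open>Conjugation by \<open>of_wo\<close> matches the permutations in the two Leibniz sums and
  preserves signs.\<close>

lemma det_reindex: "det (\<chi> i j. A $ of_wo i $ of_wo j :: real ^ ('n::finite) wo ^ 'n wo) = det A"
  unfolding det_def
proof (rule sum.reindex_bij_witness[where i = "map_permutation UNIV to_wo" and j = "map_permutation UNIV of_wo"])
  have inj: "inj to_wo" "inj of_wo" using bij_to_wo bij_of_wo by (auto simp: bij_def)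
  have app: "map_permutation UNIV of_wo p i = of_wo (p (to_wo i))" for p :: "'n wo \<Rightarrow> 'n wo" and i
    using map_permutation_apply[of of_wo UNIV "to_wo i" p] inj by simp
  fix p :: "'n wo \<Rightarrow> 'n wo" assume "p \<in> {p. p permutes UNIV}"
  hence p: "p permutes UNIV" by simp
  show "map_permutation UNIV to_wo (map_permutation UNIV of_wo p) = p"
    by (rule map_permutation_compose_inv[OF _ p]) (use bij_of_wo inj in auto)
  show "map_permutation UNIV of_wo p \<in> {p. p permutes UNIV}"
    using map_permutation_permutes[OF bij_of_wo p] by simp
  have "sign (map_permutation UNIV of_wo p) = sign p"
    using sign_map_permutation[OF _ p] inj by simp
  moreover have "(\<Prod>i\<in>UNIV. A $ i $ map_permutation UNIV of_wo p i) = (\<Prod>i\<in>UNIV. A $ of_wo i $ of_wo (p i))"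
    unfolding app by (subst prod.reindex_bij_betw[OF bij_of_wo, symmetric]) simp
  ultimately show "of_int (sign (map_permutation UNIV of_wo p)) * (\<Prod>i\<in>UNIV. A $ i $ map_permutation UNIV of_wo p i)
     = of_int (sign p) * (\<Prod>i\<in>UNIV. (\<chi> i j. A $ of_wo i $ of_wo j) $ i $ p i)" by simp
next
  have inj: "inj to_wo" "inj of_wo" using bij_to_wo bij_of_wo by (auto simp: bij_def)
  fix p :: "'n \<Rightarrow> 'n" assume "p \<in> {p. p permutes UNIV}"
  hence p: "p permutes UNIV" by simp
  show "map_permutation UNIV of_wo (map_permutation UNIV to_wo p) = p"
    by (rule map_permutation_compose_inv[OF _ p]) (use bij_to_wo inj in auto)
  show "map_permutation UNIV to_wo p \<in> {p. p permutes UNIV}"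
    using map_permutation_permutes[OF bij_to_wo p] by simp
qed

text \<open>The substitution rule is transported along \<open>reindex\<close>, compatible with
  Lebesgue measure and determinants. Integrability is asked of \<open>\<psi>\<close>, on the side of
  the parameter, because there the integrand will be the bounded \<open>vol_factor\<close>; that of
  \<open>\<phi>\<close> on the image is a consequence.\<close>

lemma nn_integral_change_of_variables:
  fixes T :: "real ^ 'n::finite \<Rightarrow> real ^ 'n" and \<phi> \<psi> :: "real ^ 'n \<Rightarrow> real"
  assumes S: "S \<in> sets borel"
    and T: "\<And>x. x \<in> S \<Longrightarrow> (T has_derivative T' x) (at x within S)" and inj: "inj_on T S"
    and m: "(\<lambda>x. ennreal (\<phi> x) * indicator (T ` S) x) \<in> borel_measurable borel"
    and \<phi>: "\<And>x. x \<in> S \<Longrightarrow> 0 \<le> \<phi> (T x)"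
    and \<psi>: "\<And>x. x \<in> S \<Longrightarrow> \<bar>det (matrix (T' x))\<bar> * \<phi> (T x) = \<psi> x"
    and i: "integrable lborel (\<lambda>x. indicator S x *\<^sub>R \<psi> x)"
  shows "(\<integral>\<^sup>+x. ennreal (\<phi> x) * indicator (T ` S) x \<partial>lborel) = (\<integral>\<^sup>+x. ennreal (\<psi> x) * indicator S x \<partial>lborel)"
proof -
  let ?S = "reindex ` S" and ?T = "\<lambda>y. reindex (T (unindex y))" and ?T' = "\<lambda>y v. reindex (T' (unindex y) (unindex v))"
  have um [measurable]: "(unindex :: _ \<Rightarrow> real ^ 'n) \<in> borel_measurable borel"
    by (intro borel_measurable_continuous_onI linear_continuous_on bounded_linear_unindex)
  have vS: "?S = unindex -` S" by (auto simp: image_iff) (metis reindex_unindex)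
  have SS: "?S \<in> sets borel" unfolding vS by (rule measurable_sets_borel[OF um S])
  have indS: "indicator ?S y = indicator S (unindex y)" for y by (simp add: vS indicator_def)
  have "?T ` ?S = unindex -` (T ` S)"
    by (auto simp: image_iff) (metis reindex_unindex)
  hence indT: "indicator (?T ` ?S) y = indicator (T ` S) (unindex y)" for y by (simp add: indicator_def)
  have det: "\<bar>det (matrix (?T' y))\<bar> = \<bar>det (matrix (T' (unindex y)))\<bar>" for y
  proof -
    have "unindex (axis j 1) = (axis (of_wo j) 1 :: real ^ 'n)" for j
      by (auto simp: unindex_def axis_def vec_eq_iff)
    hence "matrix (?T' y) = (\<chi> i j. matrix (T' (unindex y)) $ of_wo i $ of_wo j)"
      by (simp add: matrix_def reindex_def)
    thus ?thesis by (simp add: det_reindex)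
  qed
  have dT: "(?T has_derivative ?T' y) (at y within ?S)" if "y \<in> ?S" for y
  proof -
    have "(T has_derivative T' (unindex y)) (at (unindex y) within unindex ` ?S)"
      using that T by (auto simp: image_image)
    from has_derivative_in_compose[OF bounded_linear.has_derivative[OF bounded_linear_unindex has_derivative_ident] this]
    show ?thesis by (rule bounded_linear.has_derivative[OF bounded_linear_reindex])
  qed
  have injT: "inj_on ?T ?S"
    using inj by (auto simp: inj_on_def) (metis unindex_reindex)
  have "integrable (distr lborel borel unindex) (\<lambda>x. indicator S x *\<^sub>R \<psi> x)" using i by (simp add: lborel_reindex)
  hence "integrable lborel (\<lambda>y. indicator ?S y *\<^sub>R \<psi> (unindex y))"
    unfolding indS using i by (subst (asm) integrable_distr_eq) (auto dest: borel_measurable_integrable)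
  hence ai: "(\<lambda>y. \<psi> (unindex y)) absolutely_integrable_on ?S"
    unfolding set_integrable_def by (subst integrable_completion) (auto dest: borel_measurable_integrable)
  define I where "I = integral ?S (\<lambda>y. \<psi> (unindex y))"
  \<comment> \<open>The substitution rule concerns vector-valued integrands; scalars enter as
    elements of \<open>real ^ 1\<close>.\<close>
  let ?v = "\<lambda>x. vec x :: real ^ 1"
  have eq: "\<bar>det (matrix (?T' y))\<bar> *\<^sub>R ?v (\<phi> (unindex (?T y))) = ?v (\<psi> (unindex y))" if "y \<in> ?S" for y
    using that \<psi>[of "unindex y"] by (auto simp: det vec_eq_iff)
  have "(\<lambda>y. ?v (\<psi> (unindex y))) absolutely_integrable_on ?S \<and> integral ?S (\<lambda>y. ?v (\<psi> (unindex y))) = ?v I"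
    using ai by (simp add: absolutely_integrable_on_1_iff integral_on_1_eq I_def)
  hence "(\<lambda>y. \<bar>det (matrix (?T' y))\<bar> *\<^sub>R ?v (\<phi> (unindex (?T y)))) absolutely_integrable_on ?S
      \<and> integral ?S (\<lambda>y. \<bar>det (matrix (?T' y))\<bar> *\<^sub>R ?v (\<phi> (unindex (?T y)))) = ?v I"
    using eq by (simp cong: set_integrable_cong Henstock_Kurzweil_Integration.integral_cong)
  hence "(\<lambda>y. ?v (\<phi> (unindex y))) absolutely_integrable_on (?T ` ?S) \<and> integral (?T ` ?S) (\<lambda>y. ?v (\<phi> (unindex y))) = ?v I"
    by (subst (asm) has_absolute_integral_change_of_variables[OF _ dT injT]) (use SS in auto)
  hence ai': "(\<lambda>y. \<phi> (unindex y)) absolutely_integrable_on (?T ` ?S)" "integral (?T ` ?S) (\<lambda>y. \<phi> (unindex y)) = I"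
    by (simp_all add: absolutely_integrable_on_1_iff integral_on_1_eq)
  have "(\<integral>\<^sup>+x. ennreal (\<phi> x) * indicator (T ` S) x \<partial>lborel) = (\<integral>\<^sup>+x. ennreal (\<phi> x) * indicator (T ` S) x \<partial>distr lborel borel unindex)"
    by (simp add: lborel_reindex)
  also have "\<dots> = (\<integral>\<^sup>+y. ennreal (\<phi> (unindex y)) * indicator (?T ` ?S) y \<partial>lborel)"
    unfolding indT by (rule nn_integral_distr) (use m in auto)
  also have "\<dots> = ennreal I"
    by (rule nn_integral_has_integral_lebesgue')
       (use ai' \<phi> in \<open>auto simp: has_integral_iff set_lebesgue_integral_eq_integral(1)\<close>)
  also have "\<dots> = (\<integral>\<^sup>+y. ennreal (\<psi> (unindex y)) * indicator ?S y \<partial>lborel)"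
  proof (rule nn_integral_has_integral_lebesgue'[symmetric])
    show "0 \<le> \<psi> (unindex y)" if "y \<in> ?S" for y using that \<psi>[of "unindex y", symmetric] \<phi>[of "unindex y"] by auto
    show "((\<lambda>y. \<psi> (unindex y)) has_integral I) ?S"
      using ai by (auto simp: I_def has_integral_iff set_lebesgue_integral_eq_integral(1))
  qed
  also have "\<dots> = (\<integral>\<^sup>+x. ennreal (\<psi> x) * indicator S x \<partial>distr lborel borel unindex)"
  proof -
    have "(\<lambda>x. ennreal (indicator S x *\<^sub>R \<psi> x)) \<in> borel_measurable borel" using i by (auto dest: borel_measurable_integrable)
    moreover have "(\<lambda>x. ennreal (indicator S x *\<^sub>R \<psi> x)) = (\<lambda>x. ennreal (\<psi> x) * indicator S x)"
      by (auto simp: indicator_def)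
    ultimately have "(\<lambda>x. ennreal (\<psi> x) * indicator S x) \<in> borel_measurable borel" by simp
    thus ?thesis unfolding indS by (intro nn_integral_distr[symmetric]) auto
  qed
  finally show ?thesis by (simp add: lborel_reindex)
qed

section \<open>Quadratic forms\<close>

lemma matrix_inv_right: "invertible A \<Longrightarrow> A ** matrix_inv A = mat 1"
  and matrix_inv_left: "invertible A \<Longrightarrow> matrix_inv A ** A = mat 1"
  for A :: "real ^ 'n::finite ^ 'n"
  using someI_ex[of "\<lambda>A'. A ** A' = mat 1 \<and> A' ** A = mat 1"]
  by (auto simp: invertible_def matrix_inv_def)

text \<open>Invariance of the dual norm: \<open>b\<close> is a covector, \<open>a\<close> its
  pull-back under \<open>J\<close>, and \<open>G'\<close> the pulled-back metric. The vector
  \<open>z\<close> with \<open>J *v z = matrix_inv G *v b\<close> solves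
  \<open>G' *v z = a\<close>.\<close>

lemma inner_matrix_inv_transform:
  fixes G J :: "real ^ 'n::finite ^ 'n"
  assumes G: "det G \<noteq> 0" and J: "det J \<noteq> 0" and a: "a = transpose J *v b"
    and G': "G' = transpose J ** G ** J"
  shows "b \<bullet> (matrix_inv G *v b) = a \<bullet> (matrix_inv G' *v a)"
proof -
  have iG: "invertible G" "invertible J" using G J by (auto simp: invertible_det_nz)
  have iG': "invertible G'" using G J by (simp add: G' invertible_det_nz det_mul det_transpose)
  define y where "y = matrix_inv G *v b"
  define z where "z = matrix_inv J *v y"
  have Gy: "G *v y = b" using iG by (simp add: y_def matrix_vector_mul_assoc matrix_inv_right)
  have Jz: "J *v z = y" using iG by (simp add: z_def matrix_vector_mul_assoc matrix_inv_right)
  have "G' *v z = transpose J *v (G *v (J *v z))"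
    by (simp add: G' matrix_vector_mul_assoc matrix_mul_assoc)
  also have "\<dots> = a" by (simp add: Jz Gy a)
  finally have "matrix_inv G' *v a = matrix_inv G' *v (G' *v z)" by simp
  also have "\<dots> = z" using iG' by (simp add: matrix_vector_mul_assoc matrix_inv_left)
  finally have "a \<bullet> (matrix_inv G' *v a) = (transpose J *v b) \<bullet> z" by (simp add: a)
  also have "\<dots> = b \<bullet> (J *v z)" by (metis dot_lmul_matrix vector_transpose_matrix transpose_transpose)
  finally show ?thesis by (simp add: Jz y_def)
qed

lemma symmetric_form_polarize:
  fixes A B :: "real ^ 'n::finite ^ 'n"
  assumes A: "transpose A = A" and B: "transpose B = B"
    and q: "\<And>v. v \<bullet> (A *v v) = v \<bullet> (B *v v)"
  shows "A = B"
proof -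
  have "u \<bullet> (A *v v) = u \<bullet> (B *v v)" for u v
  proof -
    have sym: "v \<bullet> (M *v u) = u \<bullet> (M *v v)" if "transpose M = M" for M :: "real ^ 'n ^ 'n"
      by (metis dot_lmul_matrix inner_commute that transpose_matrix_vector)
    have "(u + v) \<bullet> (A *v (u + v)) = (u + v) \<bullet> (B *v (u + v))" by (rule q)
    thus ?thesis
      using q[of u] q[of v] sym[OF A] sym[OF B]
      by (simp add: matrix_vector_right_distrib inner_add_left inner_add_right)
  qed
  hence "A *v v = B *v v" for v by (metis vector_eq_ldot)
  thus ?thesis by (simp add: matrix_eq)
qed

text \<open>The form has eigenvalue 1 on \<open>e\<close> and s^2 on its orthogonal complement. The
  determinant is read off after an orthogonal change of basis that takes an axis to
  \<open>e\<close>; for the inverse, \<open>P\<close> is recognised as s^2 I + (1 - s^2) e e^T and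
  \<open>P *v z = a\<close> is solved explicitly.\<close>

lemma polar_form_inverse:
  fixes P :: "real ^ 'n::finite ^ 'n"
  assumes P: "transpose P = P" and e: "norm e = 1" and s: "s \<noteq> 0"
    and q: "\<And>v. v \<bullet> (P *v v) = (v \<bullet> e)\<^sup>2 + s\<^sup>2 * ((norm v)\<^sup>2 - (v \<bullet> e)\<^sup>2)"
  shows "det P = (s\<^sup>2) ^ (CARD('n) - 1)"
    and "a \<bullet> (matrix_inv P *v a) = (a \<bullet> e)\<^sup>2 + ((norm a)\<^sup>2 - (a \<bullet> e)\<^sup>2) / s\<^sup>2"
proof -
  obtain k :: 'n where True by simp
  obtain Q :: "real ^ 'n ^ 'n" where Q: "orthogonal_matrix Q" "Q *v axis k 1 = e"
    using orthogonal_matrix_exists_basis[OF e, of k] by blast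
  define E where "E = (\<chi> i j. if i = j then (if i = k then 1 else s\<^sup>2) else 0 :: real ^ 'n ^ 'n)"
  have Qinner: "(Q *v u) \<bullet> (Q *v v) = u \<bullet> v" for u v
    using Q(1) by (metis orthogonal_transformation_def orthogonal_transformation_matrix matrix_of_matrix_vector_mul matrix_vector_mul_linear)
  have Ev: "v \<bullet> (E *v v) = (v $ k)\<^sup>2 + s\<^sup>2 * ((norm v)\<^sup>2 - (v $ k)\<^sup>2)" for v
  proof -
    have "(E *v v) $ i = (if i = k then 1 else s\<^sup>2) * v $ i" for i
      by (simp add: matrix_vector_mult_def E_def if_distrib[of "\<lambda>x. x * _"] sum.delta' cong: if_cong)
    moreover have "(norm v)\<^sup>2 = (\<Sum>i\<in>UNIV. (v $ i)\<^sup>2)"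
      unfolding power2_norm_eq_inner inner_vec_def by (simp add: power2_eq_square)
    ultimately have "v \<bullet> (E *v v) = (\<Sum>i\<in>UNIV. (if i = k then (1 - s\<^sup>2) * (v $ i)\<^sup>2 else 0) + s\<^sup>2 * (v $ i)\<^sup>2)"
      by (auto simp: inner_vec_def power2_eq_square algebra_simps intro!: sum.cong)
    also have "\<dots> = (1 - s\<^sup>2) * (v $ k)\<^sup>2 + s\<^sup>2 * (norm v)\<^sup>2"
      by (simp add: sum.distrib sum_distrib_left[symmetric] \<open>(norm v)\<^sup>2 = _\<close>)
    finally show ?thesis by (simp add: algebra_simps)
  qed
  have "transpose Q ** P ** Q = E"
  proof (rule symmetric_form_polarize)
    show "transpose (transpose Q ** P ** Q) = transpose Q ** P ** Q"
      by (simp add: matrix_transpose_mul P matrix_mul_assoc)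
    show "transpose E = E" by (simp add: E_def transpose_def vec_eq_iff)
    fix v
    have "v \<bullet> ((transpose Q ** P ** Q) *v v) = (Q *v v) \<bullet> (P *v (Q *v v))"
      by (metis dot_lmul_matrix matrix_vector_mul_assoc transpose_matrix_vector transpose_transpose)
    also have "\<dots> = ((Q *v v) \<bullet> (Q *v axis k 1))\<^sup>2 + s\<^sup>2 * ((Q *v v) \<bullet> (Q *v v) - ((Q *v v) \<bullet> (Q *v axis k 1))\<^sup>2)"
      by (simp add: q Q power2_norm_eq_inner)
    also have "\<dots> = v \<bullet> (E *v v)"
      unfolding Qinner Ev by (simp add: inner_axis power2_norm_eq_inner)
    finally show "v \<bullet> ((transpose Q ** P ** Q) *v v) = v \<bullet> (E *v v)" .
  qed
  hence "det Q * det P * det Q = det E" by (metis det_mul det_transpose)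
  moreover have "det Q * det Q = 1" using det_orthogonal_matrix[OF Q(1)] by auto
  moreover have "det E = (s\<^sup>2) ^ (CARD('n) - 1)"
  proof -
    have "det E = (\<Prod>i\<in>UNIV. E $ i $ i)" by (rule det_diagonal) (simp add: E_def)
    also have "\<dots> = (\<Prod>i\<in>UNIV - {k}. s\<^sup>2)"
      by (subst prod.remove[of _ k]) (auto simp: E_def)
    finally show ?thesis by simp
  qed
  ultimately show detP: "det P = (s\<^sup>2) ^ (CARD('n) - 1)" by (metis mult.assoc mult.commute mult.right_neutral)
  have iP: "invertible P" using detP s by (simp add: invertible_det_nz)
  define M where "M = s\<^sup>2 *\<^sub>R mat 1 + (\<chi> i j. (1 - s\<^sup>2) * e $ i * e $ j :: real ^ 'n ^ 'n)"
  have Mv: "M *v v = s\<^sup>2 *\<^sub>R v + ((1 - s\<^sup>2) * (e \<bullet> v)) *\<^sub>R e" for v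
    by (simp add: M_def matrix_vector_mult_add_rdistrib scaleR_matrix_vector_assoc[symmetric] vec_eq_iff)
       (simp add: matrix_vector_mult_def inner_vec_def sum_distrib_left sum_distrib_right mult_ac)
  have "P = M"
  proof (rule symmetric_form_polarize[OF P])
    show "transpose M = M" by (simp add: M_def transpose_def vec_eq_iff mat_def)
    show "v \<bullet> (P *v v) = v \<bullet> (M *v v)" for v
      unfolding q Mv power2_norm_eq_inner by (simp add: inner_add_right inner_commute[of e] power2_eq_square algebra_simps)
  qed
  define z where "z = (1 / s\<^sup>2) *\<^sub>R (a - (a \<bullet> e) *\<^sub>R e) + (a \<bullet> e) *\<^sub>R e"
  have ee: "e \<bullet> e = 1" using e by (simp add: dot_square_norm)
  have "e \<bullet> z = a \<bullet> e" by (simp add: z_def inner_add_right inner_diff_right ee inner_commute)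
  hence "P *v z = a" using s by (simp add: \<open>P = M\<close> Mv) (simp add: z_def algebra_simps)
  hence "matrix_inv P *v a = matrix_inv P *v (P *v z)" by simp
  also have "\<dots> = z" using iP by (simp add: matrix_vector_mul_assoc matrix_inv_left)
  finally show "a \<bullet> (matrix_inv P *v a) = (a \<bullet> e)\<^sup>2 + ((norm a)\<^sup>2 - (a \<bullet> e)\<^sup>2) / s\<^sup>2"
    by (simp add: z_def inner_add_right inner_diff_right power2_norm_eq_inner power2_eq_square[of "a \<bullet> e"])
qed

section \<open>Revolution manifolds\<close>

lemma smooth_on_continuous_on: "smooth_on f U \<Longrightarrow> continuous_on U f"
  unfolding smooth_on_def by (metis Ck_on.simps(1))

lemma smooth_on_differentiable: "smooth_on f U \<Longrightarrow> x \<in> U \<Longrightarrow> f differentiable (at x)"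
  unfolding smooth_on_def by (metis Ck_on.simps(2))

lemma smooth_on_has_derivative:
  "smooth_on f U \<Longrightarrow> x \<in> U \<Longrightarrow> (f has_derivative frechet_derivative f (at x)) (at x)"
  using smooth_on_differentiable frechet_derivative_works by blast

lemma smooth_on_derivative_continuous:
  "smooth_on f U \<Longrightarrow> continuous_on U (\<lambda>x. frechet_derivative f (at x) v)"
  unfolding smooth_on_def by (metis Ck_on.simps)

lemma chart_facts:
  assumes "is_chart c"
  shows "open (fst c)" "open (snd c ` fst c)"
    "p \<in> fst c \<Longrightarrow> inv_into (fst c) (snd c) (snd c p) = p"
    "x \<in> snd c ` fst c \<Longrightarrow> snd c (inv_into (fst c) (snd c) x) = x"
    "x \<in> snd c ` fst c \<Longrightarrow> inv_into (fst c) (snd c) x \<in> fst c"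
    "continuous_on (fst c) (snd c)" "continuous_on (snd c ` fst c) (inv_into (fst c) (snd c))"
    "inj_on (snd c) (fst c)"
proof -
  have h: "homeomorphism (fst c) (snd c ` fst c) (snd c) (inv_into (fst c) (snd c))"
    using assms by (simp add: is_chart_def)
  show "open (fst c)" "open (snd c ` fst c)" using assms by (auto simp: is_chart_def)
  have i: "inv_into (fst c) (snd c) (snd c p) = p" if "p \<in> fst c" for p
    using h that by (auto simp: homeomorphism_def)
  show "p \<in> fst c \<Longrightarrow> inv_into (fst c) (snd c) (snd c p) = p" by (rule i)
  show "x \<in> snd c ` fst c \<Longrightarrow> snd c (inv_into (fst c) (snd c) x) = x" by (rule f_inv_into_f)
  show "x \<in> snd c ` fst c \<Longrightarrow> inv_into (fst c) (snd c) x \<in> fst c" by (rule inv_into_into)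
  show "continuous_on (fst c) (snd c)" "continuous_on (snd c ` fst c) (inv_into (fst c) (snd c))"
    using h by (auto simp: homeomorphism_def)
  show "inj_on (snd c) (fst c)" using i by (rule inj_on_inverseI)
qed

lemma chart_image_open:
  assumes c: "is_chart c" and "open W" "W \<subseteq> fst c"
  shows "open (snd c ` W)"
proof -
  have "snd c ` W = (snd c ` fst c) \<inter> inv_into (fst c) (snd c) -` W"
    using assms chart_facts(3)[OF c] by (auto simp: image_iff)
  thus ?thesis
    using continuous_open_preimage[OF chart_facts(7)[OF c] chart_facts(2)[OF c] assms(2)] by simp
qed

lemma chart_image_borel:
  assumes c: "is_chart c" and B: "B \<in> sets borel" "B \<subseteq> fst c"
  shows "snd c ` B \<in> sets borel"
proof -
  have "snd c ` B = (snd c ` fst c) \<inter> inv_into (fst c) (snd c) -` B"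
    using assms chart_facts(3)[OF c] by (auto simp: image_iff)
  moreover have "inv_into (fst c) (snd c) \<in> borel_measurable (restrict_space borel (snd c ` fst c))"
    by (rule borel_measurable_continuous_on_restrict[OF chart_facts(7)[OF c]])
  from measurable_sets[OF this B(1)]
  have "snd c ` fst c \<inter> inv_into (fst c) (snd c) -` B \<in> sets borel"
    using chart_facts(2)[OF c] by (simp add: space_restrict_space sets_restrict_space_iff Int_commute)
  ultimately show ?thesis by simp
qed

locale revolution =
  fixes \<A> :: "('m::t2_space, 'n::finite) chart set"
    and g :: "('m, 'n) chart \<Rightarrow> real ^ 'n \<Rightarrow> real ^ 'n ^ 'n"
    and N S :: 'm and R :: real and \<theta> :: "real \<Rightarrow> real"
    and \<Phi> :: "'m \<Rightarrow> real \<times> (real ^ 'n)" and vol :: "'m measure"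
  assumes card: "2 \<le> CARD('n)"
    and crm: "closed_revolution_manifold \<A> g N S R \<theta> \<Phi>"
    and riemannian_vol: "riemannian_volume \<A> g vol"
begin

lemma compact_M: "compact (UNIV :: 'm set)"
  and atlas: "smooth_atlas \<A>" and metric: "riemannian_metric \<A> g"
  and NS: "N \<noteq> S" and profile: "revolution_profile R \<theta>" and polar: "polar_isometry \<A> g N S R \<theta> \<Phi>"
  and lim_N: "((\<lambda>p. fst (\<Phi> p)) \<longlongrightarrow> 0) (at N)" and lim_S: "((\<lambda>p. fst (\<Phi> p)) \<longlongrightarrow> R) (at S)"
  using crm by (auto simp: closed_revolution_manifold_def closed_riemannian_manifold_def)

lemma R: "0 < R" using profile by (simp add: revolution_profile_def)

lemma chart: "c \<in> \<A> \<Longrightarrow> is_chart c" using atlas by (auto simp: smooth_atlas_def)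

lemma cover: obtains c where "c \<in> \<A>" "p \<in> fst c"
  using atlas unfolding smooth_atlas_def by (metis UNIV_I UN_E)

lemma bij_\<Phi>: "bij_betw \<Phi> (- {N, S}) ({0<..<R} \<times> sphere 0 1)"
  using polar by (simp add: polar_isometry_def)

lemma \<Phi>_range: "p \<noteq> N \<Longrightarrow> p \<noteq> S \<Longrightarrow> 0 < fst (\<Phi> p) \<and> fst (\<Phi> p) < R \<and> norm (snd (\<Phi> p)) = 1"
  using bij_betwE[OF bij_\<Phi>] by (auto simp: mem_Times_iff)

lemma \<Phi>_smooth: "c \<in> \<A> \<Longrightarrow> smooth_on (local_rep c \<Phi>) (snd c ` (fst c - {N, S}))"
  using polar by (simp add: polar_isometry_def)

lemma open_away: "open (- {N, S})" by (simp add: open_Compl)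

lemma \<Phi>_cont: "continuous_on (- {N, S}) \<Phi>"
proof (intro continuous_at_imp_continuous_on ballI)
  fix p assume p: "p \<in> - {N, S}"
  obtain c where c: "c \<in> \<A>" "p \<in> fst c" by (rule cover)
  note cf = chart_facts[OF chart[OF c(1)]]
  have o: "open (fst c - {N, S})" using cf(1) by (intro open_Diff) auto
  have "continuous_on (fst c - {N, S}) (\<lambda>p. local_rep c \<Phi> (snd c p))"
    by (rule continuous_on_compose2[OF smooth_on_continuous_on[OF \<Phi>_smooth[OF c(1)]]])
       (auto intro: continuous_on_subset[OF cf(6)])
  hence "continuous_on (fst c - {N, S}) \<Phi>"
    by (rule continuous_on_eq) (use cf(3) in \<open>auto simp: local_rep_def\<close>)
  thus "isCont \<Phi> p" using o p c(2) by (auto simp: continuous_on_eq_continuous_at)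
qed

abbreviation rad :: "'m \<Rightarrow> real" where "rad \<equiv> radius N S R \<Phi>"

lemma rad_simps [simp]: "rad N = 0" "rad S = R" "p \<noteq> N \<Longrightarrow> p \<noteq> S \<Longrightarrow> rad p = fst (\<Phi> p)"
  using NS by (auto simp: radius_def)

lemma rad_cont: "continuous_on UNIV rad"
proof (intro continuous_at_imp_continuous_on ballI)
  fix p
  have ev: "\<forall>\<^sub>F q in at p. q \<in> - ({N, S} - {p})"
    by (rule eventually_at_topological[THEN iffD2], rule exI[of _ "- ({N, S} - {p})"]) (intro conjI open_Compl finite_imp_closed; simp)
  show "isCont rad p"
  proof (cases "p = N \<or> p = S")
    case False
    have "isCont (\<lambda>p. fst (\<Phi> p)) p"
      using \<Phi>_cont False open_away by (auto simp: continuous_on_eq_continuous_at intro: continuous_intros)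
    hence "((\<lambda>p. fst (\<Phi> p)) \<longlongrightarrow> rad p) (at p)" using False by (simp add: isCont_def)
    hence "(rad \<longlongrightarrow> rad p) (at p)"
      by (rule Lim_transform_eventually) (use ev in \<open>eventually_elim, use False in auto\<close>)
    thus ?thesis by (simp add: isCont_def)
  next
    case True
    have "\<forall>\<^sub>F q in at p. q \<noteq> p" by (simp add: eventually_at_filter)
    with ev have e2: "\<forall>\<^sub>F q in at p. fst (\<Phi> q) = rad q"
      by eventually_elim (use True in auto)
    have "((\<lambda>p. fst (\<Phi> p)) \<longlongrightarrow> rad p) (at p)" using True lim_N lim_S by auto
    hence "(rad \<longlongrightarrow> rad p) (at p)" by (rule Lim_transform_eventually[OF _ e2])
    thus ?thesis by (simp add: isCont_def)
  qed
qed

lemma rad_range: "0 \<le> rad p" "rad p \<le> R" "rad p = 0 \<longleftrightarrow> p = N" "rad p = R \<longleftrightarrow> p = S"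
  using \<Phi>_range[of p] R NS by (cases "p = N"; cases "p = S"; force)+

text \<open>Polar coordinates as an open set of Euclidean space: \<open>\<Psi>\<close> maps the
  punctured ball onto the manifold without poles and \<open>Y\<close> is its inverse. This replaces
  the product with the sphere by a domain on which derivatives and Lebesgue measure are at
  hand.\<close>

definition PB :: "(real ^ 'n) set" where "PB = {y. 0 < norm y \<and> norm y < R}"

definition \<Psi> :: "real ^ 'n \<Rightarrow> 'm" where "\<Psi> y = inv_into (- {N, S}) \<Phi> (norm y, y /\<^sub>R norm y)"

definition Y :: "'m \<Rightarrow> real ^ 'n" where "Y p = fst (\<Phi> p) *\<^sub>R snd (\<Phi> p)"

lemma open_PB: "open PB"
proof -
  have "PB = norm -` {0<..<R}" by (auto simp: PB_def)
  thus ?thesis by (simp add: open_vimage continuous_on_norm)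
qed

lemma \<Psi>: assumes "y \<in> PB" shows "\<Psi> y \<noteq> N" "\<Psi> y \<noteq> S" "\<Phi> (\<Psi> y) = (norm y, y /\<^sub>R norm y)"
proof -
  have m: "(norm y, y /\<^sub>R norm y) \<in> \<Phi> ` (- {N, S})"
    using bij_betw_imp_surj_on[OF bij_\<Phi>] assms by (auto simp: PB_def)
  show "\<Psi> y \<noteq> N" "\<Psi> y \<noteq> S" using inv_into_into[OF m] by (auto simp: \<Psi>_def)
  show "\<Phi> (\<Psi> y) = (norm y, y /\<^sub>R norm y)" unfolding \<Psi>_def by (rule f_inv_into_f[OF m])
qed

lemma rad_\<Psi>: "y \<in> PB \<Longrightarrow> rad (\<Psi> y) = norm y"
  using \<Psi> by simp

lemma Y_\<Psi>: "y \<in> PB \<Longrightarrow> Y (\<Psi> y) = y"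
  using \<Psi>(3)[of y] by (auto simp: Y_def PB_def)

lemma Y_in_PB: "p \<noteq> N \<Longrightarrow> p \<noteq> S \<Longrightarrow> Y p \<in> PB"
  using \<Phi>_range[of p] by (auto simp: Y_def PB_def)

lemma \<Psi>_Y: assumes "p \<noteq> N" "p \<noteq> S" shows "\<Psi> (Y p) = p"
proof -
  have "(norm (Y p), Y p /\<^sub>R norm (Y p)) = \<Phi> p"
    using \<Phi>_range[OF assms] by (auto simp: Y_def prod_eq_iff)
  thus ?thesis unfolding \<Psi>_def
    using bij_betw_inv_into_left[OF bij_\<Phi>, of p] assms by simp
qed

lemma inj_\<Psi>: "inj_on \<Psi> PB" using Y_\<Psi> by (rule inj_on_inverseI)

text \<open>\<open>polar_isometry\<close> gives smoothness of \<open>\<Psi>\<close> in charts only,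
  on sets whose openness is not known beforehand. Continuity comes from compactness:
  \<open>Y\<close> is a continuous injection on a closed shell \<open>Z\<close> of the compact
  manifold, so its inverse is continuous.\<close>

lemma \<Psi>_cont: "continuous_on PB \<Psi>"
proof (intro continuous_at_imp_continuous_on ballI)
  fix y assume y: "y \<in> PB"
  define a b where "a = norm y / 2" and "b = (norm y + R) / 2"
  have ab: "0 < a" "b < R" "a < norm y" "norm y < b" using y by (auto simp: a_def b_def PB_def)
  define Z where "Z = {p. a \<le> rad p \<and> rad p \<le> b}"
  have "Z = rad -` {a..b}" by (auto simp: Z_def)
  hence "closed Z" using continuous_closed_vimage[of "{a..b}" rad] rad_cont
    by (auto simp: continuous_on_eq_continuous_at)
  hence Z: "compact Z" using compact_Int_closed[OF compact_M, of Z] by simp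
  have Zns: "p \<noteq> N" "p \<noteq> S" if "p \<in> Z" for p using that ab by (auto simp: Z_def)
  have "continuous_on Z Y" unfolding Y_def
    by (intro continuous_intros continuous_on_subset[OF \<Phi>_cont]) (use Zns in auto)
  hence "continuous_on (Y ` Z) \<Psi>" by (rule continuous_on_inv[OF _ Z]) (use \<Psi>_Y Zns in auto)
  moreover have "{y. a < norm y \<and> norm y < b} \<subseteq> Y ` Z"
  proof
    fix z :: "real ^ 'n" assume "z \<in> {y. a < norm y \<and> norm y < b}"
    hence z: "z \<in> PB" "a \<le> norm z" "norm z \<le> b" using ab by (auto simp: PB_def)
    hence "\<Psi> z \<in> Z" by (simp add: Z_def rad_\<Psi>)
    thus "z \<in> Y ` Z" using Y_\<Psi>[OF z(1)] by (metis imageI)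
  qed
  ultimately have c: "continuous_on {y. a < norm y \<and> norm y < b} \<Psi>" by (rule continuous_on_subset)
  have "{y :: real ^ 'n. a < norm y \<and> norm y < b} = norm -` {a<..<b}" by auto
  hence "open {y :: real ^ 'n. a < norm y \<and> norm y < b}" by (simp add: open_vimage continuous_on_norm)
  thus "isCont \<Psi> y" using c ab by (auto simp: continuous_on_eq_continuous_at)
qed

text \<open>Outside a neighbourhood of \<open>N\<close> the radius has a positive lower bound by
  compactness; a smaller \<open>norm y\<close> forces \<open>\<Psi> y\<close> into the
  neighbourhood.\<close>

lemma \<Psi>_tendsto_N:
  assumes w: "continuous_on UNIV (w :: 'm \<Rightarrow> real)"
  shows "((\<lambda>y. if y \<in> PB then w (\<Psi> y) else w N) \<longlongrightarrow> w N) (at 0)"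
proof (rule topological_tendstoI)
  fix V :: "real set" assume V: "open V" "w N \<in> V"
  define U where "U = w -` V"
  have U: "open U" "N \<in> U" using V w by (auto simp: U_def open_vimage)
  obtain \<delta> where \<delta>: "0 < \<delta>" "\<And>p. p \<notin> U \<Longrightarrow> \<delta> \<le> rad p"
  proof (cases "- U = {}")
    case True thus ?thesis using that[of 1] by auto
  next
    case False
    have "compact (- U)" using compact_Int_closed[OF compact_M, of "- U"] U by auto
    then obtain q where q: "q \<in> - U" "\<And>p. p \<in> - U \<Longrightarrow> rad q \<le> rad p"
      using continuous_attains_inf[OF _ False continuous_on_subset[OF rad_cont]] by blast
    have "0 < rad q" using rad_range[of q] q(1) U by (auto simp: less_le)
    thus ?thesis using that[of "rad q"] q by auto
  qed
  have "\<forall>\<^sub>F y in at (0 :: real ^ 'n). norm y < \<delta>"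
    using eventually_at[of "\<lambda>y. norm y < \<delta>" "0 :: real ^ 'n" UNIV] \<delta>(1) by (auto simp: dist_norm)
  thus "\<forall>\<^sub>F y in at 0. (if y \<in> PB then w (\<Psi> y) else w N) \<in> V"
  proof eventually_elim
    case (elim y)
    show ?case
    proof (cases "y \<in> PB")
      case True
      hence "\<Psi> y \<in> U" using \<delta>(2)[of "\<Psi> y"] elim rad_\<Psi>[OF True] by auto
      thus ?thesis using True by (simp add: U_def)
    qed (use V in simp)
  qed
qed

end

lemma linear_functional_inner_axis:
  fixes L :: "real ^ 'n::finite \<Rightarrow> real"
  assumes "linear L"
  shows "L v = (\<chi> i. L (axis i 1)) \<bullet> v"
proof -
  have "L v = L (\<Sum>i\<in>UNIV. v $ i *\<^sub>R axis i 1)"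
    using basis_expansion[of v] by (simp add: scalar_mult_eq_scaleR)
  also have "\<dots> = (\<Sum>i\<in>UNIV. v $ i * L (axis i 1))"
    using assms by (simp add: linear_sum linear_cmul)
  finally show ?thesis by (simp add: inner_vec_def mult.commute)
qed

lemma inner_transpose: "(transpose M *v a) \<bullet> v = a \<bullet> (M *v v)" for M :: "real ^ 'n::finite ^ 'n"
  by (simp add: dot_lmul_matrix)

lemma positive_definite_det_nonzero:
  fixes G :: "real ^ 'n::finite ^ 'n"
  assumes "\<And>v. v \<noteq> 0 \<Longrightarrow> v \<bullet> (G *v v) > 0"
  shows "det G \<noteq> 0"
proof -
  have "inj ((*v) G)"
  proof (rule injI)
    fix x y assume "G *v x = G *v y"
    hence "(x - y) \<bullet> (G *v (x - y)) = 0" by (simp add: matrix_vector_mult_diff_distrib)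
    thus "x = y" using assms[of "x - y"] by force
  qed
  thus ?thesis using det_nz_iff_inj[OF matrix_vector_mul_linear[of G]] by (simp add: matrix_of_matrix_vector_mul)
qed

section \<open>Metric, Jacobian and gradients in polar coordinates\<close>

context revolution begin

text \<open>\<open>T c\<close> is the chart \<open>c\<close> read in the coordinate \<open>y = r \<omega>\<close> of the punctured ball, and \<open>s\<close> is the factor by
  which the metric stretches the directions orthogonal to the ray.\<close>

definition T :: "('m, 'n) chart \<Rightarrow> real ^ 'n \<Rightarrow> real ^ 'n" where "T c y = snd c (\<Psi> y)"

definition U :: "('m, 'n) chart \<Rightarrow> (real ^ 'n) set" where "U c = {y \<in> PB. \<Psi> y \<in> fst c}"

lemma T_smooth: "c \<in> \<A> \<Longrightarrow> smooth_on (T c) (U c)"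
  using polar unfolding polar_isometry_def T_def[abs_def] U_def PB_def \<Psi>_def[abs_def] Let_def
  by (auto simp: conj_assoc)

lemma U_open: assumes "c \<in> \<A>" shows "open (U c)"
proof -
  have "U c = PB \<inter> \<Psi> -` fst c" by (auto simp: U_def)
  thus ?thesis
    using continuous_open_preimage[OF \<Psi>_cont open_PB] chart_facts(1)[OF chart[OF assms]] by simp
qed

lemma U_PB: "y \<in> U c \<Longrightarrow> y \<in> PB" by (simp add: U_def)

lemma T_image: "y \<in> U c \<Longrightarrow> T c y \<in> snd c ` (fst c - {N, S})"
  using \<Psi> by (auto simp: U_def T_def)

lemma local_rep_T: "c \<in> \<A> \<Longrightarrow> y \<in> U c \<Longrightarrow> local_rep c w (T c y) = w (\<Psi> y)"
  using chart_facts(3)[OF chart] by (auto simp: U_def T_def local_rep_def)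

abbreviation s :: "real ^ 'n \<Rightarrow> real" where "s y \<equiv> \<theta> (norm y) / norm y"

lemma \<theta>_pos: "0 < r \<Longrightarrow> r < R \<Longrightarrow> 0 < \<theta> r"
  using profile by (auto simp: revolution_profile_def)

lemma s_pos: "y \<in> PB \<Longrightarrow> 0 < s y"
  using \<theta>_pos by (simp add: PB_def)

lemma T_deriv: "c \<in> \<A> \<Longrightarrow> y \<in> U c \<Longrightarrow> (T c has_derivative frechet_derivative (T c) (at y)) (at y)"
  by (rule smooth_on_has_derivative[OF T_smooth])

lemma jacobian_mult:
  assumes "c \<in> \<A>" "y \<in> U c"
  shows "matrix (frechet_derivative (T c) (at y)) *v v = frechet_derivative (T c) (at y) v"
  using has_derivative_linear[OF T_deriv[OF assms]] by (simp add: matrix_works linear_matrix_vector_mul_eq)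

lemma metric_symmetric: "c \<in> \<A> \<Longrightarrow> x \<in> snd c ` fst c \<Longrightarrow> transpose (g c x) = g c x"
  and metric_positive: "c \<in> \<A> \<Longrightarrow> x \<in> snd c ` fst c \<Longrightarrow> v \<noteq> 0 \<Longrightarrow> v \<bullet> (g c x *v v) > 0"
  and metric_smooth: "c \<in> \<A> \<Longrightarrow> smooth_on (g c) (snd c ` fst c)"
  using metric by (auto simp: riemannian_metric_def)

lemma metric_det: "c \<in> \<A> \<Longrightarrow> x \<in> snd c ` fst c \<Longrightarrow> det (g c x) \<noteq> 0"
  by (rule positive_definite_det_nonzero) (rule metric_positive)

text \<open>\<open>\<Phi>\<close> after \<open>\<Psi>\<close> is
  \<open>y \<mapsto> (norm y, sgn y)\<close>, so the chain rule and the uniqueness of derivatives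
  apply.\<close>

lemma polar_derivative:
  assumes c: "c \<in> \<A>" and y: "y \<in> U c"
  shows "frechet_derivative (local_rep c \<Phi>) (at (T c y)) (frechet_derivative (T c) (at y) v)
    = (v \<bullet> sgn y, (v - (sgn y \<bullet> v) *\<^sub>R sgn y) /\<^sub>R norm y)"
proof -
  have y0: "y \<noteq> 0" using U_PB[OF y] by (auto simp: PB_def)
  have "(local_rep c \<Phi> has_derivative frechet_derivative (local_rep c \<Phi>) (at (T c y))) (at (T c y))"
    by (rule smooth_on_has_derivative[OF \<Phi>_smooth[OF c] T_image[OF y]])
  from has_derivative_compose[OF T_deriv[OF c y] this]
  have 1: "((\<lambda>y. local_rep c \<Phi> (T c y)) has_derivative
     (\<lambda>v. frechet_derivative (local_rep c \<Phi>) (at (T c y)) (frechet_derivative (T c) (at y) v))) (at y)" .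
  have "((\<lambda>y. (norm y, sgn y)) has_derivative (\<lambda>v. (v \<bullet> sgn y, (v - (sgn y \<bullet> v) *\<^sub>R sgn y) /\<^sub>R norm y))) (at y)"
    by (intro has_derivative_Pair has_derivative_norm has_derivative_sgn y0)
  hence 2: "((\<lambda>y. local_rep c \<Phi> (T c y)) has_derivative (\<lambda>v. (v \<bullet> sgn y, (v - (sgn y \<bullet> v) *\<^sub>R sgn y) /\<^sub>R norm y))) (at y)"
    by (rule has_derivative_transform_within_open[OF _ U_open[OF c] y])
       (simp add: local_rep_T[OF c] \<Psi>(3) U_PB[of _ c] sgn_div_norm)
  show ?thesis using has_derivative_unique[OF 1 2] by (simp add: fun_eq_iff)
qed

definition J :: "('m, 'n) chart \<Rightarrow> real ^ 'n \<Rightarrow> real ^ 'n ^ 'n" where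
  "J c y = matrix (frechet_derivative (T c) (at y))"

text \<open>The isometry condition evaluated on the image of \<open>v\<close>. The component of
  \<open>v\<close> orthogonal to the ray is divided by \<open>norm y\<close> in the angular
  derivative, which turns the factor \<theta>^2 into \<open>(s y)\<^sup>2\<close>.\<close>

lemma pullback_metric:
  assumes c: "c \<in> \<A>" and y: "y \<in> U c"
  shows "v \<bullet> ((transpose (J c y) ** g c (T c y) ** J c y) *v v)
    = (v \<bullet> sgn y)\<^sup>2 + (s y)\<^sup>2 * ((norm v)\<^sup>2 - (v \<bullet> sgn y)\<^sup>2)"
proof -
  let ?D = "frechet_derivative (T c) (at y)" and ?x = "T c y"
  have y0: "y \<noteq> 0" using U_PB[OF y] by (auto simp: PB_def)
  have "v \<bullet> ((transpose (J c y) ** g c ?x ** J c y) *v v) = (J c y *v v) \<bullet> (g c ?x *v (J c y *v v))"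
    by (simp add: matrix_vector_mul_assoc[symmetric] inner_commute[of v] inner_transpose inner_commute[of _ "J c y *v v"]
        del: transpose_matrix_vector)
  also have "\<dots> = ?D v \<bullet> (g c ?x *v ?D v)"
    by (simp add: J_def jacobian_mult[OF c y])
  also have "\<dots> = (fst (frechet_derivative (local_rep c \<Phi>) (at ?x) (?D v)))\<^sup>2
      + (\<theta> (fst (local_rep c \<Phi> ?x)))\<^sup>2 * (norm (snd (frechet_derivative (local_rep c \<Phi>) (at ?x) (?D v))))\<^sup>2"
    using polar T_image[OF y] c unfolding polar_isometry_def Let_def by blast
  also have "\<dots> = (v \<bullet> sgn y)\<^sup>2 + (\<theta> (norm y))\<^sup>2 * (norm ((v - (sgn y \<bullet> v) *\<^sub>R sgn y) /\<^sub>R norm y))\<^sup>2"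
    unfolding polar_derivative[OF c y] local_rep_T[OF c y] \<Psi>(3)[OF U_PB[OF y]] by simp
  also have "(norm ((v - (sgn y \<bullet> v) *\<^sub>R sgn y) /\<^sub>R norm y))\<^sup>2 = ((norm v)\<^sup>2 - (v \<bullet> sgn y)\<^sup>2) / (norm y)\<^sup>2"
  proof -
    have e: "sgn y \<bullet> sgn y = 1" using y0 by (simp add: norm_sgn dot_square_norm)
    have "(norm (v - (sgn y \<bullet> v) *\<^sub>R sgn y))\<^sup>2 = (norm v)\<^sup>2 - (v \<bullet> sgn y)\<^sup>2"
      unfolding power2_norm_eq_inner
      by (simp add: inner_diff_left inner_diff_right e inner_commute power2_eq_square)
    thus ?thesis by (simp add: power_mult_distrib divide_inverse power_inverse mult.commute)
  qed
  finally show ?thesis by (simp add: power_divide)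
qed

lemma pullback_symmetric:
  assumes c: "c \<in> \<A>" and y: "y \<in> U c"
  shows "transpose (transpose (J c y) ** g c (T c y) ** J c y) = transpose (J c y) ** g c (T c y) ** J c y"
  using metric_symmetric[OF c, of "T c y"] T_image[OF y] by (auto simp: matrix_transpose_mul matrix_mul_assoc)

text \<open>Determinants of the pulled-back form: the volume density in the coordinate
  \<open>y\<close> is the product of the stretching factors over the directions orthogonal to the
  ray.\<close>

lemma jacobian_det:
  assumes c: "c \<in> \<A>" and y: "y \<in> U c"
  shows "det (J c y) \<noteq> 0" "\<bar>det (J c y)\<bar> * sqrt (det (g c (T c y))) = s y ^ (CARD('n) - 1)"
proof -
  have y0: "norm (sgn y) = 1" using U_PB[OF y] by (auto simp: PB_def norm_sgn)
  note sp = s_pos[OF U_PB[OF y]]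
  have "det (transpose (J c y) ** g c (T c y) ** J c y) = ((s y)\<^sup>2) ^ (CARD('n) - 1)"
    by (rule polar_form_inverse(1)[OF pullback_symmetric[OF c y] y0 less_imp_neq[OF sp, symmetric] pullback_metric[OF c y]])
  hence d: "(det (J c y))\<^sup>2 * det (g c (T c y)) = ((s y)\<^sup>2) ^ (CARD('n) - 1)"
    by (simp add: det_mul det_transpose power2_eq_square mult_ac)
  thus "det (J c y) \<noteq> 0" using sp by auto
  have "\<bar>det (J c y)\<bar> * sqrt (det (g c (T c y))) = sqrt ((det (J c y))\<^sup>2 * det (g c (T c y)))"
    by (simp add: real_sqrt_mult)
  also have "\<dots> = sqrt ((s y ^ (CARD('n) - 1))\<^sup>2)" unfolding d by (simp add: power_mult[symmetric] mult.commute)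
  also have "\<dots> = s y ^ (CARD('n) - 1)" using sp by simp
  finally show "\<bar>det (J c y)\<bar> * sqrt (det (g c (T c y))) = s y ^ (CARD('n) - 1)" .
qed

text \<open>The default \<open>w N\<close> extends \<open>pull w\<close> continuously to the origin,
  which represents \<open>N\<close>, and preserves bounds on \<open>w\<close>.\<close>

definition pull :: "('m \<Rightarrow> real) \<Rightarrow> real ^ 'n \<Rightarrow> real" where
  "pull w y = (if y \<in> PB then w (\<Psi> y) else w N)"

definition pull_grad :: "('m \<Rightarrow> real) \<Rightarrow> real ^ 'n \<Rightarrow> real ^ 'n" where
  "pull_grad w y = (if y \<in> PB then (\<chi> i. frechet_derivative (pull w) (at y) (axis i 1)) else 0)"

lemma smooth_local_rep: "smooth_fun \<A> w \<Longrightarrow> c \<in> \<A> \<Longrightarrow> smooth_on (local_rep c w) (snd c ` fst c)"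
  by (simp add: smooth_fun_def)

lemma smooth_fun_continuous: assumes w: "smooth_fun \<A> w" shows "continuous_on UNIV w"
proof (intro continuous_at_imp_continuous_on ballI)
  fix p
  obtain c where c: "c \<in> \<A>" "p \<in> fst c" by (rule cover)
  note cf = chart_facts[OF chart[OF c(1)]]
  have "continuous_on (fst c) (\<lambda>p. local_rep c w (snd c p))"
    by (rule continuous_on_compose2[OF smooth_on_continuous_on[OF smooth_local_rep[OF w c(1)]] cf(6)]) auto
  hence "continuous_on (fst c) w"
    by (rule continuous_on_eq) (use cf(3) in \<open>auto simp: local_rep_def\<close>)
  thus "isCont w p" using cf(1) c(2) by (auto simp: continuous_on_eq_continuous_at)
qed

lemma pull_deriv_chart:
  assumes w: "smooth_fun \<A> w" and c: "c \<in> \<A>" and y: "y \<in> U c"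
  shows "(pull w has_derivative
    (\<lambda>v. frechet_derivative (local_rep c w) (at (T c y)) (frechet_derivative (T c) (at y) v))) (at y)"
proof -
  have "T c y \<in> snd c ` fst c" using T_image[OF y] by auto
  from has_derivative_compose[OF T_deriv[OF c y] smooth_on_has_derivative[OF smooth_local_rep[OF w c] this]]
  show ?thesis
    by (rule has_derivative_transform_within_open[OF _ U_open[OF c] y])
       (use U_PB local_rep_T[OF c] in \<open>auto simp: pull_def\<close>)
qed

lemma U_cover: assumes "y \<in> PB" obtains c where "c \<in> \<A>" "y \<in> U c"
proof -
  obtain c where "c \<in> \<A>" "\<Psi> y \<in> fst c" by (rule cover)
  thus ?thesis using that assms by (auto simp: U_def)
qed

lemma pull_has_derivative:
  assumes w: "smooth_fun \<A> w" and y: "y \<in> PB"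
  shows "(pull w has_derivative (\<lambda>v. pull_grad w y \<bullet> v)) (at y)"
proof -
  obtain c where c: "c \<in> \<A>" "y \<in> U c" by (rule U_cover[OF y])
  have d: "(pull w has_derivative frechet_derivative (pull w) (at y)) (at y)"
    by (rule frechet_derivative_works[THEN iffD1, OF differentiableI[OF pull_deriv_chart[OF w c]]])
  have "frechet_derivative (pull w) (at y) v = pull_grad w y \<bullet> v" for v
    using linear_functional_inner_axis[OF has_derivative_linear[OF d], of v] y by (simp add: pull_grad_def)
  hence "frechet_derivative (pull w) (at y) = (\<lambda>v. pull_grad w y \<bullet> v)" by (rule ext)
  with d show ?thesis by simp
qed

definition chart_grad :: "('m, 'n) chart \<Rightarrow> ('m \<Rightarrow> real) \<Rightarrow> real ^ 'n \<Rightarrow> real ^ 'n" where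
  "chart_grad c w x = (\<chi> i. frechet_derivative (local_rep c w) (at x) (axis i 1))"

lemma chart_grad_inner:
  assumes "smooth_fun \<A> w" "c \<in> \<A>" "x \<in> snd c ` fst c"
  shows "frechet_derivative (local_rep c w) (at x) v = chart_grad c w x \<bullet> v"
  unfolding chart_grad_def
  by (rule linear_functional_inner_axis[OF has_derivative_linear[OF smooth_on_has_derivative[OF smooth_local_rep]]])
     (use assms in auto)

lemma pull_grad_chart:
  assumes w: "smooth_fun \<A> w" and c: "c \<in> \<A>" and y: "y \<in> U c"
  shows "pull_grad w y = transpose (J c y) *v chart_grad c w (T c y)"
proof -
  have x: "T c y \<in> snd c ` fst c" using T_image[OF y] by auto
  have "pull_grad w y \<bullet> v = (transpose (J c y) *v chart_grad c w (T c y)) \<bullet> v" for v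
  proof -
    have "pull_grad w y \<bullet> v = frechet_derivative (local_rep c w) (at (T c y)) (frechet_derivative (T c) (at y) v)"
      by (rule fun_cong[OF has_derivative_unique[OF pull_has_derivative[OF w U_PB[OF y]] pull_deriv_chart[OF w c y]]])
    also have "\<dots> = chart_grad c w (T c y) \<bullet> (J c y *v v)"
      unfolding chart_grad_inner[OF w c x] J_def jacobian_mult[OF c y] ..
    finally show ?thesis unfolding inner_transpose .
  qed
  thus ?thesis by (rule vector_eq_rdot[THEN iffD1, OF allI])
qed

lemma pull_grad_continuous:
  assumes w: "smooth_fun \<A> w"
  shows "continuous_on PB (pull_grad w)"
proof (intro continuous_at_imp_continuous_on ballI)
  fix y assume "y \<in> PB"
  then obtain c where c: "c \<in> \<A>" "y \<in> U c" by (rule U_cover)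
  have Tc: "continuous_on (U c) (T c)" by (rule smooth_on_continuous_on[OF T_smooth[OF c(1)]])
  have "continuous_on (U c) (\<lambda>y. \<chi> i. chart_grad c w (T c y) \<bullet> frechet_derivative (T c) (at y) (axis i 1))"
  proof (intro continuous_on_vec_lambda continuous_on_inner)
    show "continuous_on (U c) (\<lambda>y. frechet_derivative (T c) (at y) (axis i 1))" for i
      by (rule smooth_on_derivative_continuous[OF T_smooth[OF c(1)]])
    have "continuous_on (snd c ` fst c) (chart_grad c w)"
      unfolding chart_grad_def[abs_def]
      by (intro continuous_on_vec_lambda smooth_on_derivative_continuous[OF smooth_local_rep[OF w c(1)]])
    thus "continuous_on (U c) (\<lambda>y. chart_grad c w (T c y))"
      by (rule continuous_on_compose2[OF _ Tc]) (blast dest: T_image)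
  qed
  hence "continuous_on (U c) (pull_grad w)"
  proof (rule continuous_on_eq)
    fix z assume z: "z \<in> U c"
    show "(\<chi> i. chart_grad c w (T c z) \<bullet> frechet_derivative (T c) (at z) (axis i 1)) = pull_grad w z"
    proof (rule vec_eq_iff[THEN iffD2], rule allI)
      fix i
      have "pull_grad w z $ i = pull_grad w z \<bullet> axis i 1" by (simp add: inner_axis)
      also have "\<dots> = chart_grad c w (T c z) \<bullet> (J c z *v axis i 1)"
        unfolding pull_grad_chart[OF w c(1) z] inner_transpose ..
      finally have "pull_grad w z $ i = chart_grad c w (T c z) \<bullet> frechet_derivative (T c) (at z) (axis i 1)"
        unfolding J_def jacobian_mult[OF c(1) z] .
      thus "(\<chi> i. chart_grad c w (T c z) \<bullet> frechet_derivative (T c) (at z) (axis i 1)) $ i = pull_grad w z $ i"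
        by simp
    qed
  qed
  thus "isCont (pull_grad w) y" using U_open[OF c(1)] c(2) by (auto simp: continuous_on_eq_continuous_at)
qed

definition sel :: "'m \<Rightarrow> ('m, 'n) chart" where "sel p = (SOME c. c \<in> \<A> \<and> p \<in> fst c)"

lemma sel: "sel p \<in> \<A>" "p \<in> fst (sel p)"
proof -
  obtain c where "c \<in> \<A>" "p \<in> fst c" by (rule cover)
  hence "\<exists>c. c \<in> \<A> \<and> p \<in> fst c" by blast
  from someI_ex[OF this] show "sel p \<in> \<A>" "p \<in> fst (sel p)" by (simp_all add: sel_def)
qed

lemma grad_sq_eq: "grad_sq \<A> g w p = chart_grad (sel p) w (snd (sel p) p)
    \<bullet> (matrix_inv (g (sel p) (snd (sel p) p)) *v chart_grad (sel p) w (snd (sel p) p))"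
  unfolding grad_sq_def Let_def sel_def chart_grad_def ..

text \<open>The chart chosen by \<open>grad_sq\<close> disappears because the dual norm of a
  gradient is invariant under the change of coordinates \<open>T\<close>.\<close>

lemma grad_sq_polar:
  assumes w: "smooth_fun \<A> w" and y: "y \<in> PB"
  shows "grad_sq \<A> g w (\<Psi> y)
    = (pull_grad w y \<bullet> sgn y)\<^sup>2 + ((norm (pull_grad w y))\<^sup>2 - (pull_grad w y \<bullet> sgn y)\<^sup>2) / (s y)\<^sup>2"
proof -
  let ?c = "sel (\<Psi> y)"
  have c: "?c \<in> \<A>" and yU: "y \<in> U ?c" using sel[of "\<Psi> y"] y by (auto simp: U_def)
  have x: "T ?c y \<in> snd ?c ` fst ?c" using T_image[OF yU] by auto
  have y0: "norm (sgn y) = 1" using y by (auto simp: PB_def norm_sgn)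
  have "grad_sq \<A> g w (\<Psi> y) = pull_grad w y \<bullet>
      (matrix_inv (transpose (J ?c y) ** g ?c (T ?c y) ** J ?c y) *v pull_grad w y)"
    unfolding grad_sq_eq T_def[symmetric]
    by (rule inner_matrix_inv_transform[OF metric_det[OF c x] jacobian_det(1)[OF c yU] pull_grad_chart[OF w c yU] refl])
  also have "\<dots> = (pull_grad w y \<bullet> sgn y)\<^sup>2 + ((norm (pull_grad w y))\<^sup>2 - (pull_grad w y \<bullet> sgn y)\<^sup>2) / (s y)\<^sup>2"
    by (rule polar_form_inverse(2)[OF pullback_symmetric[OF c yU] y0 less_imp_neq[OF s_pos[OF y], symmetric] pullback_metric[OF c yU]])
  finally show ?thesis .
qed

text \<open>The chart selected in \<open>grad_sq\<close> may change from point to point; continuity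
  of \<open>grad_sq\<close> requires its value in one fixed chart, which the transformation law
  provides.\<close>

lemma grad_sq_chart:
  assumes w: "smooth_fun \<A> w" and d: "d \<in> \<A>" "p \<in> fst d"
  shows "grad_sq \<A> g w p = chart_grad d w (snd d p) \<bullet> (matrix_inv (g d (snd d p)) *v chart_grad d w (snd d p))"
proof -
  let ?c = "sel p"
  have c: "?c \<in> \<A>" "p \<in> fst ?c" by (rule sel)+
  let ?\<tau> = "local_rep ?c (snd d)" and ?x = "snd ?c p"
  have tr: "smooth_on ?\<tau> (snd ?c ` (fst ?c \<inter> fst d))" using atlas c d by (auto simp: smooth_atlas_def)
  have x: "?x \<in> snd ?c ` (fst ?c \<inter> fst d)" using c d by auto
  have \<tau>x: "?\<tau> ?x = snd d p" using chart_facts(3)[OF chart[OF c(1)] c(2)] by (simp add: local_rep_def)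
  let ?D = "frechet_derivative ?\<tau> (at ?x)"
  have D: "(?\<tau> has_derivative ?D) (at ?x)" by (rule smooth_on_has_derivative[OF tr x])
  let ?M = "matrix ?D"
  have Mv: "?M *v v = ?D v" for v
    using has_derivative_linear[OF D] by (simp add: matrix_works linear_matrix_vector_mul_eq)
  have gM: "g ?c ?x = transpose ?M ** g d (snd d p) ** ?M"
  proof -
    have "\<forall>x\<in>snd ?c ` (fst ?c \<inter> fst d). g ?c x
        = transpose (matrix (frechet_derivative ?\<tau> (at x))) ** g d (?\<tau> x) ** matrix (frechet_derivative ?\<tau> (at x))"
      using metric c(1) d(1) unfolding riemannian_metric_def Let_def by blast
    from bspec[OF this x] show ?thesis unfolding \<tau>x .
  qed
  have xc: "?x \<in> snd ?c ` fst ?c" "snd d p \<in> snd d ` fst d" using c d by auto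
  have detM: "det ?M \<noteq> 0" using metric_det[OF c(1) xc(1)] gM by (auto simp: det_mul)
  have "(local_rep d w has_derivative frechet_derivative (local_rep d w) (at (snd d p))) (at (?\<tau> ?x))"
    unfolding \<tau>x by (rule smooth_on_has_derivative[OF smooth_local_rep[OF w d(1)] xc(2)])
  from has_derivative_compose[OF D this]
  have "((\<lambda>x. local_rep d w (?\<tau> x)) has_derivative (\<lambda>v. frechet_derivative (local_rep d w) (at (snd d p)) (?D v))) (at ?x)" .
  hence 1: "(local_rep ?c w has_derivative (\<lambda>v. frechet_derivative (local_rep d w) (at (snd d p)) (?D v))) (at ?x)"
  proof (rule has_derivative_transform_within_open[OF _ _ x])
    show "open (snd ?c ` (fst ?c \<inter> fst d))"
      using chart_facts(1)[OF chart] c d by (intro chart_image_open chart open_Int) auto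
    fix z assume "z \<in> snd ?c ` (fst ?c \<inter> fst d)"
    thus "local_rep d w (?\<tau> z) = local_rep ?c w z"
      using chart_facts(3)[OF chart[OF c(1)]] chart_facts(3)[OF chart[OF d(1)]] by (auto simp: local_rep_def)
  qed
  have 2: "(local_rep ?c w has_derivative frechet_derivative (local_rep ?c w) (at ?x)) (at ?x)"
    by (rule smooth_on_has_derivative[OF smooth_local_rep[OF w c(1)] xc(1)])
  have "chart_grad ?c w ?x \<bullet> v = (transpose ?M *v chart_grad d w (snd d p)) \<bullet> v" for v
  proof -
    have "chart_grad ?c w ?x \<bullet> v = chart_grad d w (snd d p) \<bullet> (?M *v v)"
      using fun_cong[OF has_derivative_unique[OF 2 1], of v]
      unfolding chart_grad_inner[OF w c(1) xc(1)] chart_grad_inner[OF w d(1) xc(2)] Mv .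
    thus ?thesis unfolding inner_transpose .
  qed
  hence "chart_grad ?c w ?x = transpose ?M *v chart_grad d w (snd d p)"
    by (rule vector_eq_rdot[THEN iffD1, OF allI])
  from inner_matrix_inv_transform[OF metric_det[OF d(1) xc(2)] detM this gM]
  show ?thesis unfolding grad_sq_eq by simp
qed

end

section \<open>Integration in polar coordinates\<close>

lemma integral_polar:
  fixes H :: "'a::euclidean_space \<Rightarrow> real"
  assumes H: "integrable lborel H"
  shows "(\<integral>y. H y \<partial>lborel) = (\<integral>r. (indicator {0<..} r * (unit_ball_volume TYPE('a) * (DIM('a) * r ^ (DIM('a) - 1))))
      * (\<integral>\<omega>. H (r *\<^sub>R \<omega>) \<partial>sphere_measure) \<partial>lborel)"
proof -
  let ?\<rho> = "radial_lebesgue TYPE('a)" and ?\<nu> = "sphere_measure :: 'a measure"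
  interpret \<nu>: prob_space ?\<nu> by (rule prob_space_sphere_measure)
  interpret \<rho>: sigma_finite_measure ?\<rho> by (rule sigma_finite_radial_lebesgue)
  interpret P: pair_sigma_finite ?\<rho> ?\<nu> ..
  have Hm [measurable]: "H \<in> borel_measurable borel" using borel_measurable_integrable[OF H] by simp
  define H' where "H' = (\<lambda>x :: real \<times> 'a. H (fst x *\<^sub>R snd x))"
  have H'm [measurable]: "H' \<in> borel_measurable (borel \<Otimes>\<^sub>M borel)" unfolding H'_def by measurable
  have e: "H y = H' (norm y, sgn y)" for y
    by (cases "y = 0") (simp_all add: H'_def sgn_div_norm)
  have pm: "(\<lambda>y :: 'a. (norm y, sgn y)) \<in> lborel \<rightarrow>\<^sub>M borel \<Otimes>\<^sub>M borel" by measurable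
  have iP: "integrable (?\<rho> \<Otimes>\<^sub>M ?\<nu>) H'"
    unfolding polar_measure[symmetric] integrable_distr_eq[OF pm H'm] e[symmetric] by (rule H)
  have "(\<integral>y. H y \<partial>lborel) = (\<integral>y. H' (norm y, sgn y) \<partial>lborel)" by (simp only: e)
  also have "\<dots> = (\<integral>x. H' x \<partial>(?\<rho> \<Otimes>\<^sub>M ?\<nu>))"
    unfolding polar_measure[symmetric] by (rule integral_distr[OF pm H'm, symmetric])
  also have "\<dots> = (\<integral>r. \<integral>\<omega>. H' (r, \<omega>) \<partial>?\<nu> \<partial>?\<rho>)" by (rule P.integral_fst'[OF iP, symmetric])
  also have "\<dots> = (\<integral>r. (indicator {0<..} r * (unit_ball_volume TYPE('a) * (DIM('a) * r ^ (DIM('a) - 1))))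
      * (\<integral>\<omega>. H (r *\<^sub>R \<omega>) \<partial>sphere_measure) \<partial>lborel)"
    unfolding radial_lebesgue_def
  proof (subst integral_density)
    show "(\<lambda>r. \<integral>\<omega>. H' (r, \<omega>) \<partial>?\<nu>) \<in> borel_measurable lborel" by measurable
    show "AE r in lborel. 0 \<le> indicator {0<..} r * (unit_ball_volume TYPE('a) * (DIM('a) * r ^ (DIM('a) - 1)))"
      using unit_ball_volume_pos[where 'a = 'a] by (auto simp: indicator_def)
  qed (simp_all add: H'_def)
  finally show ?thesis .
qed

definition sphere_area :: "'a::euclidean_space itself \<Rightarrow> real"
  where "sphere_area _ = unit_ball_volume TYPE('a) * DIM('a)"

lemma emeasure_Diff_Int:
  assumes "A \<in> sets M" "B \<in> sets M"
  shows "emeasure M B = emeasure M (B - A) + emeasure M (B \<inter> A)"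
proof -
  have "(B - A) \<union> (B \<inter> A) = B" by blast
  moreover have "(B - A) \<inter> (B \<inter> A) = {}" by blast
  ultimately show ?thesis using plus_emeasure[of "B - A" M "B \<inter> A"] assms by simp
qed

lemma continuous_on_det:
  fixes A :: "'a::topological_space \<Rightarrow> real ^ 'n::finite ^ 'n"
  assumes "\<And>i j. continuous_on S (\<lambda>x. A x $ i $ j)"
  shows "continuous_on S (\<lambda>x. det (A x))"
  unfolding det_def by (intro continuous_intros assms)

text \<open>Cramer's rule expresses the solution through quotients of determinants, which are
  polynomials in the entries.\<close>

lemma continuous_on_matrix_inv_mult:
  fixes A :: "'a::topological_space \<Rightarrow> real ^ 'n::finite ^ 'n"
  assumes A: "continuous_on S A" and b: "continuous_on S b" and d: "\<And>x. x \<in> S \<Longrightarrow> det (A x) \<noteq> 0"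
  shows "continuous_on S (\<lambda>x. matrix_inv (A x) *v b x)"
proof (rule continuous_on_eq)
  show "continuous_on S (\<lambda>x. \<chi> k. det (\<chi> i j. if j = k then b x $ i else A x $ i $ j) / det (A x))"
  proof (intro continuous_on_vec_lambda continuous_on_divide continuous_on_det)
    show "continuous_on S (\<lambda>x. (\<chi> i j. if j = k then b x $ i else A x $ i $ j) $ i $ j)" for i j k
      by (cases "j = k") (simp_all add: continuous_on_component A b)
    show "continuous_on S (\<lambda>x. A x $ i $ j)" for i j by (intro continuous_on_component A)
  qed (use d in auto)
  fix x assume x: "x \<in> S"
  have "A x *v (matrix_inv (A x) *v b x) = b x"
    using matrix_inv_right[of "A x"] d[OF x] by (simp add: matrix_vector_mul_assoc invertible_det_nz)
  thus "(\<chi> k. det (\<chi> i j. if j = k then b x $ i else A x $ i $ j) / det (A x)) = matrix_inv (A x) *v b x"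
    using cramer[OF d[OF x], of "matrix_inv (A x) *v b x" "b x"] by simp
qed

section \<open>The Riemannian volume in polar coordinates\<close>

context revolution begin

definition profile_derivative :: "nat \<Rightarrow> real \<Rightarrow> real" where
  "profile_derivative = (SOME d. profile R \<theta> d)"

sublocale P: profile R \<theta> profile_derivative
proof -
  from profile obtain D where D: "0 < R" "\<forall>r\<in>{0<..<R}. 0 < \<theta> r" "\<theta> 0 = 0" "\<theta> R = 0" "D 0 = \<theta>"
      "\<forall>k. \<forall>r\<in>{0..R}. (D k has_real_derivative D (Suc k) r) (at r within {0..R})"
      "D 1 0 = 1" "D 1 R = - 1" "D 2 0 = 0" "D 2 R = 0"
    unfolding revolution_profile_def by (elim conjE exE)
  have "profile R \<theta> D"
  proof
    show "(D k has_real_derivative D (Suc k) r) (at r within {0..R})" if "r \<in> {0..R}" for k r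
      using D(6) that by blast
    show "0 < \<theta> r" if "0 < r" "r < R" for r using D(2) that by simp
  qed (fact D)+
  hence "\<exists>d. profile R \<theta> d" by (rule exI[where x = D])
  thus "profile R \<theta> profile_derivative" unfolding profile_derivative_def by (rule someI_ex)
qed

text \<open>A total Borel version of \<open>\<Psi>\<close>, along which measures can be pushed
  forward.\<close>

definition \<Theta> :: "real ^ 'n \<Rightarrow> 'm" where "\<Theta> y = (if y \<in> PB then \<Psi> y else N)"

lemma \<Theta>_measurable [measurable]: "\<Theta> \<in> borel_measurable borel"
  unfolding \<Theta>_def[abs_def]
  using borel_measurable_continuous_on_if[OF borel_open[OF open_PB] \<Psi>_cont continuous_on_const] .

text \<open>By \<open>jacobian_det\<close>, the density of the Riemannian volume in the coordinate
  \<open>y\<close>.\<close>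

definition vol_factor :: "real ^ 'n \<Rightarrow> real" where "vol_factor y = (if y \<in> PB then s y ^ (CARD('n) - 1) else 0)"

lemma vol_factor_nonneg: "0 \<le> vol_factor y"
  using s_pos by (auto simp: vol_factor_def less_imp_le)

lemma vol_factor_measurable [measurable]: "vol_factor \<in> borel_measurable borel"
  unfolding vol_factor_def[abs_def]
proof (rule borel_measurable_continuous_on_if[OF borel_open[OF open_PB]])
  show "continuous_on PB (\<lambda>y. s y ^ (CARD('n) - 1))"
    by (intro continuous_intros continuous_on_compose2[OF P.\<theta>_cont]) (auto simp: PB_def)
qed auto

lemma vol_factor_bounded: obtains B where "0 \<le> B" "\<And>y. vol_factor y \<le> B"
proof -
  have "bounded (profile_derivative 1 ` {0..R})"
    by (intro compact_imp_bounded compact_continuous_image P.d_cont) auto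
  then obtain D where D: "\<And>r. r \<in> {0..R} \<Longrightarrow> \<bar>profile_derivative 1 r\<bar> \<le> D"
    unfolding bounded_iff real_norm_def by (meson imageI)
  have D0: "0 \<le> D" using D[of 0] R by fastforce
  show ?thesis
  proof (rule that[of "D ^ (CARD('n) - 1)"])
    show "vol_factor y \<le> D ^ (CARD('n) - 1)" for y
    proof (cases "y \<in> PB")
      case True
      hence y: "0 < norm y" "norm y < R" by (auto simp: PB_def)
      obtain z where z: "0 < z" "z < norm y" "\<theta> (norm y) - \<theta> 0 = (norm y - 0) * profile_derivative 1 z"
        by (rule P.\<theta>_mvt[of 0 "norm y"]) (use y in auto)
      have "s y = profile_derivative 1 z" using z(3) y P.ends(1) by (simp add: field_simps)
      hence "s y \<le> D" using D[of z] z y by simp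
      thus ?thesis using True s_pos[OF True] by (simp add: vol_factor_def power_mono)
    qed (simp add: vol_factor_def D0)
  qed (simp add: D0)
qed

lemma bounded_on_ball_integrable:
  fixes H :: "real ^ 'n \<Rightarrow> real"
  assumes [measurable]: "H \<in> borel_measurable borel" and b: "\<And>y. \<bar>H y\<bar> \<le> B" and z: "\<And>y. y \<notin> PB \<Longrightarrow> H y = 0"
  shows "integrable lborel H"
proof (rule Bochner_Integration.integrable_bound)
  show "integrable lborel (\<lambda>y :: real ^ 'n. indicator (cball 0 R) y * B)"
    using emeasure_lborel_cball_finite[of "0 :: real ^ 'n" R]
    by (intro integrable_mult_left) (simp add: integrable_indicator_iff)
  have "norm (H y) \<le> norm (indicator (cball 0 R) y * B)" for y
    using b[of y] z[of y] by (auto simp: indicator_def PB_def)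
  thus "AE y in lborel. norm (H y) \<le> norm (indicator (cball 0 R) y * B)" by simp
qed measurable

lemma \<Theta>_preimage: "{y \<in> PB. \<Psi> y \<in> B} = PB \<inter> \<Theta> -` B"
  by (auto simp: \<Theta>_def)

text \<open>Change of variables along \<open>T c\<close>, which maps the part \<open>Q\<close> of
  the ball lying over \<open>B\<close> bijectively to the chart image of \<open>B\<close>. The poles
  are excluded since \<open>\<Psi>\<close> does not reach them.\<close>

lemma vol_chart:
  assumes c: "c \<in> \<A>" and B: "B \<in> sets borel" "B \<subseteq> fst c" "N \<notin> B" "S \<notin> B"
  shows "emeasure vol B = (\<integral>\<^sup>+y. ennreal (vol_factor y) * indicator (\<Theta> -` B) y \<partial>lborel)"
proof -
  define Q where "Q = {y \<in> PB. \<Psi> y \<in> B}"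
  have Q: "Q \<in> sets borel"
    using measurable_sets_borel[OF \<Theta>_measurable B(1)] borel_open[OF open_PB] by (simp add: Q_def \<Theta>_preimage sets.Int)
  have QU: "y \<in> U c" "y \<in> PB" if "y \<in> Q" for y using that B(2) by (auto simp: Q_def U_def)
  have TQ: "T c ` Q = snd c ` B"
  proof (intro equalityI subsetI)
    fix x assume "x \<in> snd c ` B"
    then obtain p where p: "p \<in> B" "x = snd c p" by auto
    have "p \<noteq> N" "p \<noteq> S" using p(1) B by auto
    hence "Y p \<in> Q" "T c (Y p) = x" using p \<Psi>_Y Y_in_PB by (auto simp: Q_def T_def)
    thus "x \<in> T c ` Q" by auto
  qed (auto simp: T_def Q_def)
  have inj: "inj_on (T c) Q"
  proof (rule inj_onI)
    fix x y assume xy: "x \<in> Q" "y \<in> Q" "T c x = T c y"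
    hence "\<Psi> x = \<Psi> y"
      using inj_onD[OF chart_facts(8)[OF chart[OF c]], of "\<Psi> x" "\<Psi> y"] QU by (auto simp: T_def U_def)
    thus "x = y" using inj_onD[OF inj_\<Psi>] xy QU by blast
  qed
  let ?\<phi> = "\<lambda>x. sqrt (det (g c x))"
  have cd: "continuous_on (snd c ` fst c) ?\<phi>"
    by (intro continuous_on_real_sqrt continuous_on_det continuous_on_component smooth_on_continuous_on[OF metric_smooth[OF c]])
  have [measurable]: "(\<lambda>x. if x \<in> snd c ` fst c then ?\<phi> x else 0) \<in> borel_measurable borel"
    by (rule borel_measurable_continuous_on_if[OF borel_open[OF chart_facts(2)[OF chart[OF c]]] cd]) auto
  have [measurable]: "snd c ` B \<in> sets borel" by (rule chart_image_borel[OF chart[OF c] B(1,2)])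
  have "emeasure vol B = (\<integral>\<^sup>+x. ennreal (?\<phi> x) * indicator (snd c ` B) x \<partial>lborel)"
    using riemannian_vol B c by (simp add: riemannian_volume_def)
  also have "\<dots> = (\<integral>\<^sup>+x. ennreal (?\<phi> x) * indicator (T c ` Q) x \<partial>lborel)" unfolding TQ ..
  also have "\<dots> = (\<integral>\<^sup>+x. ennreal (vol_factor x) * indicator Q x \<partial>lborel)"
  proof (rule nn_integral_change_of_variables[OF Q _ inj])
    show "(T c has_derivative frechet_derivative (T c) (at x)) (at x within Q)" if "x \<in> Q" for x
      using T_deriv[OF c QU(1)[OF that]] by (rule has_derivative_at_withinI)
    have "(\<lambda>x. ennreal (?\<phi> x) * indicator (T c ` Q) x)
        = (\<lambda>x. ennreal (if x \<in> snd c ` fst c then ?\<phi> x else 0) * indicator (snd c ` B) x)"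
      unfolding TQ using B(2) by (auto simp: indicator_def fun_eq_iff)
    also have "\<dots> \<in> borel_measurable borel" by measurable
    finally show "(\<lambda>x. ennreal (?\<phi> x) * indicator (T c ` Q) x) \<in> borel_measurable borel" .
    show "\<bar>det (matrix (frechet_derivative (T c) (at x)))\<bar> * ?\<phi> (T c x) = vol_factor x" if "x \<in> Q" for x
      using jacobian_det(2)[OF c QU(1)[OF that]] QU(2)[OF that] by (simp add: J_def vol_factor_def)
    \<comment> \<open>\<open>sqrt\<close> is an odd function on the reals, so the sign has to be
      proved; it is inherited from the positive right side of \<open>jacobian_det\<close>.\<close>
    show "0 \<le> ?\<phi> (T c x)" if "x \<in> Q" for x
    proof -
      have "0 < \<bar>det (J c x)\<bar>" using jacobian_det(1)[OF c QU(1)[OF that]] by simp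
      moreover have "0 \<le> \<bar>det (J c x)\<bar> * ?\<phi> (T c x)"
        unfolding jacobian_det(2)[OF c QU(1)[OF that]] using s_pos[OF QU(2)[OF that]] by simp
      ultimately show ?thesis by (simp only: zero_le_mult_iff) auto
    qed
    obtain C where C: "0 \<le> C" "\<And>y. vol_factor y \<le> C" by (rule vol_factor_bounded, rule that)
    have "(\<lambda>x. indicator Q x *\<^sub>R vol_factor x) \<in> borel_measurable borel" using Q by measurable
    thus "integrable lborel (\<lambda>x. indicator Q x *\<^sub>R vol_factor x)"
    proof (rule bounded_on_ball_integrable)
      show "\<bar>indicator Q y *\<^sub>R vol_factor y\<bar> \<le> C" for y
        using C vol_factor_nonneg[of y] by (auto simp: indicator_def)
    qed (auto simp: indicator_def Q_def)
  qed
  also have "\<dots> = (\<integral>\<^sup>+y. ennreal (vol_factor y) * indicator (\<Theta> -` B) y \<partial>lborel)"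
    by (intro nn_integral_cong) (auto simp: Q_def \<Theta>_preimage vol_factor_def indicator_def)
  finally show ?thesis .
qed

lemma sets_vol [measurable_cong, simp]: "sets vol = sets borel"
  using riemannian_vol by (simp add: riemannian_volume_def)

lemma space_vol [simp]: "space vol = UNIV"
  using sets_eq_imp_space_eq[OF sets_vol] by simp

lemma vol_singleton: "emeasure vol {p} = 0"
proof -
  obtain c where c: "c \<in> \<A>" "p \<in> fst c" by (rule cover)
  have "emeasure vol {p} = (\<integral>\<^sup>+x\<in>snd c ` {p}. ennreal (sqrt (det (g c x))) \<partial>lborel)"
    using riemannian_vol c by (auto simp: riemannian_volume_def)
  also have "\<dots> = (\<integral>\<^sup>+x. 0 \<partial>(lborel :: (real ^ 'n) measure))"
  proof (rule nn_integral_cong_AE)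
    have "AE x in (lborel :: (real ^ 'n) measure). x \<noteq> snd c p" by (rule AE_lborel_singleton)
    thus "AE x in lborel. ennreal (sqrt (det (g c x))) * indicator (snd c ` {p}) x = 0"
      by eventually_elim simp
  qed
  finally show ?thesis by simp
qed

definition ball_measure :: "(real ^ 'n) measure" where
  "ball_measure = density lborel (\<lambda>y. ennreal (vol_factor y))"

lemma sets_ball_measure [measurable_cong, simp]: "sets ball_measure = sets borel"
  by (simp add: ball_measure_def)

lemma emeasure_polar_volume:
  "B \<in> sets borel \<Longrightarrow>
    emeasure (distr ball_measure borel \<Theta>) B = (\<integral>\<^sup>+y. ennreal (vol_factor y) * indicator (\<Theta> -` B) y \<partial>lborel)"
  using measurable_sets_borel[OF \<Theta>_measurable]
  by (subst emeasure_distr) (auto simp: ball_measure_def emeasure_density)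

text \<open>\<open>riemannian_volume\<close> prescribes the measure of Borel sets inside single
  charts. Compactness gives finitely many charts, and an induction over them splits an arbitrary
  Borel set into such pieces; the poles are null sets of both measures.\<close>

lemma vol_eq: "vol = distr ball_measure borel \<Theta>"
proof (rule measure_eqI)
  let ?V = "distr ball_measure borel \<Theta>"
  show "sets vol = sets ?V" by simp
  have poles: "emeasure ?V {p} = 0" if "p = N \<or> p = S" for p
  proof -
    have "emeasure ?V {p} = (\<integral>\<^sup>+y. 0 \<partial>(lborel :: (real ^ 'n) measure))"
      unfolding emeasure_polar_volume[OF borel_singleton[OF sets.empty_sets]]
      by (rule nn_integral_cong) (use that \<Psi> in \<open>auto simp: indicator_def \<Theta>_def vol_factor_def\<close>)
    thus ?thesis by simp
  qed
  have single: "emeasure vol B = emeasure ?V B" if c: "c \<in> \<A>" and B: "B \<in> sets borel" "B \<subseteq> fst c" for c B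
  proof -
    have m: "{N, S} \<in> sets borel" by (simp add: borel_closed)
    have n1: "emeasure vol (B \<inter> {N, S}) = 0"
      using vol_singleton null_setsI null_sets.Un[of "{N}" vol "{S}"] emeasure_mono[of "B \<inter> {N,S}" "{N, S}" vol]
      by (auto simp: null_sets_def insert_commute)
    have n2: "emeasure ?V (B \<inter> {N, S}) = 0"
      using poles null_setsI null_sets.Un[of "{N}" ?V "{S}"] emeasure_mono[of "B \<inter> {N,S}" "{N, S}" ?V]
      by (auto simp: null_sets_def insert_commute)
    have eq: "emeasure M B = emeasure M (B - {N, S}) + emeasure M (B \<inter> {N, S})" if "sets M = sets borel" for M
      using emeasure_Diff_Int[of "{N, S}" M B] B(1) m that by simp
    have "B - {N, S} \<in> sets borel" using B(1) m by simp
    hence "emeasure vol (B - {N, S}) = emeasure ?V (B - {N, S})"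
      using B c by (subst vol_chart[of c]) (auto simp: emeasure_polar_volume)
    thus ?thesis using n1 n2 eq[of vol] eq[of ?V] by simp
  qed
  have ind: "finite C \<Longrightarrow> C \<subseteq> \<A> \<Longrightarrow> \<forall>B\<in>sets borel. B \<subseteq> (\<Union>c\<in>C. fst c) \<longrightarrow> emeasure vol B = emeasure ?V B" for C
  proof (induction C rule: finite_induct)
    case (insert c C)
    show ?case
    proof (intro ballI impI)
      fix B assume B: "B \<in> sets borel" "B \<subseteq> (\<Union>c\<in>insert c C. fst c)"
      have o: "fst c \<in> sets borel" using chart_facts(1)[OF chart] insert.prems by (simp add: borel_open)
      have B1: "B \<inter> fst c \<in> sets borel" and B2: "B - fst c \<in> sets borel" using B(1) o by auto
      have eq: "emeasure M B = emeasure M (B - fst c) + emeasure M (B \<inter> fst c)" if "sets M = sets borel" for M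
        using emeasure_Diff_Int[of "fst c" M B] B(1) o that by simp
      have "emeasure vol (B \<inter> fst c) = emeasure ?V (B \<inter> fst c)"
        using insert.prems by (intro single[of c] B1) auto
      moreover have "emeasure vol (B - fst c) = emeasure ?V (B - fst c)"
        using insert.IH insert.prems B2 B(2) by auto
      ultimately show "emeasure vol B = emeasure ?V B" using eq[of vol] eq[of ?V] by simp
    qed
  qed auto
  obtain C where C: "C \<subseteq> \<A>" "finite C" "UNIV \<subseteq> (\<Union>c\<in>C. fst c)"
  proof (rule compactE_image[OF compact_M])
    show "open (fst c)" if "c \<in> \<A>" for c using chart_facts(1)[OF chart[OF that]] .
    show "UNIV \<subseteq> (\<Union>c\<in>\<A>. fst c)" using atlas by (simp add: smooth_atlas_def)
  qed
  fix B assume "B \<in> sets vol"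
  thus "emeasure vol B = emeasure ?V B" using ind[OF C(2,1)] C(3) by auto
qed

lemma finite_vol: "finite_measure vol"
proof -
  obtain B where B: "0 \<le> B" "\<And>y. vol_factor y \<le> B" by (rule vol_factor_bounded, rule that)
  have "integrable lborel vol_factor"
    by (rule bounded_on_ball_integrable[of _ B]) (use B vol_factor_nonneg in \<open>auto simp: vol_factor_def[of y for y]\<close>)
  hence "(\<integral>\<^sup>+y. ennreal (vol_factor y) \<partial>lborel) < \<infinity>"
    using vol_factor_nonneg by (subst nn_integral_eq_integral) auto
  hence "emeasure ball_measure (space ball_measure) \<noteq> \<infinity>"
    by (simp add: ball_measure_def emeasure_density)
  hence "finite_measure ball_measure" by (rule finite_measureI)
  thus ?thesis unfolding vol_eq by (rule finite_measure.finite_measure_distr) simp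
qed

lemma rad_measurable [measurable]: "rad \<in> borel_measurable borel"
  by (rule borel_measurable_continuous_onI[OF rad_cont])

abbreviation \<sigma> :: "real \<Rightarrow> nat \<Rightarrow> 'm \<Rightarrow> real" where "\<sigma> \<alpha> j p \<equiv> radial_density R \<alpha> j (rad p)"

lemma radial_density_measurable [measurable]: "radial_density R \<alpha> j \<in> borel_measurable borel"
  by (rule borel_measurable_continuous_onI[OF P.density_cont])

lemma polar_point: assumes "0 < r" "r < R" "norm \<omega> = 1"
  shows "r *\<^sub>R \<omega> \<in> PB" "norm (r *\<^sub>R \<omega>) = r" "sgn (r *\<^sub>R \<omega>) = \<omega>"
proof -
  have "\<omega> \<noteq> 0" using assms by auto
  thus "r *\<^sub>R \<omega> \<in> PB" "norm (r *\<^sub>R \<omega>) = r" "sgn (r *\<^sub>R \<omega>) = \<omega>"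
    using assms by (simp_all add: PB_def sgn_div_norm)
qed

text \<open>The factor r^(n-1) of Lebesgue measure in polar coordinates and the factor (\<theta> /
  r)^(n-1) of \<open>vol_factor\<close> combine to \<theta>^(n-1), the one in
  \<open>weight\<close>.\<close>

lemma integral_vol:
  assumes [measurable]: "F \<in> borel_measurable borel" and b: "\<And>p. \<bar>F p\<bar> \<le> B"
  shows "(\<integral>p. F p * \<sigma> \<alpha> j p \<partial>vol)
    = sphere_area TYPE(real ^ 'n) * (\<integral>r. (\<integral>\<omega>. F (\<Theta> (r *\<^sub>R \<omega>)) \<partial>sphere_measure) * P.weight \<alpha> j (CARD('n) - 1) r \<partial>lborel)"
proof -
  interpret \<nu>: prob_space "sphere_measure :: (real ^ 'n) measure" by (rule prob_space_sphere_measure)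
  define H where "H y = vol_factor y * (F (\<Theta> y) * \<sigma> \<alpha> j (\<Theta> y))" for y
  have [measurable]: "H \<in> borel_measurable borel" unfolding H_def by measurable
  obtain C where C: "0 \<le> C" "\<And>y. vol_factor y \<le> C" by (rule vol_factor_bounded, rule that)
  have iH: "integrable lborel H"
  proof (rule bounded_on_ball_integrable)
    fix y
    have "\<bar>F (\<Theta> y)\<bar> * \<sigma> \<alpha> j (\<Theta> y) \<le> B * 1"
      using b[of "\<Theta> y"] P.density_le_1 P.density_pos by (intro mult_mono) (auto simp: less_imp_le)
    hence "vol_factor y * (\<bar>F (\<Theta> y)\<bar> * \<sigma> \<alpha> j (\<Theta> y)) \<le> C * (B * 1)"
      using C vol_factor_nonneg P.density_pos[of \<alpha> j "rad (\<Theta> y)"] by (intro mult_mono[OF C(2)]) auto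
    thus "\<bar>H y\<bar> \<le> C * B"
      using vol_factor_nonneg[of y] P.density_pos[of \<alpha> j "rad (\<Theta> y)"] by (simp add: H_def abs_mult)
  qed (simp_all add: H_def vol_factor_def)
  have "(\<integral>p. F p * \<sigma> \<alpha> j p \<partial>vol) = (\<integral>y. F (\<Theta> y) * \<sigma> \<alpha> j (\<Theta> y) \<partial>ball_measure)"
    unfolding vol_eq by (rule integral_distr) measurable
  also have "\<dots> = (\<integral>y. H y \<partial>lborel)"
    unfolding ball_measure_def H_def
    by (subst integral_density) (use vol_factor_nonneg in \<open>auto simp: \<close>)
  also have "\<dots> = (\<integral>r. (indicator {0<..} r * (unit_ball_volume TYPE(real ^ 'n) * (CARD('n) * r ^ (CARD('n) - 1))))
      * (\<integral>\<omega>. H (r *\<^sub>R \<omega>) \<partial>sphere_measure) \<partial>lborel)"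
    using integral_polar[OF iH] by simp
  also have "\<dots> = (\<integral>r. sphere_area TYPE(real ^ 'n) * ((\<integral>\<omega>. F (\<Theta> (r *\<^sub>R \<omega>)) \<partial>sphere_measure) * P.weight \<alpha> j (CARD('n) - 1) r) \<partial>lborel)"
  proof (intro Bochner_Integration.integral_cong refl)
    fix r :: real
    show "(indicator {0<..} r * (unit_ball_volume TYPE(real ^ 'n) * (CARD('n) * r ^ (CARD('n) - 1)))) * (\<integral>\<omega>. H (r *\<^sub>R \<omega>) \<partial>sphere_measure)
      = sphere_area TYPE(real ^ 'n) * ((\<integral>\<omega>. F (\<Theta> (r *\<^sub>R \<omega>)) \<partial>sphere_measure) * P.weight \<alpha> j (CARD('n) - 1) r)"
    proof (cases "0 < r \<and> r < R")
      case True
      have "(\<integral>\<omega>. H (r *\<^sub>R \<omega>) \<partial>sphere_measure)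
          = (\<integral>\<omega>. ((\<theta> r / r) ^ (CARD('n) - 1) * radial_density R \<alpha> j r) * F (\<Theta> (r *\<^sub>R \<omega>)) \<partial>sphere_measure)"
      proof (rule integral_cong_AE)
        show "AE \<omega> in sphere_measure. H (r *\<^sub>R \<omega>) = ((\<theta> r / r) ^ (CARD('n) - 1) * radial_density R \<alpha> j r) * F (\<Theta> (r *\<^sub>R \<omega>))"
          using AE_sphere_measure
        proof eventually_elim
          case (elim \<omega>)
          note p = polar_point[of r \<omega>, OF _ _ elim]
          have "rad (\<Theta> (r *\<^sub>R \<omega>)) = r" using p True by (simp add: \<Theta>_def rad_\<Psi>)
          thus ?case using p True by (simp add: H_def vol_factor_def)
        qed
      qed measurable
      also have "\<dots> = ((\<theta> r / r) ^ (CARD('n) - 1) * radial_density R \<alpha> j r) * (\<integral>\<omega>. F (\<Theta> (r *\<^sub>R \<omega>)) \<partial>sphere_measure)"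
        by simp
      finally show ?thesis using True by (simp add: sphere_area_def P.weight_def power_divide)
    next
      case False
      have "indicator {0<..} r * (\<integral>\<omega>. H (r *\<^sub>R \<omega>) \<partial>sphere_measure) = 0"
      proof (cases "0 < r")
        case True
        have "(\<integral>\<omega>. H (r *\<^sub>R \<omega>) \<partial>sphere_measure) = (\<integral>\<omega>. 0 \<partial>(sphere_measure :: (real ^ 'n) measure))"
        proof (rule integral_cong_AE)
          show "AE \<omega> in sphere_measure. H (r *\<^sub>R \<omega>) = 0"
            using AE_sphere_measure by eventually_elim (use True False in \<open>simp add: H_def vol_factor_def PB_def\<close>)
        qed measurable
        thus ?thesis by simp
      qed simp
      moreover have "P.weight \<alpha> j (CARD('n) - 1) r = 0" using False by (auto simp: P.weight_def)
      ultimately show ?thesis by auto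
    qed
  qed
  finally show ?thesis by simp
qed

section \<open>The Poincare inequality for smooth functions on the manifold\<close>

lemma grad_sq_continuous: assumes w: "smooth_fun \<A> w" shows "continuous_on UNIV (grad_sq \<A> g w)"
proof (intro continuous_at_imp_continuous_on ballI)
  fix p
  obtain c where c: "c \<in> \<A>" "p \<in> fst c" by (rule cover)
  note cf = chart_facts[OF chart[OF c(1)]]
  have cg: "continuous_on (snd c ` fst c) (chart_grad c w)"
    unfolding chart_grad_def[abs_def]
    by (intro continuous_on_vec_lambda smooth_on_derivative_continuous[OF smooth_local_rep[OF w c(1)]])
  have "continuous_on (snd c ` fst c) (\<lambda>x. chart_grad c w x \<bullet> (matrix_inv (g c x) *v chart_grad c w x))"
    by (intro continuous_on_inner cg continuous_on_matrix_inv_mult smooth_on_continuous_on[OF metric_smooth[OF c(1)]] metric_det[OF c(1)])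
  from continuous_on_compose2[OF this cf(6)]
  have "continuous_on (fst c) (\<lambda>q. chart_grad c w (snd c q) \<bullet> (matrix_inv (g c (snd c q)) *v chart_grad c w (snd c q)))"
    by auto
  hence "continuous_on (fst c) (grad_sq \<A> g w)"
    by (rule continuous_on_eq) (rule grad_sq_chart[OF w c(1), symmetric])
  thus "isCont (grad_sq \<A> g w) p" using cf(1) c(2) by (auto simp: continuous_on_eq_continuous_at)
qed

lemma continuous_bounded:
  assumes "continuous_on UNIV (F :: 'm \<Rightarrow> real)" obtains B where "0 \<le> B" "\<And>p. \<bar>F p\<bar> \<le> B"
proof -
  have "bounded (range F)" using compact_imp_bounded[OF compact_continuous_image[OF assms compact_M]] .
  then obtain B where B: "\<And>p. \<bar>F p\<bar> \<le> B" unfolding bounded_iff real_norm_def by blast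
  show ?thesis using that[of B] B order_trans[OF abs_ge_zero B] by blast
qed

lemma polar_energy_eq:
  assumes w: "smooth_fun \<A> w" and r: "0 < r" "r < R" and \<omega>: "norm \<omega> = 1"
  shows "polar_energy \<theta> (pull_grad w) r \<omega> = grad_sq \<A> g w (\<Theta> (r *\<^sub>R \<omega>))"
  using grad_sq_polar[OF w polar_point(1)[OF r \<omega>]] polar_point[OF r \<omega>]
  by (simp add: polar_energy_def \<Theta>_def power_divide)

lemma pull_grad_measurable:
  assumes w: "smooth_fun \<A> w" shows "pull_grad w \<in> borel_measurable borel"
proof -
  have "(\<lambda>y. if y \<in> PB then pull_grad w y else 0) \<in> borel_measurable borel"
    by (rule borel_measurable_continuous_on_if[OF borel_open[OF open_PB] pull_grad_continuous[OF w]]) auto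
  thus ?thesis by (simp add: pull_grad_def[abs_def] cong: if_cong)
qed

lemma manifold_poincare:
  assumes w: "smooth_fun \<A> w" and K: "0 \<le> K"
    and mono: "\<And>x y. 0 < y \<Longrightarrow> y < x \<Longrightarrow> x < R \<Longrightarrow> K * (x - y) \<le> P.score \<alpha> j (CARD('n) - 1) x - P.score \<alpha> j (CARD('n) - 1) y"
    and ang: "\<And>r. 0 < r \<Longrightarrow> r < R \<Longrightarrow> K \<le> P.score \<alpha> j (CARD('n) - 1) r / r + real (CARD('n) - 1) / (\<theta> r)\<^sup>2"
  shows "K * ((\<integral>p. \<sigma> \<alpha> j p \<partial>vol) * (\<integral>p. (w p)\<^sup>2 * \<sigma> \<alpha> j p \<partial>vol) - (\<integral>p. w p * \<sigma> \<alpha> j p \<partial>vol)\<^sup>2)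
    \<le> (\<integral>p. \<sigma> \<alpha> j p \<partial>vol) * (\<integral>p. grad_sq \<A> g w p * \<sigma> \<alpha> j p \<partial>vol)"
proof -
  interpret \<nu>: prob_space "sphere_measure :: (real ^ 'n) measure" by (rule prob_space_sphere_measure)
  note wc = smooth_fun_continuous[OF w] and gc = grad_sq_continuous[OF w]
  have [measurable]: "w \<in> borel_measurable borel" "grad_sq \<A> g w \<in> borel_measurable borel"
    by (intro borel_measurable_continuous_onI wc gc)+
  obtain B where B: "0 \<le> B" "\<And>p. \<bar>w p\<bar> \<le> B" by (rule continuous_bounded[OF wc], rule that)
  obtain B' where B': "0 \<le> B'" "\<And>p. \<bar>grad_sq \<A> g w p\<bar> \<le> B'" by (rule continuous_bounded[OF gc], rule that)
  have pull: "pull w = (\<lambda>y. w (\<Theta> y))" by (simp add: fun_eq_iff pull_def \<Theta>_def)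
  let ?w = "P.weight \<alpha> j (CARD('n) - 1)"
  have m1: "1 \<le> (CARD('n) - 1)" using card by simp
  have B2: "\<bar>(w p)\<^sup>2\<bar> \<le> B\<^sup>2" for p using power_mono[OF B(2)[of p] abs_ge_zero, of 2] by simp
  \<comment> \<open>\<open>B\<close> and \<open>B'\<close> come from continuity on the compact
    manifold; the bound on \<open>grad_sq\<close> controls the energy up to both poles, where polar
    coordinates degenerate.\<close>
  interpret Q: polar_function R \<theta> profile_derivative \<alpha> j "CARD('n) - 1" K B "w N" B' "pull w" "pull_grad w"
  proof
    show "DIM(real ^ 'n) = Suc (CARD('n) - 1)" using card by simp
    show "1 \<le> CARD('n) - 1" "0 \<le> K" by (fact m1 K)+
    show "K * (x - y) \<le> P.score \<alpha> j (CARD('n) - 1) x - P.score \<alpha> j (CARD('n) - 1) y" if "0 < y" "y < x" "x < R" for x y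
      by (rule mono[OF that])
    show "K \<le> P.score \<alpha> j (CARD('n) - 1) r / r + real (CARD('n) - 1) / (\<theta> r)\<^sup>2" if "0 < r" "r < R" for r
      by (rule ang[OF that])
    show "pull w \<in> borel_measurable borel" unfolding pull by measurable
    show "pull_grad w \<in> borel_measurable borel" by (rule pull_grad_measurable[OF w])
    show "(pull w has_derivative (\<lambda>v. pull_grad w y \<bullet> v)) (at y)" if "0 < norm y" "norm y < R" for y
      using that by (intro pull_has_derivative[OF w]) (simp add: PB_def)
    show "continuous_on {y. 0 < norm y \<and> norm y < R} (pull_grad w)"
      using pull_grad_continuous[OF w] by (simp add: PB_def)
    show "\<bar>pull w y\<bar> \<le> B" for y by (simp add: pull B)
    show "(pull w \<longlongrightarrow> w N) (at 0)" using \<Psi>_tendsto_N[OF wc] by (simp add: pull_def[abs_def])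
    show "polar_energy \<theta> (pull_grad w) r \<omega> \<le> B'" if "0 < r" "r < R" "norm \<omega> = 1" for r \<omega>
      using B'(2)[of "\<Theta> (r *\<^sub>R \<omega>)"] by (simp add: polar_energy_eq[OF w that] abs_le_iff)
  qed
  note base = Q.product_poincare
  have e1: "(\<integral>p. \<sigma> \<alpha> j p \<partial>vol) = sphere_area TYPE(real ^ 'n) * (\<integral>r. ?w r \<partial>lborel)"
    using integral_vol[of "\<lambda>_. 1" 1 \<alpha> j] \<nu>.prob_space by simp
  have e2: "(\<integral>p. (w p)\<^sup>2 * \<sigma> \<alpha> j p \<partial>vol) = sphere_area TYPE(real ^ 'n) * (\<integral>r. (\<integral>\<omega>. (pull w (r *\<^sub>R \<omega>))\<^sup>2 \<partial>sphere_measure) * ?w r \<partial>lborel)"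
    unfolding pull by (rule integral_vol[OF _ B2]) measurable
  have e3: "(\<integral>p. w p * \<sigma> \<alpha> j p \<partial>vol) = sphere_area TYPE(real ^ 'n) * (\<integral>r. (\<integral>\<omega>. pull w (r *\<^sub>R \<omega>) \<partial>sphere_measure) * ?w r \<partial>lborel)"
    unfolding pull by (rule integral_vol[OF _ B(2)]) measurable
  have e4: "(\<integral>p. grad_sq \<A> g w p * \<sigma> \<alpha> j p \<partial>vol)
      = sphere_area TYPE(real ^ 'n) * (\<integral>r. (\<integral>\<omega>. polar_energy \<theta> (pull_grad w) r \<omega> \<partial>sphere_measure) * ?w r \<partial>lborel)"
  proof -
    have "(\<integral>r. (\<integral>\<omega>. grad_sq \<A> g w (\<Theta> (r *\<^sub>R \<omega>)) \<partial>sphere_measure) * ?w r \<partial>lborel)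
       = (\<integral>r. (\<integral>\<omega>. polar_energy \<theta> (pull_grad w) r \<omega> \<partial>sphere_measure) * ?w r \<partial>lborel)"
    proof (intro Bochner_Integration.integral_cong refl)
      fix r
      show "(\<integral>\<omega>. grad_sq \<A> g w (\<Theta> (r *\<^sub>R \<omega>)) \<partial>sphere_measure) * ?w r
        = (\<integral>\<omega>. polar_energy \<theta> (pull_grad w) r \<omega> \<partial>sphere_measure) * ?w r"
      proof (cases "0 < r \<and> r < R")
        case True
        have "(\<integral>\<omega>. grad_sq \<A> g w (\<Theta> (r *\<^sub>R \<omega>)) \<partial>sphere_measure) = (\<integral>\<omega>. polar_energy \<theta> (pull_grad w) r \<omega> \<partial>sphere_measure)"
        proof (rule integral_cong_AE)
          show "polar_energy \<theta> (pull_grad w) r \<in> borel_measurable sphere_measure"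
            using pull_grad_measurable[OF w] unfolding polar_energy_def[abs_def] by measurable
          show "AE \<omega> in sphere_measure. grad_sq \<A> g w (\<Theta> (r *\<^sub>R \<omega>)) = polar_energy \<theta> (pull_grad w) r \<omega>"
            using AE_sphere_measure by eventually_elim (use True polar_energy_eq[OF w] in auto)
        qed measurable
        thus ?thesis by simp
      next
        case False
        hence "?w r = 0" by (auto simp: P.weight_def)
        thus ?thesis by simp
      qed
    qed
    thus ?thesis using integral_vol[OF _ B'(2)] by simp
  qed
  \<comment> \<open>Each of the four integrals carries the factor \<open>sphere_area\<close>, and
    both sides of the inequality scale with its square.\<close>
  have scale: "K * ((k * a) * (k * b) - (k * c)\<^sup>2) \<le> (k * a) * (k * e)"
    if "K * (a * b - c\<^sup>2) \<le> a * e" for k a b c e :: real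
  proof -
    have "k\<^sup>2 * (K * (a * b - c\<^sup>2)) \<le> k\<^sup>2 * (a * e)" using that by (intro mult_left_mono) auto
    thus ?thesis by (simp add: power2_eq_square algebra_simps)
  qed
  show ?thesis unfolding e1 e2 e3 e4 by (rule scale[OF base])
qed

end

section \<open>Sobolev functions and the second eigenvalue\<close>

lemma Ck_on_cong:
  assumes "open U" "\<And>x. x \<in> U \<Longrightarrow> f x = h x" "Ck_on k f U"
  shows "Ck_on k h U"
  using assms(2,3)
proof (induction k arbitrary: f h)
  case 0 thus ?case using continuous_on_cong[of U U f h] by simp
next
  case (Suc k)
  have d: "f differentiable (at x)" if "x \<in> U" for x using Suc.prems that by simp
  have fd: "(h has_derivative frechet_derivative f (at x)) (at x)" if "x \<in> U" for x
    by (rule has_derivative_transform_within_open[OF frechet_derivative_works[THEN iffD1, OF d[OF that]] assms(1) that Suc.prems(1)])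
  have eq: "frechet_derivative f (at x) v = frechet_derivative h (at x) v" if "x \<in> U" for x v
    using frechet_derivative_at[OF fd[OF that]] by simp
  have "Ck_on k (\<lambda>x. frechet_derivative h (at x) v) U" for v
    using Suc.prems(2) by (intro Suc.IH[OF eq]) auto
  moreover have "h differentiable (at x)" if "x \<in> U" for x by (rule differentiableI[OF fd[OF that]])
  ultimately show ?case by simp
qed

lemma has_derivative_linear_combination:
  fixes a b :: real
  assumes "f differentiable (at x)" "h differentiable (at x)"
  shows "((\<lambda>x. a *\<^sub>R f x + b *\<^sub>R h x) has_derivative
    (\<lambda>v. a *\<^sub>R frechet_derivative f (at x) v + b *\<^sub>R frechet_derivative h (at x) v)) (at x)"
  using assms by (intro has_derivative_add has_derivative_scaleR_right) (simp_all add: frechet_derivative_works)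

lemma Ck_on_linear_combination:
  fixes a b :: real
  assumes "open U" "Ck_on k f U" "Ck_on k h U"
  shows "Ck_on k (\<lambda>x. a *\<^sub>R f x + b *\<^sub>R h x) U"
  using assms(2,3)
proof (induction k arbitrary: f h)
  case 0
  hence "continuous_on U f" "continuous_on U h" by simp_all
  hence "continuous_on U (\<lambda>x. a *\<^sub>R f x + b *\<^sub>R h x)" by (intro continuous_intros)
  thus ?case by simp
next
  case (Suc k)
  have fd: "((\<lambda>x. a *\<^sub>R f x + b *\<^sub>R h x) has_derivative
    (\<lambda>v. a *\<^sub>R frechet_derivative f (at x) v + b *\<^sub>R frechet_derivative h (at x) v)) (at x)" if "x \<in> U" for x
    using Suc.prems that by (intro has_derivative_linear_combination) auto
  have "Ck_on k (\<lambda>x. frechet_derivative (\<lambda>x. a *\<^sub>R f x + b *\<^sub>R h x) (at x) v) U" for v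
  proof (rule Ck_on_cong[OF assms(1)])
    show "Ck_on k (\<lambda>x. a *\<^sub>R frechet_derivative f (at x) v + b *\<^sub>R frechet_derivative h (at x) v) U"
      using Suc.prems by (intro Suc.IH) auto
    show "a *\<^sub>R frechet_derivative f (at x) v + b *\<^sub>R frechet_derivative h (at x) v
        = frechet_derivative (\<lambda>x. a *\<^sub>R f x + b *\<^sub>R h x) (at x) v" if "x \<in> U" for x
      by (rule fun_cong[OF frechet_derivative_at[OF fd[OF that]]])
  qed
  moreover have "(\<lambda>x. a *\<^sub>R f x + b *\<^sub>R h x) differentiable (at x)" if "x \<in> U" for x
    by (rule differentiableI[OF fd[OF that]])
  ultimately show ?case by simp
qed

text \<open>Nonnegativity of the form at \<open>e *\<^sub>R u - v\<close>, divided by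
  \<open>e\<close>. With small \<open>e\<close>, an error \<open>v\<close> is absorbed at a factor
  arbitrarily close to 1 on \<open>u\<close>.\<close>

lemma quadratic_form_add_le:
  fixes M :: "real ^ 'n::finite ^ 'n"
  assumes "\<And>v. 0 \<le> v \<bullet> (M *v v)" and e: "0 < e"
  shows "(u + v) \<bullet> (M *v (u + v)) \<le> (1 + e) * (u \<bullet> (M *v u)) + (1 + 1 / e) * (v \<bullet> (M *v v))"
proof -
  let ?c = "u \<bullet> (M *v v) + v \<bullet> (M *v u)"
  have "0 \<le> (e *\<^sub>R u - v) \<bullet> (M *v (e *\<^sub>R u - v))" by (rule assms)
  also have "\<dots> = e * (e * (u \<bullet> (M *v u)) - ?c) + v \<bullet> (M *v v)"
    by (simp add: matrix_vector_mult_diff_distrib matrix_vector_mult_scaleR inner_diff_left inner_diff_right algebra_simps)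
  finally have "?c * e \<le> (e * (u \<bullet> (M *v u)) + (v \<bullet> (M *v v)) / e) * e"
    using e by (simp add: algebra_simps)
  hence "?c \<le> e * (u \<bullet> (M *v u)) + (v \<bullet> (M *v v)) / e" using e by simp
  thus ?thesis by (simp add: matrix_vector_right_distrib inner_add_left inner_add_right algebra_simps)
qed

lemma power2_add_le: "(x + y)\<^sup>2 \<le> (1 + e) * x\<^sup>2 + (1 + 1 / e) * y\<^sup>2" if "0 < e" for x y e :: real
proof -
  have "0 \<le> (e * x - y)\<^sup>2 / e" using that by simp
  also have "(e * x - y)\<^sup>2 / e = e * x\<^sup>2 - 2 * x * y + y\<^sup>2 / e"
    using that by (simp add: power2_eq_square field_simps)
  finally show ?thesis by (simp add: power2_eq_square algebra_simps)
qed

text \<open>Takes the place of the triangle inequality for a seminorm with square \<open>q\<close>: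
  squaring that inequality leaves the second hypothesis, for all \<open>e\<close>, with
  \<open>d\<close> the squared distance. The hypothesis first bounds \<open>q\<close> and then, with
  small \<open>e\<close>, makes it a Cauchy sequence.\<close>

lemma convergent_if_almost_quadratic:
  fixes q :: "nat \<Rightarrow> real" and d :: "nat \<Rightarrow> nat \<Rightarrow> real"
  assumes q: "\<And>k. 0 \<le> q k" "\<And>k l e. 0 < e \<Longrightarrow> q k \<le> (1 + e) * q l + (1 + 1 / e) * d k l"
    and d: "\<And>e. 0 < e \<Longrightarrow> \<exists>K. \<forall>k\<ge>K. \<forall>l\<ge>K. d k l < e"
  shows "convergent q"
proof -
  obtain K1 where K1: "\<And>k l. K1 \<le> k \<Longrightarrow> K1 \<le> l \<Longrightarrow> d k l < 1" using d[of 1] by auto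
  define M where "M = 2 * q K1 + 2"
  have M: "0 < M" using q(1)[of K1] by (simp add: M_def)
  have qM: "q k \<le> M" if "K1 \<le> k" for k
    using q(2)[of 1 k K1] K1[OF that order_refl] by (simp add: M_def)
  have "Cauchy q"
  proof (rule CauchyI)
    fix e :: real assume e: "0 < e"
    \<comment> \<open>Chosen so that \<open>\<epsilon> * q l\<close> is at most \<open>e / 2\<close>
      for all late \<open>l\<close>; then \<open>d k l\<close> is made small relative to
      \<open>1 + 1 / \<epsilon>\<close>.\<close>
    define \<epsilon> where "\<epsilon> = e / (2 * M)"
    have \<epsilon>: "0 < \<epsilon>" using e M by (simp add: \<epsilon>_def)
    obtain K2 where K2: "\<And>k l. K2 \<le> k \<Longrightarrow> K2 \<le> l \<Longrightarrow> d k l < e / 2 / (1 + 1 / \<epsilon>)"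
      using d[of "e / 2 / (1 + 1 / \<epsilon>)"] e \<epsilon> by (auto simp: add_pos_pos)
    have le: "q k - q l < e" if "max K1 K2 \<le> k" "max K1 K2 \<le> l" for k l
    proof -
      have p: "0 < 1 + 1 / \<epsilon>" using \<epsilon> by (simp add: add_pos_pos)
      have "d k l < e / 2 / (1 + 1 / \<epsilon>)" using K2[of k l] that by simp
      hence "(1 + 1 / \<epsilon>) * d k l < e / 2" using p by (simp only: pos_less_divide_eq mult.commute)
      moreover have "\<epsilon> * q l \<le> \<epsilon> * M" using qM[of l] that \<epsilon> by (intro mult_left_mono) auto
      hence "\<epsilon> * q l \<le> e / 2" using M by (simp add: \<epsilon>_def)
      moreover have "q k \<le> q l + \<epsilon> * q l + (1 + 1 / \<epsilon>) * d k l"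
        using q(2)[OF \<epsilon>, of k l] by (simp only: distrib_right mult_1)
      ultimately show ?thesis by linarith
    qed
    show "\<exists>K. \<forall>k\<ge>K. \<forall>l\<ge>K. norm (q k - q l) < e"
    proof (intro exI allI impI)
      fix k l assume "max K1 K2 \<le> k" "max K1 K2 \<le> l"
      thus "norm (q k - q l) < e" using le[of k l] le[of l k] by (simp add: abs_less_iff)
    qed
  qed
  thus ?thesis by (rule real_Cauchy_convergent)
qed

section \<open>Sobolev functions, weighted energies and the min-max value\<close>

context revolution begin

interpretation vol: finite_measure vol by (rule finite_vol)

lemma smooth_fun_linear_combination:
  assumes "smooth_fun \<A> f" "smooth_fun \<A> h"
  shows "smooth_fun \<A> (\<lambda>p. a * f p + b * h p)"
  unfolding smooth_fun_def
proof
  fix c assume c: "c \<in> \<A>"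
  have e: "local_rep c (\<lambda>p. a * f p + b * h p) = (\<lambda>x. a *\<^sub>R local_rep c f x + b *\<^sub>R local_rep c h x)"
    by (simp add: local_rep_def fun_eq_iff)
  show "smooth_on (local_rep c (\<lambda>p. a * f p + b * h p)) (snd c ` fst c)"
    unfolding e smooth_on_def
    by (intro allI Ck_on_linear_combination[OF chart_facts(2)[OF chart[OF c]]])
       (use smooth_local_rep[OF assms(1) c] smooth_local_rep[OF assms(2) c] in \<open>auto simp: smooth_on_def\<close>)
qed

lemma smooth_fun_diff: "smooth_fun \<A> f \<Longrightarrow> smooth_fun \<A> h \<Longrightarrow> smooth_fun \<A> (\<lambda>p. f p - h p)"
  using smooth_fun_linear_combination[of f h, where a = 1 and b = "-1"] by simp

lemma chart_grad_linear_combination: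
  assumes f: "smooth_fun \<A> f" and h: "smooth_fun \<A> h" and c: "c \<in> \<A>" "x \<in> snd c ` fst c"
  shows "chart_grad c (\<lambda>p. a * f p + b * h p) x = a *\<^sub>R chart_grad c f x + b *\<^sub>R chart_grad c h x"
proof -
  have e: "local_rep c (\<lambda>p. a * f p + b * h p) = (\<lambda>x. a *\<^sub>R local_rep c f x + b *\<^sub>R local_rep c h x)"
    by (simp add: local_rep_def fun_eq_iff)
  have "frechet_derivative (local_rep c (\<lambda>p. a * f p + b * h p)) (at x) v
    = a *\<^sub>R frechet_derivative (local_rep c f) (at x) v + b *\<^sub>R frechet_derivative (local_rep c h) (at x) v" for v
    unfolding e
    by (rule fun_cong[OF frechet_derivative_at[OF has_derivative_linear_combination, symmetric]])
       (rule smooth_on_differentiable[OF smooth_local_rep[OF f c(1)] c(2)],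
        rule smooth_on_differentiable[OF smooth_local_rep[OF h c(1)] c(2)])
  thus ?thesis by (simp add: chart_grad_def vec_eq_iff)
qed

lemma inverse_metric_nonneg:
  assumes c: "c \<in> \<A>" "x \<in> snd c ` fst c"
  shows "0 \<le> v \<bullet> (matrix_inv (g c x) *v v)"
proof -
  define b where "b = matrix_inv (g c x) *v v"
  have "g c x *v b = v"
    using matrix_inv_right[of "g c x"] metric_det[OF c] by (simp add: b_def matrix_vector_mul_assoc invertible_det_nz)
  hence "v \<bullet> b = b \<bullet> (g c x *v b)" by (simp add: inner_commute)
  moreover have "0 \<le> b \<bullet> (g c x *v b)" using metric_positive[OF c, of b] by (cases "b = 0") auto
  ultimately show ?thesis by (simp add: b_def)
qed

lemma sel_image: "snd (sel p) p \<in> snd (sel p) ` fst (sel p)"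
  using sel(2) by auto

lemma grad_sq_nonneg: "0 \<le> grad_sq \<A> g w p"
  unfolding grad_sq_eq by (rule inverse_metric_nonneg[OF sel(1) sel_image])

lemma grad_sq_linear_combination_le:
  assumes f: "smooth_fun \<A> f" and h: "smooth_fun \<A> h" and e: "0 < e"
  shows "grad_sq \<A> g (\<lambda>p. a * f p + b * h p) p
    \<le> (1 + e) * (a\<^sup>2 * grad_sq \<A> g f p) + (1 + 1 / e) * (b\<^sup>2 * grad_sq \<A> g h p)"
proof -
  let ?M = "matrix_inv (g (sel p) (snd (sel p) p))"
  have sq: "(t *\<^sub>R v) \<bullet> (?M *v (t *\<^sub>R v)) = t\<^sup>2 * (v \<bullet> (?M *v v))" for t :: real and v
    by (simp add: matrix_vector_mult_scaleR power2_eq_square)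
  show ?thesis
    unfolding grad_sq_eq chart_grad_linear_combination[OF f h sel(1) sel_image] sq[symmetric]
    by (rule quadratic_form_add_le[OF inverse_metric_nonneg[OF sel(1) sel_image] e])
qed

lemma continuous_integrable:
  assumes "continuous_on UNIV (F :: 'm \<Rightarrow> real)" shows "integrable vol F"
proof -
  obtain B where "0 \<le> B" "\<And>p. \<bar>F p\<bar> \<le> B" by (rule continuous_bounded[OF assms], rule that)
  thus ?thesis
    using borel_measurable_continuous_onI[OF assms] by (intro integrable_bounded_finite_measure[OF finite_vol]) auto
qed

lemma energy_linear_combination_le:
  assumes f: "smooth_fun \<A> f" and h: "smooth_fun \<A> h" and e: "0 < e"
    and \<tau>: "continuous_on UNIV \<tau>" "\<And>p. 0 \<le> \<tau> p"
  shows "(\<integral>p. grad_sq \<A> g (\<lambda>p. a * f p + b * h p) p * \<tau> p \<partial>vol)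
    \<le> (1 + e) * (a\<^sup>2 * (\<integral>p. grad_sq \<A> g f p * \<tau> p \<partial>vol)) + (1 + 1 / e) * (b\<^sup>2 * (\<integral>p. grad_sq \<A> g h p * \<tau> p \<partial>vol))"
proof -
  have i: "integrable vol (\<lambda>p. grad_sq \<A> g w p * \<tau> p)" if "smooth_fun \<A> w" for w
    by (intro continuous_integrable continuous_on_mult grad_sq_continuous that \<tau>)
  have "(\<integral>p. grad_sq \<A> g (\<lambda>p. a * f p + b * h p) p * \<tau> p \<partial>vol)
    \<le> (\<integral>p. (1 + e) * a\<^sup>2 * (grad_sq \<A> g f p * \<tau> p) + (1 + 1 / e) * b\<^sup>2 * (grad_sq \<A> g h p * \<tau> p) \<partial>vol)"
  proof (rule integral_mono)
    show "integrable vol (\<lambda>p. (1 + e) * a\<^sup>2 * (grad_sq \<A> g f p * \<tau> p) + (1 + 1 / e) * b\<^sup>2 * (grad_sq \<A> g h p * \<tau> p))"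
      by (intro Bochner_Integration.integrable_add integrable_mult_right i f h)
    show "integrable vol (\<lambda>p. grad_sq \<A> g (\<lambda>p. a * f p + b * h p) p * \<tau> p)"
      by (intro i smooth_fun_linear_combination f h)
    fix p
    show "grad_sq \<A> g (\<lambda>p. a * f p + b * h p) p * \<tau> p
        \<le> (1 + e) * a\<^sup>2 * (grad_sq \<A> g f p * \<tau> p) + (1 + 1 / e) * b\<^sup>2 * (grad_sq \<A> g h p * \<tau> p)"
      using mult_right_mono[OF grad_sq_linear_combination_le[OF f h e, where a = a and b = b] \<tau>(2)[of p]]
      by (simp only: distrib_right mult.assoc)
  qed
  also have "\<dots> = (1 + e) * (a\<^sup>2 * (\<integral>p. grad_sq \<A> g f p * \<tau> p \<partial>vol)) + (1 + 1 / e) * (b\<^sup>2 * (\<integral>p. grad_sq \<A> g h p * \<tau> p \<partial>vol))"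
    by (subst Bochner_Integration.integral_add) (intro integrable_mult_right i f h | simp only: integral_mult_right_zero mult.assoc)+
  finally show ?thesis .
qed

lemma square_integrable_add:
  fixes f h :: "'m \<Rightarrow> real"
  assumes [measurable]: "f \<in> borel_measurable borel" "h \<in> borel_measurable borel"
    and i: "integrable vol (\<lambda>p. (f p)\<^sup>2)" "integrable vol (\<lambda>p. (h p)\<^sup>2)"
  shows "integrable vol (\<lambda>p. (a * f p + b * h p)\<^sup>2)"
    and "(\<integral>p. (a * f p + b * h p)\<^sup>2 \<partial>vol) \<le> 2 * a\<^sup>2 * (\<integral>p. (f p)\<^sup>2 \<partial>vol) + 2 * b\<^sup>2 * (\<integral>p. (h p)\<^sup>2 \<partial>vol)"
proof -
  have le: "(a * f p + b * h p)\<^sup>2 \<le> 2 * a\<^sup>2 * (f p)\<^sup>2 + 2 * b\<^sup>2 * (h p)\<^sup>2" for p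
    using power2_add_le[of 1 "a * f p" "b * h p"] by (simp add: power_mult_distrib)
  have i2: "integrable vol (\<lambda>p. 2 * a\<^sup>2 * (f p)\<^sup>2 + 2 * b\<^sup>2 * (h p)\<^sup>2)"
    by (intro Bochner_Integration.integrable_add integrable_mult_right i)
  show i3: "integrable vol (\<lambda>p. (a * f p + b * h p)\<^sup>2)"
    by (rule Bochner_Integration.integrable_bound[OF i2]) (use le in \<open>auto intro!: order_trans[OF le abs_ge_self]\<close>)
  have "(\<integral>p. (a * f p + b * h p)\<^sup>2 \<partial>vol) \<le> (\<integral>p. 2 * a\<^sup>2 * (f p)\<^sup>2 + 2 * b\<^sup>2 * (h p)\<^sup>2 \<partial>vol)"
    by (rule integral_mono[OF i3 i2 le])
  also have "\<dots> = 2 * a\<^sup>2 * (\<integral>p. (f p)\<^sup>2 \<partial>vol) + 2 * b\<^sup>2 * (\<integral>p. (h p)\<^sup>2 \<partial>vol)"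
    using i by simp
  finally show "(\<integral>p. (a * f p + b * h p)\<^sup>2 \<partial>vol) \<le> 2 * a\<^sup>2 * (\<integral>p. (f p)\<^sup>2 \<partial>vol) + 2 * b\<^sup>2 * (\<integral>p. (h p)\<^sup>2 \<partial>vol)" .
qed

lemma measurable_vol_iff: "f \<in> borel_measurable vol \<longleftrightarrow> f \<in> borel_measurable borel" for f :: "'m \<Rightarrow> real"
  by (simp cong: measurable_cong_sets)

lemma smooth_fun_measurable: "smooth_fun \<A> w \<Longrightarrow> w \<in> borel_measurable borel"
  by (intro borel_measurable_continuous_onI smooth_fun_continuous)

lemma smooth_square_integrable: "smooth_fun \<A> w \<Longrightarrow> integrable vol (\<lambda>p. (w p)\<^sup>2)"
  by (intro continuous_integrable continuous_on_power smooth_fun_continuous)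

lemma smooth_diff_square_integrable:
  assumes "smooth_fun \<A> w" "u \<in> borel_measurable borel" "integrable vol (\<lambda>p. (u p)\<^sup>2)"
  shows "integrable vol (\<lambda>p. (w p - u p)\<^sup>2)"
  using square_integrable_add(1)[OF smooth_fun_measurable[OF assms(1)] assms(2) smooth_square_integrable[OF assms(1)] assms(3), where a = 1 and b = "-1"]
  by simp

text \<open>Needed for the combination of mean zero in a two-dimensional subspace. Errors and energy
  differences of the combined sequence are bounded by those of the two sequences, with constants
  depending on \<open>a\<close> and \<open>b\<close>.\<close>

lemma H1_linear_combination:
  assumes u: "u \<in> H1 \<A> g vol" and v: "v \<in> H1 \<A> g vol"
  shows "(\<lambda>p. a * u p + b * v p) \<in> H1 \<A> g vol"
proof -
  obtain w z where w: "H1_approx \<A> g vol u w" and z: "H1_approx \<A> g vol v z" using u v by (auto simp: H1_def)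
  have um [measurable]: "u \<in> borel_measurable borel" "v \<in> borel_measurable borel"
    and ui: "integrable vol (\<lambda>p. (u p)\<^sup>2)" "integrable vol (\<lambda>p. (v p)\<^sup>2)"
    using u v by (auto simp: H1_def measurable_vol_iff)
  have ws: "smooth_fun \<A> (w k)" and zs: "smooth_fun \<A> (z k)" for k using w z by (auto simp: H1_approx_def)
  have wz: "smooth_fun \<A> (\<lambda>p. a * w k p + b * z k p)" for k by (rule smooth_fun_linear_combination[OF ws zs])
  have "H1_approx \<A> g vol (\<lambda>p. a * u p + b * v p) (\<lambda>k p. a * w k p + b * z k p)"
    unfolding H1_approx_def
  proof (intro conjI allI impI wz)
    have "(\<lambda>k. 2 * a\<^sup>2 * (\<integral>p. (w k p - u p)\<^sup>2 \<partial>vol) + 2 * b\<^sup>2 * (\<integral>p. (z k p - v p)\<^sup>2 \<partial>vol)) \<longlonglongrightarrow> 2 * a\<^sup>2 * 0 + 2 * b\<^sup>2 * 0"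
      using w z by (intro tendsto_intros) (auto simp: H1_approx_def)
    hence lim: "(\<lambda>k. 2 * a\<^sup>2 * (\<integral>p. (w k p - u p)\<^sup>2 \<partial>vol) + 2 * b\<^sup>2 * (\<integral>p. (z k p - v p)\<^sup>2 \<partial>vol)) \<longlonglongrightarrow> 0"
      by simp
    show "(\<lambda>k. \<integral>p. (a * w k p + b * z k p - (a * u p + b * v p))\<^sup>2 \<partial>vol) \<longlonglongrightarrow> 0"
    proof (rule Lim_null_comparison[OF always_eventually lim], intro allI)
      fix k
      have [measurable]: "w k \<in> borel_measurable borel" "z k \<in> borel_measurable borel"
        by (rule smooth_fun_measurable[OF ws] smooth_fun_measurable[OF zs])+
      have e: "(a * w k p + b * z k p - (a * u p + b * v p))\<^sup>2 = (a * (w k p - u p) + b * (z k p - v p))\<^sup>2" for p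
        by (simp add: algebra_simps)
      have "0 \<le> (\<integral>p. (a * (w k p - u p) + b * (z k p - v p))\<^sup>2 \<partial>vol)" by simp
      moreover have "(\<integral>p. (a * (w k p - u p) + b * (z k p - v p))\<^sup>2 \<partial>vol)
          \<le> 2 * a\<^sup>2 * (\<integral>p. (w k p - u p)\<^sup>2 \<partial>vol) + 2 * b\<^sup>2 * (\<integral>p. (z k p - v p)\<^sup>2 \<partial>vol)"
        by (rule square_integrable_add(2)[OF _ _ smooth_diff_square_integrable[OF ws um(1) ui(1)]
              smooth_diff_square_integrable[OF zs um(2) ui(2)]]) measurable
      ultimately show "norm (\<integral>p. (a * w k p + b * z k p - (a * u p + b * v p))\<^sup>2 \<partial>vol)
          \<le> 2 * a\<^sup>2 * (\<integral>p. (w k p - u p)\<^sup>2 \<partial>vol) + 2 * b\<^sup>2 * (\<integral>p. (z k p - v p)\<^sup>2 \<partial>vol)"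
        unfolding e by (simp only: real_norm_def abs_of_nonneg)
    qed
    fix e :: real assume e: "0 < e"
    define e' where "e' = e / (4 * (a\<^sup>2 + b\<^sup>2 + 1))"
    have p: "0 < a\<^sup>2 + b\<^sup>2 + 1" by (intro add_nonneg_pos add_nonneg_nonneg) auto
    have e': "0 < e'" using e p by (simp add: e'_def)
    obtain K1 where K1: "\<And>k l. K1 \<le> k \<Longrightarrow> K1 \<le> l \<Longrightarrow> (\<integral>p. grad_sq \<A> g (\<lambda>q. w k q - w l q) p \<partial>vol) < e'"
      using w e' unfolding H1_approx_def by blast
    obtain K2 where K2: "\<And>k l. K2 \<le> k \<Longrightarrow> K2 \<le> l \<Longrightarrow> (\<integral>p. grad_sq \<A> g (\<lambda>q. z k q - z l q) p \<partial>vol) < e'"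
      using z e' unfolding H1_approx_def by blast
    show "\<exists>K. \<forall>k\<ge>K. \<forall>l\<ge>K. (\<integral>p. grad_sq \<A> g (\<lambda>q. a * w k q + b * z k q - (a * w l q + b * z l q)) p \<partial>vol) < e"
    proof (intro exI allI impI)
      fix k l assume kl: "max K1 K2 \<le> k" "max K1 K2 \<le> l"
      let ?A = "\<integral>p. grad_sq \<A> g (\<lambda>q. w k q - w l q) p \<partial>vol" and ?B = "\<integral>p. grad_sq \<A> g (\<lambda>q. z k q - z l q) p \<partial>vol"
      have eq: "(\<lambda>q. a * w k q + b * z k q - (a * w l q + b * z l q)) = (\<lambda>q. a * (w k q - w l q) + b * (z k q - z l q))"
        by (simp add: fun_eq_iff algebra_simps)
      have "(\<integral>p. grad_sq \<A> g (\<lambda>q. a * w k q + b * z k q - (a * w l q + b * z l q)) p \<partial>vol) \<le> 2 * (a\<^sup>2 * ?A) + 2 * (b\<^sup>2 * ?B)"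
        unfolding eq
        using energy_linear_combination_le[OF smooth_fun_diff[OF ws[of k] ws[of l]] smooth_fun_diff[OF zs[of k] zs[of l]], where e = 1 and \<tau> = "\<lambda>_. 1" and a = a and b = b] by simp
      also have "\<dots> \<le> 2 * (a\<^sup>2 * e') + 2 * (b\<^sup>2 * e')"
        using K1[of k l] K2[of k l] kl by (intro add_mono mult_left_mono) auto
      also have "\<dots> < 4 * (a\<^sup>2 + b\<^sup>2 + 1) * e'"
      proof -
        have "0 \<le> a\<^sup>2 * e'" "0 \<le> b\<^sup>2 * e'" using e' by simp_all
        moreover have "4 * (a\<^sup>2 + b\<^sup>2 + 1) * e' = 4 * (a\<^sup>2 * e') + 4 * (b\<^sup>2 * e') + 4 * e'" by (simp add: algebra_simps)
        ultimately show ?thesis using e' by linarith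
      qed
      also have "\<dots> = e" using p by (simp add: e'_def)
      finally show "(\<integral>p. grad_sq \<A> g (\<lambda>q. a * w k q + b * z k q - (a * w l q + b * z l q)) p \<partial>vol) < e" .
    qed
  qed
  thus ?thesis
    using square_integrable_add(1)[OF um ui] by (auto simp: H1_def measurable_vol_iff)
qed

lemma density_continuous: "continuous_on UNIV (\<sigma> \<alpha> j)"
  by (rule continuous_on_compose2[OF P.density_cont rad_cont]) auto

text \<open>The weight is at most 1, so gradients that are Cauchy without it are Cauchy with it.
  Existence of the limit ensures that \<open>SOME\<close> in \<open>dirichlet_energy\<close> selects
  an actual limit.\<close>

lemma energy_convergent:
  assumes "H1_approx \<A> g vol u w"
  shows "convergent (\<lambda>k. \<integral>p. grad_sq \<A> g (w k) p * \<sigma> \<alpha> j p \<partial>vol)"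
proof (rule convergent_if_almost_quadratic[where d = "\<lambda>k l. \<integral>p. grad_sq \<A> g (\<lambda>q. w k q - w l q) p * \<sigma> \<alpha> j p \<partial>vol"])
  have ws: "smooth_fun \<A> (w k)" for k using assms by (auto simp: H1_approx_def)
  show "0 \<le> (\<integral>p. grad_sq \<A> g (w k) p * \<sigma> \<alpha> j p \<partial>vol)" for k
    by (intro integral_nonneg_AE AE_I2 mult_nonneg_nonneg grad_sq_nonneg less_imp_le[OF P.density_pos])
  show "(\<integral>p. grad_sq \<A> g (w k) p * \<sigma> \<alpha> j p \<partial>vol) \<le> (1 + e) * (\<integral>p. grad_sq \<A> g (w l) p * \<sigma> \<alpha> j p \<partial>vol)
      + (1 + 1 / e) * (\<integral>p. grad_sq \<A> g (\<lambda>q. w k q - w l q) p * \<sigma> \<alpha> j p \<partial>vol)" if "0 < e" for k l e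
    using energy_linear_combination_le[OF ws[of l] smooth_fun_diff[OF ws[of k] ws[of l]] that density_continuous[of \<alpha> j]
      less_imp_le[OF P.density_pos], where a = 1 and b = 1] by simp
  fix e :: real assume "0 < e"
  then obtain K where K: "\<And>k l. K \<le> k \<Longrightarrow> K \<le> l \<Longrightarrow> (\<integral>p. grad_sq \<A> g (\<lambda>q. w k q - w l q) p \<partial>vol) < e"
    using assms unfolding H1_approx_def by blast
  have "(\<integral>p. grad_sq \<A> g (\<lambda>q. w k q - w l q) p * \<sigma> \<alpha> j p \<partial>vol) < e" if "K \<le> k" "K \<le> l" for k l
  proof -
    note gc = grad_sq_continuous[OF smooth_fun_diff[OF ws[of k] ws[of l]]]
    have "(\<integral>p. grad_sq \<A> g (\<lambda>q. w k q - w l q) p * \<sigma> \<alpha> j p \<partial>vol) \<le> (\<integral>p. grad_sq \<A> g (\<lambda>q. w k q - w l q) p \<partial>vol)"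
    proof (rule integral_mono)
      show "integrable vol (\<lambda>p. grad_sq \<A> g (\<lambda>q. w k q - w l q) p * \<sigma> \<alpha> j p)"
        by (intro continuous_integrable continuous_on_mult gc density_continuous)
      show "integrable vol (grad_sq \<A> g (\<lambda>q. w k q - w l q))" by (rule continuous_integrable[OF gc])
      show "grad_sq \<A> g (\<lambda>q. w k q - w l q) p * \<sigma> \<alpha> j p \<le> grad_sq \<A> g (\<lambda>q. w k q - w l q) p" for p
        by (rule mult_right_le_one_le[OF grad_sq_nonneg less_imp_le[OF P.density_pos] P.density_le_1])
    qed
    also note K[OF that]
    finally show ?thesis .
  qed
  thus "\<exists>K. \<forall>k\<ge>K. \<forall>l\<ge>K. (\<integral>p. grad_sq \<A> g (\<lambda>q. w k q - w l q) p * \<sigma> \<alpha> j p \<partial>vol) < e" by blast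
qed

text \<open>A function that is not almost everywhere zero exists only if \<open>vol\<close> is not
  the zero measure.\<close>

lemma density_integral_pos:
  assumes "\<not> (AE p in vol. u p = 0)" shows "0 < (\<integral>p. \<sigma> \<alpha> j p \<partial>vol)"
proof -
  have i: "integrable vol (\<sigma> \<alpha> j)" by (rule continuous_integrable[OF density_continuous])
  have "(\<integral>p. \<sigma> \<alpha> j p \<partial>vol) \<noteq> 0"
  proof
    assume "(\<integral>p. \<sigma> \<alpha> j p \<partial>vol) = 0"
    hence "AE p in vol. \<sigma> \<alpha> j p = 0"
      using integral_nonneg_eq_0_iff_AE[OF i] P.density_pos by (simp add: less_imp_le)
    hence "AE p in vol. u p = 0" by eventually_elim (use P.density_pos in \<open>simp add: less_imp_neq[symmetric]\<close>)
    with assms show False ..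
  qed
  moreover have "0 \<le> (\<integral>p. \<sigma> \<alpha> j p \<partial>vol)"
    by (intro integral_nonneg_AE AE_I2 less_imp_le[OF P.density_pos])
  ultimately show ?thesis by simp
qed

lemma weighted_square_integrable:
  assumes [measurable]: "f \<in> borel_measurable borel" and i: "integrable vol (\<lambda>p. (f p)\<^sup>2)"
  shows "integrable vol (\<lambda>p. (f p)\<^sup>2 * \<sigma> \<alpha> j p)" "integrable vol (\<lambda>p. f p * \<sigma> \<alpha> j p)"
    "(\<integral>p. (f p)\<^sup>2 * \<sigma> \<alpha> j p \<partial>vol) \<le> (\<integral>p. (f p)\<^sup>2 \<partial>vol)"
    "(\<integral>p. f p * \<sigma> \<alpha> j p \<partial>vol)\<^sup>2 \<le> (\<integral>p. \<sigma> \<alpha> j p \<partial>vol) * (\<integral>p. (f p)\<^sup>2 * \<sigma> \<alpha> j p \<partial>vol)"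
proof -
  note d0 = less_imp_le[OF P.density_pos]
  have le: "(f p)\<^sup>2 * \<sigma> \<alpha> j p \<le> (f p)\<^sup>2" for p by (rule mult_right_le_one_le[OF zero_le_power2 d0 P.density_le_1])
  show i2: "integrable vol (\<lambda>p. (f p)\<^sup>2 * \<sigma> \<alpha> j p)"
    by (rule Bochner_Integration.integrable_bound[OF i]) (auto simp: abs_mult d0 le)
  have di: "integrable vol (\<sigma> \<alpha> j)" by (rule continuous_integrable[OF density_continuous])
  have le1: "\<bar>f p * \<sigma> \<alpha> j p\<bar> \<le> (f p)\<^sup>2 * \<sigma> \<alpha> j p + \<sigma> \<alpha> j p" for p
  proof -
    have "0 \<le> (\<bar>f p\<bar> - 1)\<^sup>2" "0 \<le> \<bar>f p\<bar>" by simp_all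
    hence "\<bar>f p\<bar> \<le> (f p)\<^sup>2 + 1" by (simp add: power2_diff)
    from mult_right_mono[OF this d0] show ?thesis by (simp add: abs_mult d0 distrib_right)
  qed
  show i1: "integrable vol (\<lambda>p. f p * \<sigma> \<alpha> j p)"
    by (rule Bochner_Integration.integrable_bound[OF Bochner_Integration.integrable_add[OF i2 di]])
       (auto intro!: order_trans[OF le1 abs_ge_self])
  show "(\<integral>p. (f p)\<^sup>2 * \<sigma> \<alpha> j p \<partial>vol) \<le> (\<integral>p. (f p)\<^sup>2 \<partial>vol)"
    by (rule integral_mono[OF i2 i le])
  define a b c where "a = (\<integral>p. \<sigma> \<alpha> j p \<partial>vol)" and "b = (\<integral>p. f p * \<sigma> \<alpha> j p \<partial>vol)" and "c = (\<integral>p. (f p)\<^sup>2 * \<sigma> \<alpha> j p \<partial>vol)"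
  have q: "0 \<le> c - 2 * t * b + t\<^sup>2 * a" for t
  proof -
    have "0 \<le> (\<integral>p. (f p - t)\<^sup>2 * \<sigma> \<alpha> j p \<partial>vol)" by (intro integral_nonneg_AE AE_I2 mult_nonneg_nonneg d0) simp
    also have "\<dots> = (\<integral>p. (f p)\<^sup>2 * \<sigma> \<alpha> j p - 2 * t * (f p * \<sigma> \<alpha> j p) + t\<^sup>2 * \<sigma> \<alpha> j p \<partial>vol)"
      by (intro Bochner_Integration.integral_cong refl) (simp add: power2_diff algebra_simps)
    also have "\<dots> = c - 2 * t * b + t\<^sup>2 * a" using i1 i2 di by (simp add: a_def b_def c_def)
    finally show ?thesis .
  qed
  have a0: "0 \<le> a" unfolding a_def by (intro integral_nonneg_AE AE_I2 d0)
  show "b\<^sup>2 \<le> a * c"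
  proof (cases "a = 0")
    case True
    have "b = 0"
    proof (rule ccontr)
      assume "b \<noteq> 0"
      \<comment> \<open>With \<open>a = 0\<close> the quadratic in \<open>t\<close> is linear, and
        this \<open>t\<close> gives it the value -1.\<close>
      thus False using q[of "(c + 1) / (2 * b)"] True by simp
    qed
    thus ?thesis using True by simp
  next
    case False
    hence "0 \<le> a * (c - 2 * (b / a) * b + (b / a)\<^sup>2 * a)" using q[of "b / a"] a0 by (intro mult_nonneg_nonneg)
    also have "\<dots> = a * c - b\<^sup>2" using False by (simp add: power2_eq_square field_simps)
    finally show ?thesis by simp
  qed
qed

text \<open>The approximating functions need not have mean zero, but the square of their weighted
  mean is at most \<open>W * d k\<close> and tends to 0. The bound is stated for every approximating
  sequence and every limit \<open>E\<close>, so that it covers whatever value \<open>SOME\<close>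
  selects in \<open>dirichlet_energy\<close>.\<close>

lemma energy_limit_lower_bound:
  assumes K: "0 \<le> K"
    and mono: "\<And>x y. 0 < y \<Longrightarrow> y < x \<Longrightarrow> x < R \<Longrightarrow>
      K * (x - y) \<le> P.score \<alpha> j (CARD('n) - 1) x - P.score \<alpha> j (CARD('n) - 1) y"
    and ang: "\<And>r. 0 < r \<Longrightarrow> r < R \<Longrightarrow> K \<le> P.score \<alpha> j (CARD('n) - 1) r / r + real (CARD('n) - 1) / (\<theta> r)\<^sup>2"
    and u [measurable]: "u \<in> borel_measurable borel" and ui: "integrable vol (\<lambda>p. (u p)\<^sup>2)"
    and mean: "(\<integral>p. u p * \<sigma> \<alpha> j p \<partial>vol) = 0" and mass: "0 < (\<integral>p. \<sigma> \<alpha> j p \<partial>vol)"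
    and w: "H1_approx \<A> g vol u w" and E: "(\<lambda>k. \<integral>p. grad_sq \<A> g (w k) p * \<sigma> \<alpha> j p \<partial>vol) \<longlonglongrightarrow> E"
  shows "K * (\<integral>p. (u p)\<^sup>2 * \<sigma> \<alpha> j p \<partial>vol) \<le> E"
proof -
  define W where "W = (\<integral>p. \<sigma> \<alpha> j p \<partial>vol)"
  define L where "L = (\<integral>p. (u p)\<^sup>2 * \<sigma> \<alpha> j p \<partial>vol)"
  define Q where "Q k = (\<integral>p. grad_sq \<A> g (w k) p * \<sigma> \<alpha> j p \<partial>vol)" for k
  define d where "d k = (\<integral>p. (w k p - u p)\<^sup>2 \<partial>vol)" for k
  have ws: "smooth_fun \<A> (w k)" for k using w by (auto simp: H1_approx_def)
  have d: "d \<longlonglongrightarrow> 0" using w by (simp add: H1_approx_def d_def[abs_def])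
  have W: "0 < W" using mass by (simp add: W_def)
  have step: "K * W * L \<le> (1 + e) * (W * Q k + K * W * d k) + K * W * (1 + 1 / e) * d k" if e: "0 < e" for e k
  proof -
    have [measurable]: "w k \<in> borel_measurable borel" by (rule smooth_fun_measurable[OF ws])
    note wi = smooth_square_integrable[OF ws[of k]] and di = smooth_diff_square_integrable[OF ws[of k] u ui]
    have dm: "(\<lambda>p. w k p - u p) \<in> borel_measurable borel" and wm: "w k \<in> borel_measurable borel" by measurable
    note wf = weighted_square_integrable[OF wm wi, of \<alpha> j] and df = weighted_square_integrable[OF dm di, of \<alpha> j]
      and uf = weighted_square_integrable[OF u ui, of \<alpha> j]
    define b where "b = (\<integral>p. w k p * \<sigma> \<alpha> j p \<partial>vol)"
    define l where "l = (\<integral>p. (w k p)\<^sup>2 * \<sigma> \<alpha> j p \<partial>vol)"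
    have "b = (\<integral>p. (w k p - u p) * \<sigma> \<alpha> j p \<partial>vol)"
      using wf(2) uf(2) mean by (simp add: b_def left_diff_distrib)
    hence "b\<^sup>2 \<le> W * (\<integral>p. (w k p - u p)\<^sup>2 * \<sigma> \<alpha> j p \<partial>vol)" using df(4) by (simp add: W_def)
    also have "\<dots> \<le> W * d k" using df(3) W by (simp add: d_def)
    finally have b2: "K * b\<^sup>2 \<le> K * (W * d k)" using K by (rule mult_left_mono)
    have "K * (W * l - b\<^sup>2) \<le> W * Q k"
      using manifold_poincare[OF ws K mono ang] by (simp add: W_def l_def b_def Q_def)
    hence P: "K * W * l \<le> W * Q k + K * W * d k" using b2 by (simp add: right_diff_distrib)
    have "L \<le> (\<integral>p. (1 + e) * ((w k p)\<^sup>2 * \<sigma> \<alpha> j p) + (1 + 1 / e) * ((w k p - u p)\<^sup>2 * \<sigma> \<alpha> j p) \<partial>vol)"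
      unfolding L_def
    proof (rule integral_mono[OF uf(1)])
      show "integrable vol (\<lambda>p. (1 + e) * ((w k p)\<^sup>2 * \<sigma> \<alpha> j p) + (1 + 1 / e) * ((w k p - u p)\<^sup>2 * \<sigma> \<alpha> j p))"
        by (intro Bochner_Integration.integrable_add integrable_mult_right wf(1) df(1))
      fix p
      have "(u p)\<^sup>2 \<le> (1 + e) * (w k p)\<^sup>2 + (1 + 1 / e) * (w k p - u p)\<^sup>2"
        using power2_add_le[OF e, of "w k p" "u p - w k p"] by (simp add: power2_commute)
      from mult_right_mono[OF this less_imp_le[OF P.density_pos]]
      show "(u p)\<^sup>2 * \<sigma> \<alpha> j p \<le> (1 + e) * ((w k p)\<^sup>2 * \<sigma> \<alpha> j p) + (1 + 1 / e) * ((w k p - u p)\<^sup>2 * \<sigma> \<alpha> j p)"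
        by (simp only: distrib_right mult.assoc)
    qed
    also have "\<dots> = (1 + e) * l + (1 + 1 / e) * (\<integral>p. (w k p - u p)\<^sup>2 * \<sigma> \<alpha> j p \<partial>vol)"
      using wf(1) df(1) by (simp add: l_def)
    also have "\<dots> \<le> (1 + e) * l + (1 + 1 / e) * d k"
      using df(3) e by (intro add_left_mono mult_left_mono) (auto simp: d_def)
    finally have "K * W * L \<le> K * W * ((1 + e) * l + (1 + 1 / e) * d k)"
      using K W by (intro mult_left_mono) auto
    also have "\<dots> = (1 + e) * (K * W * l) + K * W * (1 + 1 / e) * d k" by (simp only: distrib_left mult_ac)
    also have "\<dots> \<le> (1 + e) * (W * Q k + K * W * d k) + K * W * (1 + 1 / e) * d k"
      using P e by (intro add_right_mono mult_left_mono) auto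
    finally show ?thesis .
  qed
  \<comment> \<open>The index goes to infinity with \<open>e\<close> fixed and only afterwards
    \<open>e\<close> tends to 0, since the factor \<open>1 + 1 / e\<close> of the error is
    unbounded.\<close>
  have "K * W * L \<le> (1 + e) * (W * E)" if e: "0 < e" for e
  proof (rule LIMSEQ_le_const)
    have "(\<lambda>k. (1 + e) * (W * Q k + K * W * d k) + K * W * (1 + 1 / e) * d k)
        \<longlonglongrightarrow> (1 + e) * (W * E + K * W * 0) + K * W * (1 + 1 / e) * 0"
      using E unfolding Q_def[symmetric] by (intro tendsto_intros d)
    thus "(\<lambda>k. (1 + e) * (W * Q k + K * W * d k) + K * W * (1 + 1 / e) * d k) \<longlonglongrightarrow> (1 + e) * (W * E)" by simp
    show "\<exists>N. \<forall>k\<ge>N. K * W * L \<le> (1 + e) * (W * Q k + K * W * d k) + K * W * (1 + 1 / e) * d k"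
      using step[OF e] by blast
  qed
  hence le: "K * L \<le> (1 + e) * E" if "0 < e" for e using that W mult_le_cancel_left_pos[of W "K * L" "(1 + e) * E"]
    by (simp add: mult_ac)
  have "((\<lambda>e. (1 + e) * E) \<longlongrightarrow> (1 + 0) * E) (at_right 0)" by (intro tendsto_intros)
  hence "K * L \<le> (1 + 0) * E"
    by (rule tendsto_lowerbound) (auto simp: eventually_at_right_less le intro!: eventually_mono[OF eventually_at_right_less])
  thus ?thesis by (simp add: L_def)
qed

lemma second_eigenvalue_lower_bound:
  assumes K: "0 \<le> K"
    and mono: "\<And>x y. 0 < y \<Longrightarrow> y < x \<Longrightarrow> x < R \<Longrightarrow>
      K * (x - y) \<le> P.score \<alpha> j (CARD('n) - 1) x - P.score \<alpha> j (CARD('n) - 1) y"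
    and ang: "\<And>r. 0 < r \<Longrightarrow> r < R \<Longrightarrow> K \<le> P.score \<alpha> j (CARD('n) - 1) r / r + real (CARD('n) - 1) / (\<theta> r)\<^sup>2"
  shows "ereal K \<le> weighted_eigenvalue \<A> g vol (\<sigma> \<alpha> j) 2"
  unfolding weighted_eigenvalue_def
proof (rule INF_greatest)
  fix V assume "V \<in> H1_subspaces \<A> g vol 2"
  then obtain b :: "nat \<Rightarrow> 'm \<Rightarrow> real" where b: "\<And>i. i < 2 \<Longrightarrow> b i \<in> H1 \<A> g vol"
      "\<And>a :: nat \<Rightarrow> real. (AE p in vol. (\<Sum>i<2. a i * b i p) = 0) \<Longrightarrow> \<forall>i<2. a i = 0"
      "V = range (\<lambda>(a :: nat \<Rightarrow> real) p. \<Sum>i<2. a i * b i p)"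
    unfolding H1_subspaces_def by blast
  define I where "I i = (\<integral>p. b i p * \<sigma> \<alpha> j p \<partial>vol)" for i
  \<comment> \<open>The weighted mean is a linear functional of the two coefficients, so its kernel
    contains a nonzero vector.\<close>
  obtain a :: "nat \<Rightarrow> real" where a: "a 0 * I 0 + a 1 * I 1 = 0" "\<not> (a 0 = 0 \<and> a 1 = 0)"
  proof (cases "I 0 = 0")
    case True thus ?thesis using that[of "\<lambda>i. if i = 0 then 1 else 0"] by simp
  next
    case False thus ?thesis using that[of "\<lambda>i. if i = 0 then - I 1 else I 0"] by (simp add: mult.commute)
  qed
  define u where "u p = (\<Sum>i<2. a i * b i p)" for p
  have u2: "u = (\<lambda>p. a 0 * b 0 p + a 1 * b 1 p)" by (simp add: fun_eq_iff u_def numeral_2_eq_2)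
  have uV: "u \<in> V" unfolding b(3) u_def[abs_def] by (rule rangeI)
  have u0: "\<not> (AE p in vol. u p = 0)" using b(2)[of a] a(2) by (auto simp: u_def)
  have bm: "b i \<in> borel_measurable borel" and bi: "integrable vol (\<lambda>p. (b i p)\<^sup>2)" if "i < 2" for i
    using b(1)[OF that] by (auto simp: H1_def measurable_vol_iff)
  have mean: "(\<integral>p. u p * \<sigma> \<alpha> j p \<partial>vol) = 0"
  proof -
    have i: "integrable vol (\<lambda>p. b i p * \<sigma> \<alpha> j p)" if "i < 2" for i
      by (rule weighted_square_integrable(2)[OF bm[OF that] bi[OF that]])
    have "(\<integral>p. u p * \<sigma> \<alpha> j p \<partial>vol) = (\<integral>p. a 0 * (b 0 p * \<sigma> \<alpha> j p) + a 1 * (b 1 p * \<sigma> \<alpha> j p) \<partial>vol)"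
      by (simp add: u2 distrib_right mult.assoc)
    also have "\<dots> = a 0 * I 0 + a 1 * I 1" using i[of 0] i[of 1] by (simp add: I_def)
    finally show ?thesis using a(1) by simp
  qed
  have uH: "u \<in> H1 \<A> g vol" unfolding u2 by (rule H1_linear_combination) (simp_all add: b(1))
  hence um: "u \<in> borel_measurable borel" and ui: "integrable vol (\<lambda>p. (u p)\<^sup>2)"
    by (auto simp: H1_def measurable_vol_iff)
  obtain w where w: "H1_approx \<A> g vol u w" using uH by (auto simp: H1_def)
  let ?P = "\<lambda>E. \<exists>w. H1_approx \<A> g vol u w \<and> (\<lambda>k. \<integral>p. grad_sq \<A> g (w k) p * \<sigma> \<alpha> j p \<partial>vol) \<longlonglongrightarrow> E"
  have "\<exists>E. ?P E" using w energy_convergent[OF w, of \<alpha> j] unfolding convergent_def by blast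
  \<comment> \<open>The sequence \<open>w'\<close> behind the selected value need not be the
    sequence \<open>w\<close> that witnesses membership in \<open>H1\<close>.\<close>
  hence "?P (dirichlet_energy \<A> g vol (\<sigma> \<alpha> j) u)" unfolding dirichlet_energy_def by (rule someI_ex)
  then obtain w' where w': "H1_approx \<A> g vol u w'"
    "(\<lambda>k. \<integral>p. grad_sq \<A> g (w' k) p * \<sigma> \<alpha> j p \<partial>vol) \<longlonglongrightarrow> dirichlet_energy \<A> g vol (\<sigma> \<alpha> j) u" by blast
  have le: "K * (\<integral>p. (u p)\<^sup>2 * \<sigma> \<alpha> j p \<partial>vol) \<le> dirichlet_energy \<A> g vol (\<sigma> \<alpha> j) u"
    by (rule energy_limit_lower_bound[OF K mono ang um ui mean density_integral_pos[OF u0] w'])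
  have "(\<integral>p. (u p)\<^sup>2 * \<sigma> \<alpha> j p \<partial>vol) \<noteq> 0"
  proof
    assume z: "(\<integral>p. (u p)\<^sup>2 * \<sigma> \<alpha> j p \<partial>vol) = 0"
    have "AE p in vol. 0 \<le> (u p)\<^sup>2 * \<sigma> \<alpha> j p" by (intro AE_I2 mult_nonneg_nonneg less_imp_le[OF P.density_pos]) simp
    hence "AE p in vol. (u p)\<^sup>2 * \<sigma> \<alpha> j p = 0"
      using integral_nonneg_eq_0_iff_AE[OF weighted_square_integrable(1)[OF um ui]] z by simp
    hence "AE p in vol. u p = 0" by eventually_elim (use P.density_pos in \<open>simp add: less_imp_neq[symmetric]\<close>)
    with u0 show False ..
  qed
  moreover have "0 \<le> (\<integral>p. (u p)\<^sup>2 * \<sigma> \<alpha> j p \<partial>vol)"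
    by (intro integral_nonneg_AE AE_I2 mult_nonneg_nonneg less_imp_le[OF P.density_pos]) simp
  ultimately have "K \<le> rayleigh_quotient \<A> g vol (\<sigma> \<alpha> j) u"
    using le by (simp add: rayleigh_quotient_def pos_le_divide_eq)
  thus "ereal K \<le> (SUP u \<in> {u \<in> V. \<not> (AE p in vol. u p = 0)}. ereal (rayleigh_quotient \<A> g vol (\<sigma> \<alpha> j) u))"
    using uV u0 by (intro SUP_upper2[of u]) auto
qed

end

theorem theorem5p3:
  fixes \<A> :: "('m::t2_space, 'n::finite) chart set"
    and g :: "('m, 'n) chart \<Rightarrow> real ^ 'n \<Rightarrow> real ^ 'n ^ 'n"
    and N S :: 'm
    and R \<alpha> :: real
    and \<theta> :: "real \<Rightarrow> real"
    and \<Phi> :: "'m \<Rightarrow> real \<times> (real ^ 'n)"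
    and vol :: "'m measure"
  assumes "2 \<le> CARD('n)"
    and "closed_revolution_manifold \<A> g N S R \<theta> \<Phi>"
    and "riemannian_volume \<A> g vol"
    and "1 \<le> \<alpha>"
    and "(real CARD('n) - 1) * \<alpha>\<^sup>2 / 16 - 2 * \<alpha> * R \<ge> 2"
  shows "\<exists>(j\<^sub>0::nat) (C::real). 0 < j\<^sub>0 \<and> R - 1 / (\<alpha> * real j\<^sub>0) > 0 \<and>
           (\<forall>j\<ge>j\<^sub>0. weighted_eigenvalue \<A> g vol (\<lambda>p. radial_density R \<alpha> j (radius N S R \<Phi> p)) 2
                      \<ge> ereal (2 * real j + C))"
proof -
  interpret revolution \<A> g N S R \<theta> \<Phi> vol by unfold_locales (fact assms)+
  have m: "1 \<le> CARD('n) - 1" and cond: "real (CARD('n) - 1) * \<alpha>\<^sup>2 / 16 - 2 * \<alpha> * R \<ge> 2"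
    using assms(1,5) by (simp_all add: of_nat_diff)
  obtain j0 C where jC: "0 < j0" "0 < R - 1 / (\<alpha> * real j0)"
      "\<And>j. j0 \<le> j \<Longrightarrow> 0 \<le> 2 * real j + C"
      "\<And>j x y. j0 \<le> j \<Longrightarrow> 0 < y \<Longrightarrow> y < x \<Longrightarrow> x < R \<Longrightarrow>
         (2 * real j + C) * (x - y) \<le> P.score \<alpha> j (CARD('n) - 1) x - P.score \<alpha> j (CARD('n) - 1) y"
      "\<And>j r. j0 \<le> j \<Longrightarrow> 0 < r \<Longrightarrow> r < R \<Longrightarrow>
         2 * real j + C \<le> P.score \<alpha> j (CARD('n) - 1) r / r + real (CARD('n) - 1) / (\<theta> r)\<^sup>2"
    by (rule P.convexity_estimates[OF assms(4) m cond], rule that)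
  have "\<forall>j\<ge>j0. weighted_eigenvalue \<A> g vol (\<sigma> \<alpha> j) 2 \<ge> ereal (2 * real j + C)"
    using second_eigenvalue_lower_bound jC(3-5) by blast
  thus ?thesis using jC(1,2) by blast
qed

end
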